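(* Let $M_t$ be a family of compact manifolds of dimension $m$ in $\mathbb{R}^n$, moving under the mean curvature flow, with $M_0=M$. Let $\sigma_t=[M_t]_s\wedge\beta^m/m!$ be their volume forms, $\sigma=\sigma_0$, $S=[M]_s\wedge\beta^{m-1}/(m-1)!$, and let $\vec H$ be the mean curvature vector of $M$. Then, if $\rho$ is a sufficiently smooth function on $\mathbb{R}^n$, $$\frac{d}{dt}\Big|_{t=0}\int\rho\,d\sigma_t=-\int\rho\,|\vec H|^2\,d\sigma-\int_{\mathbb{R}^n_s} dd^{\#}\rho\wedge S.$$ As a consequence, if $\rho$ is convex (or, more generally, $m$-subharmonic), then $\int\rho\,d\sigma_t$ is decreasing.
   Context: Superforms: let $x=(x_1,\dots,x_n)$ be orthonormal coordinates on $\mathbb{R}^n$ and $\xi=(\xi_1,\dots,\xi_n)$ coordinates on a second copy of $\mathbb{R}^n$. A superform is a differential form $a=\sum a_{I,J}(x)\,dx_I\wedge d\xi_J$ on $\mathbb{R}^n_s=\mathbb{R}^n\oplus\mathbb{R}^n$ whose coefficients do not depend on $\xi$; it has bidegree $(p,q)$ if $|I|=p$, $|J|=q$. $J$ is the multiplicative operator on forms with $J(dx_i)=d\xi_i$, $J(d\xi_i)=-dx_i$; for $a$ of bidegree $(p,0)$ write $a^{\#}=J(a)$. Put $da=\sum \frac{\partial a_{I,J}}{\partial x_k}dx_k\wedge dx_I\wedge d\xi_J$ and $d^{\#}a=\sum \frac{\partial a_{I,J}}{\partial x_k}d\xi_k\wedge dx_I\wedge d\xi_J$. The superintegral of an $(n,n)$-form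 is $\int_{\mathbb{R}^n_s}a_0\,dx_1\wedge d\xi_1\wedge\dots\wedge dx_n\wedge d\xi_n=\int_{\mathbb{R}^n}a_0\,d\lambda$ ($\lambda$ Lebesgue measure). Supercurrents of bidegree $(p,q)$ (bidimension $(n-p,n-q)$) are the continuous linear functionals on smooth superforms of bidegree $(n-p,n-q)$ with compact support in $x$; equivalently superforms with distribution coefficients, acting by $T.\alpha=\int T\wedge\alpha$. A supercurrent of bidegree $(n,n)$ and order zero is identified with a measure on $\mathbb{R}^n$. The operators $d,d^{\#}$ extend to supercurrents coefficientwise. $\beta=\sum_j dx_j\wedge d\xi_j$. The supercurrent $[M]_s$: let $M\subset\mathbb{R}^n$ be a smooth submanifold (without boundary) of dimension $m$ and codimension $p=n-m$. Locally choose defining functions $\rho_1,\dots,\rho_p$ such that $n_j:=d\rho_j$ are orthonormal at the points of $M$; put $n=n_1\wedge\dots\wedge n_p$, $c_p=(-1)^{p(p-1)/2}$. Then $[M]_s=c_p\,n\wedge n^{\#}*dS_M$, where $dS_M$ is surface measure on $M$ and, for a measure $\mu$, $*\mu$ is the bidegree $(0,0)$ supercurrent with $*\mu.(\alpha_0\,dx_1\wedge d\xi_1\wedge\dots\wedge dx_n\wedge d\xi_n)=\int\alpha_0\,d\mu$. This does not depend on the choice of $\rho_j$. As a measure, $[M]_s\wedge\beta^m/m!$ is $dS_M$. Mean curvature: $F_j:=d n_j^{\#}$; $H_j$ is the trace of the restriction of $F_j$ to the tangent spaces of $M$; the mean curvature vector is $\vec H=\sum_jH_j\vec n_j$, with $\vec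 n_j$ the vector dual to $n_j$ (with this sign convention the mean curvature vector of a sphere points outwards). Mean curvature flow: a family $M_t$ of smooth submanifolds of $\mathbb{R}^n$ moves by the mean curvature flow if there is a vector field $\vec H$ on the ambient space which restricts to the mean curvature vector field of $M_t$ on each $M_t$ and such that $F_t(M_0)=M_t$, where $F_t$ is the flow of $-\vec H$. $m$-subharmonic: a superform $\alpha$ of bidegree $(n-m,n-m)$ (bidimension $(m,m)$) is weakly positive if $\alpha\wedge\alpha_1\wedge\alpha_1^{\#}\wedge\dots\wedge\alpha_m\wedge\alpha_m^{\#}\ge0$ at every point for all $(1,0)$-forms $\alpha_j$ (i.e. is a nonnegative multiple of $dx_1\wedge d\xi_1\wedge\dots\wedge dx_n\wedge d\xi_n$). A locally integrable function $u$ is $m$-subharmonic if $dd^{\#}u\wedge\beta^{m-1}\wedge\alpha$ is a positive current for any weakly positive form $\alpha$ of bidimension $(m,m)$.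
   Formalization: In the final consequence, ρ is additionally assumed to be nonnegative on the manifolds M_t; without this it fails, e.g. for ρ = -1 and a shrinking sphere, where the integral increases. *)

theory Defs
  imports "HOL-Analysis.Analysis"
begin

section \<open>Functions of class \<open>C\<^sup>k\<close>\<close>

(* Meant for open S. *)
primrec Ck_on ::
    "nat \<Rightarrow> ('a::real_normed_vector \<Rightarrow> 'b::real_normed_vector) \<Rightarrow> 'a set \<Rightarrow> bool" where
  "Ck_on 0 f S \<longleftrightarrow> continuous_on S f"
| "Ck_on (Suc k) f S \<longleftrightarrow>
     (\<forall>x\<in>S. f differentiable (at x)) \<and> (\<forall>v. Ck_on k (\<lambda>x. frechet_derivative f (at x) v) S)"

definition smooth_on ::
    "('a::real_normed_vector \<Rightarrow> 'b::real_normed_vector) \<Rightarrow> 'a set \<Rightarrow> bool" where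
  "smooth_on f S \<longleftrightarrow> (\<forall>k. Ck_on k f S)"

definition test_function :: "('a::real_normed_vector \<Rightarrow> real) \<Rightarrow> bool" where
  "test_function \<eta> \<longleftrightarrow> smooth_on \<eta> UNIV \<and> compact (closure {x. \<eta> x \<noteq> 0})"


section \<open>Superforms\<close>

(* A superform at a point: the component at (I,J) is the coefficient of dx_I wedge dxi_J,
   where in dx_I and dxi_J the indices are taken in increasing order. *)
type_synonym 'n sform = "real ^ ('n set \<times> 'n set)"

type_synonym 'n point = "real ^ 'n"

type_synonym 'n superform = "'n point \<Rightarrow> 'n sform"

(* dx_I wedge dx_K = shuffle_sign I K * dx_(I Un K) for disjoint I, K. *)
definition shuffle_sign :: "'n::linorder set \<Rightarrow> 'n set \<Rightarrow> real" where
  "shuffle_sign I K = (- 1) ^ card {(i, k). i \<in> I \<and> k \<in> K \<and> k < i}"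

(* The factor (-1)^(|J||K|) comes from moving dxi_J past dx_K in
   dx_I wedge dxi_J wedge dx_K wedge dxi_L, where K = A - I and L = B - J. *)
definition wedge ::
    "'n::{finite,linorder} sform \<Rightarrow> 'n sform \<Rightarrow> 'n sform" (infixr "\<and>\<^sub>s" 72) where
  "a \<and>\<^sub>s b = (\<chi> P. case P of (A, B) \<Rightarrow>
     \<Sum>I\<in>Pow A. \<Sum>J\<in>Pow B.
       (- 1) ^ (card J * card (A - I)) * shuffle_sign I (A - I) * shuffle_sign J (B - J)
         * a $ (I, J) * b $ (A - I, B - J))"

definition sone :: "'n::finite sform" where
  "sone = axis ({}, {}) 1"

definition dx :: "'n::finite \<Rightarrow> 'n sform" where
  "dx i = axis ({i}, {}) 1"

definition d\<xi> :: "'n::finite \<Rightarrow> 'n sform" where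
  "d\<xi> i = axis ({}, {i}) 1"

definition wedge_list :: "'n::{finite,linorder} sform list \<Rightarrow> 'n sform" where
  "wedge_list as = foldr wedge as sone"

definition wedge_power :: "'n::{finite,linorder} sform \<Rightarrow> nat \<Rightarrow> 'n sform" where
  "wedge_power a k = wedge_list (replicate k a)"

(* The multiplicative extension of dx_i -> dxi_i, dxi_i -> - dx_i sends dx_I wedge dxi_J to
   (-1)^|J| dxi_I wedge dx_J = (-1)^(|J| + |I||J|) dx_J wedge dxi_I. *)
definition Jop :: "'n::finite sform \<Rightarrow> 'n sform" where
  "Jop a = (\<chi> P. case P of (A, B) \<Rightarrow> (- 1) ^ (card A + card A * card B) * a $ (B, A))"

definition bidegree :: "nat \<Rightarrow> nat \<Rightarrow> 'n::finite sform \<Rightarrow> bool" where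
  "bidegree p q a \<longleftrightarrow> (\<forall>I J. a $ (I, J) \<noteq> 0 \<longrightarrow> card I = p \<and> card J = q)"

definition \<beta> :: "'n::{finite,linorder} sform" where
  "\<beta> = (\<Sum>j\<in>UNIV. dx j \<and>\<^sub>s d\<xi> j)"

(* The form dx_1 wedge dxi_1 wedge ... wedge dx_n wedge dxi_n. *)
definition supervol :: "'n::{finite,linorder} sform" where
  "supervol = wedge_list (map (\<lambda>i. dx i \<and>\<^sub>s d\<xi> i) (sorted_list_of_set UNIV))"

(* The number a0 such that the bidegree (n,n) part of a is a0 * supervol
   (the denominator is 1 or -1). *)
definition top_coeff :: "'n::{finite,linorder} sform \<Rightarrow> real" where
  "top_coeff a = a $ (UNIV, UNIV) / (supervol :: 'n sform) $ (UNIV, UNIV)"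

definition superintegral :: "'n::{finite,linorder} superform \<Rightarrow> real" where
  "superintegral \<alpha> = (\<integral>x. top_coeff (\<alpha> x) \<partial>lborel)"

definition fun_form :: "('n::finite point \<Rightarrow> real) \<Rightarrow> 'n superform" where
  "fun_form u = (\<lambda>x. u x *\<^sub>R sone)"

definition partial_deriv :: "'n::finite \<Rightarrow> 'n superform \<Rightarrow> 'n superform" where
  "partial_deriv k a = (\<lambda>x. frechet_derivative a (at x) (axis k 1))"

definition sd :: "'n::{finite,linorder} superform \<Rightarrow> 'n superform" where
  "sd a = (\<lambda>x. \<Sum>k\<in>UNIV. dx k \<and>\<^sub>s partial_deriv k a x)"

definition sd_sharp :: "'n::{finite,linorder} superform \<Rightarrow> 'n superform" where
  "sd_sharp a = (\<lambda>x. \<Sum>k\<in>UNIV. d\<xi> k \<and>\<^sub>s partial_deriv k a x)"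


section \<open>Supercurrents\<close>

(* A supercurrent is represented by its action on superforms. In general only the values on
   smooth superforms with compact support are meaningful. The currents below which are given
   by integration against a compactly supported measure act on every continuous superform. *)
type_synonym 'n supercurrent = "'n superform \<Rightarrow> real"

definition fun_current :: "('n::{finite,linorder} point \<Rightarrow> real) \<Rightarrow> 'n supercurrent" where
  "fun_current u = (\<lambda>\<alpha>. superintegral (\<lambda>x. u x *\<^sub>R \<alpha> x))"

(* The bidegree (0,0) current attached to a measure concentrated on the Borel set M. Restricting
   the integral to M makes the values of forms outside M irrelevant. *)
definition measure_current ::
    "'n point set \<Rightarrow> 'n point measure \<Rightarrow> 'n::{finite,linorder} supercurrent" where
  "measure_current M \<mu> = (\<lambda>\<alpha>. LINT x:M|\<mu>. top_coeff (\<alpha> x))"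

(* T wedge omega, acting by (T wedge omega).alpha = T.(omega wedge alpha). It agrees with
   omega wedge T if omega or T has even total degree, as is always the case below. *)
definition current_wedge ::
    "'n supercurrent \<Rightarrow> 'n superform \<Rightarrow> 'n::{finite,linorder} supercurrent" where
  "current_wedge T \<omega> = (\<lambda>\<alpha>. T (\<lambda>x. \<omega> x \<and>\<^sub>s \<alpha> x))"

(* Coefficientwise derivatives of a current of total degree k: integrating
   d (T wedge alpha) = dT wedge alpha + (-1)^k T wedge d alpha  to 0 gives the sign. *)
definition current_d :: "nat \<Rightarrow> 'n supercurrent \<Rightarrow> 'n::{finite,linorder} supercurrent" where
  "current_d k T = (\<lambda>\<alpha>. (- 1) ^ (k + 1) * T (sd \<alpha>))"

definition current_d_sharp ::
    "nat \<Rightarrow> 'n supercurrent \<Rightarrow> 'n::{finite,linorder} supercurrent" where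
  "current_d_sharp k T = (\<lambda>\<alpha>. (- 1) ^ (k + 1) * T (sd_sharp \<alpha>))"

(* The superintegral of a compactly supported current of bidegree (n,n). *)
definition current_integral :: "'n::{finite,linorder} supercurrent \<Rightarrow> real" where
  "current_integral T = T (fun_form (\<lambda>x. 1))"

(* The measure identified with a current of bidegree (n,n) and order zero. *)
definition current_measure :: "'n::{finite,linorder} supercurrent \<Rightarrow> 'n point measure" where
  "current_measure T = (THE \<mu>. sets \<mu> = sets borel \<and>
     (\<forall>K. compact K \<longrightarrow> emeasure \<mu> K < \<infinity>) \<and>
     (\<forall>\<eta>. test_function \<eta> \<longrightarrow> T (fun_form \<eta>) = (\<integral>x. \<eta> x \<partial>\<mu>)))"

definition positive_top_current :: "'n::{finite,linorder} supercurrent \<Rightarrow> bool" where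
  "positive_top_current T \<longleftrightarrow>
     (\<forall>\<eta>. test_function \<eta> \<and> (\<forall>x. 0 \<le> \<eta> x) \<longrightarrow> 0 \<le> T (fun_form \<eta>))"


section \<open>$m$-subharmonic functions\<close>

(* Weak positivity at a point of a form of bidimension (m,m). *)
definition weakly_positive :: "nat \<Rightarrow> 'n::{finite,linorder} sform \<Rightarrow> bool" where
  "weakly_positive m \<alpha> \<longleftrightarrow>
     bidegree (CARD('n) - m) (CARD('n) - m) \<alpha> \<and>
     (\<forall>a. (\<forall>j<m. bidegree 1 0 (a j)) \<longrightarrow>
        0 \<le> top_coeff (\<alpha> \<and>\<^sub>s wedge_list (map (\<lambda>j. a j \<and>\<^sub>s Jop (a j)) [0..<m])))"

definition m_subharmonic :: "nat \<Rightarrow> ('n::{finite,linorder} point \<Rightarrow> real) \<Rightarrow> bool" where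
  "m_subharmonic m u \<longleftrightarrow>
     (\<forall>K. compact K \<longrightarrow> set_integrable lborel K u) \<and>
     (\<forall>\<alpha> :: 'n superform. smooth_on \<alpha> UNIV \<and> (\<forall>x. weakly_positive m (\<alpha> x)) \<longrightarrow>
        positive_top_current
          (current_wedge
            (current_wedge (current_d 1 (current_d_sharp 0 (fun_current u)))
              (\<lambda>x. wedge_power \<beta> (m - 1)))
            \<alpha>))"


section \<open>Submanifolds and mean curvature\<close>

definition defining_functions ::
    "'n point set \<Rightarrow> nat \<Rightarrow> 'n point set \<Rightarrow> (nat \<Rightarrow> 'n::{finite,linorder} point \<Rightarrow> real) \<Rightarrow> bool"
  where
  "defining_functions M p U \<rho> \<longleftrightarrow> open U \<and> (\<forall>j<p. smooth_on (\<rho> j) U) \<and>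
     M \<inter> U = {x\<in>U. \<forall>j<p. \<rho> j x = 0} \<and>
     (\<forall>x \<in> M \<inter> U. inj_on (\<lambda>j. sd (fun_form (\<rho> j)) x) {..<p} \<and>
        independent ((\<lambda>j. sd (fun_form (\<rho> j)) x) ` {..<p}))"

definition submanifold :: "nat \<Rightarrow> 'n::{finite,linorder} point set \<Rightarrow> bool" where
  "submanifold m M \<longleftrightarrow> m \<le> CARD('n) \<and>
     (\<forall>x\<in>M. \<exists>U \<rho>. x \<in> U \<and> defining_functions M (CARD('n) - m) U \<rho>)"

(* A choice, for x in M, of local defining functions whose differentials are orthonormal along M.
   The inner product of the Euclidean space of superforms at a point makes the dx_i orthonormal. *)
definition normal_system ::
    "nat \<Rightarrow> 'n point set \<Rightarrow> 'n point \<Rightarrow> nat \<Rightarrow> 'n::{finite,linorder} point \<Rightarrow> real" where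
  "normal_system m M x = (SOME \<rho>. \<exists>U. x \<in> U \<and> defining_functions M (CARD('n) - m) U \<rho> \<and>
     (\<forall>y \<in> M \<inter> U. \<forall>i<CARD('n) - m. \<forall>j<CARD('n) - m.
        sd (fun_form (\<rho> i)) y \<bullet> sd (fun_form (\<rho> j)) y = (if i = j then 1 else 0)))"

definition normal_form ::
    "nat \<Rightarrow> 'n point set \<Rightarrow> 'n point \<Rightarrow> nat \<Rightarrow> 'n::{finite,linorder} superform" where
  "normal_form m M x j = sd (fun_form (normal_system m M x j))"

definition dual_vector :: "'n::finite sform \<Rightarrow> 'n point" where
  "dual_vector a = (\<chi> k. a $ ({k}, {}))"

definition tangent_space ::
    "nat \<Rightarrow> 'n point set \<Rightarrow> 'n point \<Rightarrow> 'n::{finite,linorder} point set" where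
  "tangent_space m M x =
     {v. \<forall>j<CARD('n) - m. v \<bullet> dual_vector (normal_form m M x j x) = 0}"

definition bilinear_of_form :: "'n::finite sform \<Rightarrow> 'n point \<Rightarrow> 'n point \<Rightarrow> real" where
  "bilinear_of_form a v w = (\<Sum>k\<in>UNIV. \<Sum>l\<in>UNIV. a $ ({k}, {l}) * v $ k * w $ l)"

(* The choice of the orthonormal basis is irrelevant for bilinear b. *)
definition trace_on :: "'a::euclidean_space set \<Rightarrow> ('a \<Rightarrow> 'a \<Rightarrow> real) \<Rightarrow> real" where
  "trace_on V b = (\<Sum>e \<in> (SOME E. pairwise orthogonal E \<and> (\<forall>e\<in>E. norm e = 1) \<and> span E = V). b e e)"

definition mean_curvature ::
    "nat \<Rightarrow> 'n point set \<Rightarrow> 'n point \<Rightarrow> 'n::{finite,linorder} point" where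
  "mean_curvature m M x = (\<Sum>j<CARD('n) - m.
     trace_on (tangent_space m M x)
       (bilinear_of_form (sd (\<lambda>y. Jop (normal_form m M x j y)) x))
     *\<^sub>R dual_vector (normal_form m M x j x))"


section \<open>Surface measure and the supercurrent of a submanifold\<close>

definition local_parametrization ::
    "'n::finite point set \<Rightarrow> (real ^ 'm) set \<Rightarrow> (real ^ 'm \<Rightarrow> 'n point) \<Rightarrow> bool" where
  "local_parametrization M U \<phi> \<longleftrightarrow> open U \<and> Ck_on 1 \<phi> U \<and>
     (\<forall>u\<in>U. inj (frechet_derivative \<phi> (at u))) \<and>
     (\<exists>\<psi>. homeomorphism U (\<phi> ` U) \<phi> \<psi>) \<and>
     openin (top_of_set M) (\<phi> ` U)"

definition area_density :: "(real ^ 'm \<Rightarrow> 'n::finite point) \<Rightarrow> real ^ 'm \<Rightarrow> real" where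
  "area_density \<phi> u = sqrt (det (\<chi> i j.
     frechet_derivative \<phi> (at u) (axis i 1) \<bullet> frechet_derivative \<phi> (at u) (axis j 1)))"

(* The index type 'm only carries the dimension CARD('m) of M. *)
definition surface_measure :: "'m::finite itself \<Rightarrow> 'n::finite point set \<Rightarrow> 'n point measure" where
  "surface_measure T M = (THE \<mu>. sets \<mu> = sets borel \<and> emeasure \<mu> (- M) = 0 \<and>
     (\<forall>(U :: (real ^ 'm) set) \<phi> A.
        local_parametrization M U \<phi> \<and> A \<subseteq> U \<and> A \<in> sets borel \<longrightarrow>
        emeasure \<mu> (\<phi> ` A) = (\<integral>\<^sup>+u\<in>A. ennreal (area_density \<phi> u) \<partial>lborel)))"

(* The form n wedge n# at a point x of M. *)
definition normal_square ::
    "nat \<Rightarrow> 'n point set \<Rightarrow> 'n::{finite,linorder} superform" where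
  "normal_square m M x =
     (let n = wedge_list (map (\<lambda>j. normal_form m M x j x) [0..<CARD('n) - m]) in n \<and>\<^sub>s Jop n)"

definition submanifold_current ::
    "'m::finite itself \<Rightarrow> 'n point set \<Rightarrow> 'n::{finite,linorder} supercurrent" where
  "submanifold_current T M =
     (let m = CARD('m); p = CARD('n) - m in
      current_wedge (measure_current M (surface_measure T M))
        (\<lambda>x. (- 1) ^ (p * (p - 1) div 2) *\<^sub>R normal_square m M x))"

definition volume_form ::
    "'m::finite itself \<Rightarrow> 'n::{finite,linorder} point set \<Rightarrow> 'n point measure" where
  "volume_form T M = current_measure
     (current_wedge (submanifold_current T M)
        (\<lambda>x. (1 / fact CARD('m)) *\<^sub>R wedge_power \<beta> CARD('m)))"


section \<open>Mean curvature flow\<close>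

(* F t x, for t in the interval I containing 0 and x in A, is the flow of X. At an end point of I
   that belongs to I the derivative is one-sided. *)
definition flow_on ::
    "real set \<Rightarrow> 'a set \<Rightarrow> ('a \<Rightarrow> 'a) \<Rightarrow> (real \<Rightarrow> 'a::real_normed_vector \<Rightarrow> 'a) \<Rightarrow> bool" where
  "flow_on I A X F \<longleftrightarrow>
     (\<forall>x\<in>A. F 0 x = x \<and>
        (\<forall>t\<in>I. ((\<lambda>s. F s x) has_vector_derivative X (F t x)) (at t within I)))"

definition mean_curvature_flow ::
    "nat \<Rightarrow> real set \<Rightarrow> (real \<Rightarrow> 'n::{finite,linorder} point set) \<Rightarrow> bool" where
  "mean_curvature_flow m I M \<longleftrightarrow>
     (\<forall>t\<in>I. submanifold m (M t)) \<and>
     (\<exists>X F. smooth_on X UNIV \<and>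
        (\<forall>t\<in>I. \<forall>x\<in>M t. X x = mean_curvature m (M t) x) \<and>
        flow_on I (M 0) (\<lambda>x. - X x) F \<and>
        (\<forall>t\<in>I. F t ` M 0 = M t))"

end

theory Submission
 imports Defs
begin

text \<open>
 In an orthonormal frame the current of \<open>M\<close> is the product of the forms \<open>dx\<^sub>v \<and> d\<xi>\<^sub>v\<close> over the unit
 normals \<open>v\<close>, so \<open>\<sigma>\<^sub>t\<close> is the surface measure and \<open>dd\<^sup># \<rho> \<and> S\<close> integrates the trace of the Hessian of
 \<open>\<rho>\<close> over the tangent spaces. Differentiating the area density along the flow of \<open>-H\<close> gives
 \<open>- \<integral> \<rho> tr\<^sub>T DH - \<integral> grad \<rho> \<bullet> H\<close>. Here \<open>tr\<^sub>T DZ = Z \<bullet> H\<close> for every field \<open>Z\<close> that is normal along \<open>M\<close>,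
 and the divergence theorem \<open>\<integral> tr\<^sub>T DY = \<integral> Y \<bullet> H\<close> for \<open>Y = grad \<rho>\<close> turns the second term into the integral
 of the traced Hessian. No second derivative of a parametrization enters the divergence theorem: in a
 graph chart over vectors \<open>e\<^sub>i\<close> the area density and the dual tangent frame are the values of ambient
 smooth functions, built from the orthonormal normals and the projections of the \<open>e\<^sub>i\<close>. The formula holds at
 every time, so monotonicity follows from the mean value theorem once the traced Hessian is nonnegative. For
 an \<open>m\<close>-subharmonic \<open>\<rho>\<close> this is seen by testing with the constant form of the normals at a point.
\<close>

text \<open>The flow is given only as a family of solutions starting on \<open>M 0\<close>; it is
  not assumed to extend to a differentiable map of the ambient space. Differentiability of the moved
  charts is therefore extracted from Gronwall estimates for finite linear combinations of
  trajectories. An atlas of \<open>M t0\<close>, cut into disjoint Borel pieces, is carried along,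
  so that integrals over nearby \<open>M t\<close> live on fixed parameter sets and only the
  integrand depends on time.

  Two objects given by choice or description have to be pinned down: the surface measure, by
  existence and uniqueness, and the mean curvature, whose normal system is chosen separately at each
  point, by its independence of that choice. Continuity of the mean curvature is inherited from the
  smooth ambient field that restricts to it. The curvature term has the opposite sign of \<rho>,
  hence the condition 0 \<le> \<rho> on the moving manifolds in the monotonicity statement.\<close>

section \<open>Wedge product of superforms at a point: associativity and sign rules\<close>

lemma sform_eqI: "(\<And>A B. a $ (A, B) = b $ (A, B)) \<Longrightarrow> a = (b :: 'n::finite sform)"
 by (simp add: vec_eq_iff split_paired_all)

lemma wedge_component:
 "(a \<and>\<^sub>s b) $ (A, B) = (\<Sum>I\<in>Pow A. \<Sum>J\<in>Pow B.
   (- 1) ^ (card J * card (A - I)) * shuffle_sign I (A - I) * shuffle_sign J (B - J)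
    * a $ (I, J) * b $ (A - I, B - J))"
 by (simp add: wedge_def)

lemma bounded_bilinear_wedge: "bounded_bilinear (wedge :: 'n::{finite,linorder} sform \<Rightarrow> _)"
proof -
 have "bilinear (wedge :: 'n sform \<Rightarrow> _)"
  unfolding bilinear_def
  by (intro conjI allI linearI)
   (rule sform_eqI, simp add: wedge_component algebra_simps sum.distrib sum_distrib_left)+
 then show ?thesis by (simp add: bilinear_conv_bounded_bilinear)
qed

interpretation wedge: bounded_bilinear "wedge :: 'n::{finite,linorder} sform \<Rightarrow> _"
 by (rule bounded_bilinear_wedge)

text \<open>The only new inversions pair \<open>k\<close> with an element of \<open>K\<close> below
  it.\<close>

lemma shuffle_sign_insert:
 assumes "k \<notin> I"
 shows "shuffle_sign (insert k I) K = (- 1) ^ card {j\<in>K. j < k} * shuffle_sign (I :: 'n::{finite,linorder} set) K"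
proof -
 have eq: "{(i, j). i \<in> insert k I \<and> j \<in> K \<and> j < i} =
   Pair k ` {j\<in>K. j < k} \<union> {(i, j). i \<in> I \<and> j \<in> K \<and> j < i}" by auto
 have fin: "finite {(i, j). i \<in> I \<and> j \<in> K \<and> j < i}"
  by (rule finite_subset[of _ UNIV]) auto
 have "card {(i, j). i \<in> insert k I \<and> j \<in> K \<and> j < i} =
   card {j\<in>K. j < k} + card {(i, j). i \<in> I \<and> j \<in> K \<and> j < i}"
  unfolding eq using assms by (subst card_Un_disjoint) (auto simp: fin card_image inj_on_def)
 then show ?thesis by (simp add: shuffle_sign_def power_add)
qed

lemma shuffle_sign_empty [simp]: "shuffle_sign {} K = 1" by (simp add: shuffle_sign_def)

lemma shuffle_sign_single:
 "shuffle_sign {k} (A - {k}) = (- 1) ^ card {j\<in>A. j < (k :: 'n::{finite,linorder})}"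
proof -
 have "{j \<in> A - {k}. j < k} = {j\<in>A. j < k}" by auto
 then show ?thesis using shuffle_sign_insert[of k "{}" "A - {k}"] by simp
qed

text \<open>With a single covector on the left at most one term of the double sum survives. This
  rule and \<open>dxi_wedge\<close> carry most of the sign computations; products of arbitrary forms
  are reduced to them by \<open>sform_induct\<close>.\<close>

lemma dx_wedge:
 "(dx k \<and>\<^sub>s a) $ (A, B) = (if k \<in> A then (- 1) ^ card {j\<in>A. j < k} * a $ (A - {k}, B) else 0)"
proof -
 have "(dx k \<and>\<^sub>s a) $ (A, B) = (\<Sum>I\<in>Pow A. \<Sum>J\<in>Pow B. if J = {} then
   (if I = {k} then shuffle_sign {k} (A - {k}) * a $ (A - {k}, B) else 0) else 0)"
  unfolding wedge_component by (intro sum.cong refl) (auto simp: dx_def axis_def)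
 also have "\<dots> = (\<Sum>I\<in>Pow A. if I = {k} then shuffle_sign {k} (A - {k}) * a $ (A - {k}, B) else 0)"
  by simp
 also have "\<dots> = (if k \<in> A then shuffle_sign {k} (A - {k}) * a $ (A - {k}, B) else 0)"
  by simp
 finally show ?thesis by (simp add: shuffle_sign_single)
qed

text \<open>The extra \<open>card A\<close> in the exponent counts the dx factors past which the new
  covector is moved.\<close>

lemma dxi_wedge:
 "(d\<xi> k \<and>\<^sub>s a) $ (A, B) =
  (if k \<in> B then (- 1) ^ (card A + card {j\<in>B. j < k}) * a $ (A, B - {k}) else 0)"
proof -
 have "(d\<xi> k \<and>\<^sub>s a) $ (A, B) = (\<Sum>I\<in>Pow A. \<Sum>J\<in>Pow B. if J = {k} then
   (if I = {} then (- 1) ^ card A * shuffle_sign {k} (B - {k}) * a $ (A, B - {k}) else 0) else 0)"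
  unfolding wedge_component by (intro sum.cong refl) (auto simp: d\<xi>_def axis_def)
 also have "\<dots> = (\<Sum>I\<in>Pow A. if I = {} then
   (if k \<in> B then (- 1) ^ card A * shuffle_sign {k} (B - {k}) * a $ (A, B - {k}) else 0) else 0)"
  by (intro sum.cong refl) (simp add: sum.delta)
 also have "\<dots> = (if k \<in> B then (- 1) ^ card A * shuffle_sign {k} (B - {k}) * a $ (A, B - {k}) else 0)"
  by simp
 finally show ?thesis by (simp add: shuffle_sign_single power_add)
qed

lemma sone_wedge [simp]: "sone \<and>\<^sub>s a = a"
proof (rule sform_eqI)
 fix A B
 have "(sone \<and>\<^sub>s a) $ (A, B) = (\<Sum>I\<in>Pow A. \<Sum>J\<in>Pow B. if J = {} then
   (if I = {} then a $ (A, B) else 0) else 0)"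
  unfolding wedge_component by (intro sum.cong refl) (auto simp: sone_def axis_def)
 also have "\<dots> = (\<Sum>I\<in>Pow A. if I = {} then a $ (A, B) else 0)"
  by simp
 also have "\<dots> = a $ (A, B)" by simp
 finally show "(sone \<and>\<^sub>s a) $ (A, B) = a $ (A, B)" .
qed

lemma dx_wedge_axis:
 assumes "k \<notin> I"
 shows "dx k \<and>\<^sub>s axis (I, J) 1 = (- 1) ^ card {j\<in>I. j < k} *\<^sub>R axis (insert k I, J) 1"
proof (rule sform_eqI)
 fix A B
 have "{j \<in> insert k I. j < k} = {j\<in>I. j < k}" by auto
 then show "(dx k \<and>\<^sub>s axis (I, J) 1) $ (A, B) =
   ((- 1) ^ card {j\<in>I. j < k} *\<^sub>R axis (insert k I, J) 1) $ (A, B)"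
  unfolding dx_wedge using assms by (auto simp: axis_def)
qed

lemma dxi_wedge_axis:
 assumes "k \<notin> J"
 shows "d\<xi> k \<and>\<^sub>s axis (I, J) 1 = (- 1) ^ (card I + card {j\<in>J. j < k}) *\<^sub>R axis (I, insert k J) 1"
proof (rule sform_eqI)
 fix A B
 have "{j \<in> insert k J. j < k} = {j\<in>J. j < k}" by auto
 then show "(d\<xi> k \<and>\<^sub>s axis (I, J) 1) $ (A, B) =
   ((- 1) ^ (card I + card {j\<in>J. j < k}) *\<^sub>R axis (I, insert k J) 1) $ (A, B)"
  unfolding dxi_wedge using assms by (auto simp: axis_def)
qed

text \<open>Each basis form arises from \<open>sone\<close> by successive left multiplication with
  generators, up to sign. Identities between arbitrary forms that are linear in one argument thereby
  reduce to multiplication by one covector.\<close>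

lemma sform_induct [case_names add scale one dx dxi]:
 fixes a :: "'n::{finite,linorder} sform"
 assumes add: "\<And>a b. P a \<Longrightarrow> P b \<Longrightarrow> P (a + b)"
  and scale: "\<And>c a. P a \<Longrightarrow> P (c *\<^sub>R a)"
  and one: "P sone"
  and dx: "\<And>k a. P a \<Longrightarrow> P (dx k \<and>\<^sub>s a)"
  and dxi: "\<And>k a. P a \<Longrightarrow> P (d\<xi> k \<and>\<^sub>s a)"
 shows "P a"
proof -
 \<comment> \<open>A sign is its own inverse, so scaling by it once more removes it.\<close>
 have sgn: "P b" if "P ((- 1) ^ e *\<^sub>R b)" for b e
  using scale[OF that, of "(- 1) ^ e"] by (simp add: power_mult_distrib[symmetric])
 have ax: "P (axis ({}, J) 1)" if "finite J" for J :: "'n set"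
  using that
 proof induction
  case empty
  then show ?case using one by (simp add: sone_def)
 next
  case (insert k J)
  then show ?case using dxi[OF insert.IH, of k] dxi_wedge_axis[of k J "{}"] sgn by metis
 qed
 have ax2: "P (axis (I, J) 1)" if "finite I" for I J :: "'n set"
  using that
 proof induction
  case empty
  then show ?case using ax by simp
 next
  case (insert k I)
  then show ?case using dx[OF insert.IH, of k] dx_wedge_axis[of k I J] sgn by metis
 qed
 have "P (\<Sum>i\<in>S. a $ i *\<^sub>R axis i 1)" if "finite S" for S :: "('n set \<times> 'n set) set"
  using that
 proof induction
  case empty
  then show ?case using scale[OF one, of 0] by simp
 next
  case (insert i S)
  moreover have "P (axis i 1)" using ax2[of "fst i" "snd i"] by simp
  ultimately show ?case using add scale by simp
 qed
 from this[of UNIV] have "P (\<Sum>i\<in>UNIV. a $ i *s axis i 1)" by (simp add: scalar_mult_eq_scaleR)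
 then show ?thesis by (simp add: basis_expansion)
qed

lemma sum_Pow_insert:
 assumes "finite A" "k \<notin> A" "\<And>I. I \<subseteq> A \<Longrightarrow> f I = 0"
 shows "(\<Sum>I\<in>Pow (insert k A). f I) = (\<Sum>I\<in>Pow A. f (insert k I))"
proof -
 have "(\<Sum>I\<in>Pow (insert k A). f I) = sum f (Pow A) + sum f (insert k ` Pow A)"
  unfolding Pow_insert using assms by (intro sum.union_disjoint) auto
 also have "sum f (Pow A) = 0" using assms by (intro sum.neutral) auto
 also have "sum f (insert k ` Pow A) = (\<Sum>I\<in>Pow A. f (insert k I))"
  using assms by (subst sum.reindex) (auto intro!: inj_onI dest: insert_ident[THEN iffD1, rotated 2])
 finally show ?thesis by simp
qed

text \<open>The elements of \<open>A\<close> below \<open>k\<close> split into those that go to the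
  left factor and those that go to the right one; the former give the sign of \<open>dx k\<close>
  acting on \<open>a\<close>, the latter the change of the shuffle sign.\<close>

lemma dx_wedge_assoc: "(dx k \<and>\<^sub>s a) \<and>\<^sub>s b = dx k \<and>\<^sub>s (a \<and>\<^sub>s (b :: 'n::{finite,linorder} sform))"
proof (rule sform_eqI)
 fix A B :: "'n set"
 show "((dx k \<and>\<^sub>s a) \<and>\<^sub>s b) $ (A, B) = (dx k \<and>\<^sub>s (a \<and>\<^sub>s b)) $ (A, B)"
 proof (cases "k \<in> A")
  case False
  then show ?thesis
   unfolding dx_wedge by (auto simp: wedge_component[of "dx k \<and>\<^sub>s a"] dx_wedge intro!: sum.neutral)
 next
  case True
  define A' where "A' = A - {k}"
  have A: "A = insert k A'" "k \<notin> A'" using True by (auto simp: A'_def)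
  have "((dx k \<and>\<^sub>s a) \<and>\<^sub>s b) $ (A, B) = (\<Sum>I\<in>Pow A'. \<Sum>J\<in>Pow B.
    (- 1) ^ (card J * card (A - insert k I)) * shuffle_sign (insert k I) (A - insert k I)
    * shuffle_sign J (B - J)
    * (dx k \<and>\<^sub>s a) $ (insert k I, J) * b $ (A - insert k I, B - J))"
   unfolding wedge_component[of "dx k \<and>\<^sub>s a"] A(1)
   by (rule sum_Pow_insert) (use A in \<open>auto simp: dx_wedge intro!: sum.neutral\<close>)
  also have "\<dots> = (\<Sum>I\<in>Pow A'. \<Sum>J\<in>Pow B. (- 1) ^ card {j\<in>A. j < k} *
    ((- 1) ^ (card J * card (A' - I)) * shuffle_sign I (A' - I)
    * shuffle_sign J (B - J) * a $ (I, J) * b $ (A' - I, B - J)))"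
  proof (intro sum.cong refl)
   fix I J assume I: "I \<in> Pow A'" and "J \<in> Pow B"
   have k: "k \<notin> I" using I A by auto
   have d: "A - insert k I = A' - I" "insert k I - {k} = I" using A I by auto
   have "{j\<in>A. j < k} = {j \<in> insert k I. j < k} \<union> {j\<in>A' - I. j < k}"
    using A I by auto
   then have "card {j\<in>A. j < k} = card {j \<in> insert k I. j < k} + card {j\<in>A' - I. j < k}"
    by (simp only:) (rule card_Un_disjoint, use A I in auto)
   then show "(- 1) ^ (card J * card (A - insert k I)) * shuffle_sign (insert k I) (A - insert k I)
     * shuffle_sign J (B - J) * (dx k \<and>\<^sub>s a) $ (insert k I, J) * b $ (A - insert k I, B - J) =
     (- 1) ^ card {j\<in>A. j < k} *
     ((- 1) ^ (card J * card (A' - I)) * shuffle_sign I (A' - I)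
     * shuffle_sign J (B - J) * a $ (I, J) * b $ (A' - I, B - J))"
    unfolding dx_wedge d shuffle_sign_insert[OF k] by (simp add: power_add)
  qed
  also have "\<dots> = (dx k \<and>\<^sub>s (a \<and>\<^sub>s b)) $ (A, B)"
   using True by (simp add: dx_wedge wedge_component[of a b] A'_def sum_distrib_left)
  finally show ?thesis .
 qed
qed

lemma dxi_wedge_assoc: "(d\<xi> k \<and>\<^sub>s a) \<and>\<^sub>s b = d\<xi> k \<and>\<^sub>s (a \<and>\<^sub>s (b :: 'n::{finite,linorder} sform))"
proof (rule sform_eqI)
 fix A B :: "'n set"
 show "((d\<xi> k \<and>\<^sub>s a) \<and>\<^sub>s b) $ (A, B) = (d\<xi> k \<and>\<^sub>s (a \<and>\<^sub>s b)) $ (A, B)"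
 proof (cases "k \<in> B")
  case False
  then show ?thesis
   unfolding dxi_wedge by (auto simp: wedge_component[of "d\<xi> k \<and>\<^sub>s a"] dxi_wedge intro!: sum.neutral)
 next
  case True
  define B' where "B' = B - {k}"
  have B: "B = insert k B'" "k \<notin> B'" using True by (auto simp: B'_def)
  have "((d\<xi> k \<and>\<^sub>s a) \<and>\<^sub>s b) $ (A, B) = (\<Sum>I\<in>Pow A. \<Sum>J\<in>Pow B'.
    (- 1) ^ (card (insert k J) * card (A - I)) * shuffle_sign I (A - I)
    * shuffle_sign (insert k J) (B - insert k J)
    * (d\<xi> k \<and>\<^sub>s a) $ (I, insert k J) * b $ (A - I, B - insert k J))"
   unfolding wedge_component[of "d\<xi> k \<and>\<^sub>s a"] B(1)
   by (intro sum.cong refl sum_Pow_insert) (use B in \<open>auto simp: dxi_wedge\<close>)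
  also have "\<dots> = (\<Sum>I\<in>Pow A. \<Sum>J\<in>Pow B'. (- 1) ^ (card A + card {j\<in>B. j < k}) *
    ((- 1) ^ (card J * card (A - I)) * shuffle_sign I (A - I)
    * shuffle_sign J (B' - J) * a $ (I, J) * b $ (A - I, B' - J)))"
  proof (intro sum.cong refl)
   fix I J assume I: "I \<in> Pow A" and J: "J \<in> Pow B'"
   have k: "k \<notin> J" using J B by auto
   have d: "B - insert k J = B' - J" "insert k J - {k} = J" using B J by auto
   have "{j\<in>B. j < k} = {j \<in> insert k J. j < k} \<union> {j\<in>B' - J. j < k}"
    using B J by auto
   then have c: "card {j\<in>B. j < k} = card {j \<in> insert k J. j < k} + card {j\<in>B' - J. j < k}"
    by (simp only:) (rule card_Un_disjoint, use B J in auto)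
   \<comment> \<open>Enlarging \<open>J\<close> by \<open>k\<close> adds \<open>card (A - I)\<close>
     to the exponent; together with \<open>card I\<close> from \<open>dxi_wedge\<close> this makes
     up the \<open>card A\<close> of the other side.\<close>
   have cA: "card A = card I + card (A - I)" using I
    by (simp add: card_Diff_subset card_mono)
   have cJ: "card (insert k J) = Suc (card J)" using k by simp
   show "(- 1) ^ (card (insert k J) * card (A - I)) * shuffle_sign I (A - I)
     * shuffle_sign (insert k J) (B - insert k J)
     * (d\<xi> k \<and>\<^sub>s a) $ (I, insert k J) * b $ (A - I, B - insert k J) =
     (- 1) ^ (card A + card {j\<in>B. j < k}) *
     ((- 1) ^ (card J * card (A - I)) * shuffle_sign I (A - I)
     * shuffle_sign J (B' - J) * a $ (I, J) * b $ (A - I, B' - J))"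
    unfolding dxi_wedge d shuffle_sign_insert[OF k] c cA cJ by (simp add: power_add)
  qed
  also have "\<dots> = (d\<xi> k \<and>\<^sub>s (a \<and>\<^sub>s b)) $ (A, B)"
   using True by (simp add: dxi_wedge wedge_component[of a b] B'_def sum_distrib_left)
  finally show ?thesis .
 qed
qed

lemma wedge_assoc: "(a \<and>\<^sub>s b) \<and>\<^sub>s c = a \<and>\<^sub>s (b \<and>\<^sub>s (c :: 'n::{finite,linorder} sform))"
proof (induction a rule: sform_induct)
qed (simp_all add: wedge.add_left wedge.scaleR_left dx_wedge_assoc dxi_wedge_assoc)

lemma wedge_sone [simp]: "a \<and>\<^sub>s sone = (a :: 'n::{finite,linorder} sform)"
proof (induction a rule: sform_induct)
qed (simp_all add: wedge.add_left wedge.scaleR_left wedge_assoc)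

lemma card_less_remove:
 fixes k l :: "'n::{finite,linorder}"
 assumes "k < l" "k \<in> A"
 shows "card {j\<in>A. j < l} = Suc (card {j\<in>A - {k}. j < l})" "{j\<in>A - {l}. j < k} = {j\<in>A. j < k}"
proof -
 have "{j\<in>A. j < l} = insert k {j\<in>A - {k}. j < l}" using assms by auto
 then show "card {j\<in>A. j < l} = Suc (card {j\<in>A - {k}. j < l})"
  by (simp only:) (subst card_insert_disjoint, auto)
 show "{j\<in>A - {l}. j < k} = {j\<in>A. j < k}" using assms by auto
qed

lemma Diff_two_commute: "A - {k} - {l} = A - {l} - {k}" by auto

text \<open>Removing the smaller index lowers the count below the larger one by one, while removing
  the larger leaves the other count unchanged; this is the sign. For equal indices both products
  vanish.\<close>

lemma dx_dx_anticommute: "dx k \<and>\<^sub>s dx l \<and>\<^sub>s a = - (dx l \<and>\<^sub>s dx k \<and>\<^sub>s (a :: 'n::{finite,linorder} sform))"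
proof -
 have *: "dx k \<and>\<^sub>s dx l \<and>\<^sub>s a = - (dx l \<and>\<^sub>s dx k \<and>\<^sub>s a)" if "k < l" for k l
 proof (rule sform_eqI)
  fix A B
  show "(dx k \<and>\<^sub>s dx l \<and>\<^sub>s a) $ (A, B) = (- (dx l \<and>\<^sub>s dx k \<and>\<^sub>s a)) $ (A, B)"
  proof (cases "k \<in> A \<and> l \<in> A")
   case True
   then show ?thesis using that card_less_remove[OF that, of A] Diff_two_commute[of A k l]
    by (simp add: dx_wedge)
  qed (auto simp: dx_wedge)
 qed
 have "dx k \<and>\<^sub>s dx k \<and>\<^sub>s a = 0" by (rule sform_eqI) (simp add: dx_wedge)
 then show ?thesis using *[of k l] *[of l k] by (cases k l rule: linorder_cases) auto
qed

lemma dxi_dxi_anticommute: "d\<xi> k \<and>\<^sub>s d\<xi> l \<and>\<^sub>s a = - (d\<xi> l \<and>\<^sub>s d\<xi> k \<and>\<^sub>s (a :: 'n::{finite,linorder} sform))"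
proof -
 have *: "d\<xi> k \<and>\<^sub>s d\<xi> l \<and>\<^sub>s a = - (d\<xi> l \<and>\<^sub>s d\<xi> k \<and>\<^sub>s a)" if "k < l" for k l
 proof (rule sform_eqI)
  fix A B
  show "(d\<xi> k \<and>\<^sub>s d\<xi> l \<and>\<^sub>s a) $ (A, B) = (- (d\<xi> l \<and>\<^sub>s d\<xi> k \<and>\<^sub>s a)) $ (A, B)"
  proof (cases "k \<in> B \<and> l \<in> B")
   case True
   then show ?thesis using that card_less_remove[OF that, of B] Diff_two_commute[of B k l]
    by (simp add: dxi_wedge power_add)
  qed (auto simp: dxi_wedge)
 qed
 have "d\<xi> k \<and>\<^sub>s d\<xi> k \<and>\<^sub>s a = 0" by (rule sform_eqI) (simp add: dxi_wedge)
 then show ?thesis using *[of k l] *[of l k] by (cases k l rule: linorder_cases) auto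
qed

lemma dxi_dx_anticommute: "d\<xi> l \<and>\<^sub>s dx k \<and>\<^sub>s a = - (dx k \<and>\<^sub>s d\<xi> l \<and>\<^sub>s (a :: 'n::{finite,linorder} sform))"
proof (rule sform_eqI)
 fix A B :: "'n set"
 have "k \<in> A \<Longrightarrow> (- 1 :: real) ^ card A = - ((- 1) ^ (card (A - {k})))"
  by (subst card.remove[of A k]) auto
 then show "(d\<xi> l \<and>\<^sub>s dx k \<and>\<^sub>s a) $ (A, B) = (- (dx k \<and>\<^sub>s d\<xi> l \<and>\<^sub>s a)) $ (A, B)"
  by (simp add: dx_wedge dxi_wedge power_add)
qed

declare wedge.zero_left [simp] wedge.zero_right [simp]

section \<open>Covectors attached to vectors\<close>

text \<open>\<open>dx_of v\<close> is the (1,0)-form dual to \<open>v\<close>, and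
  \<open>dxi_of v\<close> is its image under J. They allow computations in an arbitrary orthonormal
  frame instead of the coordinate one.\<close>

definition dx_of :: "'n::finite point \<Rightarrow> 'n sform" where
 "dx_of v = (\<Sum>k\<in>UNIV. v $ k *\<^sub>R dx k)"

definition dxi_of :: "'n::finite point \<Rightarrow> 'n sform" where
 "dxi_of v = (\<Sum>k\<in>UNIV. v $ k *\<^sub>R d\<xi> k)"

lemma linear_dx_of: "linear dx_of"
 by (intro linearI) (simp_all add: dx_of_def algebra_simps sum.distrib scaleR_sum_right)

lemma linear_dxi_of: "linear dxi_of"
 by (intro linearI) (simp_all add: dxi_of_def algebra_simps sum.distrib scaleR_sum_right)

lemma dx_of_axis [simp]: "dx_of (axis i 1) = dx i"
proof -
 have "dx_of (axis i 1) = (\<Sum>k\<in>UNIV. if k = i then dx k else 0)"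
  unfolding dx_of_def by (intro sum.cong refl) (auto simp: axis_def)
 then show ?thesis by simp
qed

lemma dxi_of_axis [simp]: "dxi_of (axis i 1) = d\<xi> i"
proof -
 have "dxi_of (axis i 1) = (\<Sum>k\<in>UNIV. if k = i then d\<xi> k else 0)"
  unfolding dxi_of_def by (intro sum.cong refl) (auto simp: axis_def)
 then show ?thesis by simp
qed

lemma sum_wedge_anticommute:
 fixes X Y :: "'n::{finite,linorder} \<Rightarrow> 'n sform"
 assumes "\<And>k l. X k \<and>\<^sub>s Y l \<and>\<^sub>s a = - (Y l \<and>\<^sub>s X k \<and>\<^sub>s a)"
 shows "(\<Sum>k\<in>UNIV. v k *\<^sub>R X k) \<and>\<^sub>s (\<Sum>l\<in>UNIV. w l *\<^sub>R Y l) \<and>\<^sub>s a =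
  - ((\<Sum>l\<in>UNIV. w l *\<^sub>R Y l) \<and>\<^sub>s (\<Sum>k\<in>UNIV. v k *\<^sub>R X k) \<and>\<^sub>s a)"
proof -
 have "(\<Sum>k\<in>UNIV. v k *\<^sub>R X k) \<and>\<^sub>s (\<Sum>l\<in>UNIV. w l *\<^sub>R Y l) \<and>\<^sub>s a =
   (\<Sum>k\<in>UNIV. \<Sum>l\<in>UNIV. (v k * w l) *\<^sub>R (X k \<and>\<^sub>s Y l \<and>\<^sub>s a))"
  by (subst sum.swap) (simp add: wedge.sum_left wedge.sum_right wedge.scaleR_left wedge.scaleR_right
    scaleR_sum_right mult.commute)
 also have "\<dots> = - (\<Sum>k\<in>UNIV. \<Sum>l\<in>UNIV. (w l * v k) *\<^sub>R (Y l \<and>\<^sub>s X k \<and>\<^sub>s a))"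
  unfolding assms by (simp add: sum_negf mult.commute)
 also have "\<dots> = - ((\<Sum>l\<in>UNIV. w l *\<^sub>R Y l) \<and>\<^sub>s (\<Sum>k\<in>UNIV. v k *\<^sub>R X k) \<and>\<^sub>s a)"
  by (simp add: wedge.sum_left wedge.sum_right wedge.scaleR_left wedge.scaleR_right
    scaleR_sum_right mult.commute)
 finally show ?thesis .
qed

lemma dx_of_anticommute: "dx_of v \<and>\<^sub>s dx_of w \<and>\<^sub>s a = - (dx_of w \<and>\<^sub>s dx_of v \<and>\<^sub>s a)"
 unfolding dx_of_def by (rule sum_wedge_anticommute) (rule dx_dx_anticommute)

lemma dxi_of_anticommute: "dxi_of v \<and>\<^sub>s dxi_of w \<and>\<^sub>s a = - (dxi_of w \<and>\<^sub>s dxi_of v \<and>\<^sub>s a)"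
 unfolding dxi_of_def by (rule sum_wedge_anticommute) (rule dxi_dxi_anticommute)

lemma dxi_of_dx_of_anticommute: "dxi_of v \<and>\<^sub>s dx_of w \<and>\<^sub>s a = - (dx_of w \<and>\<^sub>s dxi_of v \<and>\<^sub>s a)"
 unfolding dxi_of_def dx_of_def by (rule sum_wedge_anticommute) (rule dxi_dx_anticommute)

lemma sform_eq_minus_self: "a = - a \<Longrightarrow> a = (0 :: 'n::finite sform)"
 by (metis add.right_inverse scaleR_2 scaleR_eq_0_iff zero_neq_numeral)

lemma dx_of_self [simp]: "dx_of v \<and>\<^sub>s dx_of v \<and>\<^sub>s a = 0"
 by (rule sform_eq_minus_self) (rule dx_of_anticommute)

lemma dxi_of_self [simp]: "dxi_of v \<and>\<^sub>s dxi_of v \<and>\<^sub>s a = 0"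
 by (rule sform_eq_minus_self) (rule dxi_of_anticommute)

text \<open>The rank one (1,1)-form of \<open>v\<close>. Such forms are central and have square
  zero, and the forms needed here are sums and products of them.\<close>

definition dx_dxi :: "'n::{finite,linorder} point \<Rightarrow> 'n sform" where
 "dx_dxi v = dx_of v \<and>\<^sub>s dxi_of v"

lemma dx_dxi_commute_left:
 "dx_of v \<and>\<^sub>s dxi_of w \<and>\<^sub>s dx_of u \<and>\<^sub>s a = dx_of u \<and>\<^sub>s dx_of v \<and>\<^sub>s dxi_of w \<and>\<^sub>s a"
 "dx_of v \<and>\<^sub>s dxi_of w \<and>\<^sub>s dxi_of u \<and>\<^sub>s a = dxi_of u \<and>\<^sub>s dx_of v \<and>\<^sub>s dxi_of w \<and>\<^sub>s a"
 by (simp_all add: dxi_of_dx_of_anticommute[of w] dxi_of_anticommute[of w] wedge.minus_right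
   dx_of_anticommute[of v u] dxi_of_dx_of_anticommute[of u])

text \<open>Two covectors are moved past each generator at once, so the signs cancel. Distinct
  \<open>v\<close> and \<open>w\<close> are allowed because the entries of a Hessian form are of
  this mixed kind.\<close>

lemma dx_of_dxi_of_central: "(dx_of v \<and>\<^sub>s dxi_of w) \<and>\<^sub>s a = a \<and>\<^sub>s dx_of v \<and>\<^sub>s dxi_of w"
proof (induction a rule: sform_induct)
 case (dx k a)
 have "(dx_of v \<and>\<^sub>s dxi_of w) \<and>\<^sub>s dx k \<and>\<^sub>s a = dx k \<and>\<^sub>s (dx_of v \<and>\<^sub>s dxi_of w) \<and>\<^sub>s a"
  using dx_dxi_commute_left(1)[of v w "axis k 1" a] by (simp add: wedge_assoc)
 then show ?case using dx by (simp add: wedge_assoc)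
next
 case (dxi k a)
 have "(dx_of v \<and>\<^sub>s dxi_of w) \<and>\<^sub>s d\<xi> k \<and>\<^sub>s a = d\<xi> k \<and>\<^sub>s (dx_of v \<and>\<^sub>s dxi_of w) \<and>\<^sub>s a"
  using dx_dxi_commute_left(2)[of v w "axis k 1" a] by (simp add: wedge_assoc)
 then show ?case using dxi by (simp add: wedge_assoc)
qed (simp_all add: wedge.add_left wedge.add_right wedge.scaleR_left wedge.scaleR_right)

lemma dx_dxi_central: "dx_dxi v \<and>\<^sub>s a = a \<and>\<^sub>s dx_dxi v"
 unfolding dx_dxi_def by (rule dx_of_dxi_of_central)

lemma dx_dxi_self: "dx_dxi v \<and>\<^sub>s dx_dxi v = 0"
 by (simp add: dx_dxi_def wedge_assoc dxi_of_dx_of_anticommute[of v v] wedge.minus_right)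

lemma dx_dxi_axis: "dx_dxi (axis i 1) = dx i \<and>\<^sub>s d\<xi> i"
 by (simp add: dx_dxi_def)

lemma dx_dxi_scaleR: "dx_dxi (c *\<^sub>R v) = c\<^sup>2 *\<^sub>R dx_dxi v"
 by (simp add: dx_dxi_def linear_cmul[OF linear_dx_of] linear_cmul[OF linear_dxi_of]
   wedge.scaleR_left wedge.scaleR_right power2_eq_square)

lemma beta_eq: "\<beta> = (\<Sum>k\<in>UNIV. dx_dxi (axis k 1))"
 by (simp add: \<beta>_def dx_dxi_axis)

lemma beta_central: "\<beta> \<and>\<^sub>s a = a \<and>\<^sub>s \<beta>"
 unfolding beta_eq wedge.sum_left wedge.sum_right by (simp add: dx_dxi_central)

lemma wedge_list_Nil [simp]: "wedge_list [] = sone"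
 and wedge_list_Cons [simp]: "wedge_list (a # as) = a \<and>\<^sub>s wedge_list as"
 by (simp_all add: wedge_list_def)

lemma wedge_list_append: "wedge_list (as @ bs) = wedge_list as \<and>\<^sub>s wedge_list bs"
 by (induction as) (simp_all add: wedge_assoc)

lemma wedge_power_0 [simp]: "wedge_power a 0 = sone"
 and wedge_power_Suc [simp]: "wedge_power a (Suc k) = a \<and>\<^sub>s wedge_power a k"
 by (simp_all add: wedge_power_def)

lemma beta_power_central: "wedge_power \<beta> k \<and>\<^sub>s a = a \<and>\<^sub>s wedge_power \<beta> k"
proof (induction k)
 case (Suc k)
 then show ?case by (metis wedge_power_Suc wedge_assoc beta_central)
qed simp

text \<open>The binomial formula, cut off after the linear term because the square of
  \<open>b\<close> vanishes.\<close>

lemma wedge_power_add_square_zero: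
 assumes ab: "a \<and>\<^sub>s b = b \<and>\<^sub>s a" and bb: "b \<and>\<^sub>s b = 0"
 shows "wedge_power (a + b) (Suc k) =
  wedge_power a (Suc k) + real (Suc k) *\<^sub>R (b \<and>\<^sub>s wedge_power a k)"
proof (induction k)
 case 0
 then show ?case by (simp add: wedge.add_left)
next
 case (Suc k)
 have 1: "a \<and>\<^sub>s b \<and>\<^sub>s x = b \<and>\<^sub>s a \<and>\<^sub>s x" for x by (metis wedge_assoc ab)
 have 2: "b \<and>\<^sub>s b \<and>\<^sub>s x = 0" for x by (metis wedge_assoc bb wedge.zero_left)
 have 3: "real (Suc (Suc k)) *\<^sub>R x = real (Suc k) *\<^sub>R x + x" for x :: "'a sform"
  using scaleR_left_distrib[of "real (Suc k)" 1 x] by simp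
 have "wedge_power (a + b) (Suc (Suc k)) =
   (a + b) \<and>\<^sub>s (wedge_power a (Suc k) + real (Suc k) *\<^sub>R (b \<and>\<^sub>s wedge_power a k))"
  using Suc by simp
 also have "\<dots> = wedge_power a (Suc (Suc k)) + real (Suc (Suc k)) *\<^sub>R (b \<and>\<^sub>s wedge_power a (Suc k))"
  by (simp only: wedge_power_Suc wedge.add_left wedge.add_right wedge.scaleR_right 1 2 3
    scaleR_zero_right add_0_right add_0_left add_ac)
 finally show ?case .
qed

abbreviation dx_dxi_list :: "'n::{finite,linorder} point list \<Rightarrow> 'n sform" where
 "dx_dxi_list vs \<equiv> wedge_list (map dx_dxi vs)"

text \<open>In the multinomial expansion of commuting elements of square zero only products of
  distinct factors survive; each is met \<open>fact (length vs)\<close> times, and one power more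
  would have to repeat a factor.\<close>

lemma sum_list_dx_dxi_power:
 fixes vs :: "'n::{finite,linorder} point list"
 defines "s \<equiv> \<lambda>vs. sum_list (map (dx_dxi :: 'n point \<Rightarrow> _) vs)"
 shows "wedge_power (s vs) (length vs) = fact (length vs) *\<^sub>R dx_dxi_list vs \<and>
  wedge_power (s vs) (Suc (length vs)) = 0"
proof (induction vs)
 case Nil
 then show ?case by (simp add: s_def)
next
 case (Cons v vs)
 have s: "s (v # vs) = s vs + dx_dxi v" by (simp add: s_def add.commute)
 note P = wedge_power_add_square_zero[OF dx_dxi_central[symmetric] dx_dxi_self]
 have 1: "wedge_power (s vs) (length vs) = fact (length vs) *\<^sub>R dx_dxi_list vs"
  and 2: "wedge_power (s vs) (Suc (length vs)) = 0" using Cons by auto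
 have "wedge_power (s vs) (Suc (Suc (length vs))) = 0"
  by (subst wedge_power_Suc) (simp only: 2 wedge.zero_right)
 then show ?case unfolding s
  by (simp only: P list.size(4) add_Suc_right add_0_right One_nat_def 1 2 wedge.zero_right)
   (simp add: wedge.scaleR_right)
qed

section \<open>Orthonormal frames and powers of \<beta>\<close>

definition orthonormal_list :: "'a::real_inner list \<Rightarrow> bool" where
 "orthonormal_list vs \<longleftrightarrow>
   distinct vs \<and> pairwise orthogonal (set vs) \<and> (\<forall>v\<in>set vs. norm v = 1)"

text \<open>For orthonormal \<open>N\<close> this is the projection onto the orthogonal complement
  of \<open>N\<close>; for the unit normals at a point of \<open>M\<close> it projects onto the
  tangent space.\<close>

definition orth_rest :: "'a::real_inner set \<Rightarrow> 'a \<Rightarrow> 'a" where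
 "orth_rest N v = v - (\<Sum>u\<in>N. (v \<bullet> u) *\<^sub>R u)"

lemma linear_orth_rest: "linear (orth_rest N)"
 by (rule linearI) (simp_all add: orth_rest_def inner_add_left scaleR_add_left sum.distrib
   scaleR_diff_right scaleR_sum_right)

lemma orth_rest_inner:
 assumes "finite N" "pairwise orthogonal N" "\<forall>v\<in>N. norm v = 1" "u \<in> N"
 shows "orth_rest N v \<bullet> u = 0"
proof -
 have "(\<Sum>w\<in>N. (v \<bullet> w) * (w \<bullet> u)) = (\<Sum>w\<in>N. if w = u then v \<bullet> u else 0)"
  using assms by (intro sum.cong refl) (auto simp: pairwise_def orthogonal_def dot_square_norm)
 then show ?thesis using assms by (simp add: orth_rest_def inner_diff_left inner_sum_left)
qed

lemma orth_rest_inner_rest: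
 assumes "finite N" "pairwise orthogonal N" "\<forall>v\<in>N. norm v = 1"
 shows "orth_rest N v \<bullet> orth_rest N w = orth_rest N v \<bullet> w"
proof -
 have "orth_rest N v \<bullet> (\<Sum>u\<in>N. (w \<bullet> u) *\<^sub>R u) = 0"
  unfolding inner_sum_right using assms by (intro sum.neutral) (simp add: orth_rest_inner)
 then show ?thesis by (simp add: orth_rest_def[of N w] inner_diff_right)
qed

lemma orthonormal_list_append_orth_rest:
 assumes vs: "orthonormal_list vs" and r: "orth_rest (set vs) v \<noteq> 0"
 shows "orthonormal_list (vs @ [sgn (orth_rest (set vs) v)])"
proof -
 let ?e = "sgn (orth_rest (set vs) v)"
 have o: "u \<bullet> ?e = 0" if "u \<in> set vs" for u
  using orth_rest_inner[of "set vs" u v] vs that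
  by (simp add: orthonormal_list_def sgn_div_norm inner_commute)
 have n: "norm ?e = 1" using r by (simp add: norm_sgn)
 have "?e \<notin> set vs" using o n by fastforce
 then show ?thesis using vs o n
  by (auto simp: orthonormal_list_def pairwise_insert orthogonal_def inner_commute)
qed

lemma orthonormal_full_expansion:
 fixes N :: "'a::euclidean_space set"
 assumes "finite N" "pairwise orthogonal N" "\<forall>v\<in>N. norm v = 1" "card N = DIM('a)"
 shows "(\<Sum>u\<in>N. (v \<bullet> u) *\<^sub>R u) = v"
proof -
 have "0 \<notin> N" using assms by auto
 then have "independent N" using assms pairwise_orthogonal_independent by blast
 then have "span N = UNIV"
  by (metis assms(4) card_ge_dim_independent dim_UNIV subset_UNIV top.extremum_uniqueI order_refl)
 then show ?thesis using assms by (intro orthonormal_basis_expand) auto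
qed

text \<open>\<beta> encodes the Euclidean metric and therefore looks the same in every orthonormal
  frame: expanding each d\<xi>_k in the frame and summing over k collects the dx part of the same
  frame vector.\<close>

lemma beta_orthonormal:
 fixes vs :: "'n::{finite,linorder} point list"
 assumes vs: "orthonormal_list vs" and l: "length vs = CARD('n)"
 shows "\<beta> = sum_list (map dx_dxi vs)"
proof -
 have d: "distinct vs" using vs by (simp add: orthonormal_list_def)
 have ex: "(\<Sum>u\<in>set vs. (v \<bullet> u) *\<^sub>R u) = v" for v
  using vs l by (intro orthonormal_full_expansion) (auto simp: orthonormal_list_def distinct_card)
 have "\<beta> = (\<Sum>k\<in>UNIV. dx k \<and>\<^sub>s dxi_of (\<Sum>u\<in>set vs. (axis k 1 \<bullet> u) *\<^sub>R u))"
  unfolding ex by (simp add: \<beta>_def)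
 also have "\<dots> = (\<Sum>k\<in>UNIV. \<Sum>u\<in>set vs. u $ k *\<^sub>R (dx k \<and>\<^sub>s dxi_of u))"
  by (simp add: linear_sum[OF linear_dxi_of] linear_cmul[OF linear_dxi_of] wedge.sum_right
    wedge.scaleR_right inner_axis' )
 also have "\<dots> = (\<Sum>u\<in>set vs. \<Sum>k\<in>UNIV. u $ k *\<^sub>R (dx k \<and>\<^sub>s dxi_of u))"
  by (rule sum.swap)
 also have "\<dots> = (\<Sum>u\<in>set vs. dx_dxi u)"
  by (simp add: dx_dxi_def dx_of_def wedge.sum_left wedge.scaleR_left)
 finally show ?thesis using d by (simp add: sum_list_distinct_conv_sum_set)
qed

lemma supervol_eq: "supervol = dx_dxi_list (map (\<lambda>i. axis i 1) (sorted_list_of_set UNIV))"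
 by (simp add: supervol_def comp_def dx_dxi_axis)

lemma orthonormal_list_axis:
 "orthonormal_list (map (\<lambda>i. axis i 1 :: real^'n::{finite,linorder}) (sorted_list_of_set UNIV))"
 by (auto simp: orthonormal_list_def distinct_map inj_on_def axis_eq_axis pairwise_def
   orthogonal_def inner_axis_axis)

text \<open>Both sides are the n-th power of \<beta> divided by n!. Thus no determinant and no
  orientation enters; every frame vector occurs twice, so its sign is immaterial.\<close>

lemma dx_dxi_list_orthonormal:
 fixes vs :: "'n::{finite,linorder} point list"
 assumes vs: "orthonormal_list vs" and l: "length vs = CARD('n)"
 shows "dx_dxi_list vs = supervol"
proof -
 have "fact CARD('n) *\<^sub>R dx_dxi_list vs = wedge_power \<beta> CARD('n)"
  using sum_list_dx_dxi_power[of vs] beta_orthonormal[OF assms] l by simp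
 moreover have "fact CARD('n) *\<^sub>R (supervol :: 'n sform) = wedge_power \<beta> CARD('n)"
 proof -
  define ws where "ws = map (\<lambda>i. axis i 1 :: 'n point) (sorted_list_of_set UNIV)"
  have "\<beta> = sum_list (map dx_dxi ws)" "length ws = CARD('n)" "supervol = dx_dxi_list ws"
   unfolding ws_def supervol_eq by (intro beta_orthonormal orthonormal_list_axis refl | simp)+
  then show ?thesis using sum_list_dx_dxi_power[of ws] by simp
 qed
 ultimately have "fact CARD('n) *\<^sub>R dx_dxi_list vs = fact CARD('n) *\<^sub>R supervol" by simp
 then show ?thesis by simp
qed

lemma supervol_nonzero: "(supervol :: 'n::{finite,linorder} sform) $ (UNIV, UNIV) \<noteq> 0"
proof -
 have "wedge_list (map (\<lambda>i. dx i \<and>\<^sub>s d\<xi> i) ks) $ (set ks, set ks) \<noteq> 0" if "distinct ks" for ks :: "'n list"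
  using that
 proof (induction ks)
  case Nil
  then show ?case by (simp add: sone_def axis_def)
 next
  case (Cons k ks)
  then have "insert k (set ks) - {k} = set ks" by auto
  then show ?case using Cons by (simp add: wedge_assoc dx_wedge dxi_wedge)
 qed
 from this[of "sorted_list_of_set UNIV"] show ?thesis by (simp add: supervol_def)
qed

lemma top_coeff_supervol [simp]: "top_coeff supervol = 1"
 using supervol_nonzero by (simp add: top_coeff_def)

lemma linear_top_coeff: "linear (top_coeff :: 'n::{finite,linorder} sform \<Rightarrow> real)"
 by (rule linearI) (simp_all add: top_coeff_def add_divide_distrib)

lemma dx_dxi_list_kill:
 assumes "u \<in> set vs"
 shows "dx_dxi_list vs \<and>\<^sub>s dx_of u \<and>\<^sub>s a = 0" "dx_dxi_list vs \<and>\<^sub>s dxi_of u \<and>\<^sub>s a = 0"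
proof -
 have k1: "dx_dxi u \<and>\<^sub>s dx_of u = 0"
  by (simp add: dx_dxi_def wedge_assoc dxi_of_dx_of_anticommute[of u u sone, simplified] wedge.minus_right
   dx_of_self[of u "dxi_of u"])
 have k2: "dx_dxi u \<and>\<^sub>s dxi_of u = 0"
  using dxi_of_self[of u sone] by (simp add: dx_dxi_def wedge_assoc)
 have "dx_dxi_list vs \<and>\<^sub>s dx_of u = 0 \<and> dx_dxi_list vs \<and>\<^sub>s dxi_of u = 0" using assms
 proof (induction vs)
  case (Cons v vs)
  show ?case
  proof (cases "u = v")
   case True
   have "dx_dxi u \<and>\<^sub>s dx_dxi_list vs \<and>\<^sub>s b = dx_dxi_list vs \<and>\<^sub>s dx_dxi u \<and>\<^sub>s b" for b
    by (metis dx_dxi_central wedge_assoc)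
   then show ?thesis using k1 k2 unfolding True by (simp add: wedge_assoc)
  next
   case False
   then show ?thesis using Cons by (simp add: wedge_assoc)
  qed
 qed simp
 then show "dx_dxi_list vs \<and>\<^sub>s dx_of u \<and>\<^sub>s a = 0" "dx_dxi_list vs \<and>\<^sub>s dxi_of u \<and>\<^sub>s a = 0"
  by (metis wedge_assoc wedge.zero_left)+
qed

text \<open>The component of \<open>v\<close> in the span of \<open>vs\<close> repeats covectors
  that the list already contains, and is annihilated.\<close>

lemma dx_dxi_list_orth_rest:
 "dx_dxi_list vs \<and>\<^sub>s dx_dxi v = dx_dxi_list vs \<and>\<^sub>s dx_dxi (orth_rest (set vs) v)"
proof -
 let ?s = "\<Sum>u\<in>set vs. (v \<bullet> u) *\<^sub>R u"
 have v: "v = orth_rest (set vs) v + ?s" by (simp add: orth_rest_def)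
 have 1: "dx_dxi_list vs \<and>\<^sub>s dx_of ?s \<and>\<^sub>s a = 0" for a
  by (simp add: linear_sum[OF linear_dx_of] linear_cmul[OF linear_dx_of] wedge.sum_right
    wedge.scaleR_right wedge.sum_left wedge.scaleR_left dx_dxi_list_kill)
 have 2: "dx_dxi_list vs \<and>\<^sub>s dx_of w \<and>\<^sub>s dxi_of ?s = 0" for w
 proof -
  have "dx_dxi_list vs \<and>\<^sub>s dxi_of ?s \<and>\<^sub>s dx_of w = 0"
   by (simp add: linear_sum[OF linear_dxi_of] linear_cmul[OF linear_dxi_of] wedge.sum_right
     wedge.scaleR_right wedge.sum_left wedge.scaleR_left dx_dxi_list_kill)
  then show ?thesis
   using dxi_of_dx_of_anticommute[of ?s w sone] by (simp add: wedge.minus_right)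
 qed
 have "dx_dxi_list vs \<and>\<^sub>s dx_dxi v = dx_dxi_list vs \<and>\<^sub>s dx_dxi (orth_rest (set vs) v + ?s)"
  using v by simp
 also have "\<dots> = dx_dxi_list vs \<and>\<^sub>s dx_dxi (orth_rest (set vs) v)"
  unfolding dx_dxi_def linear_add[OF linear_dx_of] linear_add[OF linear_dxi_of]
   wedge.add_left wedge.add_right 1 2 by simp
 finally show ?thesis .
qed

lemma dx_dxi_list_wedge_dx_dxi:
 assumes "orth_rest (set vs) v \<noteq> 0"
 shows "dx_dxi_list vs \<and>\<^sub>s dx_dxi v =
  (norm (orth_rest (set vs) v))\<^sup>2 *\<^sub>R dx_dxi_list (vs @ [sgn (orth_rest (set vs) v)])"
proof -
 let ?r = "orth_rest (set vs) v"
 have "?r = norm ?r *\<^sub>R sgn ?r" using assms by (simp add: sgn_div_norm)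
 then have "dx_dxi ?r = (norm ?r)\<^sup>2 *\<^sub>R dx_dxi (sgn ?r)" by (metis dx_dxi_scaleR)
 then show ?thesis
  by (subst dx_dxi_list_orth_rest) (simp add: wedge_list_append wedge.scaleR_right)
qed

lemma dx_dxi_0 [simp]: "dx_dxi 0 = 0"
 using dx_dxi_scaleR[of 0 0] by simp

text \<open>The left side is the trace of a projection, the right side the dimension of its
  range.\<close>

lemma sum_norm_orth_rest_axis:
 fixes vs :: "'n::{finite,linorder} point list"
 assumes "orthonormal_list vs"
 shows "(\<Sum>k\<in>UNIV. (norm (orth_rest (set vs) (axis k 1)))\<^sup>2) = real CARD('n) - real (length vs)"
proof -
 have *: "(norm (orth_rest (set vs) (axis k 1)))\<^sup>2 = 1 - (\<Sum>u\<in>set vs. (u $ k)\<^sup>2)" for k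
 proof -
  have "(norm (orth_rest (set vs) (axis k 1)))\<^sup>2 = orth_rest (set vs) (axis k 1) \<bullet> axis k 1"
   using orth_rest_inner_rest[of "set vs" "axis k 1" "axis k 1"] assms
   by (simp add: orthonormal_list_def dot_square_norm)
  also have "\<dots> = 1 - (\<Sum>u\<in>set vs. (u $ k)\<^sup>2)"
   by (simp add: orth_rest_def inner_axis inner_axis' power2_eq_square)
  finally show ?thesis .
 qed
 have n: "(\<Sum>k\<in>UNIV. (u $ k)\<^sup>2) = 1" if "u \<in> set vs" for u
 proof -
  have "(\<Sum>k\<in>UNIV. (u $ k)\<^sup>2) = (norm u)\<^sup>2"
   by (simp add: norm_vec_def L2_set_def real_sqrt_pow2 sum_nonneg)
  then show ?thesis using that assms by (simp add: orthonormal_list_def)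
 qed
 have "(\<Sum>k\<in>UNIV. \<Sum>u\<in>set vs. (u $ k)\<^sup>2) = (\<Sum>u\<in>set vs. \<Sum>k\<in>UNIV. (u $ k)\<^sup>2)"
  by (rule sum.swap)
 also have "\<dots> = real (length vs)"
  using assms n by (simp add: orthonormal_list_def distinct_card)
 finally show ?thesis by (simp add: * sum_subtractf)
qed

text \<open>One factor \<beta> is expanded over the coordinate axes. Each axis extends the frame by
  its normalized residual, with the squared length of the residual as weight, and the weights add up
  to the number of missing frame vectors. Applied to the unit normals this makes
  \<open>volume_form\<close> the surface measure.\<close>

lemma top_coeff_dx_dxi_list_beta:
 fixes vs :: "'n::{finite,linorder} point list"
 assumes "orthonormal_list vs" "length vs + m = CARD('n)"
 shows "top_coeff (dx_dxi_list vs \<and>\<^sub>s wedge_power \<beta> m) = fact m"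
 using assms
proof (induction m arbitrary: vs)
 case 0
 then show ?case using dx_dxi_list_orthonormal[of vs] by simp
next
 case (Suc m)
 have *: "top_coeff ((dx_dxi_list vs \<and>\<^sub>s dx_dxi v) \<and>\<^sub>s wedge_power \<beta> m) =
   (norm (orth_rest (set vs) v))\<^sup>2 * fact m" for v
 \<comment> \<open>An axis in the span of \<open>vs\<close> has no normalized residual; its term is
   zero on both sides.\<close>
 proof (cases "orth_rest (set vs) v = 0")
  case True
  then show ?thesis
   by (subst dx_dxi_list_orth_rest) (simp add: linear_0[OF linear_top_coeff])
 next
  case False
  have "top_coeff (dx_dxi_list (vs @ [sgn (orth_rest (set vs) v)]) \<and>\<^sub>s wedge_power \<beta> m) = fact m"
   using Suc.prems by (intro Suc.IH orthonormal_list_append_orth_rest False) auto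
  then show ?thesis unfolding dx_dxi_list_wedge_dx_dxi[OF False]
   by (simp only: wedge.scaleR_left linear_cmul[OF linear_top_coeff] real_scaleR_def)
 qed
 have "dx_dxi_list vs \<and>\<^sub>s wedge_power \<beta> (Suc m) =
   (\<Sum>k\<in>UNIV. (dx_dxi_list vs \<and>\<^sub>s dx_dxi (axis k 1)) \<and>\<^sub>s wedge_power \<beta> m)"
  by (simp add: wedge_assoc beta_eq wedge.sum_left wedge.sum_right)
 then have "top_coeff (dx_dxi_list vs \<and>\<^sub>s wedge_power \<beta> (Suc m)) =
   (\<Sum>k\<in>UNIV. (norm (orth_rest (set vs) (axis k 1)))\<^sup>2 * fact m)"
  by (simp only: linear_sum[OF linear_top_coeff] *)
 also have "\<dots> = real (Suc m) * fact m"
  using sum_norm_orth_rest_axis[OF Suc.prems(1)] Suc.prems(2)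
  by (simp add: sum_distrib_right[symmetric] flip: of_nat_Suc)
 finally show ?case by simp
qed

text \<open>The residual of \<open>v\<close>, once normalized, serves as one more frame vector,
  which leads back to \<open>top_coeff_dx_dxi_list_beta\<close>.\<close>

lemma top_coeff_dx_dxi_list_beta_dx_dxi:
 fixes vs :: "'n::{finite,linorder} point list"
 assumes vs: "orthonormal_list vs" and l: "length vs + Suc m = CARD('n)"
 shows "top_coeff (dx_dxi_list vs \<and>\<^sub>s wedge_power \<beta> m \<and>\<^sub>s dx_dxi v) =
  fact m * (norm (orth_rest (set vs) v))\<^sup>2"
proof (cases "orth_rest (set vs) v = 0")
 case True
 then have "dx_dxi_list vs \<and>\<^sub>s dx_dxi v = 0" by (subst dx_dxi_list_orth_rest) simp
 then show ?thesis using True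
  by (metis beta_power_central wedge_assoc wedge.zero_left linear_0[OF linear_top_coeff] norm_zero
    power_zero_numeral mult_zero_right)
next
 case False
 have "top_coeff (dx_dxi_list (vs @ [sgn (orth_rest (set vs) v)]) \<and>\<^sub>s wedge_power \<beta> m) = fact m"
  using l by (intro top_coeff_dx_dxi_list_beta orthonormal_list_append_orth_rest vs False) auto
 moreover have "dx_dxi_list vs \<and>\<^sub>s wedge_power \<beta> m \<and>\<^sub>s dx_dxi v =
   (dx_dxi_list vs \<and>\<^sub>s dx_dxi v) \<and>\<^sub>s wedge_power \<beta> m"
  by (simp add: beta_power_central wedge_assoc)
 ultimately show ?thesis unfolding dx_dxi_list_wedge_dx_dxi[OF False]
  by (simp only: wedge.scaleR_left linear_cmul[OF linear_top_coeff] real_scaleR_def mult.commute)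
qed

text \<open>By polarization, the rank one case determines the value at every symmetric matrix.\<close>

lemma top_coeff_dx_dxi_list_beta_symmetric:
 fixes vs :: "'n::{finite,linorder} point list"
 assumes vs: "orthonormal_list vs" and l: "length vs + Suc m = CARD('n)"
  and sym: "\<And>k l. h k l = h l k"
 shows "top_coeff (dx_dxi_list vs \<and>\<^sub>s wedge_power \<beta> m \<and>\<^sub>s
   (\<Sum>k\<in>UNIV. \<Sum>l\<in>UNIV. h k l *\<^sub>R (dx k \<and>\<^sub>s d\<xi> l))) =
  fact m * (\<Sum>k\<in>UNIV. \<Sum>l\<in>UNIV. h k l * orth_rest (set vs) (axis k 1) $ l)"
proof -
 let ?r = "orth_rest (set vs)"
 define b where "b v w = top_coeff (dx_dxi_list vs \<and>\<^sub>s wedge_power \<beta> m \<and>\<^sub>s dx_of v \<and>\<^sub>s dxi_of w)" for v w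
 have b_add: "b (v + v') w = b v w + b v' w" "b v (w + w') = b v w + b v w'" for v v' w w'
  by (simp_all add: b_def linear_add[OF linear_dx_of] linear_add[OF linear_dxi_of]
    wedge.add_left wedge.add_right linear_add[OF linear_top_coeff])
 have b_self: "b v v = fact m * (?r v \<bullet> ?r v)" for v
  using top_coeff_dx_dxi_list_beta_dx_dxi[OF vs l, of v] by (simp add: b_def dx_dxi_def dot_square_norm)
 have pol: "b v w + b w v = 2 * (fact m * (?r v \<bullet> ?r w))" for v w
  using b_self[of "v + w"] b_self[of v] b_self[of w]
  by (simp add: b_add linear_add[OF linear_orth_rest] inner_add_left inner_add_right
    inner_commute[of "?r w" "?r v"] algebra_simps)
 have rr: "?r (axis k 1) \<bullet> ?r (axis l 1) = ?r (axis k 1) $ l" for k l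
  using orth_rest_inner_rest[of "set vs" "axis k 1" "axis l 1"] vs
  by (simp add: orthonormal_list_def inner_axis)
 define s where "s = (\<Sum>k\<in>UNIV. \<Sum>l\<in>UNIV. h k l * b (axis k 1) (axis l 1))"
 have "s = (\<Sum>l\<in>UNIV. \<Sum>k\<in>UNIV. h k l * b (axis k 1) (axis l 1))"
  unfolding s_def by (rule sum.swap)
 then have "s + s = (\<Sum>k\<in>UNIV. \<Sum>l\<in>UNIV. h k l * (b (axis k 1) (axis l 1) + b (axis l 1) (axis k 1)))"
  using sym by (simp add: s_def ring_distribs sum.distrib)
 also have "\<dots> = 2 * (fact m * (\<Sum>k\<in>UNIV. \<Sum>l\<in>UNIV. h k l * ?r (axis k 1) $ l))"
  by (simp add: pol rr sum_distrib_left algebra_simps)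
 finally have "s = fact m * (\<Sum>k\<in>UNIV. \<Sum>l\<in>UNIV. h k l * ?r (axis k 1) $ l)" by simp
 then show ?thesis
  by (simp add: s_def b_def wedge.sum_right wedge.scaleR_right linear_sum[OF linear_top_coeff]
    linear_cmul[OF linear_top_coeff])
qed

section \<open>The operator J, bidegrees and weak positivity\<close>

lemma Jop_component: "Jop a $ (A, B) = (- 1) ^ (card A + card A * card B) * a $ (B, A)"
 by (simp add: Jop_def)

lemma linear_Jop: "linear Jop"
 by (intro linearI sform_eqI) (simp_all add: Jop_component algebra_simps)

lemma Jop_sone [simp]: "Jop sone = sone"
 by (rule sform_eqI) (auto simp: Jop_component sone_def axis_def)

lemma Jop_dx_wedge: "Jop (dx k \<and>\<^sub>s a) = d\<xi> k \<and>\<^sub>s Jop (a :: 'n::{finite,linorder} sform)"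
proof (rule sform_eqI)
 fix A B :: "'n set"
 show "Jop (dx k \<and>\<^sub>s a) $ (A, B) = (d\<xi> k \<and>\<^sub>s Jop a) $ (A, B)"
 proof (cases "k \<in> B")
  case True
  then have "card B = Suc (card (B - {k}))" by (subst card.remove[of B k]) auto
  then show ?thesis using True
   by (simp add: Jop_component dx_wedge dxi_wedge power_add algebra_simps del: card_Diff_insert)
 qed (simp add: Jop_component dx_wedge dxi_wedge)
qed

lemma Jop_dx_of_wedge: "Jop (dx_of v \<and>\<^sub>s a) = dxi_of v \<and>\<^sub>s Jop a"
 by (simp add: dx_of_def dxi_of_def wedge.sum_left wedge.scaleR_left linear_sum[OF linear_Jop]
   linear_cmul[OF linear_Jop] Jop_dx_wedge)

lemma Jop_dx_of [simp]: "Jop (dx_of (v :: 'n::{finite,linorder} point)) = dxi_of v"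
 using Jop_dx_of_wedge[of v sone] by simp

lemma Jop_wedge_list_dx_of: "Jop (wedge_list (map dx_of vs)) = wedge_list (map dxi_of vs)"
 by (induction vs) (simp_all add: Jop_dx_of_wedge)

lemma wedge_list_dx_of_dxi_of:
 "wedge_list (map dx_of vs) \<and>\<^sub>s dxi_of v \<and>\<^sub>s a =
  (- 1) ^ length vs *\<^sub>R (dxi_of v \<and>\<^sub>s wedge_list (map dx_of vs) \<and>\<^sub>s a)"
 by (induction vs) (simp_all add: wedge_assoc wedge.scaleR_right dxi_of_dx_of_anticommute)

text \<open>The origin of the constant c_p: each d\<xi> factor has to pass the dx factors that
  follow its partner, in total 0 + 1 + ... + (p - 1) transpositions.\<close>

lemma wedge_list_normal_square:
 "wedge_list (map dx_of vs) \<and>\<^sub>s Jop (wedge_list (map dx_of vs)) =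
  (- 1) ^ (length vs * (length vs - 1) div 2) *\<^sub>R dx_dxi_list vs"
proof (induction vs)
 case (Cons v vs)
 have "length (v # vs) * (length (v # vs) - 1) = 2 * length vs + length vs * (length vs - 1)"
  by (cases vs) auto
 then have e: "length (v # vs) * (length (v # vs) - 1) div 2 =
   length vs + length vs * (length vs - 1) div 2"
  by (simp only:)
 show ?case unfolding e using Cons
  by (simp add: Jop_dx_of_wedge Jop_wedge_list_dx_of wedge_assoc wedge_list_dx_of_dxi_of
    wedge.scaleR_right power_add dx_dxi_def)
qed simp

lemma bidegree_dx_of: "bidegree p q a \<Longrightarrow> bidegree (Suc p) q (dx_of v \<and>\<^sub>s a)"
proof -
 assume a: "bidegree p q a"
 have "card I = Suc p \<and> card J = q" if "(dx_of v \<and>\<^sub>s a) $ (I, J) \<noteq> 0" for I J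
 proof -
  have "(\<Sum>k\<in>UNIV. v $ k * (dx k \<and>\<^sub>s a) $ (I, J)) \<noteq> 0"
   using that by (simp add: dx_of_def wedge.sum_left wedge.scaleR_left)
  then obtain k where "(dx k \<and>\<^sub>s a) $ (I, J) \<noteq> 0"
   by (metis (mono_tags, lifting) mult_zero_right sum.neutral)
  then have "k \<in> I" "a $ (I - {k}, J) \<noteq> 0" by (auto simp: dx_wedge split: if_splits)
  then show ?thesis using a card.remove[of I k] unfolding bidegree_def by auto
 qed
 then show ?thesis by (simp add: bidegree_def)
qed

lemma bidegree_dxi_of: "bidegree p q a \<Longrightarrow> bidegree p (Suc q) (dxi_of v \<and>\<^sub>s a)"
proof -
 assume a: "bidegree p q a"
 have "card I = p \<and> card J = Suc q" if "(dxi_of v \<and>\<^sub>s a) $ (I, J) \<noteq> 0" for I J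
 proof -
  have "(\<Sum>k\<in>UNIV. v $ k * (d\<xi> k \<and>\<^sub>s a) $ (I, J)) \<noteq> 0"
   using that by (simp add: dxi_of_def wedge.sum_left wedge.scaleR_left)
  then obtain k where "(d\<xi> k \<and>\<^sub>s a) $ (I, J) \<noteq> 0"
   by (metis (mono_tags, lifting) mult_zero_right sum.neutral)
  then have "k \<in> J" "a $ (I, J - {k}) \<noteq> 0" by (auto simp: dxi_wedge split: if_splits)
  then show ?thesis using a card.remove[of J k] unfolding bidegree_def by auto
 qed
 then show ?thesis by (simp add: bidegree_def)
qed

lemma bidegree_dx_dxi_list: "bidegree (length vs) (length vs) (dx_dxi_list vs)"
proof (induction vs)
 case Nil
 then show ?case by (auto simp: bidegree_def sone_def axis_def split: if_splits)
next
 case (Cons v vs)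
 then show ?case by (simp add: dx_dxi_def wedge_assoc bidegree_dx_of bidegree_dxi_of)
qed

lemma dx_component: "dx k $ (I, J) = (if I = {k} \<and> J = {} then 1 else 0)"
 by (simp add: dx_def axis_def)

lemma dxi_component: "d\<xi> k $ (I, J) = (if I = {} \<and> J = {k} then 1 else 0)"
 by (simp add: d\<xi>_def axis_def)

lemma bidegree_1_0_dx_of:
 fixes a :: "'n::{finite,linorder} sform"
 assumes "bidegree 1 0 a"
 shows "a = dx_of (dual_vector a)"
proof (rule sform_eqI)
 fix I J :: "'n set"
 have "dx_of (dual_vector a) $ (I, J) = (\<Sum>k\<in>UNIV. a $ ({k}, {}) * (if I = {k} \<and> J = {} then 1 else 0))"
  by (simp add: dx_of_def dual_vector_def dx_component)
 also have "\<dots> = a $ (I, J)"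
 proof (cases "a $ (I, J) = 0")
  case True
  then show ?thesis by (auto intro!: sum.neutral)
 next
  case False
  then have "card I = 1" "card J = 0" using assms unfolding bidegree_def by auto
  then obtain i where "I = {i}" "J = {}" by (auto simp: card_1_singleton_iff)
  then show ?thesis by (simp add: if_distrib[of "\<lambda>t. _ * t"] cong: if_cong)
 qed
 finally show "a $ (I, J) = dx_of (dual_vector a) $ (I, J)" by simp
qed

text \<open>Orthogonalizing the vectors of \<open>ws\<close> one after the other turns each factor
  into a squared length times a new frame vector; a dependent vector makes the product
  vanish.\<close>

lemma top_coeff_dx_dxi_list_nonneg:
 fixes vs ws :: "'n::{finite,linorder} point list"
 assumes "orthonormal_list vs" "length vs + length ws = CARD('n)"
 shows "0 \<le> top_coeff (dx_dxi_list vs \<and>\<^sub>s dx_dxi_list ws)"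
 using assms
proof (induction ws arbitrary: vs)
 case Nil
 then show ?case using dx_dxi_list_orthonormal[of vs] by simp
next
 case (Cons w ws)
 have e: "dx_dxi_list vs \<and>\<^sub>s dx_dxi_list (w # ws) = (dx_dxi_list vs \<and>\<^sub>s dx_dxi w) \<and>\<^sub>s dx_dxi_list ws"
  by (simp add: wedge_assoc)
 show ?case
 proof (cases "orth_rest (set vs) w = 0")
  case True
  then have "dx_dxi_list vs \<and>\<^sub>s dx_dxi w = 0" by (subst dx_dxi_list_orth_rest) simp
  then show ?thesis unfolding e by (simp add: linear_0[OF linear_top_coeff])
 next
  case False
  have "0 \<le> top_coeff (dx_dxi_list (vs @ [sgn (orth_rest (set vs) w)]) \<and>\<^sub>s dx_dxi_list ws)"
   using Cons.prems by (intro Cons.IH orthonormal_list_append_orth_rest False) auto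
  then show ?thesis unfolding e dx_dxi_list_wedge_dx_dxi[OF False]
   by (simp only: wedge.scaleR_left linear_cmul[OF linear_top_coeff] real_scaleR_def) simp
 qed
qed

text \<open>For a (1,0)-form a with dual vector v the product of a with its image under J is
  \<open>dx_dxi v\<close>, so the positivity condition becomes
  \<open>top_coeff_dx_dxi_list_nonneg\<close>.\<close>

lemma weakly_positive_dx_dxi_list:
 fixes vs :: "'n::{finite,linorder} point list"
 assumes "orthonormal_list vs" "length vs + m = CARD('n)"
 shows "weakly_positive m (dx_dxi_list vs)"
 unfolding weakly_positive_def
proof (intro conjI allI impI)
 have "CARD('n) - m = length vs" using assms(2) by simp
 then show "bidegree (CARD('n) - m) (CARD('n) - m) (dx_dxi_list vs)"
  by (simp add: bidegree_dx_dxi_list)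
next
 fix a :: "nat \<Rightarrow> 'n sform" assume a: "\<forall>j<m. bidegree 1 0 (a j)"
 have "a j \<and>\<^sub>s Jop (a j) = dx_dxi (dual_vector (a j))" if "j < m" for j
  using bidegree_1_0_dx_of[of "a j"] a that unfolding dx_dxi_def by (metis Jop_dx_of)
 then have e: "map (\<lambda>j. a j \<and>\<^sub>s Jop (a j)) [0..<m] = map dx_dxi (map (\<lambda>j. dual_vector (a j)) [0..<m])"
  by simp
 show "0 \<le> top_coeff (dx_dxi_list vs \<and>\<^sub>s wedge_list (map (\<lambda>j. a j \<and>\<^sub>s Jop (a j)) [0..<m]))"
  unfolding e using top_coeff_dx_dxi_list_nonneg[OF assms(1), of "map (\<lambda>j. dual_vector (a j)) [0..<m]"] assms(2)
  by simp
qed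

section \<open>Calculus of \<open>C\<^sup>k\<close> functions\<close>

abbreviation FD where "FD f x \<equiv> frechet_derivative f (at x)"

lemma Ck_on_cong:
 assumes "open S" "\<And>x. x \<in> S \<Longrightarrow> f x = g x" "Ck_on k f S"
 shows "Ck_on k g S"
 using assms(2,3)
proof (induction k arbitrary: f g)
 case 0
 then show ?case by (simp cong: continuous_on_cong)
next
 case (Suc k)
 have d: "f differentiable (at x)" if "x \<in> S" for x using Suc that by simp
 have "(g has_derivative FD f x) (at x)" if "x \<in> S" for x
  using has_derivative_transform_within_open[OF _ assms(1) that Suc.prems(1)] d[OF that]
  by (simp add: frechet_derivative_works)
 then have D: "g differentiable (at x)" "FD g x = FD f x"
  if "x \<in> S" for x
  using that by (auto simp: differentiable_def intro: frechet_derivative_at[symmetric])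
 have "Ck_on k (\<lambda>x. FD g x v) S" for v
  by (rule Suc.IH[of "\<lambda>x. FD f x v"]) (use D Suc.prems in auto)
 then show ?case using D by simp
qed

lemma Ck_on_subset: "Ck_on k f S \<Longrightarrow> T \<subseteq> S \<Longrightarrow> Ck_on k f T"
 by (induction k arbitrary: f) (auto intro: continuous_on_subset)

lemma Ck_on_SucD: "Ck_on (Suc k) f S \<Longrightarrow> Ck_on k f S"
proof (induction k arbitrary: f)
 case 0
 then show ?case
  by (auto intro!: continuous_at_imp_continuous_on differentiable_imp_continuous_within)
qed simp

lemma Ck_on_le: "Ck_on k f S \<Longrightarrow> j \<le> k \<Longrightarrow> Ck_on j f S"
proof (induction k)
 case (Suc k)
 then show ?case using Ck_on_SucD[of k f S] by (cases "j = Suc k") auto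
qed simp

text \<open>The closure properties below exhibit a derivative and check, for each fixed direction,
  that it is one order less regular. Openness of \<open>S\<close> makes the exhibited derivative the
  value of \<open>frechet_derivative\<close> near each point.\<close>

lemma Ck_on_SucI:
 assumes "open S" "\<And>x. x \<in> S \<Longrightarrow> (f has_derivative f' x) (at x)"
  and "\<And>v. Ck_on k (\<lambda>x. f' x v) S"
 shows "Ck_on (Suc k) f S"
proof -
 have "Ck_on k (\<lambda>x. FD f x v) S" for v
  by (rule Ck_on_cong[OF assms(1) _ assms(3)[of v]])
   (simp add: frechet_derivative_at[OF assms(2), symmetric])
 then show ?thesis using assms(2) by (auto simp: differentiable_def)
qed

lemma Ck_on_Suc_has_derivative:
 "Ck_on (Suc k) f S \<Longrightarrow> x \<in> S \<Longrightarrow> (f has_derivative FD f x) (at x)"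
 by (simp flip: frechet_derivative_works)

lemma Ck_on_continuous_on: "Ck_on k f S \<Longrightarrow> continuous_on S f"
 using Ck_on_le[of k f S 0] by simp

lemma Ck_on_const: "open S \<Longrightarrow> Ck_on k (\<lambda>x. c) S"
proof (induction k arbitrary: c)
 case (Suc k)
 then show ?case by (intro Ck_on_SucI[where f' = "\<lambda>x v. 0"]) auto
qed simp

lemma Ck_on_bounded_linear:
 assumes "bounded_linear L" "open S" "Ck_on k f S"
 shows "Ck_on k (\<lambda>x. L (f x)) S"
 using assms(3)
proof (induction k arbitrary: f)
 case 0
 then show ?case using assms(1) by (simp add: bounded_linear.continuous_on)
next
 case (Suc k)
 show ?case
 proof (rule Ck_on_SucI[OF assms(2)])
  show "((\<lambda>x. L (f x)) has_derivative (\<lambda>v. L (FD f x v))) (at x)"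
   if "x \<in> S" for x
   using assms(1) Ck_on_Suc_has_derivative[OF Suc.prems that]
   by (rule bounded_linear.has_derivative)
  show "Ck_on k (\<lambda>x. L (FD f x v)) S" for v
   using Suc.prems by (intro Suc.IH) simp
 qed
qed

lemma Ck_on_ident: "open S \<Longrightarrow> Ck_on k (\<lambda>x. x) S"
proof (cases k)
 case (Suc j)
 assume "open S"
 then show ?thesis unfolding Suc by (intro Ck_on_SucI[where f' = "\<lambda>x v. v"] Ck_on_const) auto
qed (simp add: continuous_on_id)

lemma Ck_on_linear: "bounded_linear L \<Longrightarrow> open S \<Longrightarrow> Ck_on k L S"
 using Ck_on_bounded_linear[OF _ _ Ck_on_ident] by blast

lemma Ck_on_add:
 assumes "open S" "Ck_on k f S" "Ck_on k g S"
 shows "Ck_on k (\<lambda>x. f x + g x) S"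
 using assms(2,3)
proof (induction k arbitrary: f g)
 case 0
 then show ?case by (simp add: continuous_on_add)
next
 case (Suc k)
 show ?case
  by (rule Ck_on_SucI[OF assms(1) has_derivative_add[OF Ck_on_Suc_has_derivative[OF Suc.prems(1)]
      Ck_on_Suc_has_derivative[OF Suc.prems(2)]] Suc.IH]) (use Suc.prems in auto)
qed

lemma Ck_on_bilinear:
 assumes "bounded_bilinear pr" "open S" "Ck_on k f S" "Ck_on k g S"
 shows "Ck_on k (\<lambda>x. pr (f x) (g x)) S"
 using assms(3,4)
proof (induction k arbitrary: f g)
 case 0
 then show ?case using assms(1) by (simp add: bounded_bilinear.continuous_on)
next
 case (Suc k)
 show ?case
 proof (rule Ck_on_SucI[OF assms(2)])
  show "((\<lambda>x. pr (f x) (g x)) has_derivative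
    (\<lambda>v. pr (f x) (FD g x v) + pr (FD f x v) (g x))) (at x)"
   if "x \<in> S" for x
   by (rule bounded_bilinear.FDERIV[OF assms(1)]) (rule Ck_on_Suc_has_derivative Suc.prems that)+
  show "Ck_on k (\<lambda>x. pr (f x) (FD g x v) + pr (FD f x v) (g x)) S"
   for v
   using Suc.prems Ck_on_SucD[OF Suc.prems(1)] Ck_on_SucD[OF Suc.prems(2)]
   by (intro Ck_on_add assms(2) Suc.IH) auto
 qed
qed

lemmas Ck_on_mult = Ck_on_bilinear[OF bounded_bilinear_mult]
lemmas Ck_on_scaleR = Ck_on_bilinear[OF bounded_bilinear_scaleR]
lemmas Ck_on_inner = Ck_on_bilinear[OF bounded_bilinear_inner]

lemma Ck_on_diff:
 assumes "open S" "Ck_on k f S" "Ck_on k g S"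
 shows "Ck_on k (\<lambda>x. f x - g x) S"
 using Ck_on_add[OF assms(1,2) Ck_on_bounded_linear[OF bounded_linear_minus[OF bounded_linear_ident] assms(1,3)]]
 by simp

lemma Ck_on_sum:
 assumes "open S" "\<And>i. i \<in> I \<Longrightarrow> Ck_on k (f i) S"
 shows "Ck_on k (\<lambda>x. \<Sum>i\<in>I. f i x) S"
 using assms(2)
 by (induction I rule: infinite_finite_induct) (simp_all add: Ck_on_const Ck_on_add assms(1))

lemma Ck_on_prod:
 fixes f :: "'i \<Rightarrow> 'a::real_normed_vector \<Rightarrow> real"
 assumes "open S" "\<And>i. i \<in> I \<Longrightarrow> Ck_on k (f i) S"
 shows "Ck_on k (\<lambda>x. \<Prod>i\<in>I. f i x) S"
 using assms(2)
 by (induction I rule: infinite_finite_induct) (simp_all add: Ck_on_const Ck_on_mult assms(1))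

lemma Ck_on_vec_lambda:
 fixes f :: "'a::real_normed_vector \<Rightarrow> 'i::finite \<Rightarrow> real"
 assumes "open S" "\<And>i. Ck_on k (\<lambda>x. f x i) S"
 shows "Ck_on k (\<lambda>x. \<chi> i. f x i) S"
proof -
 have "(\<chi> i. f x i) = (\<Sum>i\<in>UNIV. f x i *\<^sub>R axis i 1)" for x
  by (simp add: vec_eq_iff axis_def if_distrib cong: if_cong)
 then show ?thesis
  by (simp only:) (intro Ck_on_sum Ck_on_scaleR Ck_on_const assms)
qed

text \<open>The exponent is generalized in the induction because differentiation lowers it by one.
  The exponents used later are -1/2 (normalization) and -1 (partition of unity).\<close>

lemma Ck_on_powr:
 fixes f :: "'a::real_normed_vector \<Rightarrow> real"
 assumes "open S" "\<And>x. x \<in> S \<Longrightarrow> 0 < f x" "Ck_on k f S"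
 shows "Ck_on k (\<lambda>x. f x powr a) S"
 using assms(3)
proof (induction k arbitrary: a)
 case 0
 have "\<forall>x\<in>S. f x \<noteq> 0" using assms(2) by force
 then show ?case using 0 by (simp add: continuous_on_powr)
next
 case (Suc k)
 show ?case
 proof (rule Ck_on_SucI[OF assms(1)])
  show "((\<lambda>x. f x powr a) has_derivative
    (\<lambda>v. (a * f x powr (a - 1)) * FD f x v)) (at x)" if "x \<in> S" for x
  proof -
   have "((\<lambda>y. y powr a) has_field_derivative (a * f x powr (a - 1))) (at (f x))"
    using assms(2)[OF that] by (rule has_real_derivative_powr)
   from diff_chain_at[OF Ck_on_Suc_has_derivative[OF Suc.prems that] this[unfolded has_field_derivative_def]]
   show ?thesis by (simp add: comp_def)
  qed
  show "Ck_on k (\<lambda>x. (a * f x powr (a - 1)) * FD f x v) S" for v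
   using Suc.prems Ck_on_SucD[OF Suc.prems] by (intro Ck_on_mult Ck_on_const assms(1) Suc.IH) auto
 qed
qed

section \<open>Smooth functions supported in a box\<close>

text \<open>The functions x^(-j) exp(-1/x), continued by zero. The derivative of each is a
  combination of two others, so smoothness follows by one induction over all j
  simultaneously.\<close>

definition flat :: "nat \<Rightarrow> real \<Rightarrow> real" where
 "flat j x = (if 0 < x then (1 / x) ^ j * exp (- (1 / x)) else 0)"

text \<open>A quadratic bound at 0 makes the difference quotients at 0 tend to 0, which is the one
  point where the derivative is not given by the usual rules.\<close>

lemma flat_bound: "\<bar>flat j x\<bar> \<le> real (j + 2) ^ (j + 2) * x\<^sup>2"
proof (cases "0 < x")
 case True
 define y where "y = 1 / x"
 \<comment> \<open>The inequality (y/N)^N \<le> exp y, with y = 1/x, absorbs the factor y^j and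
   leaves two powers of y for the square of x.\<close>
 define N where "N = j + 2"
 have y: "0 < y" and N: "0 < real N" using True by (auto simp: y_def N_def)
 have "y / N \<le> exp (y / N)" using exp_ge_add_one_self[of "y / N"] by linarith
 then have "(y / N) ^ N \<le> exp (y / N) ^ N" using y by (intro power_mono) auto
 also have "\<dots> = exp y" using N by (simp flip: exp_of_nat_mult)
 finally have "y ^ N \<le> real N ^ N * exp y" using N by (simp add: power_divide field_simps)
 then have "y ^ N * exp (- y) \<le> (real N ^ N * exp y) * exp (- y)" by (intro mult_right_mono) auto
 also have "\<dots> = real N ^ N" by (simp add: exp_minus)
 finally have "y ^ j * exp (- y) * y\<^sup>2 \<le> real N ^ N" by (simp add: N_def power_add power2_eq_square mult_ac)
 then have "y ^ j * exp (- y) \<le> real N ^ N * x\<^sup>2"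
  using True by (simp add: y_def field_simps power2_eq_square)
 then show ?thesis using True by (simp add: flat_def y_def N_def)
qed (simp add: flat_def)

lemma flat_has_derivative:
 "(flat j has_real_derivative (- real j * flat (j + 1) x + flat (j + 2) x)) (at x)"
proof (cases x "0 :: real" rule: linorder_cases)
 case less
 have "(flat j has_real_derivative 0) (at x)"
  by (rule has_field_derivative_transform_within_open[where f = "\<lambda>_. 0" and S = "{..<0}"])
   (use less in \<open>auto simp: flat_def\<close>)
 then show ?thesis using less by (simp add: flat_def)
next
 case equal
 have "((\<lambda>h. flat j h / h) \<longlongrightarrow> 0) (at 0)"
 proof (rule Lim_null_comparison)
  have "norm (flat j h / h) \<le> real (j + 2) ^ (j + 2) * \<bar>h\<bar>" if "h \<noteq> 0" for h
  proof -
   have "\<bar>flat j h\<bar> \<le> (real (j + 2) ^ (j + 2) * \<bar>h\<bar>) * \<bar>h\<bar>"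
    using flat_bound[of j h] by (simp add: power2_eq_square mult.assoc flip: abs_mult)
   then show ?thesis using that by (simp only: real_norm_def abs_divide) (simp add: divide_le_eq)
  qed
  then show "\<forall>\<^sub>F h in at 0. norm (flat j h / h) \<le> real (j + 2) ^ (j + 2) * \<bar>h\<bar>"
   unfolding eventually_at_filter by (intro always_eventually) blast
  show "((\<lambda>h. real (j + 2) ^ (j + 2) * \<bar>h\<bar>) \<longlongrightarrow> 0) (at 0)"
   by (rule tendsto_eq_intros | simp)+
 qed
 then show ?thesis unfolding equal by (simp add: DERIV_def flat_def)
next
 case greater
 have "((\<lambda>x. (1 / x) ^ j * exp (- (1 / x))) has_real_derivative
   (- real j * flat (j + 1) x + flat (j + 2) x)) (at x)"
 proof -
  have 1: "((\<lambda>x. 1 / x) has_real_derivative - ((1 / x)\<^sup>2)) (at x)"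
   using greater by (auto intro!: derivative_eq_intros simp: power2_eq_square)
  have 2: "((\<lambda>x. exp (- (1 / x))) has_real_derivative exp (- (1 / x)) * (1 / x)\<^sup>2) (at x)"
   using DERIV_fun_exp[OF DERIV_minus[OF 1]] by simp
  have "(real j * ((1 / x) ^ (j - Suc 0) * - ((1 / x)\<^sup>2))) * exp (- (1 / x)) +
    (exp (- (1 / x)) * (1 / x)\<^sup>2) * (1 / x) ^ j =
    - real j * flat (j + 1) x + flat (j + 2) x"
  proof -
   have "(real j * (y ^ (j - Suc 0) * - (y\<^sup>2))) * E + (E * y\<^sup>2) * y ^ j =
     - real j * (y ^ (j + 1) * E) + y ^ (j + 2) * E" for y E :: real
    by (cases j) (simp_all add: power2_eq_square algebra_simps)
   then show ?thesis using greater by (simp only: flat_def if_True)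
  qed
  then show ?thesis using DERIV_mult[OF DERIV_power[OF 1, of j] 2] by (simp add: mult_ac)
 qed
 then show ?thesis
  by (rule has_field_derivative_transform_within_open[where S = "{0<..}"])
   (use greater in \<open>auto simp: flat_def\<close>)
qed

lemma Ck_on_flat:
 assumes "open S" "Ck_on k f S"
 shows "Ck_on k (\<lambda>x. flat j (f x)) S"
 using assms(2)
proof (induction k arbitrary: j)
 case 0
 have "continuous_on UNIV (flat j)"
  using flat_has_derivative by (intro DERIV_continuous_on) (auto intro: DERIV_subset)
 then show ?case using 0 by (auto intro: continuous_on_compose2)
next
 case (Suc k)
 show ?case
 proof (rule Ck_on_SucI[OF assms(1)])
  show "((\<lambda>x. flat j (f x)) has_derivative
    (\<lambda>v. (- real j * flat (j + 1) (f x) + flat (j + 2) (f x)) * FD f x v)) (at x)"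
   if "x \<in> S" for x
   using diff_chain_at[OF Ck_on_Suc_has_derivative[OF Suc.prems that]
     flat_has_derivative[unfolded has_field_derivative_def]]
   by (simp add: comp_def)
  show "Ck_on k (\<lambda>x. (- real j * flat (j + 1) (f x) + flat (j + 2) (f x)) * FD f x v) S" for v
   using Suc.prems Ck_on_SucD[OF Suc.prems]
   by (intro Ck_on_mult Ck_on_add Ck_on_const assms(1) Suc.IH) auto
 qed
qed

text \<open>As \<open>c\<close> tends to infinity, these functions increase to the indicator function of the box.\<close>

definition box_bump :: "real \<Rightarrow> real^'n \<Rightarrow> real^'n \<Rightarrow> real^'n::finite \<Rightarrow> real" where
 "box_bump c a b x = (\<Prod>i\<in>UNIV. flat 0 (c * (x $ i - a $ i)) * flat 0 (c * (b $ i - x $ i)))"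

lemma smooth_box_bump: "smooth_on (box_bump c a b) UNIV"
 unfolding smooth_on_def box_bump_def
 by (intro allI Ck_on_prod Ck_on_mult Ck_on_flat Ck_on_diff Ck_on_const open_UNIV
   Ck_on_linear bounded_linear_vec_nth)

lemma flat_0_nonneg: "0 \<le> flat 0 x" and flat_0_pos_iff: "0 < flat 0 x \<longleftrightarrow> 0 < x"
 and flat_0_le_1: "flat 0 x \<le> 1"
 by (auto simp: flat_def)

lemma box_bump_nonneg: "0 \<le> box_bump c a b x"
 unfolding box_bump_def by (intro prod_nonneg) (simp add: flat_0_nonneg)

lemma box_bump_le_1: "box_bump c a b x \<le> 1"
 unfolding box_bump_def by (intro prod_le_1) (auto simp: flat_0_nonneg flat_0_le_1 mult_le_one)

lemma box_bump_pos: "0 < c \<Longrightarrow> x \<in> box a b \<Longrightarrow> 0 < box_bump c a b x"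
 unfolding box_bump_def by (intro prod_pos) (simp add: flat_0_pos_iff mem_box_cart)

lemma box_bump_eq_0:
 assumes "0 < c" "x \<notin> box a b"
 shows "box_bump c a b x = 0"
proof -
 obtain i where "\<not> (a $ i < x $ i \<and> x $ i < b $ i)" using assms(2) by (auto simp: mem_box_cart)
 then have "c * (x $ i - a $ i) \<le> 0 \<or> c * (b $ i - x $ i) \<le> 0"
  using assms(1) by (auto simp: mult_le_0_iff not_less)
 then have "flat 0 (c * (x $ i - a $ i)) * flat 0 (c * (b $ i - x $ i)) = 0" by (auto simp: flat_def)
 then show ?thesis unfolding box_bump_def by (intro prod_zero) auto
qed

lemma test_function_box_bump: "0 < c \<Longrightarrow> test_function (box_bump c a b)"
proof -
 assume c: "0 < c"
 have "closure {x. box_bump c a b x \<noteq> 0} \<subseteq> cbox a b"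
  using box_bump_eq_0[OF c] by (intro closure_minimal) (auto intro: box_subset_cbox[THEN subsetD])
 then have "compact (closure {x. box_bump c a b x \<noteq> 0})"
  by (meson bounded_cbox bounded_subset closed_closure compact_eq_bounded_closed)
 then show ?thesis by (simp add: test_function_def smooth_box_bump)
qed

lemma box_bump_tendsto:
 assumes "x \<in> box a b"
 shows "(\<lambda>k. box_bump (real (Suc k)) a b x) \<longlonglongrightarrow> 1"
proof -
 have *: "(\<lambda>k. flat 0 (real (Suc k) * d)) \<longlonglongrightarrow> 1" if "0 < d" for d
 proof -
  have "(\<lambda>k. exp (- (1 / d * inverse (real (Suc k))))) \<longlonglongrightarrow> exp (- (1 / d * 0))"
   by (intro tendsto_intros LIMSEQ_inverse_real_of_nat)
  moreover have "flat 0 (real (Suc k) * d) = exp (- (1 / d * inverse (real (Suc k))))" for k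
   using that by (simp add: flat_def divide_inverse mult.commute del: of_nat_Suc)
  ultimately show ?thesis by simp
 qed
 have "(\<lambda>k. box_bump (real (Suc k)) a b x) \<longlonglongrightarrow> (\<Prod>i\<in>(UNIV::'a set). 1 * 1)"
  unfolding box_bump_def using assms by (intro tendsto_prod tendsto_mult *) (auto simp: mem_box_cart)
 then show ?thesis by simp
qed

section \<open>Gradients and Hessians\<close>

definition grad :: "(real^'n \<Rightarrow> real) \<Rightarrow> real^'n \<Rightarrow> real^'n::finite" where
 "grad f x = (\<chi> k. FD f x (axis k 1))"

definition hess :: "(real^'n \<Rightarrow> real) \<Rightarrow> real^'n \<Rightarrow> real^'n \<Rightarrow> real^'n::finite" where
 "hess f x = FD (grad f) x"

lemma linear_eq_inner_axis:
 assumes "linear (f :: real^'n::finite \<Rightarrow> real)"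
 shows "f v = (\<chi> k. f (axis k 1)) \<bullet> v"
proof -
 have "f v = f (\<Sum>k\<in>UNIV. v $ k *\<^sub>R axis k 1)"
  by (simp add: basis_expansion flip: scalar_mult_eq_scaleR)
 also have "\<dots> = (\<Sum>k\<in>UNIV. v $ k * f (axis k 1))"
  by (simp add: linear_sum[OF assms] linear_cmul[OF assms])
 finally show ?thesis by (simp add: inner_vec_def mult.commute)
qed

lemma frechet_derivative_eq_grad:
 assumes "f differentiable (at x)"
 shows "FD f x v = grad f x \<bullet> v"
 unfolding grad_def using assms
 by (intro linear_eq_inner_axis) (rule linear_frechet_derivative)

lemma has_derivative_grad:
 assumes "f differentiable (at x)"
 shows "(f has_derivative (\<lambda>v. grad f x \<bullet> v)) (at x)"
proof -
 have "FD f x = (\<lambda>v. grad f x \<bullet> v)"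
  using frechet_derivative_eq_grad[OF assms] by (rule ext)
 then show ?thesis using assms by (simp add: frechet_derivative_works)
qed

lemma grad_unique:
 assumes "(f has_derivative (\<lambda>v. g \<bullet> v)) (at x)"
 shows "grad f x = g"
 using frechet_derivative_at[OF assms, symmetric] by (simp add: grad_def vec_eq_iff inner_axis)

lemma Ck_on_grad: "open S \<Longrightarrow> Ck_on (Suc k) f S \<Longrightarrow> Ck_on k (grad f) S"
 unfolding grad_def by (rule Ck_on_vec_lambda) auto

lemma smooth_on_differentiable: "smooth_on f S \<Longrightarrow> x \<in> S \<Longrightarrow> f differentiable (at x)"
 unfolding smooth_on_def using Ck_on.simps(2) by blast

lemma has_derivative_hess:
 "Ck_on 2 f S \<Longrightarrow> open S \<Longrightarrow> x \<in> S \<Longrightarrow> (grad f has_derivative hess f x) (at x)"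
 using Ck_on_grad[of S 1 f] Ck_on_Suc_has_derivative[of 0 "grad f" S x]
 by (simp add: hess_def numeral_2_eq_2 del: Ck_on.simps)

text \<open>The mean value theorem in the direction \<open>w\<close>, applied to the difference of
  \<open>f\<close> along two parallel segments, leaves a difference of first derivatives; both are
  expanded at \<open>x\<close>. Differentiability of \<open>f'\<close> at the single point
  \<open>x\<close> suffices, and the two remainders give the factor 2.\<close>

lemma second_difference_bound:
 fixes f :: "'a::real_normed_vector \<Rightarrow> real"
 assumes S: "ball x r \<subseteq> S"
  and f: "\<And>y. y \<in> S \<Longrightarrow> (f has_derivative f' y) (at y)"
  and e: "\<And>h. norm h < r \<Longrightarrow> \<bar>f' (x + h) w - f' x w - H h\<bar> \<le> e * norm h"
  and H: "linear H"
  and s: "0 < s" "s * (norm v + norm w) < r" "0 \<le> e"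
 shows "\<bar>f (x + s *\<^sub>R v + s *\<^sub>R w) - f (x + s *\<^sub>R v) - f (x + s *\<^sub>R w) + f x - s\<^sup>2 * H v\<bar>
  \<le> 2 * e * s\<^sup>2 * (norm v + norm w)"
proof -
 define g where "g t = f (x + (s *\<^sub>R v + t *\<^sub>R w)) - f (x + (0 + t *\<^sub>R w))" for t
 have n: "norm (s *\<^sub>R v + t *\<^sub>R w) \<le> s * (norm v + norm w)" "norm (0 + t *\<^sub>R w) \<le> s * (norm v + norm w)"
  if "0 \<le> t" "t \<le> s" for t
 proof -
  have tw: "t * norm w \<le> s * norm w" using that by (intro mult_right_mono) auto
  have "norm (s *\<^sub>R v + t *\<^sub>R w) \<le> s * norm v + t * norm w"
   using norm_triangle_ineq[of "s *\<^sub>R v" "t *\<^sub>R w"] s that by simp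
  then show "norm (s *\<^sub>R v + t *\<^sub>R w) \<le> s * (norm v + norm w)"
   using tw by (simp add: distrib_left)
  have "0 \<le> s * norm v" using s by simp
  then have "t * norm w \<le> s * (norm v + norm w)"
   unfolding distrib_left using tw by linarith
  then show "norm (0 + t *\<^sub>R w) \<le> s * (norm v + norm w)" using that by simp
 qed
 have inS: "x + h \<in> S" if "norm h < r" for h
  using S that by (auto simp: dist_norm)
 have l: "linear (f' (x + h))" if "norm h < r" for h
  using f[OF inS[OF that]] by (rule has_derivative_linear)
 have comp: "((\<lambda>t. f (x + (a + t *\<^sub>R w))) has_derivative (\<lambda>\<tau>. \<tau> * f' (x + (a + t *\<^sub>R w)) w)) (at t)"
  if "norm (a + t *\<^sub>R w) < r" for a t
 proof -
  have "((\<lambda>t. x + (a + t *\<^sub>R w)) has_derivative (\<lambda>\<tau>. \<tau> *\<^sub>R w)) (at t)"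
   by (auto intro!: derivative_eq_intros)
  from diff_chain_at[OF this f[OF inS[OF that]]] show ?thesis
   by (simp add: comp_def linear_cmul[OF l[OF that]])
 qed
 have g': "(g has_real_derivative (f' (x + (s *\<^sub>R v + t *\<^sub>R w)) w - f' (x + (0 + t *\<^sub>R w)) w)) (at t)"
  if "0 \<le> t" "t \<le> s" for t
 proof -
  have a: "norm (s *\<^sub>R v + t *\<^sub>R w) < r" "norm (0 + t *\<^sub>R w) < r"
   using n[OF that] s by linarith+
  show ?thesis
   unfolding g_def has_field_derivative_def
   by (rule has_derivative_eq_rhs[OF has_derivative_diff[OF comp[OF a(1)] comp[OF a(2)]]])
    (simp add: fun_eq_iff algebra_simps)
 qed
 obtain t where t: "0 < t" "t < s"
   "g s - g 0 = (s - 0) * (f' (x + (s *\<^sub>R v + t *\<^sub>R w)) w - f' (x + (0 + t *\<^sub>R w)) w)"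
  using MVT2[OF s(1), of g "\<lambda>t. f' (x + (s *\<^sub>R v + t *\<^sub>R w)) w - f' (x + (0 + t *\<^sub>R w)) w"] g' by blast
 define A where "A = f' (x + (s *\<^sub>R v + t *\<^sub>R w)) w - f' x w - H (s *\<^sub>R v + t *\<^sub>R w)"
 define B where "B = f' (x + (0 + t *\<^sub>R w)) w - f' x w - H (0 + t *\<^sub>R w)"
 have n': "norm (s *\<^sub>R v + t *\<^sub>R w) \<le> s * (norm v + norm w)" "norm (0 + t *\<^sub>R w) \<le> s * (norm v + norm w)"
  using n[of t] t by auto
 have A: "\<bar>A\<bar> \<le> e * norm (s *\<^sub>R v + t *\<^sub>R w)" unfolding A_def by (rule e) (use n' s in linarith)
 have B: "\<bar>B\<bar> \<le> e * norm (0 + t *\<^sub>R w)" unfolding B_def by (rule e) (use n' s in linarith)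
 have AB: "\<bar>A\<bar> \<le> e * (s * (norm v + norm w))" "\<bar>B\<bar> \<le> e * (s * (norm v + norm w))"
  using A B n' s(3) mult_left_mono order_trans by blast+
 have "g s - g 0 = s * (A - B) + s\<^sup>2 * H v"
  unfolding t(3) A_def B_def by (simp add: linear_add[OF H] linear_cmul[OF H] power2_eq_square algebra_simps)
 moreover have "\<bar>s * (A - B)\<bar> \<le> s * (e * (s * (norm v + norm w)) + e * (s * (norm v + norm w)))"
  unfolding abs_mult using AB s by (intro mult_mono) auto
 moreover have "s * (e * (s * (norm v + norm w)) + e * (s * (norm v + norm w))) =
   2 * e * s\<^sup>2 * (norm v + norm w)" by (simp add: power2_eq_square algebra_simps)
 moreover have "f (x + s *\<^sub>R v + s *\<^sub>R w) - f (x + s *\<^sub>R v) - f (x + s *\<^sub>R w) + f x = g s - g 0"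
  by (simp add: g_def add.assoc)
 ultimately show ?thesis by linarith
qed

text \<open>The second difference of \<open>f\<close> is symmetric in \<open>v\<close> and
  \<open>w\<close>; compared with both mixed derivatives at scale s it forces them to agree.\<close>

lemma second_derivative_symmetric:
 fixes f :: "'a::real_normed_vector \<Rightarrow> real"
 assumes "open S" "x \<in> S" and f: "\<And>y. y \<in> S \<Longrightarrow> (f has_derivative f' y) (at y)"
  and v: "((\<lambda>y. f' y v) has_derivative Hv) (at x)" and w: "((\<lambda>y. f' y w) has_derivative Hw) (at x)"
 shows "Hw v = Hv w"
proof (rule ccontr)
 assume ne: "Hw v \<noteq> Hv w"
 define c where "c = norm v + norm w"
 have c: "0 \<le> c" by (simp add: c_def)
 \<comment> \<open>The two estimates add up to \<open>4 * e * c\<close>, so the factor 5 leaves a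
   strict margin; \<open>c + 1\<close> keeps the denominator positive.\<close>
 define e where "e = \<bar>Hw v - Hv w\<bar> / (5 * (c + 1))"
 have e: "0 < e" using ne c by (simp add: e_def)
 obtain r0 where r0: "0 < r0" "ball x r0 \<subseteq> S" using assms(1,2) open_contains_ball by blast
 obtain r1 where r1: "0 < r1" "\<And>y. norm (y - x) < r1 \<Longrightarrow> norm (f' y v - f' x v - Hv (y - x)) \<le> e * norm (y - x)"
  using v e unfolding has_derivative_at_alt by blast
 obtain r2 where r2: "0 < r2" "\<And>y. norm (y - x) < r2 \<Longrightarrow> norm (f' y w - f' x w - Hw (y - x)) \<le> e * norm (y - x)"
  using w e unfolding has_derivative_at_alt by blast
 define r where "r = min r0 (min r1 r2)"
 define s where "s = r / (2 * (c + 1))"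
 have r: "0 < r" using r0 r1 r2 by (simp add: r_def)
 have s: "0 < s" using r c by (simp add: s_def)
 have "s * (c + 1) = r / 2" unfolding s_def using c by (simp add: field_simps)
 then have sc: "s * c < r" using r s by (simp add: distrib_left)
 have b: "ball x r \<subseteq> S" using r0 by (auto simp: r_def)
 have 1: "\<bar>f (x + s *\<^sub>R v + s *\<^sub>R w) - f (x + s *\<^sub>R v) - f (x + s *\<^sub>R w) + f x - s\<^sup>2 * Hw v\<bar>
   \<le> 2 * e * s\<^sup>2 * (norm v + norm w)"
 proof (rule second_difference_bound[OF b f])
  show "\<bar>f' (x + h) w - f' x w - Hw h\<bar> \<le> e * norm h" if "norm h < r" for h
   using r2(2)[of "x + h"] that by (simp add: r_def)
 qed (use has_derivative_linear[OF w] s sc e in \<open>auto simp: c_def\<close>)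
 have 2: "\<bar>f (x + s *\<^sub>R w + s *\<^sub>R v) - f (x + s *\<^sub>R w) - f (x + s *\<^sub>R v) + f x - s\<^sup>2 * Hv w\<bar>
   \<le> 2 * e * s\<^sup>2 * (norm w + norm v)"
 proof (rule second_difference_bound[OF b f])
  show "\<bar>f' (x + h) v - f' x v - Hv h\<bar> \<le> e * norm h" if "norm h < r" for h
   using r1(2)[of "x + h"] that by (simp add: r_def)
 qed (use has_derivative_linear[OF v] s sc e in \<open>auto simp: c_def add.commute\<close>)
 have sw: "x + s *\<^sub>R w + s *\<^sub>R v = x + s *\<^sub>R v + s *\<^sub>R w" by (simp add: algebra_simps)
 have "\<bar>s\<^sup>2 * Hw v - s\<^sup>2 * Hv w\<bar> \<le> 2 * (2 * e * s\<^sup>2 * c)"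
  using 1 2[unfolded sw add.commute[of "norm w"]] unfolding c_def[symmetric] by linarith
 moreover have "\<bar>s\<^sup>2 * Hw v - s\<^sup>2 * Hv w\<bar> = s\<^sup>2 * \<bar>Hw v - Hv w\<bar>"
  by (simp add: abs_mult flip: right_diff_distrib)
 ultimately have "s\<^sup>2 * \<bar>Hw v - Hv w\<bar> \<le> s\<^sup>2 * (4 * e * c)"
  by (simp add: mult_ac)
 then have "\<bar>Hw v - Hv w\<bar> \<le> 4 * e * c"
  using s by simp
 also have "\<dots> \<le> 4 * e * (c + 1)" using e by simp
 also have "\<dots> < 5 * e * (c + 1)" using e c by simp
 also have "\<dots> = \<bar>Hw v - Hv w\<bar>" using c by (simp add: e_def field_simps)
 finally show False by simp
qed

lemma hess_inner:
 assumes "Ck_on 2 f S" "open S" "x \<in> S"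
 shows "((\<lambda>y. FD f y w) has_derivative (\<lambda>v. hess f x v \<bullet> w)) (at x)"
proof (rule has_derivative_transform_within_open[OF _ assms(2,3)])
 show "((\<lambda>y. grad f y \<bullet> w) has_derivative (\<lambda>v. hess f x v \<bullet> w)) (at x)"
  using has_derivative_hess[OF assms] by (rule has_derivative_inner_left)
 show "grad f y \<bullet> w = FD f y w" if "y \<in> S" for y
  using assms(1) that by (intro frechet_derivative_eq_grad[symmetric]) (auto simp: numeral_2_eq_2)
qed

lemma hess_symmetric:
 assumes "Ck_on 2 f S" "open S" "x \<in> S"
 shows "hess f x v \<bullet> w = hess f x w \<bullet> v"
 using second_derivative_symmetric[where f = f and f' = "\<lambda>y. FD f y", OF assms(2,3) _ hess_inner[OF assms, of w] hess_inner[OF assms, of v]]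
  Ck_on_Suc_has_derivative[of 1 f S] assms(1)
 by (simp add: numeral_2_eq_2 del: Ck_on.simps)

section \<open>Orthonormal defining functions\<close>

lemma partial_deriv_scaleR:
 assumes "f differentiable (at x)"
 shows "partial_deriv k (\<lambda>x. f x *\<^sub>R a) x = (grad f x $ k) *\<^sub>R a"
proof -
 have "((\<lambda>x. f x *\<^sub>R a) has_derivative (\<lambda>v. (grad f x \<bullet> v) *\<^sub>R a)) (at x)"
  by (rule has_derivative_scaleR_left[OF has_derivative_grad[OF assms]])
 from frechet_derivative_at[OF this, symmetric] show ?thesis
  by (simp add: partial_deriv_def inner_axis)
qed

lemma sd_scaleR:
 assumes "f differentiable (at x)"
 shows "sd (\<lambda>x. f x *\<^sub>R a) x = dx_of (grad f x) \<and>\<^sub>s a"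
 unfolding sd_def partial_deriv_scaleR[OF assms] dx_of_def
 by (simp add: wedge.sum_left wedge.scaleR_left wedge.scaleR_right)

lemma sd_sharp_scaleR:
 assumes "f differentiable (at x)"
 shows "sd_sharp (\<lambda>x. f x *\<^sub>R a) x = dxi_of (grad f x) \<and>\<^sub>s a"
 unfolding sd_sharp_def partial_deriv_scaleR[OF assms] dxi_of_def
 by (simp add: wedge.sum_left wedge.scaleR_left wedge.scaleR_right)

lemma sd_fun_form: "f differentiable (at x) \<Longrightarrow> sd (fun_form f) x = dx_of (grad f x)"
 using sd_scaleR[of f x sone] by (simp add: fun_form_def)

lemma dual_vector_dx_of [simp]: "dual_vector (dx_of v) = (v :: 'n::{finite,linorder} point)"
proof -
 have "(\<Sum>k\<in>UNIV. v $ k * (if i = k then 1 else 0)) = v $ i" for i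
  by (simp add: if_distrib cong: if_cong)
 then show ?thesis by (simp add: dual_vector_def dx_of_def dx_component vec_eq_iff)
qed

lemma dx_of_inner [simp]: "dx_of v \<bullet> dx_of w = v \<bullet> (w :: 'n::{finite,linorder} point)"
proof -
 have "dx_of v \<bullet> dx_of w = (\<Sum>k\<in>UNIV. \<Sum>l\<in>UNIV. (v $ k * w $ l) * (dx k \<bullet> dx l))"
  by (subst sum.swap) (simp add: dx_of_def inner_sum_left inner_sum_right sum_distrib_left mult_ac)
 also have "\<dots> = (\<Sum>k\<in>UNIV. \<Sum>l\<in>UNIV. if l = k then v $ k * w $ k else 0)"
  by (intro sum.cong refl) (auto simp: dx_def inner_axis_axis)
 finally show ?thesis by (simp add: inner_vec_def)
qed

lemma inj_dx_of: "inj (dx_of :: 'n::{finite,linorder} point \<Rightarrow> _)"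
 by (metis dual_vector_dx_of injI)

lemma linear_dual_vector: "linear dual_vector"
 by (rule linearI) (simp_all add: dual_vector_def vec_eq_iff)

lemma independent_dx_of_iff:
 "independent (dx_of ` S) \<longleftrightarrow> independent (S :: 'n::{finite,linorder} point set)"
proof
 assume "independent (dx_of ` S)"
 moreover have "inj_on dual_vector (span (dx_of ` S))"
  unfolding linear_span_image[OF linear_dx_of] by (auto intro: inj_onI)
 ultimately have "independent (dual_vector ` dx_of ` S)"
  by (rule linear_independent_injective_image[OF linear_dual_vector])
 then show "independent S" by (simp add: image_image)
next
 assume "independent S"
 then show "independent (dx_of ` S)"
  by (rule linear_independent_injective_image[OF linear_dx_of]) (rule inj_on_subset[OF inj_dx_of], simp)
qed

lemma defining_functions_iff_grad:
 "defining_functions M p U \<rho> \<longleftrightarrow> open U \<and> (\<forall>j<p. smooth_on (\<rho> j) U) \<and>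
   M \<inter> U = {x\<in>U. \<forall>j<p. \<rho> j x = 0} \<and>
   (\<forall>x \<in> M \<inter> U. inj_on (\<lambda>j. grad (\<rho> j) x) {..<p} \<and>
    independent ((\<lambda>j. grad (\<rho> j) x) ` {..<p}))"
 (is "_ \<longleftrightarrow> ?r")
proof -
 have "inj_on (\<lambda>j. sd (fun_form (\<rho> j)) x) {..<p} \<and>
   independent ((\<lambda>j. sd (fun_form (\<rho> j)) x) ` {..<p}) \<longleftrightarrow>
   inj_on (\<lambda>j. grad (\<rho> j) x) {..<p} \<and> independent ((\<lambda>j. grad (\<rho> j) x) ` {..<p})"
  if s: "\<forall>j<p. smooth_on (\<rho> j) U" and x: "x \<in> M \<inter> U" for x
 proof -
  have e: "sd (fun_form (\<rho> j)) x = dx_of (grad (\<rho> j) x)" if "j < p" for j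
   using s x that by (intro sd_fun_form) (auto intro: smooth_on_differentiable)
  have 1: "inj_on (\<lambda>j. sd (fun_form (\<rho> j)) x) {..<p} \<longleftrightarrow> inj_on (\<lambda>j. grad (\<rho> j) x) {..<p}"
   unfolding inj_on_def using e by (simp add: inj_eq[OF inj_dx_of])
  have 2: "(\<lambda>j. sd (fun_form (\<rho> j)) x) ` {..<p} = dx_of ` (\<lambda>j. grad (\<rho> j) x) ` {..<p}"
   unfolding image_image using e by (intro image_cong) auto
  show ?thesis unfolding 1 2 independent_dx_of_iff ..
 qed
 then show ?thesis unfolding defining_functions_def by blast
qed

definition orthonormal_system ::
  "'n point set \<Rightarrow> nat \<Rightarrow> 'n point set \<Rightarrow> (nat \<Rightarrow> 'n::{finite,linorder} point \<Rightarrow> real) \<Rightarrow> bool" where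
 "orthonormal_system M p U \<rho> \<longleftrightarrow> open U \<and> (\<forall>j<p. smooth_on (\<rho> j) U) \<and>
   M \<inter> U = {x\<in>U. \<forall>j<p. \<rho> j x = 0} \<and>
   (\<forall>x \<in> M \<inter> U. \<forall>i<p. \<forall>j<p. grad (\<rho> i) x \<bullet> grad (\<rho> j) x = (if i = j then 1 else 0))"

definition normals :: "nat \<Rightarrow> (nat \<Rightarrow> 'n point \<Rightarrow> real) \<Rightarrow> 'n point \<Rightarrow> 'n::finite point list" where
 "normals p \<rho> x = map (\<lambda>j. grad (\<rho> j) x) [0..<p]"

lemma length_normals [simp]: "length (normals p \<rho> x) = p"
 by (simp add: normals_def)

lemma set_normals: "set (normals p \<rho> x) = (\<lambda>j. grad (\<rho> j) x) ` {..<p}"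
 by (simp add: normals_def lessThan_atLeast0)

lemma grad_in_normals: "j < p \<Longrightarrow> grad (\<rho> j) x \<in> set (normals p \<rho> x)"
 by (simp add: set_normals)

lemma
 assumes "\<forall>i<p. \<forall>j<p. grad (\<rho> i) x \<bullet> grad (\<rho> j) x = (if i = j then 1 else 0)"
 shows orthonormal_list_normalsI: "orthonormal_list (normals p \<rho> x)"
  and inj_on_grad_orthonormal: "inj_on (\<lambda>j. grad (\<rho> j) x) {..<p}"
proof -
 show i: "inj_on (\<lambda>j. grad (\<rho> j) x) {..<p}"
 proof (rule inj_onI)
  fix i j assume "i \<in> {..<p}" "j \<in> {..<p}" "grad (\<rho> i) x = grad (\<rho> j) x"
  then have "grad (\<rho> i) x \<bullet> grad (\<rho> j) x = 1" using assms by auto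
  then show "i = j" using assms \<open>i \<in> _\<close> \<open>j \<in> _\<close> by (auto split: if_splits)
 qed
 show "orthonormal_list (normals p \<rho> x)"
  unfolding orthonormal_list_def set_normals
 proof (intro conjI)
  show "distinct (normals p \<rho> x)"
   using i by (simp add: normals_def distinct_map lessThan_atLeast0)
  show "pairwise orthogonal ((\<lambda>j. grad (\<rho> j) x) ` {..<p})"
   using assms by (auto simp: pairwise_def orthogonal_def)
  show "\<forall>v\<in>(\<lambda>j. grad (\<rho> j) x) ` {..<p}. norm v = 1"
   using assms by (auto simp: norm_eq_1)
 qed
qed

lemma orthonormal_list_independent:
 "orthonormal_list vs \<Longrightarrow> independent (set vs)"
 unfolding orthonormal_list_def
 by (intro pairwise_orthogonal_independent) auto

lemma orthonormal_system_normals: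
 "orthonormal_system M p U \<rho> \<Longrightarrow> x \<in> M \<Longrightarrow> x \<in> U \<Longrightarrow> orthonormal_list (normals p \<rho> x)"
 unfolding orthonormal_system_def by (intro orthonormal_list_normalsI) auto

lemma orthonormal_system_inj:
 "orthonormal_system M p U \<rho> \<Longrightarrow> x \<in> M \<Longrightarrow> x \<in> U \<Longrightarrow> inj_on (\<lambda>j. grad (\<rho> j) x) {..<p}"
 unfolding orthonormal_system_def by (intro inj_on_grad_orthonormal) auto

lemma smooth_onI: "(\<And>k. Ck_on k f S) \<Longrightarrow> smooth_on f S"
 by (simp add: smooth_on_def)

lemma smooth_onD: "smooth_on f S \<Longrightarrow> Ck_on k f S"
 by (simp add: smooth_on_def)

text \<open>Gram-Schmidt with variable coefficients. Where the functions vanish, derivatives of the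
  coefficients drop out of the product rule, so gradients there are orthonormalized as vectors; off
  the zero set nothing is claimed. The last conjunct, about the span at \<open>x\<close>, keeps the
  next residual nonzero at \<open>x\<close>.\<close>

lemma gram_schmidt_defining_functions:
 fixes \<rho> :: "nat \<Rightarrow> real^'n::finite \<Rightarrow> real"
 assumes U: "open U" "x \<in> U" "\<forall>j<p. smooth_on (\<rho> j) U" "\<forall>j<p. \<rho> j x = 0"
  and inj: "inj_on (\<lambda>j. grad (\<rho> j) x) {..<p}"
  and ind: "independent ((\<lambda>j. grad (\<rho> j) x) ` {..<p})"
 shows "q \<le> p \<Longrightarrow> \<exists>U' \<rho>'. open U' \<and> x \<in> U' \<and> U' \<subseteq> U \<and> (\<forall>j<q. smooth_on (\<rho>' j) U') \<and>
   (\<forall>y\<in>U'. (\<forall>j<q. \<rho>' j y = 0) \<longleftrightarrow> (\<forall>j<q. \<rho> j y = 0)) \<and>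
   (\<forall>y\<in>U'. (\<forall>j<q. \<rho> j y = 0) \<longrightarrow>
    (\<forall>i<q. \<forall>j<q. grad (\<rho>' i) y \<bullet> grad (\<rho>' j) y = (if i = j then 1 else 0))) \<and>
   (\<forall>j<q. grad (\<rho>' j) x \<in> span ((\<lambda>j. grad (\<rho> j) x) ` {..<q}))"
proof (induction q)
 case 0
 then show ?case using U by (intro exI[of _ U]) auto
next
 case (Suc q)
 then obtain U' \<rho>' where U': "open U'" "x \<in> U'" "U' \<subseteq> U" and sm: "\<forall>j<q. smooth_on (\<rho>' j) U'"
  and zero: "\<forall>y\<in>U'. (\<forall>j<q. \<rho>' j y = 0) \<longleftrightarrow> (\<forall>j<q. \<rho> j y = 0)"
  and on: "\<forall>y\<in>U'. (\<forall>j<q. \<rho> j y = 0) \<longrightarrow>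
    (\<forall>i<q. \<forall>j<q. grad (\<rho>' i) y \<bullet> grad (\<rho>' j) y = (if i = j then 1 else 0))"
  and sp: "\<forall>j<q. grad (\<rho>' j) x \<in> span ((\<lambda>j. grad (\<rho> j) x) ` {..<q})"
  by auto
 have q: "q < p" using Suc.prems by simp
 have smq: "Ck_on k (\<rho> q) U'" for k
  using U q Ck_on_subset[OF smooth_onD U'(3)] by blast
 have smq': "Ck_on k (\<rho>' j) U'" if "j < q" for k j
  using sm that by (auto dest: smooth_onD)
 define a where "a j y = grad (\<rho> q) y \<bullet> grad (\<rho>' j) y" for j y
 define w where "w y = grad (\<rho> q) y - (\<Sum>j<q. a j y *\<^sub>R grad (\<rho>' j) y)" for y
 have Cg: "Ck_on k (grad (\<rho> q)) U'" "j < q \<Longrightarrow> Ck_on k (grad (\<rho>' j)) U'" for k j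
  using smq smq' U'(1) by (blast intro: Ck_on_grad)+
 have Ca: "Ck_on k (a j) U'" if "j < q" for k j
  unfolding a_def by (intro Ck_on_inner U' Cg that)
 have Cw: "Ck_on k w U'" for k
  unfolding w_def by (intro Ck_on_diff Ck_on_sum Ck_on_scaleR U' Cg Ca) auto
 have Cww: "Ck_on k (\<lambda>y. w y \<bullet> w y) U'" for k by (intro Ck_on_inner U' Cw)
 \<comment> \<open>Shrinking to \<open>U''\<close> keeps the residual \<open>w\<close> nonzero, so
   that it can be normalized; \<open>x\<close> remains inside because its gradients are
   independent.\<close>
 define U'' where "U'' = U' \<inter> (\<lambda>y. w y \<bullet> w y) -` {0<..}"
 have U'': "open U''" "U'' \<subseteq> U'"
  unfolding U''_def using Cww[of 0] U' by (auto intro: continuous_open_preimage)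
 have wpos: "0 < w y \<bullet> w y" if "y \<in> U''" for y using that by (auto simp: U''_def)
 define g where "g y = \<rho> q y - (\<Sum>j<q. a j y * \<rho>' j y)" for y
 \<comment> \<open>The reciprocal of the length of \<open>w\<close>, as a power so that
   \<open>Ck_on_powr\<close> gives its smoothness.\<close>
 define \<nu> where "\<nu> y = (w y \<bullet> w y) powr (- 1 / 2)" for y
 have C\<nu>: "Ck_on k \<nu> U''" for k
  unfolding \<nu>_def using wpos by (intro Ck_on_powr U'' Ck_on_subset[OF Cww]) auto
 have Cg': "Ck_on k g U''" for k
  unfolding g_def
  by (intro Ck_on_subset[OF _ U''(2)] Ck_on_diff Ck_on_sum Ck_on_mult U' smq smq' Ca) auto
 have \<nu>pos: "0 < \<nu> y" if "y \<in> U''" for y using wpos[OF that] by (auto simp: \<nu>_def)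
 have \<nu>w: "(\<nu> y)\<^sup>2 * (w y \<bullet> w y) = 1" if "y \<in> U''" for y
 proof -
  have "(\<nu> y)\<^sup>2 = (w y \<bullet> w y) powr (- 1 / 2 + - 1 / 2)"
   unfolding \<nu>_def power2_eq_square by (subst powr_add) simp
  then show ?thesis using wpos[OF that] by (simp add: powr_minus)
 qed
 define h where "h y = \<nu> y * g y" for y
 have Ch: "Ck_on k h U''" for k unfolding h_def by (intro Ck_on_mult U'' C\<nu> Cg')
 \<comment> \<open>At common zeros \<open>g\<close> and the earlier \<rho>' vanish, so only the
   terms with undifferentiated coefficients remain.\<close>
 have gr: "grad h y = \<nu> y *\<^sub>R w y" if y: "y \<in> U''" and z: "\<forall>j<Suc q. \<rho> j y = 0" for y
 proof (rule grad_unique)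
  have z': "\<rho>' j y = 0" if "j < q" for j using z zero y U'' that by auto
  have gy: "g y = 0" using z z' by (simp add: g_def)
  have y': "y \<in> U'" using y U'' by auto
  have d: "f differentiable (at y)" if "Ck_on 1 f U'" for f :: "real^'n \<Rightarrow> real"
   using that y' by simp
  have "(g has_derivative (\<lambda>v. grad (\<rho> q) y \<bullet> v - (\<Sum>j<q. a j y * (grad (\<rho>' j) y \<bullet> v) + (grad (a j) y \<bullet> v) * \<rho>' j y))) (at y)"
   unfolding g_def
   by (intro has_derivative_diff has_derivative_sum has_derivative_mult has_derivative_grad d smq smq' Ca) auto
  moreover have "grad (\<rho> q) y \<bullet> v - (\<Sum>j<q. a j y * (grad (\<rho>' j) y \<bullet> v) + (grad (a j) y \<bullet> v) * \<rho>' j y) = w y \<bullet> v" for v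
   by (simp add: w_def inner_diff_left inner_sum_left z')
  ultimately have "(g has_derivative (\<lambda>v. w y \<bullet> v)) (at y)" by simp
  moreover have "\<nu> differentiable (at y)" using C\<nu>[of 1] y by simp
  ultimately have "(h has_derivative (\<lambda>v. \<nu> y * (w y \<bullet> v) + (grad \<nu> y \<bullet> v) * g y)) (at y)"
   unfolding h_def by (intro has_derivative_mult has_derivative_grad)
  then show "(h has_derivative (\<lambda>v. (\<nu> y *\<^sub>R w y) \<bullet> v)) (at y)" by (simp add: gy)
 qed
 have xz: "\<forall>j<Suc q. \<rho> j x = 0" using U q by auto
 have spx: "(\<Sum>j<q. a j x *\<^sub>R grad (\<rho>' j) x) \<in> span ((\<lambda>j. grad (\<rho> j) x) ` {..<q})"
  using sp by (intro span_sum span_scale) auto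
 have wx: "w x \<noteq> 0"
 proof
  assume "w x = 0"
  then have "grad (\<rho> q) x \<in> span ((\<lambda>j. grad (\<rho> j) x) ` {..<q})"
   using spx by (simp add: w_def)
  moreover have "(\<lambda>j. grad (\<rho> j) x) ` {..<q} \<subseteq> (\<lambda>j. grad (\<rho> j) x) ` {..<p} - {grad (\<rho> q) x}"
   using inj q by (auto dest: inj_onD)
  ultimately have "grad (\<rho> q) x \<in> span ((\<lambda>j. grad (\<rho> j) x) ` {..<p} - {grad (\<rho> q) x})"
   using span_mono by blast
  then show False using ind q unfolding dependent_def by auto
 qed
 then have xU'': "x \<in> U''" using U' by (simp add: U''_def)
 define \<rho>'' where "\<rho>'' = \<rho>'(q := h)"
 have wn: "w y \<bullet> grad (\<rho>' i) y = 0" if y: "y \<in> U'" "\<forall>j<q. \<rho> j y = 0" and i: "i < q" for y i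
 proof -
  have "(\<Sum>j<q. a j y * (grad (\<rho>' j) y \<bullet> grad (\<rho>' i) y)) = (\<Sum>j<q. if j = i then a i y else 0)"
   using on y i by (intro sum.cong refl) auto
  then show ?thesis using i by (simp add: w_def inner_diff_left inner_sum_left a_def)
 qed
 show ?case
 proof (intro exI[of _ U''] exI[of _ \<rho>''] conjI)
  show "\<forall>j<Suc q. smooth_on (\<rho>'' j) U''"
   using Ch smq' U'' by (auto simp: \<rho>''_def less_Suc_eq intro!: smooth_onI intro: Ck_on_subset)
  show "\<forall>y\<in>U''. (\<forall>j<Suc q. \<rho>'' j y = 0) \<longleftrightarrow> (\<forall>j<Suc q. \<rho> j y = 0)"
  proof
   fix y assume y: "y \<in> U''"
   have 1: "(\<forall>j<q. \<rho>' j y = 0) \<longleftrightarrow> (\<forall>j<q. \<rho> j y = 0)" using zero y U'' by auto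
   have 2: "h y = 0 \<longleftrightarrow> \<rho> q y = 0" if "\<forall>j<q. \<rho>' j y = 0"
    using that \<nu>pos[OF y] by (simp add: h_def g_def)
   have 3: "(\<forall>j<Suc q. \<rho>'' j y = 0) \<longleftrightarrow> (\<forall>j<q. \<rho>' j y = 0) \<and> h y = 0"
    by (auto simp: \<rho>''_def less_Suc_eq)
   have 4: "(\<forall>j<Suc q. \<rho> j y = 0) \<longleftrightarrow> (\<forall>j<q. \<rho> j y = 0) \<and> \<rho> q y = 0"
    by (auto simp: less_Suc_eq)
   show "(\<forall>j<Suc q. \<rho>'' j y = 0) \<longleftrightarrow> (\<forall>j<Suc q. \<rho> j y = 0)"
    unfolding 3 4 using 1 2 by blast
  qed
  show "\<forall>y\<in>U''. (\<forall>j<Suc q. \<rho> j y = 0) \<longrightarrow>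
    (\<forall>i<Suc q. \<forall>j<Suc q. grad (\<rho>'' i) y \<bullet> grad (\<rho>'' j) y = (if i = j then 1 else 0))"
  proof (intro ballI impI allI)
   fix y i j assume y: "y \<in> U''" and z: "\<forall>j<Suc q. \<rho> j y = 0" and ij: "i < Suc q" "j < Suc q"
   have y': "y \<in> U'" "\<forall>j<q. \<rho> j y = 0" using y z U'' by auto
   have ww: "\<nu> y * (\<nu> y * (w y \<bullet> w y)) = 1" using \<nu>w[OF y] by (simp add: power2_eq_square mult_ac)
   show "grad (\<rho>'' i) y \<bullet> grad (\<rho>'' j) y = (if i = j then 1 else 0)"
    using ij on y' wn[OF y'] ww
    by (cases "i = q"; cases "j = q") (auto simp: \<rho>''_def gr[OF y z] inner_commute)
  qed
  show "\<forall>j<Suc q. grad (\<rho>'' j) x \<in> span ((\<lambda>j. grad (\<rho> j) x) ` {..<Suc q})"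
  proof (intro allI impI)
   fix j assume j: "j < Suc q"
   have m: "span ((\<lambda>j. grad (\<rho> j) x) ` {..<q}) \<subseteq> span ((\<lambda>j. grad (\<rho> j) x) ` {..<Suc q})"
    by (intro span_mono) auto
   have "w x \<in> span ((\<lambda>j. grad (\<rho> j) x) ` {..<Suc q})"
    unfolding w_def using m spx by (intro span_diff) (auto intro: span_base)
   then show "grad (\<rho>'' j) x \<in> span ((\<lambda>j. grad (\<rho> j) x) ` {..<Suc q})"
    using j m sp by (cases "j = q") (auto simp: \<rho>''_def gr[OF xU'' xz] intro: span_scale)
  qed
 qed (use U' U'' xU'' in auto)
qed

lemma orthonormal_system_imp_defining_functions:
 assumes "orthonormal_system M p U \<rho>"
 shows "defining_functions M p U \<rho>"
 using assms orthonormal_system_inj[OF assms] orthonormal_list_independent[OF orthonormal_system_normals[OF assms]]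
 unfolding defining_functions_iff_grad set_normals by (auto simp: orthonormal_system_def)

text \<open>The Gram-Schmidt process shows that the choice in \<open>normal_system\<close> is made
  from a nonempty set, so the chosen functions have the properties asked of them.\<close>

lemma normal_system_orthonormal:
 assumes M: "submanifold m M" and x: "x \<in> (M :: 'n::{finite,linorder} point set)"
 obtains U where "x \<in> U" "orthonormal_system M (CARD('n) - m) U (normal_system m M x)"
proof -
 define p where "p = CARD('n) - m"
 obtain U \<rho> where "x \<in> U" "defining_functions M p U \<rho>"
  using M x unfolding submanifold_def p_def by blast
 then have U: "open U" "x \<in> U" "\<forall>j<p. smooth_on (\<rho> j) U" "M \<inter> U = {x\<in>U. \<forall>j<p. \<rho> j x = 0}"
  "inj_on (\<lambda>j. grad (\<rho> j) x) {..<p}" "independent ((\<lambda>j. grad (\<rho> j) x) ` {..<p})"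
  using x unfolding defining_functions_iff_grad by auto
 have z: "\<forall>j<p. \<rho> j x = 0" using U x by auto
 obtain U' \<rho>' where U': "open U'" "x \<in> U'" "U' \<subseteq> U" "\<forall>j<p. smooth_on (\<rho>' j) U'"
  "\<forall>y\<in>U'. (\<forall>j<p. \<rho>' j y = 0) \<longleftrightarrow> (\<forall>j<p. \<rho> j y = 0)"
  "\<forall>y\<in>U'. (\<forall>j<p. \<rho> j y = 0) \<longrightarrow>
    (\<forall>i<p. \<forall>j<p. grad (\<rho>' i) y \<bullet> grad (\<rho>' j) y = (if i = j then 1 else 0))"
  using gram_schmidt_defining_functions[OF U(1,2,3) z U(5,6) order_refl] by blast
 have "M \<inter> U' = {x\<in>U'. \<forall>j<p. \<rho>' j x = 0}" using U'(3,5) U(4) by auto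
 then have os: "orthonormal_system M p U' \<rho>'"
  using U' U(4) unfolding orthonormal_system_def by auto
 have sdg: "sd (fun_form (\<rho> i)) y \<bullet> sd (fun_form (\<rho> j)) y = grad (\<rho> i) y \<bullet> grad (\<rho> j) y"
  if "defining_functions M p V \<rho>" "y \<in> V" "i < p" "j < p" for V \<rho> y i j
  using that by (subst (1 2) sd_fun_form) (auto simp: defining_functions_def intro: smooth_on_differentiable)
 define Q where "Q \<rho> \<longleftrightarrow> (\<exists>V. x \<in> V \<and> defining_functions M p V \<rho> \<and>
   (\<forall>y \<in> M \<inter> V. \<forall>i<p. \<forall>j<p.
    sd (fun_form (\<rho> i)) y \<bullet> sd (fun_form (\<rho> j)) y = (if i = j then 1 else 0)))" for \<rho>
 have "Q \<rho>'" unfolding Q_def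
  using os orthonormal_system_imp_defining_functions[OF os] U'(2) sdg
  by (intro exI[of _ U']) (auto simp: orthonormal_system_def)
 moreover have "normal_system m M x = (SOME \<rho>. Q \<rho>)"
  unfolding normal_system_def Q_def p_def ..
 ultimately have "Q (normal_system m M x)" by (simp add: someI)
 then obtain V where V: "x \<in> V" "defining_functions M p V (normal_system m M x)"
  "\<forall>y \<in> M \<inter> V. \<forall>i<p. \<forall>j<p.
    sd (fun_form (normal_system m M x i)) y \<bullet> sd (fun_form (normal_system m M x j)) y =
    (if i = j then 1 else 0)" unfolding Q_def by blast
 have "orthonormal_system M p V (normal_system m M x)"
  using V(2,3) sdg[OF V(2)] unfolding orthonormal_system_def
  by (auto simp: defining_functions_def)
 then show thesis using that V(1) by (simp add: p_def)
qed

section \<open>Charts\<close>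

text \<open>In finite dimension an injective map is bounded below, and this bound survives a small
  perturbation; the difference of two solutions of the linear equation is then controlled by the
  perturbation.\<close>

lemma continuous_on_inv_blinfun:
 fixes A :: "'b::metric_space \<Rightarrow> ('a::euclidean_space \<Rightarrow>\<^sub>L 'a)"
 assumes A: "continuous_on S A" and bij: "\<And>z. z \<in> S \<Longrightarrow> bij (blinfun_apply (A z))"
 shows "continuous_on S (\<lambda>z. inv (blinfun_apply (A z)) w)"
 unfolding continuous_on_iff
proof (intro ballI allI impI)
 fix z0 and \<epsilon> :: real assume z0: "z0 \<in> S" and \<epsilon>: "0 < \<epsilon>"
 define x where "x z = inv (blinfun_apply (A z)) w" for z
 have Ax: "blinfun_apply (A z) (x z) = w" if "z \<in> S" for z
  using bij[OF that] by (simp add: x_def bij_is_surj surj_f_inv_f)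
 obtain c where c: "0 < c" "\<And>v. c * norm v \<le> norm (blinfun_apply (A z0) v)"
  using linear_inj_bounded_below_pos[of "blinfun_apply (A z0)"] bij[OF z0]
  by (metis bij_is_inj blinfun.bounded_linear_right bounded_linear.linear)
 \<comment> \<open>The first entry lets half of the lower bound \<open>c\<close> absorb the
   perturbation; the second makes the remaining term smaller than \<open>\<epsilon>\<close>.\<close>
 define \<eta> where "\<eta> = min (c / 2) (c / 2 * \<epsilon> / (norm (x z0) + 1))"
 have \<eta>: "0 < \<eta>" using c \<epsilon> by (simp add: \<eta>_def add_nonneg_pos)
 obtain d where d: "0 < d" "\<And>z. z \<in> S \<Longrightarrow> dist z z0 < d \<Longrightarrow> dist (A z) (A z0) < \<eta>"
  using A z0 \<eta> unfolding continuous_on_iff by blast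
 show "\<exists>d>0. \<forall>z\<in>S. dist z z0 < d \<longrightarrow> dist (x z) (x z0) < \<epsilon>"
 proof (intro exI[of _ d] conjI ballI impI d(1))
  fix z assume z: "z \<in> S" "dist z z0 < d"
  have n: "norm (A z - A z0) < \<eta>" using d(2)[OF z] by (simp add: dist_norm)
  have b: "norm (blinfun_apply (A z) v - blinfun_apply (A z0) v) \<le> \<eta> * norm v" for v
   using norm_blinfun[of "A z - A z0" v] mult_right_mono[OF less_imp_le[OF n] norm_ge_zero[of v]]
   by (simp add: blinfun.diff_left)
  let ?u = "x z - x z0"
  have "blinfun_apply (A z) ?u = blinfun_apply (A z0) (x z0) - blinfun_apply (A z) (x z0)"
   using Ax z z0 by (simp add: blinfun.diff_right)
  then have 1: "norm (blinfun_apply (A z) ?u) \<le> \<eta> * norm (x z0)"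
   using b[of "x z0"] by (simp add: norm_minus_commute)
  have "c * norm ?u \<le> norm (blinfun_apply (A z0) ?u)" by (rule c)
  also have "\<dots> \<le> norm (blinfun_apply (A z) ?u) + norm (blinfun_apply (A z) ?u - blinfun_apply (A z0) ?u)"
   by (metis norm_triangle_sub norm_minus_commute)
  also have "\<dots> \<le> \<eta> * norm (x z0) + c / 2 * norm ?u"
  proof -
   have "\<eta> \<le> c / 2" unfolding \<eta>_def by (rule min.cobounded1)
   from mult_right_mono[OF this norm_ge_zero[of ?u]] show ?thesis using 1 b[of ?u] by linarith
  qed
  finally have "c / 2 * norm ?u \<le> \<eta> * norm (x z0)" by simp
  also have "\<dots> < \<eta> * (norm (x z0) + 1)" using \<eta> by simp
  also have "\<dots> \<le> c / 2 * \<epsilon>"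
  proof -
   have "\<eta> \<le> c / 2 * \<epsilon> / (norm (x z0) + 1)" unfolding \<eta>_def by (rule min.cobounded2)
   moreover have "0 < norm (x z0) + 1" by (simp add: add_nonneg_pos)
   ultimately show ?thesis by (simp only: pos_le_divide_eq)
  qed
  finally show "dist (x z) (x z0) < \<epsilon>" using c by (simp add: dist_norm)
 qed
qed

definition coords :: "('m \<Rightarrow> 'n::finite point) \<Rightarrow> 'n point \<Rightarrow> real^'m" where
 "coords e y = (\<chi> i. e i \<bullet> y)"

lemma linear_coords: "linear (coords (e :: 'm::finite \<Rightarrow> _))"
 by (rule linearI) (simp_all add: coords_def vec_eq_iff inner_add_right)

lemma bounded_linear_coords: "bounded_linear (coords (e :: 'm::finite \<Rightarrow> _))"
 using linear_coords linear_conv_bounded_linear by blast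

text \<open>Such a chart is a graph over the span of the \<open>e i\<close>, with the linear inverse \<open>coords e\<close>.\<close>

definition graph_chart ::
  "'n point set \<Rightarrow> ('m::finite \<Rightarrow> 'n point) \<Rightarrow> 'n point set \<Rightarrow> (real^'m) set \<Rightarrow>
   (real^'m \<Rightarrow> 'n::finite point) \<Rightarrow> bool" where
 "graph_chart M e V W \<phi> \<longleftrightarrow> open V \<and> open W \<and> \<phi> ` W = M \<inter> V \<and> Ck_on 1 \<phi> W \<and>
   (\<forall>u\<in>W. coords e (\<phi> u) = u)"

text \<open>The inverse function theorem for the map \<open>\<Psi>\<close> that keeps the
  coordinates along a tangent basis at \<open>x\<close> and replaces the normal coordinates by the
  values of the defining functions. Then \<open>M\<close> is the zero set of the normal part, and
  the chart is the inverse of \<open>\<Psi>\<close> on the tangent plane.\<close>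

lemma graph_chart_exists:
 fixes M :: "'n::{finite,linorder} point set"
 assumes sys: "orthonormal_system M p U \<rho>" and x: "x \<in> M" "x \<in> U"
  and dim: "p + CARD('m) = CARD('n)"
 obtains e :: "'m::finite \<Rightarrow> 'n point" and V W \<phi> where
  "graph_chart M e V W \<phi>" "x \<in> V" "V \<subseteq> U"
  "\<And>u v. u \<in> W \<Longrightarrow> (\<forall>j<p. v \<bullet> grad (\<rho> j) (\<phi> u) = 0) \<Longrightarrow>
    FD \<phi> u (coords e v) = v"
proof -
 have U: "open U" and sm: "\<And>j. j < p \<Longrightarrow> smooth_on (\<rho> j) U"
  and MU: "M \<inter> U = {x\<in>U. \<forall>j<p. \<rho> j x = 0}"
  using sys unfolding orthonormal_system_def by auto
 define n where "n j = grad (\<rho> j) x" for j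
 have on: "n i \<bullet> n j = (if i = j then 1 else 0)" if "i < p" "j < p" for i j
  using sys x that unfolding orthonormal_system_def n_def by auto
 define N where "N = set (normals p \<rho> x)"
 have N: "orthonormal_list (normals p \<rho> x)" using orthonormal_system_normals[OF sys x] .
 have N': "N = n ` {..<p}" by (simp add: N_def set_normals n_def)
 have injn: "inj_on n {..<p}" using orthonormal_system_inj[OF sys x] by (simp add: n_def[abs_def])
 \<comment> \<open>The tangent space at \<open>x\<close>, with \<open>e\<close> an orthonormal basis
   of it indexed by \<open>'m\<close>.\<close>
 define T where "T = {v. \<forall>u\<in>N. orthogonal u v}"
 have "dim T + dim N = DIM('n point)"
 proof -
  have "T = {v \<in> UNIV. \<forall>u\<in>span N. orthogonal u v}"
   unfolding T_def by (auto simp: orthogonal_commute intro: orthogonal_to_span span_base)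
  then show ?thesis using dim_subspace_orthogonal_to_vectors[of "span N" UNIV] by simp
 qed
 moreover have "dim N = p"
  using dim_eq_card_independent[OF orthonormal_list_independent[OF N]] injn
  by (simp add: N'[unfolded N_def] N_def card_image)
 ultimately have dT: "dim T = CARD('m)" using dim by simp
 have sT: "subspace T" unfolding T_def by (rule subspace_orthogonal_to_vectors)
 obtain B where B: "B \<subseteq> T" "pairwise orthogonal B" "\<And>b. b \<in> B \<Longrightarrow> norm b = 1"
  "independent B" "card B = dim T" "span B = T"
  using orthonormal_basis_subspace[OF sT] by metis
 have finB: "finite B" using B(4) independent_bound by blast
 obtain e :: "'m \<Rightarrow> 'n point" where e: "bij_betw e UNIV B"
  using finite_same_card_bij[of "UNIV :: 'm set" B] finB B(5) dT by auto
 have ee: "e i \<bullet> e j = (if i = j then 1 else 0)" for i j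
 proof (cases "i = j")
  case True
  then show ?thesis using B(3)[of "e i"] e by (auto simp: norm_eq_1 bij_betw_def)
 next
  case False
  then have "e i \<noteq> e j" using e by (auto simp: bij_betw_def inj_def)
  then show ?thesis using False B(2) e by (auto simp: pairwise_def orthogonal_def bij_betw_def)
 qed
 have en: "e i \<bullet> n j = 0" if "j < p" for i j
  using B(1) e that unfolding T_def N' by (auto simp: orthogonal_def inner_commute bij_betw_def)
 have exp: "(\<Sum>i\<in>UNIV. (v \<bullet> e i) *\<^sub>R e i) + (\<Sum>j<p. (v \<bullet> n j) *\<^sub>R n j) = v" for v
 proof -
  have "e i \<noteq> n j" if "j < p" for i j
  proof
   assume "e i = n j"
   then show False using en[OF that, of i] ee[of i i] by simp
  qed
  then have disj: "range e \<inter> N = {}" unfolding N' by auto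
  have "pairwise orthogonal (range e \<union> N)"
   using ee en on unfolding N' pairwise_def orthogonal_def by (auto simp: inner_commute)
  moreover have "\<forall>v\<in>range e \<union> N. norm v = 1" using ee on unfolding N' by (auto simp: norm_eq_1)
  moreover have "card (range e \<union> N) = DIM('n point)"
   using disj injn e dim unfolding N' by (subst card_Un_disjoint) (auto simp: card_image bij_betw_def)
  ultimately have "(\<Sum>u\<in>range e \<union> N. (v \<bullet> u) *\<^sub>R u) = v"
   by (intro orthonormal_full_expansion) (auto simp: N')
  also have "(\<Sum>u\<in>range e \<union> N. (v \<bullet> u) *\<^sub>R u) = (\<Sum>u\<in>range e. (v \<bullet> u) *\<^sub>R u) + (\<Sum>u\<in>N. (v \<bullet> u) *\<^sub>R u)"
   using disj by (intro sum.union_disjoint) (auto simp: N')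
  also have "(\<Sum>u\<in>range e. (v \<bullet> u) *\<^sub>R u) = (\<Sum>i\<in>UNIV. (v \<bullet> e i) *\<^sub>R e i)"
   using e by (subst sum.reindex) (auto simp: bij_betw_def)
  also have "(\<Sum>u\<in>N. (v \<bullet> u) *\<^sub>R u) = (\<Sum>j<p. (v \<bullet> n j) *\<^sub>R n j)"
   unfolding N' using injn by (subst sum.reindex) auto
  finally show ?thesis .
 qed
 define \<iota> where "\<iota> c = (\<Sum>i\<in>UNIV. c $ i *\<^sub>R e i)" for c :: "real^'m"
 have lin\<iota>: "linear \<iota>"
  by (rule linearI) (simp_all add: \<iota>_def scaleR_add_left sum.distrib scaleR_sum_right)
 then have bl\<iota>: "bounded_linear \<iota>" by (simp add: linear_conv_bounded_linear)
 have \<iota>e: "e i \<bullet> \<iota> c = c $ i" for i c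
  by (simp add: \<iota>_def inner_sum_right ee if_distrib cong: if_cong)
 have \<iota>n: "n j \<bullet> \<iota> c = 0" if "j < p" for j c
  using en[OF that] by (simp add: \<iota>_def inner_sum_right inner_commute)
 \<comment> \<open>At \<open>x\<close> the gradients are the \<open>n j\<close>, so the derivative
   of \<open>\<Psi>\<close> there is the expansion in the full orthonormal frame, that is the
   identity.\<close>
 define \<Psi> where "\<Psi> y = (\<Sum>i\<in>UNIV. (y \<bullet> e i) *\<^sub>R e i) + (\<Sum>j<p. \<rho> j y *\<^sub>R n j)" for y
 define D where "D y v = (\<Sum>i\<in>UNIV. (v \<bullet> e i) *\<^sub>R e i) + (\<Sum>j<p. (grad (\<rho> j) y \<bullet> v) *\<^sub>R n j)" for y v
 have blD: "bounded_linear (D y)" for y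
  unfolding D_def
  by (intro bounded_linear_add bounded_linear_sum bounded_linear_scaleR_const
    bounded_linear_inner_left bounded_linear_inner_right)
 define A where "A y = Blinfun (D y)" for y
 have A: "blinfun_apply (A y) = D y" for y
  by (simp add: A_def bounded_linear_Blinfun_apply blD)
 have der: "(\<Psi> has_derivative blinfun_apply (A y)) (at y)" if "y \<in> U" for y
  unfolding A \<Psi>_def D_def using sm that
  by (intro has_derivative_add has_derivative_sum has_derivative_scaleR_left has_derivative_grad
    has_derivative_inner_left has_derivative_ident) (auto intro: smooth_on_differentiable)
 have contA: "continuous_on U A"
 proof (rule continuous_on_blinfun_componentwise)
  fix i :: "'n point"
  have "continuous_on U (grad (\<rho> j))" if "j < p" for j
   using Ck_on_grad[OF U smooth_onD[OF sm[OF that]], of 0] by simp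
  then show "continuous_on U (\<lambda>y. blinfun_apply (A y) i)"
   unfolding A D_def by (intro continuous_intros) auto
 qed
 have "D x = id" using exp by (auto simp: D_def n_def[symmetric] inner_commute)
 then have Ax: "id_blinfun o\<^sub>L A x = id_blinfun"
  by (intro blinfun_eqI) (simp add: A)
 obtain U' V0 \<Theta> \<Theta>' where IF: "open U'" "U' \<subseteq> U" "x \<in> U'" "open V0" "\<Psi> x \<in> V0"
  "homeomorphism U' V0 \<Psi> \<Theta>" "\<And>y. y \<in> V0 \<Longrightarrow> (\<Theta> has_derivative \<Theta>' y) (at y)"
  "\<And>y. y \<in> V0 \<Longrightarrow> \<Theta>' y = inv (blinfun_apply (A (\<Theta> y)))"
  "\<And>y. y \<in> V0 \<Longrightarrow> bij (blinfun_apply (A (\<Theta> y)))"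
  using inverse_function_theorem[OF U der contA x(2) Ax] by metis
 have hom: "\<And>y. y \<in> U' \<Longrightarrow> \<Psi> y \<in> V0 \<and> \<Theta> (\<Psi> y) = y" "\<And>z. z \<in> V0 \<Longrightarrow> \<Theta> z \<in> U' \<and> \<Psi> (\<Theta> z) = z"
  "continuous_on V0 \<Theta>"
  using IF(6) unfolding homeomorphism_def by auto
 have \<Psi>e: "e i \<bullet> \<Psi> y = e i \<bullet> y" for i y
  by (simp add: \<Psi>_def inner_add_right inner_sum_right ee en if_distrib inner_commute cong: if_cong)
 have \<Psi>n: "n j \<bullet> \<Psi> y = \<rho> j y" if "j < p" for j y
 proof -
  have "(\<Sum>i<p. \<rho> i y * (n j \<bullet> n i)) = (\<Sum>i<p. if i = j then \<rho> j y else 0)"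
   using that on by (intro sum.cong refl) auto
  then show ?thesis using that en
   by (simp add: \<Psi>_def inner_add_right inner_sum_right inner_commute[of "n j" "e _"])
 qed
 define W where "W = {c. \<iota> c \<in> V0}"
 define \<phi> where "\<phi> c = \<Theta> (\<iota> c)" for c
 have Wopen: "open W"
  unfolding W_def using IF(4) bl\<iota>
  by (intro open_vimage[unfolded vimage_def]) (auto intro: linear_continuous_on)
 have \<Psi>\<phi>: "\<phi> c \<in> U'" "\<Psi> (\<phi> c) = \<iota> c" if "c \<in> W" for c
  using hom(2) that by (auto simp: W_def \<phi>_def)
 have inM: "\<phi> c \<in> M" if "c \<in> W" for c
 proof -
  have "\<rho> j (\<phi> c) = 0" if "j < p" for j
   using \<Psi>n[OF that, of "\<phi> c"] \<Psi>\<phi>[OF \<open>c \<in> W\<close>] \<iota>n[OF that] by simp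
  then show ?thesis using MU \<Psi>\<phi>[OF that] IF(2) by auto
 qed
 have \<Psi>M: "\<Psi> y = \<iota> (coords e y)" if "y \<in> M \<inter> U" for y
 proof -
  have "\<rho> j y = 0" if "j < p" for j using MU \<open>y \<in> _\<close> that by auto
  then show ?thesis by (simp add: \<Psi>_def \<iota>_def coords_def inner_commute)
 qed
 have image: "\<phi> ` W = M \<inter> U'"
 proof
  show "\<phi> ` W \<subseteq> M \<inter> U'" using inM \<Psi>\<phi> by auto
  show "M \<inter> U' \<subseteq> \<phi> ` W"
  proof
   fix y assume y: "y \<in> M \<inter> U'"
   then have "\<Psi> y = \<iota> (coords e y)" using IF(2) by (intro \<Psi>M) auto
   then have "coords e y \<in> W" "\<phi> (coords e y) = y" using hom(1)[of y] y by (auto simp: W_def \<phi>_def)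
   then show "y \<in> \<phi> ` W" by force
  qed
 qed
 have co: "coords e (\<phi> c) = c" if "c \<in> W" for c
  using \<Psi>e[of _ "\<phi> c"] \<Psi>\<phi>[OF that] \<iota>e by (simp add: coords_def vec_eq_iff)
 have d\<phi>: "(\<phi> has_derivative (\<lambda>c. inv (D (\<phi> u)) (\<iota> c))) (at u)" if "u \<in> W" for u
 proof -
  have "\<iota> u \<in> V0" using that by (simp add: W_def)
  from diff_chain_at[OF bounded_linear_imp_has_derivative[OF bl\<iota>] IF(7)[OF this]]
  show ?thesis using IF(8)[OF \<open>\<iota> u \<in> V0\<close>] by (simp add: comp_def \<phi>_def[abs_def] A)
 qed
 have continv: "continuous_on V0 (\<lambda>z. inv (blinfun_apply (A (\<Theta> z))) w)" for w
 proof (rule continuous_on_inv_blinfun[OF _ IF(9)])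
  show "continuous_on V0 (\<lambda>z. A (\<Theta> z))"
   using hom(2,3) IF(2) by (intro continuous_on_compose2[OF contA]) auto
 qed
 have C1: "Ck_on (Suc 0) \<phi> W"
 proof (rule Ck_on_SucI[OF Wopen d\<phi>])
  fix v
  show "Ck_on 0 (\<lambda>u. inv (D (\<phi> u)) (\<iota> v)) W"
   using continuous_on_compose2[OF continv[of "\<iota> v"] linear_continuous_on[OF bl\<iota>, of W]]
   by (auto simp: W_def \<phi>_def A)
 qed
 show thesis
 proof (rule that)
  show "graph_chart M e U' W \<phi>"
   using IF(1) Wopen image C1 co by (simp add: graph_chart_def del: Ck_on.simps)
  show "x \<in> U'" "U' \<subseteq> U" by (fact IF)+
  \<comment> \<open>On a tangent vector the normal part of \<open>D (\<phi> u)\<close> vanishes, so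
    it is sent to its coordinates along \<open>e\<close>; inverting this gives the derivative of the
    chart.\<close>
  fix u v assume u: "u \<in> W" and v: "\<forall>j<p. v \<bullet> grad (\<rho> j) (\<phi> u) = 0"
  have "D (\<phi> u) v = \<iota> (coords e v)"
   using v by (simp add: D_def \<iota>_def coords_def inner_commute)
  moreover have "bij (D (\<phi> u))" using IF(9)[of "\<iota> u"] u by (simp add: A W_def \<phi>_def)
  ultimately have "inv (D (\<phi> u)) (\<iota> (coords e v)) = v" by (metis bij_is_inj inv_f_f)
  then show "FD \<phi> u (coords e v) = v"
   using frechet_derivative_at[OF d\<phi>[OF u]] by metis
 qed
qed

section \<open>Traces and Gram determinants\<close>

text \<open>The trace of \<open>L\<close> composed with the projection onto the complement of
  \<open>N\<close>. The standard basis makes it independent of any choice of tangent basis.\<close>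

definition tan_trace :: "(real^'n) set \<Rightarrow> (real^'n \<Rightarrow> real^'n) \<Rightarrow> real" where
 "tan_trace N L = (\<Sum>k\<in>UNIV. L (axis k 1) \<bullet> orth_rest N (axis k (1::real)))" for N :: "(real^'n::finite) set"

lemma orth_rest_adjoint:
 assumes "finite N" "pairwise orthogonal N" "\<forall>v\<in>N. norm v = 1"
 shows "orth_rest N v \<bullet> w = v \<bullet> orth_rest N w"
 using orth_rest_inner_rest[OF assms, of v w] orth_rest_inner_rest[OF assms, of w v]
 by (simp add: inner_commute)

lemma sum_axis_inner:
 fixes L :: "real^'n::finite \<Rightarrow> real^'n"
 assumes "linear L"
 shows "(\<Sum>k\<in>UNIV. (b \<bullet> axis k 1) * (L (axis k 1) \<bullet> a)) = L b \<bullet> a"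
proof -
 have "L b = L (\<Sum>k\<in>UNIV. (b \<bullet> axis k 1) *\<^sub>R axis k 1)"
  by (simp add: inner_axis basis_expansion flip: scalar_mult_eq_scaleR)
 also have "\<dots> = (\<Sum>k\<in>UNIV. (b \<bullet> axis k 1) *\<^sub>R L (axis k 1))"
  by (simp add: linear_sum[OF assms] linear_cmul[OF assms])
 finally show ?thesis by (simp add: inner_sum_left)
qed

text \<open>Any expansion of the projection into rank one terms computes the trace. It is applied to
  orthonormal tangent bases, to projected axes, and to the mutually dual tangent frames of a
  chart.\<close>

lemma tan_trace_dual:
 fixes L :: "real^'n::finite \<Rightarrow> real^'n"
 assumes L: "linear L" and dual: "\<And>v. orth_rest N v = (\<Sum>i\<in>I. (b i \<bullet> v) *\<^sub>R a i)"
 shows "tan_trace N L = (\<Sum>i\<in>I. L (b i) \<bullet> a i)"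
proof -
 have "tan_trace N L = (\<Sum>k\<in>UNIV. \<Sum>i\<in>I. (b i \<bullet> axis k 1) * (L (axis k 1) \<bullet> a i))"
  by (simp add: tan_trace_def dual inner_sum_right)
 also have "\<dots> = (\<Sum>i\<in>I. \<Sum>k\<in>UNIV. (b i \<bullet> axis k 1) * (L (axis k 1) \<bullet> a i))"
  by (rule sum.swap)
 also have "\<dots> = (\<Sum>i\<in>I. L (b i) \<bullet> a i)"
  by (simp only: sum_axis_inner[OF L])
 finally show ?thesis .
qed

text \<open>Whichever orthonormal basis \<open>trace_on\<close> picks, it expands the projection and
  \<open>tan_trace_dual\<close> applies.\<close>

lemma trace_on_eq_tan_trace:
 fixes L :: "real^'n::finite \<Rightarrow> real^'n"
 assumes N: "finite N" "pairwise orthogonal N" "\<forall>v\<in>N. norm v = 1" and L: "linear L"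
 shows "trace_on {v. \<forall>u\<in>N. v \<bullet> u = 0} (\<lambda>v w. L v \<bullet> w) = tan_trace N L"
proof -
 let ?T = "{v. \<forall>u\<in>N. v \<bullet> u = 0}"
 have sT: "subspace ?T" by (auto simp: subspace_def inner_add_left)
 obtain B where B: "B \<subseteq> ?T" "pairwise orthogonal B" "\<And>b. b \<in> B \<Longrightarrow> norm b = 1" "span B = ?T"
  by (rule orthonormal_basis_subspace[OF sT], rule that; (assumption | blast))
 define Q where "Q E \<longleftrightarrow> pairwise orthogonal E \<and> (\<forall>e\<in>E. norm e = 1) \<and> span E = ?T" for E
 define E where "E = (SOME E. Q E)"
 have "Q B" using B by (simp add: Q_def)
 then have "Q E" unfolding E_def by (rule someI)
 then have E: "pairwise orthogonal E \<and> (\<forall>e\<in>E. norm e = 1) \<and> span E = ?T"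
  unfolding Q_def .
 then have finE: "finite E"
  by (intro pairwise_orthogonal_imp_finite) simp
 have "orth_rest N v = (\<Sum>e\<in>E. (e \<bullet> v) *\<^sub>R e)" for v
 proof -
  have "orth_rest N v \<in> span E" using E orth_rest_inner[OF N] by auto
  then have "orth_rest N v = (\<Sum>e\<in>E. (orth_rest N v \<bullet> e) *\<^sub>R e)"
   using orthonormal_basis_expand[of E "orth_rest N v"] E finE by (simp add: inner_commute)
  also have "\<dots> = (\<Sum>e\<in>E. (e \<bullet> v) *\<^sub>R e)"
  proof (intro sum.cong refl)
   fix e assume "e \<in> E"
   then have "e \<in> ?T" using E span_base by blast
   then have "orth_rest N e = e" by (simp add: orth_rest_def)
   then show "(orth_rest N v \<bullet> e) *\<^sub>R e = (e \<bullet> v) *\<^sub>R e"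
    using orth_rest_adjoint[OF N, of v e] by (simp add: inner_commute)
  qed
  finally show ?thesis .
 qed
 from tan_trace_dual[OF L this] show ?thesis unfolding trace_on_def E_def Q_def by (rule sym)
qed

text \<open>The projected axes form a Parseval frame of the complement: the projection expands in
  them with themselves as dual system, and the trace becomes a sum of values of the quadratic
  form.\<close>

lemma tan_trace_nonneg:
 fixes L :: "real^'n::finite \<Rightarrow> real^'n"
 assumes N: "finite N" "pairwise orthogonal N" "\<forall>v\<in>N. norm v = 1" and L: "linear L"
  and pos: "\<And>v. 0 \<le> L v \<bullet> v"
 shows "0 \<le> tan_trace N L"
proof -
 have "orth_rest N v = (\<Sum>k\<in>UNIV. (orth_rest N (axis k 1) \<bullet> v) *\<^sub>R orth_rest N (axis k 1))" for v
 proof -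
  have "orth_rest N (orth_rest N v) = orth_rest N v"
   using orth_rest_inner[OF N] by (simp add: orth_rest_def[of N "orth_rest N v"])
  moreover have "orth_rest N v = (\<Sum>k\<in>UNIV. (orth_rest N (axis k 1) \<bullet> v) *\<^sub>R axis k 1)"
   by (simp add: orth_rest_adjoint[OF N] inner_axis' basis_expansion flip: scalar_mult_eq_scaleR)
  ultimately show ?thesis
   by (metis (no_types, lifting) linear_sum[OF linear_orth_rest] linear_cmul[OF linear_orth_rest] sum.cong)
 qed
 from tan_trace_dual[OF L this] show ?thesis using pos by (simp add: sum_nonneg)
qed

text \<open>The Gram matrix is \<open>B\<^sup>T B\<close> for the square matrix \<open>B\<close> of coordinates in an orthonormal
 basis of a space containing the vectors.\<close>

lemma det_gram_nonneg:
 fixes v :: "'m::finite \<Rightarrow> 'a::euclidean_space"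
 shows "0 \<le> det (\<chi> i j. v i \<bullet> v j)"
proof -
 obtain B where B: "B \<subseteq> span (range v)" "pairwise orthogonal B" "\<And>b. b \<in> B \<Longrightarrow> norm b = 1"
  "independent B" "card B = dim (span (range v))" "span B = span (range v)"
  using orthonormal_basis_subspace[OF subspace_span] by metis
 have finB: "finite B" using B(4) independent_bound by blast
 have "card B \<le> card (range v)" using B(5) dim_le_card'[of "range v"] by simp
 also have "\<dots> \<le> CARD('m)" by (rule card_image_le) simp
 finally obtain f where f: "f ` B \<subseteq> (UNIV :: 'm set)" "inj_on f B"
  using finB card_le_inj[of B "UNIV :: 'm set"] by auto
 define b where "b k = (if k \<in> f ` B then inv_into B f k else 0)" for k
 have "v i \<bullet> v j = (\<Sum>k\<in>UNIV. (v i \<bullet> b k) * (v j \<bullet> b k))" for i j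
 proof -
  have "v i = (\<Sum>c\<in>B. (v i \<bullet> c) *\<^sub>R c)"
   using B finB by (intro orthonormal_basis_expand[symmetric]) (auto intro: span_base)
  then have "v i \<bullet> v j = (\<Sum>c\<in>B. (v i \<bullet> c) *\<^sub>R c) \<bullet> v j"
   by (rule arg_cong[where f = "\<lambda>x. x \<bullet> v j"])
  also have "\<dots> = (\<Sum>c\<in>B. (v i \<bullet> c) * (v j \<bullet> c))"
   by (simp add: inner_sum_right inner_commute[of _ "v j"])
  also have "\<dots> = (\<Sum>k\<in>f ` B. (v i \<bullet> b k) * (v j \<bullet> b k))"
   using f(2) by (simp add: sum.reindex b_def)
  also have "\<dots> = (\<Sum>k\<in>UNIV. (v i \<bullet> b k) * (v j \<bullet> b k))"
   by (rule sum.mono_neutral_left) (auto simp: b_def)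
  finally show ?thesis .
 qed
 then have "(\<chi> i j. v i \<bullet> v j) = (\<chi> i k. v i \<bullet> b k) ** transpose (\<chi> i k. v i \<bullet> b k)"
  by (simp add: matrix_matrix_mult_def transpose_def vec_eq_iff)
 then show ?thesis by (simp add: det_mul)
qed

text \<open>Conjugation with \<open>h\<close> is a sign preserving bijection between the
  permutations of the two index types.\<close>

lemma det_reindex:
 fixes A :: "real^'m^'m" and h :: "'k::finite \<Rightarrow> 'm::finite"
 assumes h: "bij h"
 shows "det (\<chi> i j. A $ h i $ h j) = det A"
proof -
 have hh: "h (inv h x) = x" "inv h (h y) = y" for x y
  using h by (simp_all add: bij_is_surj surj_f_inv_f bij_is_inj)
 have s: "sign (h \<circ> q \<circ> inv h) = sign q" if "q permutes UNIV" for q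
 proof -
  have "map_permutation UNIV h q = h \<circ> q \<circ> inv h"
   using h by (simp add: map_permutation_def bij_is_surj restrict_id_def comp_def)
  then show ?thesis using sign_map_permutation[of h UNIV q] h that by (simp add: bij_is_inj)
 qed
 have per: "h \<circ> q \<circ> inv h permutes UNIV" if "q permutes UNIV" for q
 proof -
  have "bij (h \<circ> q \<circ> inv h)"
   using h permutes_bij[OF that] by (intro bij_comp bij_imp_bij_inv)
  then show ?thesis by (intro bij_imp_permutes) auto
 qed
 have per': "inv h \<circ> p \<circ> h permutes UNIV" if "p permutes UNIV" for p
 proof -
  have "bij (inv h \<circ> p \<circ> h)"
   using h permutes_bij[OF that] by (intro bij_comp bij_imp_bij_inv)
  then show ?thesis by (intro bij_imp_permutes) auto
 qed
 show ?thesis unfolding det_def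
 proof (rule sum.reindex_bij_witness[where i = "\<lambda>p. inv h \<circ> p \<circ> h" and j = "\<lambda>q. h \<circ> q \<circ> inv h"])
  fix q :: "'k \<Rightarrow> 'k" assume q: "q \<in> {p. p permutes UNIV}"
  have "(\<Prod>i\<in>UNIV. A $ i $ (h \<circ> q \<circ> inv h) i) = (\<Prod>i\<in>UNIV. A $ h i $ (h \<circ> q \<circ> inv h) (h i))"
   by (rule prod.reindex_bij_betw[symmetric, OF h])
  then show "of_int (sign (h \<circ> q \<circ> inv h)) * (\<Prod>i\<in>UNIV. A $ i $ (h \<circ> q \<circ> inv h) i) =
    of_int (sign q) * (\<Prod>i\<in>UNIV. (\<chi> i j. A $ h i $ h j) $ i $ q i)"
   using s q by (simp add: hh)
 qed (auto simp: per per' hh fun_eq_iff)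
qed

text \<open>The Gram matrix is transformed into \<open>transpose A ** G ** A\<close>, whose
  determinant gains the square of that of \<open>A\<close>.\<close>

lemma area_density_compose:
 fixes \<phi> :: "real^'m::finite \<Rightarrow> real^'n::finite" and \<theta> :: "real^'m \<Rightarrow> real^'m"
 assumes \<phi>: "(\<phi> has_derivative D) (at (\<theta> u))" and \<theta>: "(\<theta> has_derivative E) (at u)"
  and \<psi>: "(\<psi> has_derivative (\<lambda>v. D (E v))) (at u)"
 shows "area_density \<psi> u = \<bar>det (matrix E)\<bar> * area_density \<phi> (\<theta> u)"
proof -
 define A where "A = matrix E"
 define G where "G = (\<chi> i j. D (axis i 1) \<bullet> D (axis j 1))"
 have lin: "linear D" "linear E" using \<phi> \<theta> by (auto dest: has_derivative_linear)
 have DE: "D (E (axis i 1)) = (\<Sum>a\<in>UNIV. A $ a $ i *\<^sub>R D (axis a 1))" for i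
 proof -
  have "E (axis i 1) = (\<Sum>a\<in>UNIV. A $ a $ i *\<^sub>R axis a 1)"
   unfolding A_def matrix_def by (simp add: basis_expansion flip: scalar_mult_eq_scaleR)
  then show ?thesis by (simp add: linear_sum[OF lin(1)] linear_cmul[OF lin(1)])
 qed
 have "D (E (axis i 1)) \<bullet> D (E (axis j 1)) = (transpose A ** G ** A) $ i $ j" for i j
  by (simp add: DE inner_sum_left inner_sum_right matrix_matrix_mult_def transpose_def G_def
    sum_distrib_left sum_distrib_right mult_ac)
 then have "(\<chi> i j. D (E (axis i 1)) \<bullet> D (E (axis j 1))) = transpose A ** G ** A"
  by (simp add: vec_eq_iff)
 then have "det (\<chi> i j. D (E (axis i 1)) \<bullet> D (E (axis j 1))) = (det A)\<^sup>2 * det G"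
  by (simp add: det_mul power2_eq_square)
 then show ?thesis
  unfolding area_density_def frechet_derivative_at[OF \<phi>, symmetric] frechet_derivative_at[OF \<psi>, symmetric]
  by (simp add: G_def A_def real_sqrt_mult)
qed

section \<open>Geometry of a chart\<close>

text \<open>A graph chart with orthonormal normals. The assumption \<open>tangent\<close> says that
  the derivative of the chart inverts \<open>coords e\<close> on tangent spaces; it makes the
  coordinate vectors \<open>\<tau> i\<close> and the projections \<open>w i\<close> of the
  \<open>e i\<close> dual frames.\<close>

locale adapted_chart =
 fixes M :: "'n::{finite,linorder} point set" and p :: nat and U and \<rho>
  and e :: "'m::finite \<Rightarrow> 'n point" and V W \<phi>
 assumes sys: "orthonormal_system M p U \<rho>"
  and chart: "graph_chart M e V W \<phi>"
  and VU: "V \<subseteq> U"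
  and tangent: "\<And>u v. u \<in> W \<Longrightarrow> (\<forall>j<p. v \<bullet> grad (\<rho> j) (\<phi> u) = 0) \<Longrightarrow>
    FD \<phi> u (coords e v) = v"
begin

definition \<tau> :: "'m \<Rightarrow> real^'m \<Rightarrow> 'n point" where
 "\<tau> i u = FD \<phi> u (axis i 1)"

definition N :: "'n point \<Rightarrow> 'n point set" where
 "N y = set (normals p \<rho> y)"

text \<open>At points of \<open>M\<close> the projection of \<open>e i\<close> onto the tangent
  space; elsewhere in \<open>U\<close> the formula serves as a smooth extension.\<close>

definition w :: "'m \<Rightarrow> 'n point \<Rightarrow> 'n point" where
 "w i y = e i - (\<Sum>j<p. (e i \<bullet> grad (\<rho> j) y) *\<^sub>R grad (\<rho> j) y)"

lemma openU: "open U" and smooth: "j < p \<Longrightarrow> smooth_on (\<rho> j) U"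
 and MU: "M \<inter> U = {x\<in>U. \<forall>j<p. \<rho> j x = 0}"
 using sys unfolding orthonormal_system_def by auto

lemma openV: "open V" and openW: "open W" and image: "\<phi> ` W = M \<inter> V" and C1: "Ck_on (Suc 0) \<phi> W"
 and coords_\<phi>: "u \<in> W \<Longrightarrow> coords e (\<phi> u) = u"
 using chart unfolding graph_chart_def by auto

lemma \<phi>_in: "u \<in> W \<Longrightarrow> \<phi> u \<in> M" "u \<in> W \<Longrightarrow> \<phi> u \<in> V" "u \<in> W \<Longrightarrow> \<phi> u \<in> U"
 using image VU by auto

lemma coords_in: "y \<in> M \<Longrightarrow> y \<in> V \<Longrightarrow> coords e y \<in> W" "y \<in> M \<Longrightarrow> y \<in> V \<Longrightarrow> \<phi> (coords e y) = y"
 using image coords_\<phi> by (metis IntI imageE)+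

lemma continuous_\<phi>: "continuous_on W \<phi>"
 using C1 by (rule Ck_on_continuous_on)

lemma D\<phi>: "u \<in> W \<Longrightarrow> (\<phi> has_derivative FD \<phi> u) (at u)"
 using C1 by (rule Ck_on_Suc_has_derivative)

lemma linear_D\<phi>: "u \<in> W \<Longrightarrow> linear (FD \<phi> u)"
 using D\<phi> by (rule has_derivative_linear)

lemma D\<phi>_expand: "u \<in> W \<Longrightarrow> FD \<phi> u c = (\<Sum>i\<in>UNIV. c $ i *\<^sub>R \<tau> i u)"
proof -
 assume u: "u \<in> W"
 have "FD \<phi> u c = FD \<phi> u (\<Sum>i\<in>UNIV. c $ i *\<^sub>R axis i 1)"
  by (simp add: basis_expansion flip: scalar_mult_eq_scaleR)
 then show ?thesis
  by (simp add: linear_sum[OF linear_D\<phi>[OF u]] linear_cmul[OF linear_D\<phi>[OF u]] \<tau>_def)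
qed

lemma coords_D\<phi>: "u \<in> W \<Longrightarrow> coords e (FD \<phi> u c) = c"
proof -
 assume u: "u \<in> W"
 have "((\<lambda>u. coords e (\<phi> u)) has_derivative (\<lambda>c. coords e (FD \<phi> u c))) (at u)"
  by (rule bounded_linear.has_derivative[OF bounded_linear_coords D\<phi>[OF u]])
 moreover have "((\<lambda>u. coords e (\<phi> u)) has_derivative (\<lambda>c. c)) (at u)"
  by (rule has_derivative_transform_within_open[OF has_derivative_ident openW u]) (simp add: coords_\<phi>)
 ultimately show ?thesis by (metis has_derivative_unique)
qed

text \<open>The composition with the chart is constantly zero near \<open>u\<close>, so the chain
  rule kills the derivative in all directions in the range of \<open>FD \<phi> u\<close>.\<close>

lemma derivative_along_D\<phi>:
 fixes f :: "'n point \<Rightarrow> 'b::real_normed_vector"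
 assumes u: "u \<in> W" and f: "(f has_derivative f') (at (\<phi> u))"
  and S: "open S" "\<phi> u \<in> S" "\<And>y. y \<in> M \<Longrightarrow> y \<in> S \<Longrightarrow> f y = 0"
 shows "f' (FD \<phi> u c) = 0"
proof -
 have 1: "((\<lambda>u. f (\<phi> u)) has_derivative (\<lambda>c. f' (FD \<phi> u c))) (at u)"
  using diff_chain_at[OF D\<phi>[OF u] f] by (simp add: comp_def)
 have o: "open (W \<inter> \<phi> -` S)" using continuous_\<phi> openW S by (intro continuous_open_preimage) auto
 have "((\<lambda>u. f (\<phi> u)) has_derivative (\<lambda>c. 0)) (at u)"
  by (rule has_derivative_transform_within_open[OF has_derivative_const o, of u 0])
   (use u S \<phi>_in in auto)
 with 1 show ?thesis by (metis has_derivative_unique)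
qed

lemma D\<phi>_tangent:
 assumes u: "u \<in> W" and j: "j < p"
 shows "FD \<phi> u c \<bullet> grad (\<rho> j) (\<phi> u) = 0"
proof -
 have "\<rho> j differentiable (at (\<phi> u))"
  using smooth_on_differentiable[OF smooth[OF j]] \<phi>_in[OF u] by blast
 from derivative_along_D\<phi>[OF u has_derivative_grad[OF this] openU \<phi>_in(3)[OF u], of c]
 show ?thesis using MU j by (auto simp: inner_commute)
qed

lemma \<tau>_tangent: "u \<in> W \<Longrightarrow> j < p \<Longrightarrow> \<tau> i u \<bullet> grad (\<rho> j) (\<phi> u) = 0"
 unfolding \<tau>_def by (rule D\<phi>_tangent)

lemma orthonormal_N: "y \<in> M \<Longrightarrow> y \<in> U \<Longrightarrow> finite (N y)"
 "y \<in> M \<Longrightarrow> y \<in> U \<Longrightarrow> pairwise orthogonal (N y)" "y \<in> M \<Longrightarrow> y \<in> U \<Longrightarrow> \<forall>v\<in>N y. norm v = 1"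
 using orthonormal_system_normals[OF sys, of y] by (auto simp: N_def orthonormal_list_def)

lemma orth_rest_N:
 "y \<in> M \<Longrightarrow> y \<in> U \<Longrightarrow> orth_rest (N y) v = v - (\<Sum>j<p. (v \<bullet> grad (\<rho> j) y) *\<^sub>R grad (\<rho> j) y)"
 using orthonormal_system_inj[OF sys, of y]
 by (simp add: orth_rest_def N_def set_normals sum.reindex)

lemma w_eq: "y \<in> M \<Longrightarrow> y \<in> U \<Longrightarrow> w i y = orth_rest (N y) (e i)"
 by (simp add: w_def orth_rest_N)

lemma orth_rest_N_grad: "y \<in> M \<Longrightarrow> y \<in> U \<Longrightarrow> j < p \<Longrightarrow> orth_rest (N y) v \<bullet> grad (\<rho> j) y = 0"
 by (intro orth_rest_inner orthonormal_N) (auto simp: N_def grad_in_normals)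

lemma w_tangent: "y \<in> M \<Longrightarrow> y \<in> U \<Longrightarrow> j < p \<Longrightarrow> w i y \<bullet> grad (\<rho> j) y = 0"
 by (simp add: w_eq orth_rest_N_grad)

lemma orth_rest_tangent:
 "y \<in> M \<Longrightarrow> y \<in> U \<Longrightarrow> (\<And>j. j < p \<Longrightarrow> v \<bullet> grad (\<rho> j) y = 0) \<Longrightarrow> orth_rest (N y) v = v"
 by (simp add: orth_rest_N)

lemma orth_rest_eq_\<tau>: "u \<in> W \<Longrightarrow> orth_rest (N (\<phi> u)) v = (\<Sum>i\<in>UNIV. (w i (\<phi> u) \<bullet> v) *\<^sub>R \<tau> i u)"
proof -
 assume u: "u \<in> W"
 note y = \<phi>_in(1,3)[OF u]
 let ?r = "orth_rest (N (\<phi> u)) v"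
 have "?r = FD \<phi> u (coords e ?r)"
  using tangent[OF u, of ?r] orth_rest_N_grad[OF y] by simp
 also have "\<dots> = (\<Sum>i\<in>UNIV. (e i \<bullet> ?r) *\<^sub>R \<tau> i u)"
  by (simp add: D\<phi>_expand[OF u] coords_def)
 also have "\<dots> = (\<Sum>i\<in>UNIV. (w i (\<phi> u) \<bullet> v) *\<^sub>R \<tau> i u)"
  by (simp only: w_eq[OF y] orth_rest_adjoint[OF orthonormal_N[OF y]])
 finally show ?thesis .
qed

lemma orth_rest_eq_w: "u \<in> W \<Longrightarrow> orth_rest (N (\<phi> u)) v = (\<Sum>i\<in>UNIV. (\<tau> i u \<bullet> v) *\<^sub>R w i (\<phi> u))"
proof -
 assume u: "u \<in> W"
 note y = \<phi>_in(1,3)[OF u]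
 have "orth_rest (N (\<phi> u)) v \<bullet> z = (\<Sum>i\<in>UNIV. (\<tau> i u \<bullet> v) *\<^sub>R w i (\<phi> u)) \<bullet> z" for z
 proof -
  have "orth_rest (N (\<phi> u)) v \<bullet> z = v \<bullet> (\<Sum>i\<in>UNIV. (w i (\<phi> u) \<bullet> z) *\<^sub>R \<tau> i u)"
   by (subst orth_rest_adjoint[OF orthonormal_N[OF y]]) (simp only: orth_rest_eq_\<tau>[OF u])
  then show ?thesis
   by (simp add: inner_sum_left inner_sum_right inner_commute[of v] mult.commute)
 qed
 then show ?thesis by (subst vector_eq_rdot[symmetric]) blast
qed

lemma tan_trace_eq:
 assumes "u \<in> W" "linear L"
 shows "tan_trace (N (\<phi> u)) L = (\<Sum>i\<in>UNIV. L (w i (\<phi> u)) \<bullet> \<tau> i u)"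
  and "tan_trace (N (\<phi> u)) L = (\<Sum>i\<in>UNIV. L (\<tau> i u) \<bullet> w i (\<phi> u))"
 by (rule tan_trace_dual[OF assms(2) orth_rest_eq_\<tau>[OF assms(1)]],
   rule tan_trace_dual[OF assms(2) orth_rest_eq_w[OF assms(1)]])

lemma w_\<tau>: "u \<in> W \<Longrightarrow> w i (\<phi> u) \<bullet> \<tau> k u = (if i = k then 1 else 0)"
proof -
 assume u: "u \<in> W"
 note y = \<phi>_in(1,3)[OF u]
 have "w i (\<phi> u) \<bullet> \<tau> k u = e i \<bullet> \<tau> k u"
  by (simp only: w_eq[OF y] orth_rest_adjoint[OF orthonormal_N[OF y]]
    orth_rest_tangent[OF y \<tau>_tangent[OF u]])
 also have "\<dots> = coords e (\<tau> k u) $ i" by (simp add: coords_def)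
 also have "\<dots> = axis k 1 $ i" by (simp add: \<tau>_def coords_D\<phi>[OF u])
 finally show ?thesis by (auto simp: axis_def)
qed

definition gram_w :: "'n point \<Rightarrow> real^'m^'m" where
 "gram_w y = (\<chi> i j. w i y \<bullet> w j y)"

definition gram_\<tau> :: "real^'m \<Rightarrow> real^'m^'m" where
 "gram_\<tau> u = (\<chi> i j. \<tau> i u \<bullet> \<tau> j u)"

definition \<kappa> :: "'n point \<Rightarrow> real" where
 "\<kappa> y = det (gram_w y) powr (- 1 / 2)"

lemma sum_gram_w:
 assumes u: "u \<in> W"
 shows "(\<Sum>b\<in>UNIV. (\<tau> b u \<bullet> \<tau> a u) *\<^sub>R w b (\<phi> u)) = \<tau> a u"
proof -
 have "orth_rest (N (\<phi> u)) (\<tau> a u) = \<tau> a u"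
  by (rule orth_rest_tangent[OF \<phi>_in(1,3)[OF u]]) (rule \<tau>_tangent[OF u])
 then show ?thesis by (rule trans[OF orth_rest_eq_w[OF u, symmetric]])
qed

lemma sum_gram_\<tau>:
 assumes u: "u \<in> W"
 shows "(\<Sum>b\<in>UNIV. (w b (\<phi> u) \<bullet> w a (\<phi> u)) *\<^sub>R \<tau> b u) = w a (\<phi> u)"
proof -
 have "orth_rest (N (\<phi> u)) (w a (\<phi> u)) = w a (\<phi> u)"
  by (rule orth_rest_tangent[OF \<phi>_in(1,3)[OF u]]) (rule w_tangent[OF \<phi>_in(1,3)[OF u]])
 then show ?thesis by (rule trans[OF orth_rest_eq_\<tau>[OF u, symmetric]])
qed

text \<open>Dual bases of the same space have mutually inverse Gram matrices: expand
  \<open>w a\<close> in the \<open>\<tau> b\<close> and pair with \<open>\<tau> c\<close>.\<close>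

lemma gram_inverse: "u \<in> W \<Longrightarrow> gram_w (\<phi> u) ** gram_\<tau> u = mat 1"
proof -
 assume u: "u \<in> W"
 have "(\<Sum>b\<in>UNIV. (w a (\<phi> u) \<bullet> w b (\<phi> u)) * (\<tau> b u \<bullet> \<tau> c u)) = (if a = c then 1 else 0)" for a c
 proof -
  have "(\<Sum>b\<in>UNIV. (w b (\<phi> u) \<bullet> w a (\<phi> u)) *\<^sub>R \<tau> b u) \<bullet> \<tau> c u = (if a = c then 1 else 0)"
   by (simp only: sum_gram_\<tau>[OF u] w_\<tau>[OF u])
  then show ?thesis by (simp add: inner_sum_left inner_commute[of "w a (\<phi> u)"])
 qed
 then show ?thesis
  by (simp add: matrix_matrix_mult_def gram_w_def gram_\<tau>_def vec_eq_iff mat_def)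
qed

lemma det_gram: "u \<in> W \<Longrightarrow> det (gram_w (\<phi> u)) * det (gram_\<tau> u) = 1"
 using gram_inverse[of u] by (metis det_mul det_I)

lemma det_gram_pos: "u \<in> W \<Longrightarrow> 0 < det (gram_w (\<phi> u))" "u \<in> W \<Longrightarrow> 0 < det (gram_\<tau> u)"
proof -
 assume u: "u \<in> W"
 have "0 \<le> det (gram_w (\<phi> u))" "0 \<le> det (gram_\<tau> u)"
  unfolding gram_w_def gram_\<tau>_def by (rule det_gram_nonneg)+
 then show "0 < det (gram_w (\<phi> u))" "0 < det (gram_\<tau> u)"
  using det_gram[OF u] by (auto simp: less_le)
qed

lemma area_density_eq: "area_density \<phi> u = sqrt (det (gram_\<tau> u))"
 by (simp add: area_density_def gram_\<tau>_def \<tau>_def)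

lemma area_density_\<kappa>: "u \<in> W \<Longrightarrow> area_density \<phi> u = \<kappa> (\<phi> u)"
proof -
 assume u: "u \<in> W"
 have "det (gram_\<tau> u) = inverse (det (gram_w (\<phi> u)))"
  using det_gram[OF u] by (metis inverse_unique mult.commute inverse_inverse_eq)
 then show ?thesis using det_gram_pos[OF u]
  by (simp add: area_density_eq \<kappa>_def powr_minus powr_half_sqrt real_sqrt_inverse)
qed

lemma area_density_pos: "u \<in> W \<Longrightarrow> 0 < area_density \<phi> u"
 using det_gram_pos by (simp add: area_density_eq)

lemma local_parametrization: "local_parametrization M W \<phi>"
 unfolding local_parametrization_def
proof (intro conjI ballI exI)
 show "open W" "Ck_on 1 \<phi> W" using openW C1 by simp_all
 show "inj (FD \<phi> u)" if "u \<in> W" for u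
  using coords_D\<phi>[OF that] by (metis injI)
 show "homeomorphism W (\<phi> ` W) \<phi> (coords e)"
  unfolding homeomorphism_def
  using coords_\<phi> continuous_\<phi> linear_continuous_on[OF bounded_linear_coords]
  by (auto simp: image_image)
 show "openin (top_of_set M) (\<phi> ` W)"
  unfolding image using openV by (simp add: openin_open_Int)
qed

text \<open>Since the chart has the globally defined linear inverse \<open>coords e\<close>, the
  transition map \<open>\<theta>\<close> is differentiable without a further inverse function
  argument, and \<open>\<psi>\<close> is the chart after \<open>\<theta>\<close>.\<close>

lemma reparametrization:
 fixes \<psi> :: "real^'m \<Rightarrow> 'n point"
 assumes X: "open X" and \<psi>: "Ck_on 1 \<psi> X" and im: "\<psi> ` X \<subseteq> M \<inter> V" and u: "u \<in> X"
 defines "\<theta> \<equiv> \<lambda>u. coords e (\<psi> u)"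
 shows "(\<theta> has_derivative FD \<theta> u) (at u)"
  and "area_density \<psi> u = \<bar>det (matrix (FD \<theta> u))\<bar> * area_density \<phi> (\<theta> u)"
proof -
 have d\<psi>: "(\<psi> has_derivative FD \<psi> u) (at u)"
  using \<psi> u by (simp flip: frechet_derivative_works)
 have "(\<theta> has_derivative (\<lambda>v. coords e (FD \<psi> u v))) (at u)"
  unfolding \<theta>_def by (rule bounded_linear.has_derivative[OF bounded_linear_coords d\<psi>])
 then show d\<theta>: "(\<theta> has_derivative FD \<theta> u) (at u)"
  using frechet_derivative_at by metis
 have \<theta>W: "\<theta> u \<in> W" if "u \<in> X" for u using im that unfolding \<theta>_def by (intro coords_in) auto
 have "((\<lambda>u. \<phi> (\<theta> u)) has_derivative (\<lambda>v. FD \<phi> (\<theta> u) (FD \<theta> u v))) (at u)"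
  using diff_chain_at[OF d\<theta> D\<phi>[OF \<theta>W[OF u]]] by (simp add: comp_def)
 then have "(\<psi> has_derivative (\<lambda>v. FD \<phi> (\<theta> u) (FD \<theta> u v))) (at u)"
 proof (rule has_derivative_transform_within_open[OF _ X u])
  show "\<phi> (\<theta> y) = \<psi> y" if "y \<in> X" for y
   unfolding \<theta>_def using im that by (intro coords_in) auto
 qed
 then show "area_density \<psi> u = \<bar>det (matrix (FD \<theta> u))\<bar> * area_density \<phi> (\<theta> u)"
  by (rule area_density_compose[OF D\<phi>[OF \<theta>W[OF u]] d\<theta>])
qed

lemma smooth_w: "Ck_on k (w i) U"
 unfolding w_def using openU Ck_on_grad[OF openU smooth_onD[OF smooth]]
 by (intro Ck_on_diff Ck_on_sum Ck_on_scaleR Ck_on_inner Ck_on_const) auto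

end

lemma continuous_on_det:
 fixes A :: "'a::topological_space \<Rightarrow> real^'m^'m::finite"
 assumes "\<And>i j. continuous_on S (\<lambda>x. A x $ i $ j)"
 shows "continuous_on S (\<lambda>x. det (A x))"
 unfolding det_def by (intro continuous_intros assms)

lemma continuous_on_area_density:
 fixes \<psi> :: "real^'m::finite \<Rightarrow> real^'n::finite"
 assumes "Ck_on 1 \<psi> X"
 shows "continuous_on X (area_density \<psi>)"
 unfolding area_density_def using assms
 by (intro continuous_on_real_sqrt continuous_on_det) (auto intro!: continuous_intros)

lemma Ck_on_det:
 fixes A :: "'a::real_normed_vector \<Rightarrow> real^'m^'m::finite"
 assumes "open S" "\<And>i j. Ck_on k (\<lambda>x. A x $ i $ j) S"
 shows "Ck_on k (\<lambda>x. det (A x)) S"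
 unfolding det_def by (intro Ck_on_sum Ck_on_mult Ck_on_prod Ck_on_const assms)

section \<open>Change of variables\<close>

text \<open>The library's change of variables theorem needs a well-ordered index type, hence the detour
 through a copy of the index type.\<close>

typedef (overloaded) ('a::finite) wo_copy = "{..<CARD('a)}" morphisms wo_rep wo_abs
 by (rule exI[of _ 0]) simp

instance wo_copy :: (finite) finite
proof
 have "(UNIV :: 'a wo_copy set) = wo_abs ` {..<CARD('a)}"
  by (rule type_definition.univ[OF type_definition_wo_copy])
 then show "finite (UNIV :: 'a wo_copy set)" by (rule ssubst) simp
qed

instantiation wo_copy :: (finite) linorder
begin
definition "x \<le> y \<longleftrightarrow> wo_rep x \<le> wo_rep y"
definition "x < y \<longleftrightarrow> wo_rep x < wo_rep y"
instance
 by standard (auto simp: less_eq_wo_copy_def less_wo_copy_def wo_rep_inject)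
end

instance wo_copy :: (finite) wellorder
proof
 fix P :: "'a wo_copy \<Rightarrow> bool" and a :: "'a wo_copy"
 assume step: "\<And>x. (\<And>y. y < x \<Longrightarrow> P y) \<Longrightarrow> P x"
 show "P a"
  by (induction a rule: measure_induct_rule[where f = wo_rep])
   (rule step, simp add: less_wo_copy_def)
qed

lemma card_wo_copy: "CARD('a::finite wo_copy) = CARD('a)"
 using type_definition.card[OF type_definition_wo_copy[where 'a = 'a]] by simp

definition relabel :: "('k \<Rightarrow> 'm) \<Rightarrow> real^'m \<Rightarrow> real^'k" where
 "relabel h x = (\<chi> k. x $ h k)"

lemma linear_relabel: "linear (relabel (h :: 'k::finite \<Rightarrow> 'm::finite))"
 by (rule linearI) (simp_all add: relabel_def vec_eq_iff)

lemma bounded_linear_relabel: "bounded_linear (relabel (h :: 'k::finite \<Rightarrow> 'm::finite))"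
 using linear_relabel linear_conv_bounded_linear by blast

lemma prod_Basis_vec:
 fixes f :: "real^'m::finite \<Rightarrow> 'b::comm_monoid_mult"
 shows "(\<Prod>b\<in>Basis. f b) = (\<Prod>i\<in>UNIV. f (axis i 1))"
proof -
 have "(Basis :: (real^'m) set) = range (\<lambda>i. axis i 1)" by (auto simp: Basis_vec_def)
 then show ?thesis
  by (rule ssubst) (subst prod.reindex, auto simp: inj_on_def axis_eq_axis)
qed

text \<open>A renaming of coordinates carries boxes to boxes with the same side lengths.\<close>

lemma distr_relabel:
 assumes h: "bij (h :: 'k::finite \<Rightarrow> 'm::finite)"
 shows "distr lborel borel (relabel h) = lborel"
proof (rule lborel_eqI[symmetric])
 fix l u :: "real^'k" assume le: "\<And>b. b \<in> Basis \<Longrightarrow> l \<bullet> b \<le> u \<bullet> b"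
 have hh: "h (inv h x) = x" "inv h (h y) = y" for x y
  using h by (simp_all add: bij_is_surj surj_f_inv_f bij_is_inj)
 have le': "l $ i \<le> u $ i" for i
  using le[of "axis i 1"] by (auto simp: inner_axis Basis_vec_def)
 have vim: "relabel h -` box l u = box (relabel (inv h) l) (relabel (inv h) u)"
  by (auto simp: mem_box_cart relabel_def) (metis hh)+
 have le2: "relabel (inv h) l \<bullet> b \<le> relabel (inv h) u \<bullet> b" if "b \<in> Basis" for b
  using that le' by (auto simp: Basis_vec_def inner_axis relabel_def)
 have m: "relabel h \<in> borel_measurable lborel"
  using linear_continuous_on[OF bounded_linear_relabel[of h], of UNIV]
  by (simp add: borel_measurable_continuous_onI)
 have "emeasure (distr lborel borel (relabel h)) (box l u) =
   emeasure lborel (box (relabel (inv h) l) (relabel (inv h) u))"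
  using m by (subst emeasure_distr) (simp_all add: vim)
 also have "\<dots> = (\<Prod>b\<in>Basis. (relabel (inv h) u - relabel (inv h) l) \<bullet> b)"
  by (rule emeasure_lborel_box[OF le2])
 also have "(\<Prod>b\<in>Basis. (relabel (inv h) u - relabel (inv h) l) \<bullet> b) = (\<Prod>i\<in>UNIV. (u - l) $ inv h i)"
  by (simp add: prod_Basis_vec inner_axis relabel_def)
 also have "\<dots> = (\<Prod>i\<in>UNIV. (u - l) $ i)"
  by (rule prod.reindex_bij_betw[OF bij_imp_bij_inv[OF h]])
 also have "\<dots> = (\<Prod>b\<in>Basis. (u - l) \<bullet> b)"
  by (simp add: prod_Basis_vec inner_axis)
 finally show "emeasure (distr lborel borel (relabel h)) (box l u) = (\<Prod>b\<in>Basis. (u - l) \<bullet> b)" .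
qed simp

text \<open>The known theorem equates integrability and values for absolutely integrable functions.
  For nonnegative functions this also covers infinite integrals, because both sides fail to be
  integrable together.\<close>

lemma nn_integral_change_of_variables_wellorder:
 fixes \<theta> :: "real^'k::{finite,wellorder} \<Rightarrow> real^'k::_" and f :: "real^'k::_ \<Rightarrow> real"
 assumes S: "S \<in> sets borel" and \<theta>S: "\<theta> ` S \<in> sets borel"
  and der: "\<And>x. x \<in> S \<Longrightarrow> (\<theta> has_derivative \<theta>' x) (at x within S)" and inj: "inj_on \<theta> S"
  and f: "f \<in> borel_measurable borel" "\<And>x. 0 \<le> f x"
  and g: "(\<lambda>x. indicator S x * (\<bar>det (matrix (\<theta>' x))\<bar> * f (\<theta> x))) \<in> borel_measurable borel"
 shows "(\<integral>\<^sup>+x. ennreal (indicator (\<theta> ` S) x * f x) \<partial>lborel) =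
  (\<integral>\<^sup>+x. ennreal (indicator S x * (\<bar>det (matrix (\<theta>' x))\<bar> * f (\<theta> x))) \<partial>lborel)"
proof -
 define F where "F x = indicator (\<theta> ` S) x * f x" for x
 define G where "G x = indicator S x * (\<bar>det (matrix (\<theta>' x))\<bar> * f (\<theta> x))" for x
 have F: "F \<in> borel_measurable lborel" "\<And>x. 0 \<le> F x"
  unfolding F_def using \<theta>S f by auto
 have G: "G \<in> borel_measurable lborel" "\<And>x. 0 \<le> G x"
  unfolding G_def using g f by auto
 have "(\<lambda>x. \<bar>det (matrix (\<theta>' x))\<bar> *\<^sub>R (vec (f (\<theta> x)) :: real^1)) absolutely_integrable_on S \<and>
   integral S (\<lambda>x. \<bar>det (matrix (\<theta>' x))\<bar> *\<^sub>R (vec (f (\<theta> x)) :: real^1)) = vec b \<longleftrightarrow>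
   (\<lambda>x. vec (f x) :: real^1) absolutely_integrable_on (\<theta> ` S) \<and>
   integral (\<theta> ` S) (\<lambda>x. vec (f x) :: real^1) = vec b" for b
  using S by (intro has_absolute_integral_change_of_variables der inj) auto
 then have *: "(\<lambda>x. \<bar>det (matrix (\<theta>' x))\<bar> * f (\<theta> x)) absolutely_integrable_on S \<and>
   integral S (\<lambda>x. \<bar>det (matrix (\<theta>' x))\<bar> * f (\<theta> x)) = b \<longleftrightarrow>
   f absolutely_integrable_on (\<theta> ` S) \<and> integral (\<theta> ` S) f = b" for b
  by (simp add: absolutely_integrable_on_1_iff integral_on_1_eq)
 have iF: "f absolutely_integrable_on (\<theta> ` S) \<longleftrightarrow> integrable lborel F"
  unfolding set_integrable_def using integrable_completion[OF F(1)] by (simp add: F_def[abs_def])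
 have iG: "(\<lambda>x. \<bar>det (matrix (\<theta>' x))\<bar> * f (\<theta> x)) absolutely_integrable_on S \<longleftrightarrow> integrable lborel G"
  unfolding set_integrable_def using integrable_completion[OF G(1)] by (simp add: G_def[abs_def])
 have vF: "integral (\<theta> ` S) f = integral\<^sup>L lborel F" if "f absolutely_integrable_on (\<theta> ` S)"
  using set_lebesgue_integral_eq_integral(2)[OF that] integral_completion[OF F(1)]
  by (simp add: set_lebesgue_integral_def F_def[abs_def])
 have vG: "integral S (\<lambda>x. \<bar>det (matrix (\<theta>' x))\<bar> * f (\<theta> x)) = integral\<^sup>L lborel G"
  if "(\<lambda>x. \<bar>det (matrix (\<theta>' x))\<bar> * f (\<theta> x)) absolutely_integrable_on S"
  using set_lebesgue_integral_eq_integral(2)[OF that] integral_completion[OF G(1)]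
  by (simp add: set_lebesgue_integral_def G_def[abs_def])
 have "(\<integral>\<^sup>+x. ennreal (F x) \<partial>lborel) = (\<integral>\<^sup>+x. ennreal (G x) \<partial>lborel)"
 proof (cases "integrable lborel F")
  case True
  then have f: "f absolutely_integrable_on (\<theta> ` S)" using iF by simp
  then have g: "(\<lambda>x. \<bar>det (matrix (\<theta>' x))\<bar> * f (\<theta> x)) absolutely_integrable_on S"
   "integral S (\<lambda>x. \<bar>det (matrix (\<theta>' x))\<bar> * f (\<theta> x)) = integral (\<theta> ` S) f"
   using *[of "integral (\<theta> ` S) f"] by auto
  have "integrable lborel G" "integral\<^sup>L lborel F = integral\<^sup>L lborel G"
   using g iG vF[OF f] vG[OF g(1)] by simp_all
  then show ?thesis using True F(2) G(2) by (simp add: nn_integral_eq_integral)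
 next
  case False
  then have "\<not> integrable lborel G" using *[of "integral S (\<lambda>x. \<bar>det (matrix (\<theta>' x))\<bar> * f (\<theta> x))"] iF iG by simp
  then show ?thesis using False F G
   by (simp add: integrable_iff_bounded less_top[symmetric])
 qed
 then show ?thesis by (simp add: F_def G_def)
qed

lemma nn_integral_change_of_variables:
 fixes \<theta> :: "real^'m::finite \<Rightarrow> real^'m" and f :: "real^'m \<Rightarrow> real"
 assumes S: "S \<in> sets borel" and \<theta>S: "\<theta> ` S \<in> sets borel"
  and der: "\<And>x. x \<in> S \<Longrightarrow> (\<theta> has_derivative \<theta>' x) (at x)" and inj: "inj_on \<theta> S"
  and f: "f \<in> borel_measurable borel" "\<And>x. 0 \<le> f x"
  and g: "(\<lambda>x. indicator S x * (\<bar>det (matrix (\<theta>' x))\<bar> * f (\<theta> x))) \<in> borel_measurable borel"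
 shows "(\<integral>\<^sup>+x. ennreal (indicator (\<theta> ` S) x * f x) \<partial>lborel) =
  (\<integral>\<^sup>+x. ennreal (indicator S x * (\<bar>det (matrix (\<theta>' x))\<bar> * f (\<theta> x))) \<partial>lborel)"
proof -
 obtain h :: "'m wo_copy \<Rightarrow> 'm" where h: "bij h"
  using finite_same_card_bij[of "UNIV :: 'm wo_copy set" "UNIV :: 'm set"] card_wo_copy[where 'a = 'm] by auto
 have hh: "h (inv h x) = x" "inv h (h y) = y" for x y
  using h by (simp_all add: bij_is_surj surj_f_inv_f bij_is_inj)
 define R where "R = relabel h"
 define R' where "R' = relabel (inv h)"
 have RR: "R (R' y) = y" "R' (R x) = x" for x y
  by (simp_all add: R_def R'_def relabel_def hh vec_eq_iff)
 have bl: "bounded_linear R" "bounded_linear R'" by (simp_all add: R_def R'_def bounded_linear_relabel)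
 have mR [measurable]: "R \<in> borel_measurable borel" "R' \<in> borel_measurable borel"
  using linear_continuous_on[OF bl(1), of UNIV] linear_continuous_on[OF bl(2), of UNIV]
  by (simp_all add: borel_measurable_continuous_onI)
 \<comment> \<open>The given map conjugated by the renaming; its derivative has the same determinant
   by \<open>det_reindex\<close>.\<close>
 define T where "T y = R (\<theta> (R' y))" for y
 define T' where "T' y v = R (\<theta>' (R' y) (R' v))" for y v
 have img: "R ` X = R' -` X" for X using RR by (auto simp: image_iff) (metis RR(1))
 have TS: "T ` R ` S = R ` \<theta> ` S" by (simp add: T_def image_image RR)
 have S': "R ` S \<in> sets borel" "T ` R ` S \<in> sets borel"
  unfolding TS unfolding img using measurable_sets[OF mR(2) S] measurable_sets[OF mR(2) \<theta>S] by auto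
 have detT: "det (matrix (T' y)) = det (matrix (\<theta>' (R' y)))" for y
 proof -
  have ax: "R' (axis b 1) = axis (h b) 1" for b
   by (auto simp: R'_def relabel_def vec_eq_iff axis_def hh)
  have "matrix (T' y) = (\<chi> a b. matrix (\<theta>' (R' y)) $ h a $ h b)"
   by (simp add: matrix_def T'_def ax R_def relabel_def vec_eq_iff)
  then show ?thesis using det_reindex[OF h] by simp
 qed
 have derT: "(T has_derivative T' y) (at y within R ` S)" if "y \<in> R ` S" for y
 proof -
  have "R' y \<in> S" using that RR by auto
  from diff_chain_at[OF bounded_linear_imp_has_derivative[OF bl(2)] der[OF this]]
  have "((\<lambda>y. \<theta> (R' y)) has_derivative (\<lambda>v. \<theta>' (R' y) (R' v))) (at y)" by (simp add: comp_def)
  from bounded_linear.has_derivative[OF bl(1) this]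
  have "(T has_derivative T' y) (at y)" by (simp add: T_def[abs_def] T'_def[abs_def])
  then show ?thesis by (rule has_derivative_at_withinI)
 qed
 have injT: "inj_on T (R ` S)"
 proof (rule inj_onI)
  fix x y assume "x \<in> R ` S" "y \<in> R ` S" "T x = T y"
  then have "R' x \<in> S" "R' y \<in> S" "\<theta> (R' x) = \<theta> (R' y)" using RR unfolding T_def by (auto, metis RR(2))
  then show "x = y" using inj_onD[OF inj] RR by metis
 qed
 have ind: "indicator (R ` X) y = (indicator X (R' y) :: real)" for X y
  unfolding img by (simp add: indicator_def)
 have gT: "(\<lambda>y. indicator (R ` S) y * (\<bar>det (matrix (T' y))\<bar> * f (R' (T y)))) =
   (\<lambda>y. (\<lambda>x. indicator S x * (\<bar>det (matrix (\<theta>' x))\<bar> * f (\<theta> x))) (R' y))"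
  unfolding ind detT by (simp add: T_def RR fun_eq_iff)
 have lb: "lborel = distr lborel borel R'"
  unfolding R'_def using distr_relabel[OF bij_imp_bij_inv[OF h]] by simp
 have "(\<integral>\<^sup>+x. ennreal (indicator (\<theta> ` S) x * f x) \<partial>lborel) =
   (\<integral>\<^sup>+y. ennreal (indicator (\<theta> ` S) (R' y) * f (R' y)) \<partial>lborel)"
  using \<theta>S f by (subst lb, subst nn_integral_distr) auto
 also have "\<dots> = (\<integral>\<^sup>+y. ennreal (indicator (T ` R ` S) y * f (R' y)) \<partial>lborel)"
  unfolding TS by (simp add: ind)
 also have "\<dots> = (\<integral>\<^sup>+y. ennreal (indicator (R ` S) y * (\<bar>det (matrix (T' y))\<bar> * f (R' (T y)))) \<partial>lborel)"
 proof (rule nn_integral_change_of_variables_wellorder[OF S' derT injT])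
  show "(\<lambda>y. f (R' y)) \<in> borel_measurable borel" using f by measurable
  show "(\<lambda>y. indicator (R ` S) y * (\<bar>det (matrix (T' y))\<bar> * f (R' (T y)))) \<in> borel_measurable borel"
   unfolding gT by (rule measurable_compose[OF mR(2) g])
 qed (use f in auto)
 also have "\<dots> = (\<integral>\<^sup>+y. ennreal ((\<lambda>x. indicator S x * (\<bar>det (matrix (\<theta>' x))\<bar> * f (\<theta> x))) (R' y)) \<partial>lborel)"
  by (rule nn_integral_cong) (use fun_cong[OF gT] in simp)
 also have "\<dots> = (\<integral>\<^sup>+x. ennreal (indicator S x * (\<bar>det (matrix (\<theta>' x))\<bar> * f (\<theta> x))) \<partial>lborel)"
  using g by (subst lb, subst nn_integral_distr) auto
 finally show ?thesis .
qed

section \<open>Surface measure\<close>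

text \<open>The property under the \<open>THE\<close> in \<open>surface_measure\<close>, named so
  that existence and uniqueness can be stated separately.\<close>

definition is_surface_measure ::
  "'m::finite itself \<Rightarrow> 'n::finite point set \<Rightarrow> 'n point measure \<Rightarrow> bool" where
 "is_surface_measure T M \<mu> \<longleftrightarrow> sets \<mu> = sets borel \<and> emeasure \<mu> (- M) = 0 \<and>
   (\<forall>(U :: (real ^ 'm) set) \<phi> A.
    local_parametrization M U \<phi> \<and> A \<subseteq> U \<and> A \<in> sets borel \<longrightarrow>
    emeasure \<mu> (\<phi> ` A) = (\<integral>\<^sup>+u\<in>A. ennreal (area_density \<phi> u) \<partial>lborel))"

lemma borel_vimage_continuous_on:
 fixes f :: "'a::topological_space \<Rightarrow> 'b::euclidean_space"
 assumes "W \<in> sets borel" "continuous_on W f" "B \<in> sets borel"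
 shows "{u\<in>W. f u \<in> B} \<in> sets borel"
proof -
 have "(\<lambda>x. indicator W x *\<^sub>R f x) \<in> borel_measurable borel"
  using assms by (intro borel_measurable_continuous_on_indicator)
 from measurable_sets[OF this assms(3)] have "(\<lambda>x. indicator W x *\<^sub>R f x) -` B \<inter> W \<in> sets borel"
  using assms(1) by auto
 also have "(\<lambda>x. indicator W x *\<^sub>R f x) -` B \<inter> W = {u\<in>W. f u \<in> B}" by auto
 finally show ?thesis .
qed

text \<open>The image of the whole domain is relatively open in a closed set, hence Borel, and the
  image of \<open>A\<close> is the preimage of \<open>A\<close> under the continuous
  inverse.\<close>

lemma local_parametrization_image_borel:
 fixes M :: "'n::finite point set"
 assumes M: "closed M" and \<psi>: "local_parametrization M X \<psi>" and A: "A \<subseteq> X" "A \<in> sets borel"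
 shows "\<psi> ` A \<in> sets borel"
proof -
 obtain g where g: "homeomorphism X (\<psi> ` X) \<psi> g"
  using \<psi> unfolding local_parametrization_def by blast
 have "openin (top_of_set M) (\<psi> ` X)" using \<psi> by (simp add: local_parametrization_def)
 then obtain S where S: "open S" "\<psi> ` X = M \<inter> S" unfolding openin_open by blast
 have "\<psi> ` X \<in> sets borel" unfolding S(2) using S(1) M by (intro sets.Int) auto
 moreover have "continuous_on (\<psi> ` X) g" using g by (simp add: homeomorphism_def)
 ultimately have "{y\<in>\<psi> ` X. g y \<in> A} \<in> sets borel" using A by (intro borel_vimage_continuous_on)
 also have "{y\<in>\<psi> ` X. g y \<in> A} = \<psi> ` A"
  using A g unfolding homeomorphism_def by auto
 finally show ?thesis .
qed

lemma local_parametrization_inj: "local_parametrization M X \<psi> \<Longrightarrow> inj_on \<psi> X"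
 unfolding local_parametrization_def homeomorphism_def by (metis inj_on_inverseI)

lemma local_parametrization_subset: "local_parametrization M X \<psi> \<Longrightarrow> \<psi> ` X \<subseteq> M"
 unfolding local_parametrization_def by (metis openin_imp_subset)

lemma local_parametrization_Ck: "local_parametrization M X \<psi> \<Longrightarrow> Ck_on 1 \<psi> X"
 "local_parametrization M X \<psi> \<Longrightarrow> open X"
 unfolding local_parametrization_def by blast+

lemma area_density_nonneg: "0 \<le> area_density \<phi> u"
 by (simp add: area_density_def det_gram_nonneg)

text \<open>Finitely many adapted charts. The closed balls inside the chart domains make continuous
  functions of the parameter bounded on the parts that are used; the open balls already cover
  \<open>M\<close>.\<close>

locale surface_atlas =
 fixes M :: "'n::{finite,linorder} point set" and L :: nat and p :: nat and U :: "nat \<Rightarrow> 'n point set"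
  and \<rho> and e :: "nat \<Rightarrow> 'm::finite \<Rightarrow> 'n point" and V W \<phi> and c :: "nat \<Rightarrow> real^'m" and r :: "nat \<Rightarrow> real"
 assumes compactM: "compact M"
  and adapted: "i < L \<Longrightarrow> adapted_chart M p (U i) (\<rho> i) (e i) (V i) (W i) (\<phi> i)"
  and ball: "i < L \<Longrightarrow> cball (c i) (r i) \<subseteq> W i"
  and cover: "M \<subseteq> (\<Union>i<L. \<phi> i ` ball (c i) (r i))"
begin

definition domain :: "nat \<Rightarrow> 'n point set" where
 "domain i = {y\<in>V i. coords (e i) y \<in> ball (c i) (r i)}"

text \<open>The usual disjointification, made with ambient Borel sets so that the same pieces can be
  intersected with images of other parametrizations.\<close>

definition piece :: "nat \<Rightarrow> 'n point set" where
 "piece i = domain i - (\<Union>j<i. domain j)"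

definition A :: "nat \<Rightarrow> (real^'m) set" where
 "A i = {u\<in>W i. \<phi> i u \<in> piece i}"

lemma closedM: "closed M" using compactM by (rule compact_imp_closed)

lemma open_domain: "i < L \<Longrightarrow> open (domain i)"
proof -
 assume i: "i < L"
 have "domain i = V i \<inter> coords (e i) -` ball (c i) (r i)" by (auto simp: domain_def)
 then show ?thesis
  using adapted_chart.openV[OF adapted[OF i]] linear_continuous_on[OF bounded_linear_coords[of "e i"]]
  by (simp add: continuous_open_preimage)
qed

lemma piece_borel: "i < L \<Longrightarrow> piece i \<in> sets borel"
 unfolding piece_def using open_domain by (intro sets.Diff sets.finite_UN) auto

lemma piece_disjoint: "i \<noteq> j \<Longrightarrow> piece i \<inter> piece j = {}"
 unfolding piece_def using linorder_neq_iff[of i j] by auto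

lemma piece_V: "piece i \<subseteq> V i"
 by (auto simp: piece_def domain_def)

lemma cover_piece: "y \<in> M \<Longrightarrow> \<exists>i<L. y \<in> piece i"
proof -
 assume y: "y \<in> M"
 have "\<exists>i. i < L \<and> y \<in> domain i"
 proof -
  obtain i u where i: "i < L" "u \<in> ball (c i) (r i)" "y = \<phi> i u" using cover y by blast
  then have "u \<in> W i" using ball[OF i(1)] ball_subset_cball by blast
  then show ?thesis
   using i adapted_chart.\<phi>_in(2)[OF adapted[OF i(1)]] adapted_chart.coords_\<phi>[OF adapted[OF i(1)]]
   by (auto simp: domain_def)
 qed
 then obtain i where i: "i < L \<and> y \<in> domain i" "\<And>j. j < i \<Longrightarrow> \<not> (j < L \<and> y \<in> domain j)"
  using exists_least_iff[of "\<lambda>i. i < L \<and> y \<in> domain i"] by blast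
 then have "y \<in> piece i" by (auto simp: piece_def)
 then show ?thesis using i by blast
qed

lemma A_borel: "i < L \<Longrightarrow> A i \<in> sets borel"
 unfolding A_def using adapted_chart.openW[OF adapted] adapted_chart.continuous_\<phi>[OF adapted] piece_borel
 by (intro borel_vimage_continuous_on) auto

lemma A_ball: "i < L \<Longrightarrow> A i \<subseteq> ball (c i) (r i)"
proof
 fix u assume i: "i < L" and u: "u \<in> A i"
 then have "coords (e i) (\<phi> i u) \<in> ball (c i) (r i)" "u \<in> W i"
  by (auto simp: A_def piece_def domain_def)
 then show "u \<in> ball (c i) (r i)" by (simp only: adapted_chart.coords_\<phi>[OF adapted[OF i]])
qed

lemma A_W: "A i \<subseteq> W i" by (auto simp: A_def)

lemma A_cball: "i < L \<Longrightarrow> A i \<subseteq> cball (c i) (r i)"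
 using A_ball ball_subset_cball by blast

lemma image_A: "i < L \<Longrightarrow> \<phi> i ` A i = M \<inter> piece i"
proof -
 assume i: "i < L"
 have "\<phi> i ` A i = \<phi> i ` W i \<inter> piece i" by (auto simp: A_def)
 also have "\<dots> = M \<inter> piece i"
  unfolding adapted_chart.image[OF adapted[OF i]] using piece_V[of i] by blast
 finally show ?thesis .
qed

lemma image_A_disjoint: "i < L \<Longrightarrow> j < L \<Longrightarrow> i \<noteq> j \<Longrightarrow> \<phi> i ` A i \<inter> \<phi> j ` A j = {}"
 using image_A[of i] image_A[of j] piece_disjoint[of i j] by blast

lemma union_image_A: "(\<Union>i<L. \<phi> i ` A i) = M"
proof -
 have "(\<Union>i<L. \<phi> i ` A i) = (\<Union>i<L. M \<inter> piece i)" using image_A by simp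
 also have "\<dots> = M" using cover_piece by blast
 finally show ?thesis .
qed

text \<open>The weighted Lebesgue measure on the i-th parameter piece, pushed forward. Multiplying
  the chart by the indicator of \<open>W i\<close> makes it Borel on the whole space; the density
  vanishes outside \<open>A i\<close>.\<close>

definition part :: "nat \<Rightarrow> 'n point measure" where
 "part i = distr (density lborel (\<lambda>u. ennreal (indicator (A i) u * area_density (\<phi> i) u))) borel
   (\<lambda>u. indicator (W i) u *\<^sub>R \<phi> i u)"

lemma measurable_\<phi>: "i < L \<Longrightarrow> (\<lambda>u. indicator (W i) u *\<^sub>R \<phi> i u) \<in> borel_measurable borel"
 using adapted_chart.openW[OF adapted] adapted_chart.continuous_\<phi>[OF adapted]
 by (intro borel_measurable_continuous_on_indicator) auto

lemma measurable_W_density: "i < L \<Longrightarrow> (\<lambda>u. indicator (W i) u * area_density (\<phi> i) u) \<in> borel_measurable borel"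
 using borel_measurable_continuous_on_indicator[of "W i" "area_density (\<phi> i)"]
  adapted_chart.openW[OF adapted, of i] continuous_on_area_density[of "\<phi> i" "W i"] adapted_chart.C1[OF adapted, of i]
 by simp

lemma measurable_density: "i < L \<Longrightarrow> (\<lambda>u. indicator (A i) u * area_density (\<phi> i) u) \<in> borel_measurable borel"
proof -
 assume i: "i < L"
 have "(\<lambda>u. indicator (A i) u * (indicator (W i) u * area_density (\<phi> i) u)) \<in> borel_measurable borel"
  by (rule borel_measurable_times[OF borel_measurable_indicator[OF A_borel[OF i]] measurable_W_density[OF i]])
 also have "(\<lambda>u. indicator (A i) u * (indicator (W i) u * area_density (\<phi> i) u)) =
   (\<lambda>u. indicator (A i) u * area_density (\<phi> i) u)"
  using A_W[of i] by (auto simp: indicator_def fun_eq_iff)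
 finally show ?thesis .
qed

lemma sets_part [simp]: "sets (part i) = sets borel"
 by (simp add: part_def)

lemma emeasure_part:
 assumes i: "i < L" and B: "B \<in> sets borel"
 shows "emeasure (part i) B =
  (\<integral>\<^sup>+u. ennreal (indicator {u\<in>W i. \<phi> i u \<in> piece i \<inter> B} u * area_density (\<phi> i) u) \<partial>lborel)"
proof -
 have m: "(\<lambda>u. indicator (W i) u *\<^sub>R \<phi> i u) \<in> borel_measurable borel" by (rule measurable_\<phi>[OF i])
 have vB: "(\<lambda>u. indicator (W i) u *\<^sub>R \<phi> i u) -` B \<in> sets borel"
  using measurable_sets[OF m B] by simp
 have "emeasure (part i) B = emeasure (density lborel (\<lambda>u. ennreal (indicator (A i) u * area_density (\<phi> i) u)))
   ((\<lambda>u. indicator (W i) u *\<^sub>R \<phi> i u) -` B)"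
  unfolding part_def using m B by (subst emeasure_distr) auto
 also have "\<dots> = (\<integral>\<^sup>+u. ennreal (indicator (A i) u * area_density (\<phi> i) u) *
   indicator ((\<lambda>u. indicator (W i) u *\<^sub>R \<phi> i u) -` B) u \<partial>lborel)"
  using measurable_density[OF i] vB by (subst emeasure_density) auto
 also have "\<dots> = (\<integral>\<^sup>+u. ennreal (indicator {u\<in>W i. \<phi> i u \<in> piece i \<inter> B} u * area_density (\<phi> i) u) \<partial>lborel)"
  by (rule nn_integral_cong) (auto simp: A_def indicator_def)
 finally show ?thesis .
qed

definition measure :: "'n point measure" where
 "measure = measure_of UNIV (sets borel) (\<lambda>B. \<Sum>i<L. emeasure (part i) B)"

lemma sets_measure: "sets measure = sets borel"
proof -
 have "sigma_sets UNIV (sets borel) = (sets borel :: 'n point set set)"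
  using sets.sigma_sets_eq[of "borel :: 'n point measure"] by simp
 then show ?thesis by (simp add: measure_def)
qed

lemma emeasure_measure: "B \<in> sets borel \<Longrightarrow> emeasure measure B = (\<Sum>i<L. emeasure (part i) B)"
 unfolding measure_def
proof (rule emeasure_measure_of_sigma)
 show "sigma_algebra UNIV (sets (borel :: 'n point measure))"
  using sets.sigma_algebra_axioms[of "borel :: 'n point measure"] by simp
 show "positive (sets borel) (\<lambda>B. \<Sum>i<L. emeasure (part i) B)" by (simp add: positive_def)
 show "countably_additive (sets borel) (\<lambda>B. \<Sum>i<L. emeasure (part i) B)"
 proof (rule countably_additiveI)
  fix B :: "nat \<Rightarrow> 'n point set"
  assume B: "range B \<subseteq> sets borel" "disjoint_family B"
  have "(\<Sum>k. \<Sum>i<L. emeasure (part i) (B k)) = (\<Sum>i<L. \<Sum>k. emeasure (part i) (B k))"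
   by (rule suminf_sum) simp
  also have "\<dots> = (\<Sum>i<L. emeasure (part i) (\<Union>k. B k))"
   using B by (intro sum.cong refl suminf_emeasure) auto
  finally show "(\<Sum>k. \<Sum>i<L. emeasure (part i) (B k)) = (\<Sum>i<L. emeasure (part i) (\<Union>k. B k))" .
 qed
qed simp

text \<open>An arbitrary parametrization is compared with the i-th chart through the transition map:
  \<open>reparametrization\<close> gives the density and the change of variables formula the
  integral.\<close>

lemma part_parametrization:
 fixes \<psi> :: "real^'m \<Rightarrow> 'n point"
 assumes i: "i < L" and \<psi>: "local_parametrization M X \<psi>" and B: "B \<subseteq> X" "B \<in> sets borel"
 shows "emeasure (part i) (\<psi> ` B) =
  (\<integral>\<^sup>+x. ennreal (indicator {x\<in>B. \<psi> x \<in> piece i} x * area_density \<psi> x) \<partial>lborel)"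
proof -
 interpret adapted_chart M p "U i" "\<rho> i" "e i" "V i" "W i" "\<phi> i" by (rule adapted[OF i])
 note X = local_parametrization_Ck[OF \<psi>]
 have sub: "\<psi> ` X \<subseteq> M" by (rule local_parametrization_subset[OF \<psi>])
 have cont: "continuous_on X \<psi>" using X(1) by (rule Ck_on_continuous_on)
 \<comment> \<open>The part of the domain whose image lies in the i-th chart, where the transition
   map is defined.\<close>
 define X' where "X' = X \<inter> \<psi> -` V i"
 have X': "open X'" "X' \<subseteq> X" "\<psi> ` X' \<subseteq> M \<inter> V i"
  unfolding X'_def using cont X openV sub by (auto intro: continuous_open_preimage)
 have C1': "Ck_on 1 \<psi> X'" using X(1) X'(2) by (rule Ck_on_subset)
 define \<theta> where "\<theta> x = coords (e i) (\<psi> x)" for x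
 define B' where "B' = {x\<in>B. \<psi> x \<in> piece i}"
 have B'X: "B' \<subseteq> X'" using B piece_V[of i] by (auto simp: B'_def X'_def)
 have "B' \<in> sets borel"
 proof -
  have "{x\<in>X. \<psi> x \<in> piece i} \<in> sets borel"
   using X cont piece_borel[OF i] by (intro borel_vimage_continuous_on) auto
  moreover have "B' = B \<inter> {x\<in>X. \<psi> x \<in> piece i}" using B by (auto simp: B'_def)
  ultimately show ?thesis using B by auto
 qed
 have \<phi>\<theta>: "\<theta> x \<in> W i" "\<phi> i (\<theta> x) = \<psi> x" if "x \<in> X'" for x
  using coords_in[of "\<psi> x"] X'(3) that by (auto simp: \<theta>_def)
 have img: "\<theta> ` B' = {u\<in>W i. \<phi> i u \<in> piece i \<inter> \<psi> ` B}"
 proof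
  show "\<theta> ` B' \<subseteq> {u\<in>W i. \<phi> i u \<in> piece i \<inter> \<psi> ` B}" using \<phi>\<theta> B'X by (auto simp: B'_def)
  show "{u\<in>W i. \<phi> i u \<in> piece i \<inter> \<psi> ` B} \<subseteq> \<theta> ` B'"
  proof
   fix u assume "u \<in> {u\<in>W i. \<phi> i u \<in> piece i \<inter> \<psi> ` B}"
   then obtain x where x: "u \<in> W i" "\<phi> i u \<in> piece i" "x \<in> B" "\<phi> i u = \<psi> x" by auto
   then have "\<theta> x = u" using coords_\<phi>[OF x(1)] by (simp add: \<theta>_def)
   then show "u \<in> \<theta> ` B'" using x by (auto simp: B'_def)
  qed
 qed
 have imB: "\<psi> ` B \<in> sets borel" by (rule local_parametrization_image_borel[OF closedM \<psi> B])
 have mimg: "\<theta> ` B' \<in> sets borel"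
  unfolding img using openW continuous_\<phi> piece_borel[OF i] imB by (intro borel_vimage_continuous_on) auto
 have inj: "inj_on \<theta> B'"
 proof (rule inj_onI)
  fix x y assume xy: "x \<in> B'" "y \<in> B'" "\<theta> x = \<theta> y"
  have "\<psi> x = \<phi> i (\<theta> x)" "\<psi> y = \<phi> i (\<theta> y)"
   using \<phi>\<theta>(2) B'X xy(1,2) by (metis subsetD)+
  then have "\<psi> x = \<psi> y" using xy(3) by metis
  then show "x = y" using local_parametrization_inj[OF \<psi>] xy B by (auto simp: B'_def dest: inj_onD)
 qed
 have rep: "(\<theta> has_derivative FD \<theta> x) (at x)"
  "area_density \<psi> x = \<bar>det (matrix (FD \<theta> x))\<bar> * area_density (\<phi> i) (\<theta> x)" if "x \<in> B'" for x
  using reparametrization[OF X'(1) C1' X'(3), of x] B'X that by (auto simp: \<theta>_def[abs_def])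
 have dens: "indicator B' x * (\<bar>det (matrix (FD \<theta> x))\<bar> * (indicator (W i) (\<theta> x) * area_density (\<phi> i) (\<theta> x)))
   = indicator B' x * area_density \<psi> x" for x
  using rep(2)[of x] \<phi>\<theta>(1)[of x] B'X by (auto simp: indicator_def)
 have mdens: "(\<lambda>x. indicator B' x * area_density \<psi> x) \<in> borel_measurable borel"
  using borel_measurable_continuous_on_indicator[OF \<open>B' \<in> sets borel\<close>, of "area_density \<psi>"]
   continuous_on_subset[OF continuous_on_area_density[OF C1'] B'X] by simp
 have "emeasure (part i) (\<psi> ` B) = (\<integral>\<^sup>+u. ennreal (indicator (\<theta> ` B') u * (indicator (W i) u * area_density (\<phi> i) u)) \<partial>lborel)"
  unfolding emeasure_part[OF i imB] img
  by (rule nn_integral_cong) (auto simp: indicator_def)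
 also have "\<dots> = (\<integral>\<^sup>+x. ennreal (indicator B' x *
   (\<bar>det (matrix (FD \<theta> x))\<bar> * (indicator (W i) (\<theta> x) * area_density (\<phi> i) (\<theta> x)))) \<partial>lborel)"
  by (rule nn_integral_change_of_variables[OF \<open>B' \<in> sets borel\<close> mimg rep(1) inj measurable_W_density[OF i]])
   (auto simp: dens mdens intro!: mult_nonneg_nonneg area_density_nonneg)
 finally have "emeasure (part i) (\<psi> ` B) = (\<integral>\<^sup>+x. ennreal (indicator B' x * area_density \<psi> x) \<partial>lborel)"
  by (simp only: dens)
 then show ?thesis unfolding B'_def .
qed

text \<open>Summing over the pieces restores the full area integral, because each point of
  \<open>M\<close> lies in exactly one piece.\<close>

lemma is_surface_measure_measure: "is_surface_measure TYPE('m) M measure"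
 unfolding is_surface_measure_def
proof (intro conjI allI impI)
 show "sets measure = sets borel" by (rule sets_measure)
 have "- M \<in> sets borel" using closedM by auto
 moreover have "emeasure (part i) (- M) = 0" if i: "i < L" for i
 proof -
  have "{u\<in>W i. \<phi> i u \<in> piece i \<inter> - M} = {}" using adapted_chart.\<phi>_in[OF adapted[OF i]] by auto
  then show ?thesis unfolding emeasure_part[OF i \<open>- M \<in> sets borel\<close>] by simp
 qed
 ultimately show "emeasure measure (- M) = 0" by (simp add: emeasure_measure)
next
 fix X :: "(real^'m) set" and \<psi> B
 assume *: "local_parametrization M X \<psi> \<and> B \<subseteq> X \<and> B \<in> sets borel"
 then have \<psi>: "local_parametrization M X \<psi>" and B: "B \<subseteq> X" "B \<in> sets borel" by auto
 note X = local_parametrization_Ck[OF \<psi>]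
 have cont: "continuous_on X \<psi>" using X(1) by (rule Ck_on_continuous_on)
 have sub: "\<psi> ` X \<subseteq> M" by (rule local_parametrization_subset[OF \<psi>])
 have m: "(\<lambda>x. indicator {x\<in>B. \<psi> x \<in> piece i} x * area_density \<psi> x) \<in> borel_measurable borel" if i: "i < L" for i
 proof -
  have "{x\<in>X. \<psi> x \<in> piece i} \<in> sets borel"
   using X cont piece_borel[OF i] by (intro borel_vimage_continuous_on) auto
  moreover have "{x\<in>B. \<psi> x \<in> piece i} = B \<inter> {x\<in>X. \<psi> x \<in> piece i}" using B by auto
  ultimately have "{x\<in>B. \<psi> x \<in> piece i} \<in> sets borel" using B by auto
  moreover have "continuous_on {x\<in>B. \<psi> x \<in> piece i} (area_density \<psi>)"
   using B by (intro continuous_on_subset[OF continuous_on_area_density[OF X(1)]]) auto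
  ultimately show ?thesis
   using borel_measurable_continuous_on_indicator[of "{x\<in>B. \<psi> x \<in> piece i}" "area_density \<psi>"] by simp
 qed
 have "emeasure measure (\<psi> ` B) = (\<Sum>i<L. \<integral>\<^sup>+x. ennreal (indicator {x\<in>B. \<psi> x \<in> piece i} x * area_density \<psi> x) \<partial>lborel)"
  using local_parametrization_image_borel[OF closedM \<psi> B] part_parametrization[OF _ \<psi> B]
  by (simp add: emeasure_measure)
 also have "\<dots> = (\<integral>\<^sup>+x. (\<Sum>i<L. ennreal (indicator {x\<in>B. \<psi> x \<in> piece i} x * area_density \<psi> x)) \<partial>lborel)"
  using m by (intro nn_integral_sum[symmetric]) auto
 also have "\<dots> = (\<integral>\<^sup>+x\<in>B. ennreal (area_density \<psi> x) \<partial>lborel)"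
 proof (rule nn_integral_cong)
  fix x
  show "(\<Sum>i<L. ennreal (indicator {x\<in>B. \<psi> x \<in> piece i} x * area_density \<psi> x)) =
    ennreal (area_density \<psi> x) * indicator B x"
  proof (cases "x \<in> B")
   case True
   then have "\<psi> x \<in> M" using sub B(1) by blast
   then obtain k where k: "k < L" "\<psi> x \<in> piece k" using cover_piece by blast
   have "(\<Sum>i<L. ennreal (indicator {x\<in>B. \<psi> x \<in> piece i} x * area_density \<psi> x)) =
     (\<Sum>i<L. if i = k then ennreal (area_density \<psi> x) else 0)"
   proof (intro sum.cong refl)
    fix i
    have "\<psi> x \<in> piece i \<longleftrightarrow> i = k" using k piece_disjoint[of i k] by auto
    then show "ennreal (indicator {x\<in>B. \<psi> x \<in> piece i} x * area_density \<psi> x) =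
      (if i = k then ennreal (area_density \<psi> x) else 0)"
     using True by (cases "i = k") auto
   qed
   then show ?thesis using k True by simp
  qed simp
 qed
 finally show "emeasure measure (\<psi> ` B) = (\<integral>\<^sup>+x\<in>B. ennreal (area_density \<psi> x) \<partial>lborel)" .
qed

text \<open>On each piece the measure is prescribed by the chart, the pieces exhaust
  \<open>M\<close>, and the complement of \<open>M\<close> is null.\<close>

lemma surface_measure_unique:
 assumes \<nu>: "is_surface_measure TYPE('m) M \<nu>"
 shows "\<nu> = measure"
proof (rule measure_eqI)
 have s: "sets \<nu> = sets borel" using \<nu> by (simp add: is_surface_measure_def)
 then show "sets \<nu> = sets measure" by (simp add: sets_measure)
 fix B assume "B \<in> sets \<nu>"
 then have B: "B \<in> sets borel" using s by simp
 have M: "M \<in> sets borel" using closedM by auto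
 have eq: "emeasure \<nu> (M \<inter> piece i \<inter> B) = emeasure (part i) B" if i: "i < L" for i
 proof -
  interpret adapted_chart M p "U i" "\<rho> i" "e i" "V i" "W i" "\<phi> i" by (rule adapted[OF i])
  define C where "C = {u\<in>W i. \<phi> i u \<in> piece i \<inter> B}"
  have C: "C \<in> sets borel"
   unfolding C_def using openW continuous_\<phi> piece_borel[OF i] B by (intro borel_vimage_continuous_on) auto
  have "\<phi> i ` C = \<phi> i ` W i \<inter> (piece i \<inter> B)" by (auto simp: C_def)
  also have "\<dots> = M \<inter> piece i \<inter> B" unfolding image using piece_V[of i] by blast
  finally have im: "\<phi> i ` C = M \<inter> piece i \<inter> B" .
  have "C \<subseteq> W i" by (auto simp: C_def)
  then have "emeasure \<nu> (\<phi> i ` C) = (\<integral>\<^sup>+u\<in>C. ennreal (area_density (\<phi> i) u) \<partial>lborel)"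
   using \<nu>[unfolded is_surface_measure_def] local_parametrization C by blast
  then have "emeasure \<nu> (M \<inter> piece i \<inter> B) = (\<integral>\<^sup>+u\<in>C. ennreal (area_density (\<phi> i) u) \<partial>lborel)"
   by (simp only: im)
  also have "\<dots> = emeasure (part i) B"
   unfolding emeasure_part[OF i B] C_def by (rule nn_integral_cong) (auto simp: indicator_def)
  finally show ?thesis .
 qed
 have "emeasure \<nu> B = emeasure \<nu> (B \<inter> M)"
 proof -
  have "emeasure \<nu> (B - M) \<le> emeasure \<nu> (- M)"
   using M s by (intro emeasure_mono) auto
  then have "emeasure \<nu> (B - M) = 0" using \<nu> by (simp add: is_surface_measure_def)
  moreover have "emeasure \<nu> (B \<inter> M) + emeasure \<nu> (B - M) = emeasure \<nu> (B \<inter> M \<union> (B - M))"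
   using B M s by (intro plus_emeasure) auto
  moreover have "B \<inter> M \<union> (B - M) = B" by blast
  ultimately show ?thesis by simp
 qed
 also have "B \<inter> M = (\<Union>i<L. M \<inter> piece i \<inter> B)" using cover_piece by blast
 also have "emeasure \<nu> \<dots> = (\<Sum>i<L. emeasure \<nu> (M \<inter> piece i \<inter> B))"
 proof (rule sum_emeasure[symmetric])
  show "disjoint_family_on (\<lambda>i. M \<inter> piece i \<inter> B) {..<L}"
   unfolding disjoint_family_on_def using piece_disjoint by blast
 qed (use M B s piece_borel in auto)
 also have "\<dots> = emeasure measure B" using eq B by (simp add: emeasure_measure)
 finally show "emeasure \<nu> B = emeasure measure B" .
qed

lemma surface_measure_eq: "surface_measure TYPE('m) M = measure"
 unfolding surface_measure_def is_surface_measure_def[of "TYPE('m)", symmetric]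
 using is_surface_measure_measure surface_measure_unique by (rule the_equality)

end

text \<open>Each point has an adapted chart and a closed ball around its parameter; compactness
  keeps finitely many. All data of a chart are packed into one tuple \<open>a x\<close> so that they
  are chosen simultaneously.\<close>

lemma surface_atlas_exists:
 fixes M :: "'n::{finite,linorder} point set"
 assumes sub: "submanifold CARD('m::finite) M" and comp: "compact M"
 obtains L U \<rho> and e :: "nat \<Rightarrow> 'm::finite \<Rightarrow> 'n point" and V W \<phi> c r where
  "surface_atlas M L (CARD('n) - CARD('m)) U \<rho> e V W \<phi> c r"
proof -
 define p where "p = CARD('n) - CARD('m)"
 have dim: "p + CARD('m) = CARD('n)" using sub by (simp add: p_def submanifold_def)
 define Q where "Q x (a :: 'n point set \<times> (nat \<Rightarrow> 'n point \<Rightarrow> real) \<times> ('m \<Rightarrow> 'n point) \<times> 'n point set \<times>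
   (real^'m) set \<times> (real^'m \<Rightarrow> 'n point) \<times> (real^'m) \<times> real) \<longleftrightarrow>
   (case a of (U, \<rho>, e, V, W, \<phi>, c, r) \<Rightarrow> adapted_chart M p U \<rho> e V W \<phi> \<and>
     cball c r \<subseteq> W \<and> x \<in> \<phi> ` ball c r)" for x a
 have ex: "\<exists>a. Q x a" if x: "x \<in> M" for x
 proof -
  obtain U where U: "x \<in> U" "orthonormal_system M p U (normal_system CARD('m) M x)"
   using normal_system_orthonormal[OF sub x] unfolding p_def by blast
  obtain e :: "'m \<Rightarrow> 'n point" and V W \<phi> where
   ch: "graph_chart M e V W \<phi>" "x \<in> V" "V \<subseteq> U"
   "\<And>u v. u \<in> W \<Longrightarrow> (\<forall>j<p. v \<bullet> grad (normal_system CARD('m) M x j) (\<phi> u) = 0) \<Longrightarrow>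
    FD \<phi> u (coords e v) = v"
   using graph_chart_exists[OF U(2) x U(1) dim] by blast
  have ad: "adapted_chart M p U (normal_system CARD('m) M x) e V W \<phi>"
   by (rule adapted_chart.intro) (use U ch in auto)
  have c: "coords e x \<in> W" "\<phi> (coords e x) = x" using adapted_chart.coords_in[OF ad x ch(2)] by auto
  obtain r where "0 < r" "cball (coords e x) r \<subseteq> W"
   using adapted_chart.openW[OF ad] c(1) open_contains_cball by blast
  then have "Q x (U, normal_system CARD('m) M x, e, V, W, \<phi>, coords e x, r)"
   using ad c unfolding Q_def by (auto intro!: image_eqI[of x \<phi> "coords e x"])
  then show ?thesis by blast
 qed
 then obtain a where a: "\<And>x. x \<in> M \<Longrightarrow> Q x (a x)" by metis
 \<comment> \<open>An ambient open neighbourhood of \<open>x\<close> that meets \<open>M\<close>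
   exactly in the image of the open ball.\<close>
 define D where "D x = (case a x of (U, \<rho>, e, V, W, \<phi>, c, r) \<Rightarrow> {y\<in>V. coords e y \<in> ball c r})" for x
 have D: "open (D x)" "x \<in> D x" "\<And>y. y \<in> M \<Longrightarrow> y \<in> D x \<Longrightarrow> Q y (a x)" if x: "x \<in> M" for x
 proof -
  obtain U \<rho> e V W \<phi> c r where ax: "a x = (U, \<rho>, e, V, W, \<phi>, c, r)" by (cases "a x") auto
  have ad: "adapted_chart M p U \<rho> e V W \<phi>" and b: "cball c r \<subseteq> W" "x \<in> \<phi> ` ball c r"
   using a[OF x] by (auto simp: Q_def ax)
  interpret adapted_chart M p U \<rho> e V W \<phi> by (rule ad)
  have "D x = V \<inter> coords e -` ball c r" by (auto simp: D_def ax)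
  then show "open (D x)" using openV linear_continuous_on[OF bounded_linear_coords[of e]]
   by (simp add: continuous_open_preimage)
  obtain u where u: "u \<in> ball c r" "x = \<phi> u" using b(2) by blast
  have "u \<in> W" using u(1) b(1) ball_subset_cball by blast
  then have "x \<in> V" "coords e x \<in> ball c r" using u \<phi>_in(2) coords_\<phi> by simp_all
  then show "x \<in> D x" by (simp add: D_def ax)
  fix y assume y: "y \<in> M" "y \<in> D x"
  then have "y \<in> V" "coords e y \<in> ball c r" by (auto simp: D_def ax)
  then show "Q y (a x)"
   using ad b(1) coords_in[OF y(1)] by (auto simp: Q_def ax intro!: image_eqI[of y \<phi> "coords e y"])
 qed
 obtain F where F: "F \<subseteq> M" "finite F" "M \<subseteq> (\<Union>x\<in>F. D x)"
  using compactE_image[OF comp, of M D] D(1,2) by (metis (no_types, lifting) UN_iff subsetI)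
 obtain X :: "nat \<Rightarrow> 'n point" and L where X: "F = X ` {..<L}"
  using finite_imp_nat_seg_image_inj_on[OF F(2)] by (auto simp: lessThan_def)
 define s where "s i = a (X i)" for i
 have XM: "X i \<in> M" if "i < L" for i using F(1) X that by auto
 have Qs: "Q (X i) (s i)" if "i < L" for i using a[OF XM[OF that]] by (simp add: s_def)
 define U where "U i = fst (s i)" for i
 define \<rho> where "\<rho> i = fst (snd (s i))" for i
 define e where "e i = fst (snd (snd (s i)))" for i
 define V where "V i = fst (snd (snd (snd (s i))))" for i
 define W where "W i = fst (snd (snd (snd (snd (s i)))))" for i
 define \<phi> where "\<phi> i = fst (snd (snd (snd (snd (snd (s i))))))" for i
 define c where "c i = fst (snd (snd (snd (snd (snd (snd (s i)))))))" for i
 define r where "r i = snd (snd (snd (snd (snd (snd (snd (s i)))))))" for i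
 have Qeq: "Q y (s i) \<longleftrightarrow> adapted_chart M p (U i) (\<rho> i) (e i) (V i) (W i) (\<phi> i) \<and>
     cball (c i) (r i) \<subseteq> W i \<and> y \<in> \<phi> i ` ball (c i) (r i)" for y i
  by (simp add: Q_def U_def \<rho>_def e_def V_def W_def \<phi>_def c_def r_def split: prod.split)
 have "surface_atlas M L p U \<rho> e V W \<phi> c r"
 proof (rule surface_atlas.intro)
  have Qs': "adapted_chart M p (U i) (\<rho> i) (e i) (V i) (W i) (\<phi> i) \<and> cball (c i) (r i) \<subseteq> W i" if "i < L" for i
   using Qs[OF that] unfolding Qeq by blast
  show "compact M" by (fact comp)
  show "adapted_chart M p (U i) (\<rho> i) (e i) (V i) (W i) (\<phi> i)" if "i < L" for i
   using Qs'[OF that] by (rule conjunct1)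
  show "cball (c i) (r i) \<subseteq> W i" if "i < L" for i
   using Qs'[OF that] by (rule conjunct2)
  show "M \<subseteq> (\<Union>i<L. \<phi> i ` ball (c i) (r i))"
  proof
   fix y assume y: "y \<in> M"
   then obtain i where i: "i < L" "y \<in> D (X i)" using F(3) X by auto
   then have "Q y (s i)" using D(3)[OF XM y] by (simp add: s_def)
   then have "y \<in> \<phi> i ` ball (c i) (r i)" unfolding Qeq by (elim conjE)
   then show "y \<in> (\<Union>i<L. \<phi> i ` ball (c i) (r i))" by (rule UN_I[rotated]) (use i in simp)
  qed
 qed
 then show thesis using that by (simp add: p_def)
qed

lemma surface_measure_is_surface_measure:
 fixes M :: "'n::{finite,linorder} point set"
 assumes "submanifold CARD('m::finite) M" "compact M"
 shows "is_surface_measure TYPE('m) M (surface_measure TYPE('m) M)"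
proof -
 obtain L U \<rho> and e :: "nat \<Rightarrow> 'm \<Rightarrow> 'n point" and V W \<phi> c r where
  "surface_atlas M L (CARD('n) - CARD('m)) U \<rho> e V W \<phi> c r"
  using surface_atlas_exists[OF assms] by blast
 then interpret surface_atlas M L "CARD('n) - CARD('m)" U \<rho> e V W \<phi> c r .
 show ?thesis unfolding surface_measure_eq by (rule is_surface_measure_measure)
qed

text \<open>The defining property determines the measure on Borel subsets of the image, so the
  restricted surface measure is a push-forward; integrability and integrals are transported along
  it.\<close>

lemma surface_measure_integral_image:
 fixes M :: "'n::finite point set" and \<psi> :: "real^'m::finite \<Rightarrow> 'n point"
 assumes \<mu>: "is_surface_measure TYPE('m) M \<mu>" and M: "closed M"
  and \<psi>: "local_parametrization M X \<psi>" and A: "A \<subseteq> X" "A \<in> sets borel"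
  and f: "f \<in> borel_measurable borel"
 shows "set_integrable \<mu> (\<psi> ` A) f \<longleftrightarrow> set_integrable lborel A (\<lambda>u. area_density \<psi> u * f (\<psi> u))"
  and "(LINT y:\<psi> ` A|\<mu>. f y) = (LINT u:A|lborel. area_density \<psi> u * f (\<psi> u) :: real)"
proof -
 note X = local_parametrization_Ck[OF \<psi>]
 have cont: "continuous_on X \<psi>" using X(1) by (rule Ck_on_continuous_on)
 have s: "sets \<mu> = sets borel" using \<mu> by (simp add: is_surface_measure_def)
 have imA: "\<psi> ` A \<in> sets borel" by (rule local_parametrization_image_borel[OF M \<psi> A])
 define \<psi>0 where "\<psi>0 u = indicator X u *\<^sub>R \<psi> u" for u
 have m\<psi>: "\<psi>0 \<in> borel_measurable borel"
  unfolding \<psi>0_def[abs_def] using X cont by (intro borel_measurable_continuous_on_indicator) auto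
 define d where "d u = indicator A u * area_density \<psi> u" for u
 have md: "d \<in> borel_measurable borel"
  unfolding d_def[abs_def] using borel_measurable_continuous_on_indicator[OF A(2), of "area_density \<psi>"]
   continuous_on_subset[OF continuous_on_area_density[OF X(1)] A(1)] by simp
 have d0: "0 \<le> d u" for u by (simp add: d_def area_density_nonneg)
 have f\<mu>: "f \<in> borel_measurable \<mu>" using f measurable_cong_sets[OF s refl] by blast
 have eq: "density \<mu> (\<lambda>y. ennreal (indicator (\<psi> ` A) y)) = distr (density lborel (\<lambda>u. ennreal (d u))) borel \<psi>0"
 proof (rule measure_eqI)
  fix B assume "B \<in> sets (density \<mu> (\<lambda>y. ennreal (indicator (\<psi> ` A) y)))"
  then have B: "B \<in> sets borel" by (simp add: s)
  have C: "{u\<in>A. \<psi> u \<in> B} \<in> sets borel" "{u\<in>A. \<psi> u \<in> B} \<subseteq> X"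
   using A B continuous_on_subset[OF cont A(1)] by (auto intro: borel_vimage_continuous_on)
  have "emeasure (density \<mu> (\<lambda>y. ennreal (indicator (\<psi> ` A) y))) B =
    (\<integral>\<^sup>+y. ennreal (indicator (\<psi> ` A) y) * indicator B y \<partial>\<mu>)"
   using imA B s by (subst emeasure_density) auto
  also have "\<dots> = (\<integral>\<^sup>+y. indicator (\<psi> ` A \<inter> B) y \<partial>\<mu>)"
   by (rule nn_integral_cong) (simp split: split_indicator)
  also have "\<dots> = emeasure \<mu> (\<psi> ` {u\<in>A. \<psi> u \<in> B})"
  proof -
   have "\<psi> ` A \<inter> B = \<psi> ` {u\<in>A. \<psi> u \<in> B}" by auto
   moreover have "\<psi> ` A \<inter> B \<in> sets \<mu>" using imA B s by auto
   ultimately show ?thesis by (metis nn_integral_indicator)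
  qed
  also have "\<dots> = (\<integral>\<^sup>+u\<in>{u\<in>A. \<psi> u \<in> B}. ennreal (area_density \<psi> u) \<partial>lborel)"
   using \<mu>[unfolded is_surface_measure_def, THEN conjunct2, THEN conjunct2, rule_format, of X \<psi>] \<psi> C
   by blast
  also have "\<dots> = (\<integral>\<^sup>+u. ennreal (d u) * indicator (\<psi>0 -` B) u \<partial>lborel)"
  proof (rule nn_integral_cong)
   fix u
   show "ennreal (area_density \<psi> u) * indicator {u\<in>A. \<psi> u \<in> B} u = ennreal (d u) * indicator (\<psi>0 -` B) u"
    using A(1) by (cases "u \<in> A") (auto simp: d_def \<psi>0_def split: split_indicator)
  qed
  also have "\<dots> = emeasure (distr (density lborel (\<lambda>u. ennreal (d u))) borel \<psi>0) B"
   using m\<psi> B md measurable_sets[OF m\<psi> B]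
   by (subst emeasure_distr) (auto simp: emeasure_density)
  finally show "emeasure (density \<mu> (\<lambda>y. ennreal (indicator (\<psi> ` A) y))) B =
    emeasure (distr (density lborel (\<lambda>u. ennreal (d u))) borel \<psi>0) B" .
 qed (simp add: s)
 have mf0: "(\<lambda>u. f (\<psi>0 u)) \<in> borel_measurable borel" using m\<psi> f by (rule measurable_compose)
 have du: "d u * f (\<psi>0 u) = indicator A u * (area_density \<psi> u * f (\<psi> u))" for u
  using A by (auto simp: d_def \<psi>0_def indicator_def)
 have mi: "(indicator (\<psi> ` A) :: _ \<Rightarrow> real) \<in> borel_measurable \<mu>" using imA s by simp
 have m\<psi>': "\<psi>0 \<in> measurable (density lborel (\<lambda>u. ennreal (d u))) borel" using m\<psi> by simp
 have "set_integrable \<mu> (\<psi> ` A) f \<longleftrightarrow> integrable (density \<mu> (\<lambda>y. ennreal (indicator (\<psi> ` A) y))) f"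
  unfolding set_integrable_def using f\<mu> mi by (subst integrable_density) auto
 also have "\<dots> \<longleftrightarrow> integrable (density lborel (\<lambda>u. ennreal (d u))) (\<lambda>u. f (\<psi>0 u))"
  unfolding eq by (rule integrable_distr_eq[OF m\<psi>' f])
 also have "\<dots> \<longleftrightarrow> integrable lborel (\<lambda>u. d u *\<^sub>R f (\<psi>0 u))"
  using mf0 md d0 by (intro integrable_density) auto
 finally show "set_integrable \<mu> (\<psi> ` A) f \<longleftrightarrow> set_integrable lborel A (\<lambda>u. area_density \<psi> u * f (\<psi> u))"
  by (simp add: set_integrable_def du)
 have "(LINT y:\<psi> ` A|\<mu>. f y) = integral\<^sup>L (density \<mu> (\<lambda>y. ennreal (indicator (\<psi> ` A) y))) f"
  unfolding set_lebesgue_integral_def using f\<mu> mi by (subst integral_density) auto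
 also have "\<dots> = integral\<^sup>L (density lborel (\<lambda>u. ennreal (d u))) (\<lambda>u. f (\<psi>0 u))"
  unfolding eq by (rule integral_distr[OF m\<psi>' f])
 also have "\<dots> = integral\<^sup>L lborel (\<lambda>u. d u *\<^sub>R f (\<psi>0 u))"
  using mf0 md d0 by (intro integral_density) auto
 finally show "(LINT y:\<psi> ` A|\<mu>. f y) = (LINT u:A|lborel. area_density \<psi> u * f (\<psi> u))"
  by (simp add: set_lebesgue_integral_def du)
qed

text \<open>Stated for arbitrary parametrizations rather than for an atlas, because it is also
  applied to charts moved by the flow. The compact sets \<open>K i\<close> give integrability on
  each piece.\<close>

lemma surface_integral_pieces:
 fixes M :: "'n::finite point set" and \<psi> :: "nat \<Rightarrow> real^'m::finite \<Rightarrow> 'n point" and f :: "'n point \<Rightarrow> real"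
 assumes \<mu>: "is_surface_measure TYPE('m) M \<mu>" and M: "compact M"
  and \<psi>: "\<And>i. i < L \<Longrightarrow> local_parametrization M (X i) (\<psi> i)"
  and A: "\<And>i. i < L \<Longrightarrow> A i \<subseteq> K i" "\<And>i. i < L \<Longrightarrow> K i \<subseteq> X i" "\<And>i. i < L \<Longrightarrow> compact (K i)"
   "\<And>i. i < L \<Longrightarrow> A i \<in> sets borel"
  and disj: "\<And>i j. i < L \<Longrightarrow> j < L \<Longrightarrow> i \<noteq> j \<Longrightarrow> \<psi> i ` A i \<inter> \<psi> j ` A j = {}"
  and cover: "(\<Union>i<L. \<psi> i ` A i) = M"
  and f: "continuous_on M f"
 shows "(LINT y:M|\<mu>. f y) = (\<Sum>i<L. LINT u:A i|lborel. area_density (\<psi> i) u * f (\<psi> i u))"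
  and "set_integrable \<mu> M f"
  and "\<And>i. i < L \<Longrightarrow> set_integrable lborel (A i) (\<lambda>u. area_density (\<psi> i) u * f (\<psi> i u))"
proof -
 have Mb: "M \<in> sets borel" "closed M" using compact_imp_closed[OF M] by auto
 have s: "sets \<mu> = sets borel" using \<mu> by (simp add: is_surface_measure_def)
 define f0 where "f0 y = indicator M y *\<^sub>R f y" for y
 have f0: "f0 \<in> borel_measurable borel"
  unfolding f0_def[abs_def] using Mb f by (intro borel_measurable_continuous_on_indicator)
 have AX: "A i \<subseteq> X i" if "i < L" for i using A that by blast
 have inM: "\<psi> i u \<in> M" if "i < L" "u \<in> X i" for i u
  using local_parametrization_subset[OF \<psi>[OF that(1)]] that(2) by blast
 have f0\<psi>: "f0 (\<psi> i u) = f (\<psi> i u)" if "i < L" "u \<in> X i" for i u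
  using inM[OF that] by (simp add: f0_def)
 have int: "set_integrable lborel (A i) (\<lambda>u. area_density (\<psi> i) u * f (\<psi> i u))" if i: "i < L" for i
 proof -
  have "continuous_on (X i) (\<psi> i)"
   using local_parametrization_Ck(1)[OF \<psi>[OF i]] by (rule Ck_on_continuous_on)
  then have "continuous_on (X i) (\<lambda>u. area_density (\<psi> i) u * f (\<psi> i u))"
   using inM[OF i]
   by (intro continuous_on_mult continuous_on_area_density local_parametrization_Ck(1)[OF \<psi>[OF i]]
     continuous_on_compose2[OF f]) auto
  then have "set_integrable lborel (K i) (\<lambda>u. area_density (\<psi> i) u * f (\<psi> i u))"
   unfolding set_integrable_def using A(2,3)[OF i] by (intro borel_integrable_compact) (auto intro: continuous_on_subset)
  then show ?thesis by (rule set_integrable_subset) (use A i in auto)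
 qed
 then show "\<And>i. i < L \<Longrightarrow> set_integrable lborel (A i) (\<lambda>u. area_density (\<psi> i) u * f (\<psi> i u))" .
 have imb: "\<psi> i ` A i \<in> sets borel" if "i < L" for i
  using A(4) AX that by (intro local_parametrization_image_borel[OF Mb(2) \<psi>]) auto
 note surf = surface_measure_integral_image[OF \<mu> Mb(2) \<psi> AX A(4) f0]
 have c1: "set_integrable lborel (A i) (\<lambda>u. area_density (\<psi> i) u * f0 (\<psi> i u)) \<longleftrightarrow>
   set_integrable lborel (A i) (\<lambda>u. area_density (\<psi> i) u * f (\<psi> i u))" if "i < L" for i
  using AX[OF that] f0\<psi>[OF that] by (intro set_integrable_cong refl) auto
 have i0: "set_integrable \<mu> (\<psi> i ` A i) f0" if i: "i < L" for i
  using surf(1)[OF i i i] int[OF i] c1[OF i] by blast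
 have df: "disjoint_family_on (\<lambda>i. \<psi> i ` A i) {..<L}"
  using disj by (auto simp: disjoint_family_on_def)
 have "(LINT y:M|\<mu>. f y) = (LINT y:M|\<mu>. f0 y)"
  using Mb s by (intro set_lebesgue_integral_cong) (auto simp: f0_def)
 also have "\<dots> = (\<Sum>i<L. LINT y:\<psi> i ` A i|\<mu>. f0 y)"
  unfolding cover[symmetric]
  using i0 imb s df by (intro set_integral_finite_Union) auto
 also have "\<dots> = (\<Sum>i<L. LINT u:A i|lborel. area_density (\<psi> i) u * f (\<psi> i u))"
 proof (intro sum.cong refl)
  fix i assume "i \<in> {..<L}"
  then have i: "i < L" by simp
  show "(LINT y:\<psi> i ` A i|\<mu>. f0 y) = (LINT u:A i|lborel. area_density (\<psi> i) u * f (\<psi> i u))"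
   unfolding surf(2)[OF i i i]
   using A(4)[OF i] AX[OF i] f0\<psi>[OF i] by (intro set_lebesgue_integral_cong) auto
 qed
 finally show "(LINT y:M|\<mu>. f y) = (\<Sum>i<L. LINT u:A i|lborel. area_density (\<psi> i) u * f (\<psi> i u))" .
 have "set_integrable \<mu> (\<Union>i<L. \<psi> i ` A i) f0"
  using i0 imb s by (intro set_integrable_UN) auto
 moreover have "(\<lambda>x. indicator M x *\<^sub>R f0 x) = (\<lambda>x. indicator M x *\<^sub>R f x)"
  by (auto simp: f0_def fun_eq_iff split: split_indicator)
 ultimately show "set_integrable \<mu> M f" unfolding cover set_integrable_def by (simp only:)
qed

section \<open>Estimates for flows\<close>

lemma vector_derivative_bound_Icc:
 fixes a :: "real \<Rightarrow> 'a::real_normed_vector"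
 assumes d: "\<And>s. s \<in> {0..1} \<Longrightarrow> (a has_vector_derivative a' s) (at s within {0..1})"
  and t: "0 \<le> t" "t \<le> 1" and B: "\<And>s. 0 \<le> s \<Longrightarrow> s \<le> t \<Longrightarrow> norm (a' s) \<le> B"
 shows "norm (a t - a 0) \<le> B * t"
proof -
 have "norm (a t - a 0) \<le> B * norm (t - 0)"
 proof (rule differentiable_bound)
  show "(a has_derivative (\<lambda>x. x *\<^sub>R a' s)) (at s within {0..t})" if "s \<in> {0..t}" for s
   using d[of s] that t by (auto simp: has_vector_derivative_def intro: has_derivative_subset)
  show "onorm (\<lambda>x. x *\<^sub>R a' s) \<le> B" if "s \<in> {0..t}" for s
  proof (rule onorm_le)
   fix x :: real
   show "norm (x *\<^sub>R a' s) \<le> B * norm x"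
    using mult_right_mono[OF B[of s] abs_ge_zero[of x]] that by (simp add: mult.commute)
  qed
 qed (use t in auto)
 then show ?thesis using t by simp
qed

lemma short_time_gronwall:
 fixes a :: "real \<Rightarrow> 'a::real_normed_vector"
 assumes d: "\<And>s. s \<in> {0..1} \<Longrightarrow> (a has_vector_derivative a' s) (at s within {0..1})"
  and b: "\<And>s. s \<in> {0..1} \<Longrightarrow> norm (a' s) \<le> q * norm (a s) + r"
  and q: "0 \<le> q" "q \<le> 1 / 2" and r: "0 \<le> r" and t: "t \<in> {0..1}"
 shows "norm (a t) \<le> 2 * (norm (a 0) + r)"
proof -
 have "continuous_on {0..1} a"
  unfolding continuous_on_eq_continuous_within using has_vector_derivative_continuous[OF d] by blast
 then have "continuous_on {0..1} (\<lambda>s. norm (a s))" by (rule continuous_on_norm)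
 then obtain z where z: "z \<in> {0..1}" "\<And>s. s \<in> {0..1} \<Longrightarrow> norm (a s) \<le> norm (a z)"
  using continuous_attains_sup[of "{0..1::real}" "\<lambda>s. norm (a s)"] by auto
 have "norm (a z - a 0) \<le> (q * norm (a z) + r) * z"
 proof (rule vector_derivative_bound_Icc[OF d])
  fix s assume s: "0 \<le> s" "s \<le> z"
  have "norm (a' s) \<le> q * norm (a s) + r" using b[of s] s z by auto
  also have "\<dots> \<le> q * norm (a z) + r" using z(2)[of s] s z(1) q by (auto intro: mult_left_mono)
  finally show "norm (a' s) \<le> q * norm (a z) + r" .
 qed (use z in auto)
 also have "\<dots> \<le> (q * norm (a z) + r) * 1"
  using z q r by (intro mult_left_mono) auto
 also have "\<dots> \<le> 1 / 2 * norm (a z) + r"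
  using mult_right_mono[OF q(2) norm_ge_zero[of "a z"]] by simp
 finally have "norm (a z) \<le> 2 * (norm (a 0) + r)"
  using norm_triangle_sub[of "a z" "a 0"] by simp
 then show ?thesis using z(2)[OF t] by linarith
qed

lemma C1_bounds:
 fixes f :: "'a::euclidean_space \<Rightarrow> 'b::euclidean_space"
 assumes f: "Ck_on 1 f UNIV"
 obtains L where "0 \<le> L" "\<And>x v. x \<in> cball 0 R \<Longrightarrow> norm (FD f x v) \<le> L * norm v"
  "\<And>x y. x \<in> cball 0 R \<Longrightarrow> y \<in> cball 0 R \<Longrightarrow> norm (f x - f y) \<le> L * norm (x - y)"
proof -
 have D: "(f has_derivative FD f x) (at x)" for x
  using f by (simp flip: frechet_derivative_works)
 have "\<exists>B. \<forall>x\<in>cball 0 R. norm (FD f x b) \<le> B" for b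
 proof -
  have "continuous_on UNIV (\<lambda>x. FD f x b)" using f by simp
  then have "compact ((\<lambda>x. FD f x b) ` cball 0 R)"
   by (intro compact_continuous_image compact_cball) (auto intro: continuous_on_subset)
  then have "bounded ((\<lambda>x. FD f x b) ` cball 0 R)" by (rule compact_imp_bounded)
  then show ?thesis unfolding bounded_iff by auto
 qed
 then obtain B where B: "\<And>b x. x \<in> cball 0 R \<Longrightarrow> norm (FD f x b) \<le> B b" by metis
 define L where "L = (\<Sum>b\<in>Basis. \<bar>B b\<bar>)"
 have 1: "norm (FD f x v) \<le> L * norm v" if x: "x \<in> cball 0 R" for x v
 proof -
  have lin: "linear (FD f x)" using D has_derivative_linear by blast
  have "FD f x v = FD f x (\<Sum>b\<in>Basis. (v \<bullet> b) *\<^sub>R b)"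
   by (simp add: euclidean_representation)
  also have "\<dots> = (\<Sum>b\<in>Basis. (v \<bullet> b) *\<^sub>R FD f x b)"
   by (simp add: linear_sum[OF lin] linear_cmul[OF lin])
  also have "norm \<dots> \<le> (\<Sum>b\<in>Basis. norm v * \<bar>B b\<bar>)"
  proof (rule sum_norm_le)
   fix b :: 'a assume b: "b \<in> Basis"
   have "norm (FD f x b) \<le> \<bar>B b\<bar>" using B[OF x, of b] by linarith
   then show "norm ((v \<bullet> b) *\<^sub>R FD f x b) \<le> norm v * \<bar>B b\<bar>"
    unfolding norm_scaleR using Basis_le_norm[OF b, of v] by (intro mult_mono) auto
  qed
  finally show ?thesis by (simp add: L_def sum_distrib_left mult.commute sum_distrib_right)
 qed
 show thesis
 proof (rule that[OF _ 1])
  show "0 \<le> L" by (simp add: L_def sum_nonneg)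
  fix x y :: 'a assume xy: "x \<in> cball 0 R" "y \<in> cball 0 R"
  show "norm (f x - f y) \<le> L * norm (x - y)"
  proof (rule differentiable_bound[of "cball 0 R" f "\<lambda>x. FD f x"])
   show "(f has_derivative FD f x) (at x within cball 0 R)" for x
    using D by (rule has_derivative_at_withinI)
   show "onorm (FD f x) \<le> L" if "x \<in> cball 0 R" for x
    using 1[OF that] by (rule onorm_le)
  qed (use xy in auto)
 qed
qed

text \<open>One constant \<open>L\<close> bounds the field, its derivative and the Lipschitz
  constants of both, on a ball in which the trajectories will be shown to stay.\<close>

locale C2_field =
 fixes V :: "'a::euclidean_space \<Rightarrow> 'a" and V' :: "'a \<Rightarrow> 'a \<Rightarrow> 'a" and R L :: real
 assumes der: "\<And>x. (V has_derivative V' x) (at x)"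
  and L0: "0 \<le> L"
  and Vbound: "\<And>x. norm x \<le> R \<Longrightarrow> norm (V x) \<le> L"
  and V'bound: "\<And>x v. norm x \<le> R \<Longrightarrow> norm (V' x v) \<le> L * norm v"
  and Vlip: "\<And>x y. norm x \<le> R \<Longrightarrow> norm y \<le> R \<Longrightarrow> norm (V x - V y) \<le> L * norm (x - y)"
  and V'lip: "\<And>x y v. norm x \<le> R \<Longrightarrow> norm y \<le> R \<Longrightarrow> norm (V' x v - V' y v) \<le> L * norm (x - y) * norm v"

lemma C2_field_exists:
 fixes V :: "'a::euclidean_space \<Rightarrow> 'a"
 assumes V: "Ck_on 2 V UNIV"
 obtains L where "C2_field V (\<lambda>x. FD V x) R L"
proof -
 define V' where "V' x = FD V x" for x
 have C1: "Ck_on 1 V UNIV" and C1': "Ck_on 1 (\<lambda>x. V' x b) UNIV" for b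
  using V Ck_on_le[OF V, of 1] by (simp_all add: numeral_2_eq_2 V'_def)
 have der: "(V has_derivative V' x) (at x)" for x
  using C1 by (simp add: V'_def flip: frechet_derivative_works)
 have lin: "linear (V' x)" for x using der by (rule has_derivative_linear)
 obtain L1 where L1: "0 \<le> L1" "\<And>x v. x \<in> cball 0 R \<Longrightarrow> norm (V' x v) \<le> L1 * norm v"
  "\<And>x y. x \<in> cball 0 R \<Longrightarrow> y \<in> cball 0 R \<Longrightarrow> norm (V x - V y) \<le> L1 * norm (x - y)"
  using C1_bounds[OF C1, of R] unfolding V'_def by blast
 have "\<exists>L. 0 \<le> L \<and> (\<forall>x\<in>cball 0 R. \<forall>y\<in>cball 0 R. norm (V' x b - V' y b) \<le> L * norm (x - y))" for b
  using C1_bounds[OF C1'[of b], of R] by metis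
 then obtain B where B: "\<And>b. 0 \<le> B b"
  "\<And>b x y. x \<in> cball 0 R \<Longrightarrow> y \<in> cball 0 R \<Longrightarrow> norm (V' x b - V' y b) \<le> B b * norm (x - y)" by metis
 define L2 where "L2 = (\<Sum>b\<in>Basis. B b)"
 have L2: "0 \<le> L2" using B(1) by (simp add: L2_def sum_nonneg)
 have l2: "norm (V' x v - V' y v) \<le> L2 * norm (x - y) * norm v" if xy: "x \<in> cball 0 R" "y \<in> cball 0 R" for x y v
 proof -
  have rep: "V' z v = (\<Sum>b\<in>Basis. (v \<bullet> b) *\<^sub>R V' z b)" for z
  proof -
   have "V' z v = V' z (\<Sum>b\<in>Basis. (v \<bullet> b) *\<^sub>R b)" by (simp add: euclidean_representation)
   then show ?thesis by (simp add: linear_sum[OF lin] linear_cmul[OF lin])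
  qed
  have "V' x v - V' y v = (\<Sum>b\<in>Basis. (v \<bullet> b) *\<^sub>R (V' x b - V' y b))"
   by (simp add: rep[of x] rep[of y] sum_subtractf scaleR_diff_right)
  also have "norm \<dots> \<le> (\<Sum>b\<in>Basis. norm v * (B b * norm (x - y)))"
  proof (rule sum_norm_le)
   fix b :: 'a assume b: "b \<in> Basis"
   show "norm ((v \<bullet> b) *\<^sub>R (V' x b - V' y b)) \<le> norm v * (B b * norm (x - y))"
    unfolding norm_scaleR using Basis_le_norm[OF b, of v] B(2)[OF xy, of b] by (intro mult_mono) auto
  qed
  also have "\<dots> = L2 * norm (x - y) * norm v"
   by (simp add: L2_def sum_distrib_left sum_distrib_right mult_ac)
  finally show ?thesis .
 qed
 have "continuous_on (cball 0 R) V" using C1 Ck_on_continuous_on continuous_on_subset by blast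
 then have "bounded (V ` cball 0 R)"
  by (intro compact_imp_bounded compact_continuous_image compact_cball)
 then obtain L3 where L3: "\<And>x. x \<in> cball 0 R \<Longrightarrow> norm (V x) \<le> L3" unfolding bounded_iff by blast
 define L where "L = max L1 (max L2 \<bar>L3\<bar>)"
 have L: "L1 \<le> L" "L2 \<le> L" "L3 \<le> L" "0 \<le> L" using L1 by (auto simp: L_def)
 have "C2_field V V' R L"
 proof
  fix x y v :: 'a
  assume x: "norm x \<le> R"
  then have xc: "x \<in> cball 0 R" by simp
  show "norm (V x) \<le> L" using L3[OF xc] L by linarith
  show "norm (V' x v) \<le> L * norm v"
   using L1(2)[OF xc, of v] mult_right_mono[OF L(1) norm_ge_zero[of v]] by linarith
  assume "norm y \<le> R"
  then have yc: "y \<in> cball 0 R" by simp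
  show "norm (V x - V y) \<le> L * norm (x - y)"
   using L1(3)[OF xc yc] mult_right_mono[OF L(1) norm_ge_zero[of "x - y"]] by linarith
  have "L2 * (norm (x - y) * norm v) \<le> L * (norm (x - y) * norm v)"
   using L(2) by (intro mult_right_mono) auto
  then show "norm (V' x v - V' y v) \<le> L * norm (x - y) * norm v"
   using l2[OF xc yc, of v] by (simp add: mult.assoc)
 qed (use der L in auto)
 then show thesis using that unfolding V'_def[abs_def] by blast
qed

context C2_field
begin

lemma linear_V': "linear (V' x)" using der by (rule has_derivative_linear)

lemma segment_bound:
 assumes "norm x \<le> R" "norm y \<le> R" "0 \<le> t" "t \<le> 1"
 shows "norm (y + t *\<^sub>R (x - y)) \<le> R"
proof -
 have "y + t *\<^sub>R (x - y) = (1 - t) *\<^sub>R y + t *\<^sub>R x" by (simp add: algebra_simps)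
 also have "norm \<dots> \<le> (1 - t) * norm y + t * norm x"
  using norm_triangle_ineq[of "(1 - t) *\<^sub>R y" "t *\<^sub>R x"] assms by simp
 also have "\<dots> \<le> (1 - t) * R + t * R" using assms by (intro add_mono mult_left_mono) auto
 finally show ?thesis by (simp add: algebra_simps)
qed

lemma V_segment_derivative:
 "((\<lambda>t. V (y + t *\<^sub>R (x - y))) has_vector_derivative V' (y + t *\<^sub>R (x - y)) (x - y)) (at t within S)"
proof -
 have "((\<lambda>t. y + t *\<^sub>R (x - y)) has_derivative (\<lambda>s. s *\<^sub>R (x - y))) (at t within S)"
  by (auto intro!: derivative_eq_intros)
 from diff_chain_within[OF this has_derivative_at_withinI[OF der]] show ?thesis
  by (simp add: has_vector_derivative_def comp_def linear_cmul[OF linear_V'])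
qed

text \<open>The derivative is taken at a third point \<open>z\<close>, so that differences belonging
  to several pairs of points can be compared with one and the same linear map.\<close>

lemma taylor_bound:
 assumes x: "norm x \<le> R" and y: "norm y \<le> R" and z: "norm z \<le> R"
 shows "norm (V x - V y - V' z (x - y)) \<le> L * (norm (x - y) + norm (y - z)) * norm (x - y)"
proof -
 define g where "g t = V (y + t *\<^sub>R (x - y)) - t *\<^sub>R V' z (x - y)" for t
 have "norm (g 1 - g 0) \<le> (L * (norm (x - y) + norm (y - z)) * norm (x - y)) * 1"
 proof (rule vector_derivative_bound_Icc)
  show "(g has_vector_derivative (V' (y + s *\<^sub>R (x - y)) (x - y) - V' z (x - y))) (at s within {0..1})"
   for s unfolding g_def
   by (rule has_vector_derivative_diff[OF V_segment_derivative])
    (auto simp: has_vector_derivative_def intro!: derivative_eq_intros)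
  fix s :: real assume s: "0 \<le> s" "s \<le> 1"
  have "norm (y + s *\<^sub>R (x - y) - z) \<le> norm (x - y) + norm (y - z)"
  proof -
   have "norm (y + s *\<^sub>R (x - y) - z) \<le> norm (s *\<^sub>R (x - y)) + norm (y - z)"
    using norm_triangle_ineq[of "s *\<^sub>R (x - y)" "y - z"] by (simp add: algebra_simps)
   also have "norm (s *\<^sub>R (x - y)) \<le> norm (x - y)" using s by (simp add: mult_left_le_one_le)
   finally show ?thesis by simp
  qed
  then have "L * norm (y + s *\<^sub>R (x - y) - z) * norm (x - y) \<le> L * (norm (x - y) + norm (y - z)) * norm (x - y)"
   using L0 by (intro mult_right_mono mult_left_mono) auto
  then show "norm (V' (y + s *\<^sub>R (x - y)) (x - y) - V' z (x - y)) \<le> L * (norm (x - y) + norm (y - z)) * norm (x - y)"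
   using V'lip[OF segment_bound[OF x y s] z, of "x - y"] by linarith
 qed auto
 then show ?thesis by (simp add: g_def algebra_simps)
qed

text \<open>The increments of the field along two segments are compared by differentiating along
  both at once: the discrepancy of the displacements enters through the bound of \<open>V'\<close>,
  the distance of the segments through its Lipschitz constant.\<close>

lemma second_difference_field:
 assumes a0: "norm a0 \<le> R" and b0: "norm b0 \<le> R" and a1: "norm a1 \<le> R" and b1: "norm b1 \<le> R"
 shows "norm ((V a1 - V b1) - (V a0 - V b0)) \<le>
  L * norm ((a1 - a0) - (b1 - b0)) +
  L * (norm (a0 - b0) + norm ((a1 - a0) - (b1 - b0))) * norm (b1 - b0)"
proof -
 let ?d = "(a1 - a0) - (b1 - b0)"
 define g where "g t = V (a0 + t *\<^sub>R (a1 - a0)) - V (b0 + t *\<^sub>R (b1 - b0))" for t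
 have "norm (g 1 - g 0) \<le> (L * norm ?d + L * (norm (a0 - b0) + norm ?d) * norm (b1 - b0)) * 1"
 proof (rule vector_derivative_bound_Icc)
  show "(g has_vector_derivative (V' (a0 + s *\<^sub>R (a1 - a0)) (a1 - a0) - V' (b0 + s *\<^sub>R (b1 - b0)) (b1 - b0)))
    (at s within {0..1})" for s
   unfolding g_def by (intro has_vector_derivative_diff V_segment_derivative)
  fix s :: real assume s: "0 \<le> s" "s \<le> 1"
  let ?a = "a0 + s *\<^sub>R (a1 - a0)" and ?b = "b0 + s *\<^sub>R (b1 - b0)"
  have "norm (?a - ?b) \<le> norm (a0 - b0) + norm ?d"
  proof -
   have "?a - ?b = (a0 - b0) + s *\<^sub>R ?d" by (simp add: algebra_simps)
   then have "norm (?a - ?b) \<le> norm (a0 - b0) + norm (s *\<^sub>R ?d)" by (simp only: norm_triangle_ineq)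
   also have "norm (s *\<^sub>R ?d) \<le> norm ?d" using s by (simp add: mult_left_le_one_le)
   finally show ?thesis by simp
  qed
  then have "L * norm (?a - ?b) * norm (b1 - b0) \<le> L * (norm (a0 - b0) + norm ?d) * norm (b1 - b0)"
   using L0 by (intro mult_right_mono mult_left_mono) auto
  then have 2: "norm (V' ?a (b1 - b0) - V' ?b (b1 - b0)) \<le> L * (norm (a0 - b0) + norm ?d) * norm (b1 - b0)"
   using V'lip[OF segment_bound[OF a1 a0 s] segment_bound[OF b1 b0 s], of "b1 - b0"] by linarith
  have 1: "norm (V' ?a ?d) \<le> L * norm ?d" by (rule V'bound[OF segment_bound[OF a1 a0 s]])
  have "V' ?a (a1 - a0) - V' ?b (b1 - b0) = V' ?a ?d + (V' ?a (b1 - b0) - V' ?b (b1 - b0))"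
   by (simp only: linear_diff[OF linear_V', of _ "a1 - a0"]) simp
  then show "norm (V' ?a (a1 - a0) - V' ?b (b1 - b0)) \<le> L * norm ?d + L * (norm (a0 - b0) + norm ?d) * norm (b1 - b0)"
   using 1 2 norm_triangle_ineq[of "V' ?a ?d" "V' ?a (b1 - b0) - V' ?b (b1 - b0)"] by (simp only:)
 qed auto
 then show ?thesis by (simp add: g_def)
qed

text \<open>Solutions of \<open>u' = V u\<close> over a time interval of length \<open>h\<close>, rescaled to the unit interval.\<close>

definition trajectory :: "real \<Rightarrow> (real \<Rightarrow> 'a) \<Rightarrow> bool" where
 "trajectory h u \<longleftrightarrow> (\<forall>s\<in>{0..1}. norm (u s) \<le> R \<and>
   (u has_vector_derivative h *\<^sub>R V (u s)) (at s within {0..1}))"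

text \<open>A continuity argument: as long as the solution has moved by at most 1, the speed bound
  shows that it has moved by at most 1/2, so the distance 1 is never reached.\<close>

lemma trajectoryI:
 assumes u: "\<And>s. s \<in> {0..1} \<Longrightarrow> (u has_vector_derivative h *\<^sub>R V (u s)) (at s within {0..1})"
  and R: "norm (u 0) + 1 \<le> R" and h: "\<bar>h\<bar> * L \<le> 1 / 2"
 shows "trajectory h u"
proof -
 define f where "f s = norm (u s - u 0)" for s
 have "continuous_on {0..1} u"
  unfolding continuous_on_eq_continuous_within using has_vector_derivative_continuous[OF u] by blast
 then have cf: "continuous_on {0..1} f"
  unfolding f_def by (intro continuous_intros)
 have bd: "norm (u s) \<le> R" if "f s \<le> 1" for s
  using that R norm_triangle_sub[of "u s" "u 0"] by (simp add: f_def)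
 have small: "f t \<le> 1 / 2" if t: "t \<in> {0..1}" "\<And>s. 0 \<le> s \<Longrightarrow> s \<le> t \<Longrightarrow> f s \<le> 1" for t
 proof -
  have "f t \<le> (1 / 2) * t"
   unfolding f_def
  proof (rule vector_derivative_bound_Icc[OF u])
   fix s assume "0 \<le> s" "s \<le> t"
   then have "norm (V (u s)) \<le> L" by (intro Vbound bd t(2))
   then have "\<bar>h\<bar> * norm (V (u s)) \<le> \<bar>h\<bar> * L" by (intro mult_left_mono) auto
   then show "norm (h *\<^sub>R V (u s)) \<le> 1 / 2" using h by simp
  qed (use t in auto)
  then show ?thesis using t by simp
 qed
 have lt: "f s < 1" if s: "s \<in> {0..1}" for s
 proof (rule ccontr)
  assume "\<not> f s < 1"
  define Z where "Z = {0..1} \<inter> f -` {1..}"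
  have "closed Z" unfolding Z_def by (intro continuous_closed_preimage cf) auto
  then have "compact ({0..1} \<inter> Z)" by (intro compact_Int_closed compact_Icc)
  moreover have "{0..1} \<inter> Z = Z" by (auto simp: Z_def)
  ultimately have "compact Z" by simp
  moreover have "s \<in> Z" using \<open>\<not> f s < 1\<close> s by (auto simp: Z_def)
  ultimately obtain z where z: "z \<in> Z" "\<And>s. s \<in> Z \<Longrightarrow> z \<le> s"
   using compact_attains_inf[of Z] by blast
  have z01: "0 \<le> z" "z \<le> 1" "1 \<le> f z" using z(1) by (auto simp: Z_def)
  \<comment> \<open>Before the first time \<open>z\<close> at which the distance is at least 1 it
    takes the value 3/4, a value strictly between the bound 1/2 and 1.\<close>
  have "\<exists>y. 0 \<le> y \<and> y \<le> z \<and> f y = 3 / 4"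
  proof (rule IVT')
   show "f 0 \<le> 3 / 4" by (simp add: f_def)
   show "continuous_on {0..z} f" using z01 by (intro continuous_on_subset[OF cf]) auto
  qed (use z01 in auto)
  then obtain y where y: "0 \<le> y" "y \<le> z" "f y = 3 / 4" by blast
  have "f y \<le> 1 / 2"
  proof (rule small)
   fix r assume r: "0 \<le> r" "r \<le> y"
   show "f r \<le> 1"
   proof (rule ccontr)
    assume "\<not> f r \<le> 1"
    then have "r \<in> Z" using r y z01 by (auto simp: Z_def)
    then have "z = y" using z(2)[of r] r y by linarith
    then show False using y z01 by simp
   qed
  qed (use y z01 in auto)
  then show False using y by simp
 qed
 show ?thesis unfolding trajectory_def by (intro ballI conjI u bd less_imp_le[OF lt])
qed

lemma trajectoryD:
 assumes "trajectory h u" "s \<in> {0..1}"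
 shows "norm (u s) \<le> R" "(u has_vector_derivative h *\<^sub>R V (u s)) (at s within {0..1})"
 using assms by (auto simp: trajectory_def)

lemma trajectory_move:
 assumes u: "trajectory h u" and s: "s \<in> {0..1}"
 shows "norm (u s - u 0) \<le> \<bar>h\<bar> * L"
proof -
 have "norm (u s - u 0) \<le> (\<bar>h\<bar> * L) * s"
 proof (rule vector_derivative_bound_Icc[OF trajectoryD(2)[OF u]])
  fix r assume "0 \<le> r" "r \<le> s"
  then have "norm (V (u r)) \<le> L" using s by (intro Vbound trajectoryD(1)[OF u]) auto
  then show "norm (h *\<^sub>R V (u r)) \<le> \<bar>h\<bar> * L" by (simp add: mult_left_mono)
 qed (use s in auto)
 also have "\<dots> \<le> (\<bar>h\<bar> * L) * 1" using s L0 by (intro mult_left_mono) auto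
 finally show ?thesis by simp
qed

lemma trajectory_diff:
 assumes u: "trajectory h u" and v: "trajectory h v" and h: "\<bar>h\<bar> * L \<le> 1 / 2" and s: "s \<in> {0..1}"
 shows "norm (u s - v s) \<le> 2 * norm (u 0 - v 0)"
proof -
 have "norm ((\<lambda>s. u s - v s) s) \<le> 2 * (norm ((\<lambda>s. u s - v s) 0) + 0)"
 proof (rule short_time_gronwall[OF _ _ _ h _ s])
  show "((\<lambda>s. u s - v s) has_vector_derivative h *\<^sub>R V (u r) - h *\<^sub>R V (v r)) (at r within {0..1})"
   if "r \<in> {0..1}" for r
   using that by (intro has_vector_derivative_diff trajectoryD(2)[OF u] trajectoryD(2)[OF v])
  show "norm (h *\<^sub>R V (u r) - h *\<^sub>R V (v r)) \<le> \<bar>h\<bar> * L * norm (u r - v r) + 0" if "r \<in> {0..1}" for r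
  proof -
   have "norm (h *\<^sub>R V (u r) - h *\<^sub>R V (v r)) = \<bar>h\<bar> * norm (V (u r) - V (v r))"
    by (simp flip: scaleR_diff_right)
   also have "\<dots> \<le> \<bar>h\<bar> * (L * norm (u r - v r))"
    using that by (intro mult_left_mono Vlip trajectoryD(1)[OF u] trajectoryD(1)[OF v]) auto
   finally show ?thesis by (simp add: mult.assoc)
  qed
 qed (use L0 in auto)
 then show ?thesis by simp
qed

lemma trajectory_diff_move:
 assumes u: "trajectory h u" and v: "trajectory h v" and h: "\<bar>h\<bar> * L \<le> 1 / 2" and s: "s \<in> {0..1}"
 shows "norm ((u s - u 0) - (v s - v 0)) \<le> 2 * (\<bar>h\<bar> * L) * norm (u 0 - v 0)"
proof -
 have "norm ((\<lambda>s. u s - v s) s - (\<lambda>s. u s - v s) 0) \<le> (2 * (\<bar>h\<bar> * L) * norm (u 0 - v 0)) * s"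
 proof (rule vector_derivative_bound_Icc)
  show "((\<lambda>s. u s - v s) has_vector_derivative h *\<^sub>R V (u r) - h *\<^sub>R V (v r)) (at r within {0..1})"
   if "r \<in> {0..1}" for r
   using that by (intro has_vector_derivative_diff trajectoryD(2)[OF u] trajectoryD(2)[OF v])
  fix r assume "0 \<le> r" "r \<le> s"
  then have r: "r \<in> {0..1}" using s by auto
  have "norm (h *\<^sub>R V (u r) - h *\<^sub>R V (v r)) = \<bar>h\<bar> * norm (V (u r) - V (v r))"
   by (simp flip: scaleR_diff_right)
  also have "\<dots> \<le> \<bar>h\<bar> * (L * norm (u r - v r))"
   using r by (intro mult_left_mono Vlip trajectoryD(1)[OF u] trajectoryD(1)[OF v]) auto
  also have "\<dots> \<le> \<bar>h\<bar> * (L * (2 * norm (u 0 - v 0)))"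
   using L0 by (intro mult_left_mono trajectory_diff[OF u v h r]) auto
  finally show "norm (h *\<^sub>R V (u r) - h *\<^sub>R V (v r)) \<le> 2 * (\<bar>h\<bar> * L) * norm (u 0 - v 0)"
   by (simp add: mult_ac)
 qed (use s in auto)
 also have "\<dots> \<le> (2 * (\<bar>h\<bar> * L) * norm (u 0 - v 0)) * 1"
  using s L0 by (intro mult_left_mono) auto
 finally show ?thesis by (simp add: algebra_simps)
qed

text \<open>The error is quadratic in the time step and still proportional to the initial distance;
  it therefore survives division by a spatial increment and becomes an estimate for the derivative
  of the flow map.\<close>

lemma trajectory_diff_first_order:
 assumes u: "trajectory h u" and v: "trajectory h v" and h: "\<bar>h\<bar> * L \<le> 1 / 2"
 shows "norm ((u 1 - v 1) - (u 0 - v 0) - h *\<^sub>R (V (u 0) - V (v 0))) \<le>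
  4 * L\<^sup>2 * h\<^sup>2 * norm (u 0 - v 0)"
proof -
 define a where "a s = (u s - v s) - s *\<^sub>R (h *\<^sub>R (V (u 0) - V (v 0)))" for s
 let ?n = "norm (u 0 - v 0)"
 have "norm (a 1 - a 0) \<le> (4 * L\<^sup>2 * h\<^sup>2 * ?n) * 1"
 proof (rule vector_derivative_bound_Icc)
  show "(a has_vector_derivative (h *\<^sub>R V (u r) - h *\<^sub>R V (v r)) - h *\<^sub>R (V (u 0) - V (v 0))) (at r within {0..1})"
   if "r \<in> {0..1}" for r
   unfolding a_def using that
   by (intro has_vector_derivative_diff trajectoryD(2)[OF u] trajectoryD(2)[OF v])
    (auto simp: has_vector_derivative_def intro!: derivative_eq_intros)
  fix r :: real assume "0 \<le> r" "r \<le> 1"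
  then have r: "r \<in> {0..1}" by simp
  let ?d = "norm ((u r - u 0) - (v r - v 0))"
  have d: "?d \<le> 2 * (\<bar>h\<bar> * L) * ?n" by (rule trajectory_diff_move[OF u v h r])
  have d': "?d \<le> ?n" using d mult_right_mono[OF h norm_ge_zero[of "u 0 - v 0"]] by simp
  have "norm ((V (u r) - V (v r)) - (V (u 0) - V (v 0))) \<le> L * ?d + L * (?n + ?d) * norm (v r - v 0)"
   using r by (intro second_difference_field trajectoryD(1)[OF u] trajectoryD(1)[OF v]) auto
  also have "L * ?d \<le> L * (2 * (\<bar>h\<bar> * L) * ?n)" using d L0 by (intro mult_left_mono)
  also have "L * (?n + ?d) * norm (v r - v 0) \<le> L * (?n + ?n) * (\<bar>h\<bar> * L)"
   using L0 d' by (intro mult_mono trajectory_move[OF v r]) auto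
  finally have "norm ((V (u r) - V (v r)) - (V (u 0) - V (v 0))) \<le> 4 * L\<^sup>2 * \<bar>h\<bar> * ?n"
   by (simp add: power2_eq_square algebra_simps)
  then have "\<bar>h\<bar> * norm ((V (u r) - V (v r)) - (V (u 0) - V (v 0))) \<le> \<bar>h\<bar> * (4 * L\<^sup>2 * \<bar>h\<bar> * ?n)"
   by (intro mult_left_mono) auto
  moreover have "norm ((h *\<^sub>R V (u r) - h *\<^sub>R V (v r)) - h *\<^sub>R (V (u 0) - V (v 0))) =
    \<bar>h\<bar> * norm ((V (u r) - V (v r)) - (V (u 0) - V (v 0)))"
   by (simp flip: scaleR_diff_right)
  moreover have "\<bar>h\<bar> * (4 * L\<^sup>2 * \<bar>h\<bar> * ?n) = 4 * L\<^sup>2 * h\<^sup>2 * ?n"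
  proof -
   have "h\<^sup>2 = \<bar>h\<bar> * \<bar>h\<bar>" by (simp add: power2_eq_square)
   then show ?thesis by (simp only: mult_ac)
  qed
  ultimately show "norm ((h *\<^sub>R V (u r) - h *\<^sub>R V (v r)) - h *\<^sub>R (V (u 0) - V (v 0))) \<le> 4 * L\<^sup>2 * h\<^sup>2 * ?n"
   by linarith
 qed auto
 then show ?thesis by (simp add: a_def algebra_simps)
qed

text \<open>All differences are compared with the single linear map \<open>V' (z s)\<close>, which
  acts on the whole combination. The combination thus solves a linear equation up to Taylor errors
  that are quadratic in the distances, and \<open>short_time_gronwall\<close> bounds it by its
  initial value.\<close>

lemma trajectory_combination:
 fixes u v :: "'j::finite \<Rightarrow> real \<Rightarrow> 'a" and c :: "'j \<Rightarrow> real"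
 assumes u: "\<And>j. trajectory h (u j)" and v: "\<And>j. trajectory h (v j)" and z: "trajectory h z"
  and h: "\<bar>h\<bar> * L \<le> 1 / 2"
 shows "norm (\<Sum>j\<in>UNIV. c j *\<^sub>R (u j 1 - v j 1)) \<le> 2 * (norm (\<Sum>j\<in>UNIV. c j *\<^sub>R (u j 0 - v j 0)) +
  2 * (\<Sum>j\<in>UNIV. \<bar>c j\<bar> * ((norm (u j 0 - v j 0) + norm (v j 0 - z 0)) * norm (u j 0 - v j 0))))"
proof -
 define a where "a s = (\<Sum>j\<in>UNIV. c j *\<^sub>R (u j s - v j s))" for s
 define a' where "a' s = (\<Sum>j\<in>UNIV. c j *\<^sub>R (h *\<^sub>R V (u j s) - h *\<^sub>R V (v j s)))" for s
 \<comment> \<open>The Taylor error of the j-th pair at time 0. Each distance may double along the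
   flow, which gives \<open>4 * L * E j\<close>; the factor
   \<open>\<bar>h\<bar> * L \<le> 1 / 2\<close> reduces this to 2.\<close>
 define E where "E j = (norm (u j 0 - v j 0) + norm (v j 0 - z 0)) * norm (u j 0 - v j 0)" for j
 have E0: "0 \<le> E j" for j by (simp add: E_def)
 have "norm (a 1) \<le> 2 * (norm (a 0) + 2 * (\<Sum>j\<in>UNIV. \<bar>c j\<bar> * E j))"
 proof (rule short_time_gronwall)
  show "(a has_vector_derivative a' s) (at s within {0..1})" if "s \<in> {0..1}" for s
   unfolding a_def a'_def using that
   by (intro has_vector_derivative_sum has_vector_derivative_scaleR[where f = "\<lambda>_. c _" and f' = 0, simplified]
     bounded_linear.has_vector_derivative[OF bounded_linear_scaleR_right]
     has_vector_derivative_diff trajectoryD(2)[OF u] trajectoryD(2)[OF v])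
  fix s :: real assume s: "s \<in> {0..1}"
  note us = trajectoryD(1)[OF u s] and vs = trajectoryD(1)[OF v s] and zs = trajectoryD(1)[OF z s]
  define e where "e j = V (u j s) - V (v j s) - V' (z s) (u j s - v j s)" for j
  have e: "norm (e j) \<le> 4 * L * E j" for j
  proof -
   have "norm (e j) \<le> L * (norm (u j s - v j s) + norm (v j s - z s)) * norm (u j s - v j s)"
    unfolding e_def by (rule taylor_bound[OF us vs zs])
   also have "\<dots> \<le> L * (2 * norm (u j 0 - v j 0) + 2 * norm (v j 0 - z 0)) * (2 * norm (u j 0 - v j 0))"
    using L0 by (intro mult_mono add_mono trajectory_diff[OF u v h s] trajectory_diff[OF v z h s]) auto
   also have "\<dots> = 4 * L * E j" by (simp add: E_def algebra_simps)
   finally show ?thesis .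
  qed
  have "a' s = h *\<^sub>R (V' (z s) (a s) + (\<Sum>j\<in>UNIV. c j *\<^sub>R e j))"
  proof -
   have "V' (z s) (a s) = (\<Sum>j\<in>UNIV. c j *\<^sub>R V' (z s) (u j s - v j s))"
    by (simp add: a_def linear_sum[OF linear_V'] linear_cmul[OF linear_V'])
   then have "V' (z s) (a s) + (\<Sum>j\<in>UNIV. c j *\<^sub>R e j) = (\<Sum>j\<in>UNIV. c j *\<^sub>R (V (u j s) - V (v j s)))"
    by (simp add: e_def sum.distrib[symmetric] flip: scaleR_add_right)
   then show ?thesis by (simp add: a'_def scaleR_sum_right scaleR_diff_right mult.commute)
  qed
  then have "norm (a' s) \<le> \<bar>h\<bar> * (norm (V' (z s) (a s)) + norm (\<Sum>j\<in>UNIV. c j *\<^sub>R e j))"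
   by (simp add: mult_left_mono norm_triangle_ineq)
  also have "\<dots> \<le> \<bar>h\<bar> * (L * norm (a s) + (\<Sum>j\<in>UNIV. \<bar>c j\<bar> * (4 * L * E j)))"
  proof (intro mult_left_mono add_mono V'bound[OF zs] sum_norm_le)
   show "norm (c j *\<^sub>R e j) \<le> \<bar>c j\<bar> * (4 * L * E j)" for j
    using e[of j] by (simp add: mult_left_mono)
  qed auto
  also have "\<dots> = \<bar>h\<bar> * L * norm (a s) + \<bar>h\<bar> * L * (4 * (\<Sum>j\<in>UNIV. \<bar>c j\<bar> * E j))"
   by (simp add: sum_distrib_left algebra_simps)
  also have "\<dots> \<le> \<bar>h\<bar> * L * norm (a s) + 1 / 2 * (4 * (\<Sum>j\<in>UNIV. \<bar>c j\<bar> * E j))"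
   using E0 by (intro add_left_mono mult_right_mono h) (auto intro!: sum_nonneg mult_nonneg_nonneg)
  finally show "norm (a' s) \<le> \<bar>h\<bar> * L * norm (a s) + 2 * (\<Sum>j\<in>UNIV. \<bar>c j\<bar> * E j)" by simp
 qed (use L0 h E0 in \<open>auto intro!: sum_nonneg mult_nonneg_nonneg\<close>)
 then show ?thesis by (simp add: a_def E_def)
qed

end

section \<open>Regularity of the flow map along parametrizations\<close>

lemma has_derivative_sequence:
 fixes f :: "'a::real_normed_vector \<Rightarrow> 'b::real_normed_vector"
 assumes "(f has_derivative f') (at u)"
 shows "(\<lambda>n. real (Suc n) *\<^sub>R (f (u + (1 / real (Suc n)) *\<^sub>R v) - f u)) \<longlonglongrightarrow> f' v"
proof -
 have lin: "linear f'" using assms by (rule has_derivative_linear)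
 have "((\<lambda>t. u + t *\<^sub>R v) has_derivative (\<lambda>s. s *\<^sub>R v)) (at 0)"
  by (auto intro!: derivative_eq_intros)
 from diff_chain_at[OF this, of f f'] assms
 have "((\<lambda>t. f (u + t *\<^sub>R v)) has_derivative (\<lambda>s. f' (s *\<^sub>R v))) (at 0)"
  by (simp add: comp_def)
 then have "((\<lambda>t. norm (f (u + t *\<^sub>R v) - f u - f' (t *\<^sub>R v)) / norm t) \<longlongrightarrow> 0) (at 0)"
  unfolding has_derivative_at by simp
 moreover have "filterlim (\<lambda>n. 1 / real (Suc n)) (at 0) sequentially"
  using LIMSEQ_inverse_real_of_nat by (auto simp: filterlim_at divide_inverse)
 ultimately have "(\<lambda>n. norm (f (u + (1 / real (Suc n)) *\<^sub>R v) - f u - f' ((1 / real (Suc n)) *\<^sub>R v))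
   / norm (1 / real (Suc n))) \<longlonglongrightarrow> 0"
  by (rule filterlim_compose)
 moreover have "norm (f (u + (1 / real (Suc n)) *\<^sub>R v) - f u - f' ((1 / real (Suc n)) *\<^sub>R v))
   / norm (1 / real (Suc n)) = norm (real (Suc n) *\<^sub>R (f (u + (1 / real (Suc n)) *\<^sub>R v) - f u) - f' v)" for n
 proof -
  have "real (Suc n) *\<^sub>R (f (u + (1 / real (Suc n)) *\<^sub>R v) - f u) - f' v =
    real (Suc n) *\<^sub>R (f (u + (1 / real (Suc n)) *\<^sub>R v) - f u - f' ((1 / real (Suc n)) *\<^sub>R v))"
   by (simp add: linear_cmul[OF lin] scaleR_diff_right)
  then have "norm (real (Suc n) *\<^sub>R (f (u + (1 / real (Suc n)) *\<^sub>R v) - f u) - f' v) =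
    real (Suc n) * norm (f (u + (1 / real (Suc n)) *\<^sub>R v) - f u - f' ((1 / real (Suc n)) *\<^sub>R v))"
   by (simp only: norm_scaleR abs_of_nat)
  then show ?thesis by (simp del: of_nat_Suc)
 qed
 ultimately have "(\<lambda>n. norm (real (Suc n) *\<^sub>R (f (u + (1 / real (Suc n)) *\<^sub>R v) - f u) - f' v)) \<longlonglongrightarrow> 0"
  by simp
 then show ?thesis by (simp only: tendsto_norm_zero_iff LIM_zero_iff)
qed

lemma Cauchy_dominated:
 fixes s :: "nat \<Rightarrow> 'a::real_normed_vector" and \<alpha> :: "nat \<Rightarrow> 'b::real_normed_vector" and \<beta> :: "nat \<Rightarrow> real"
 assumes \<alpha>: "Cauchy \<alpha>" and \<beta>: "\<beta> \<longlonglongrightarrow> 0"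
  and b: "\<And>m n. m \<ge> k \<Longrightarrow> n \<ge> k \<Longrightarrow> norm (s m - s n) \<le> 2 * (norm (\<alpha> m - \<alpha> n) + (\<beta> m + \<beta> n))"
 shows "Cauchy s"
proof (rule metric_CauchyI)
 fix e :: real assume e: "0 < e"
 obtain M1 where M1: "\<And>m n. m \<ge> M1 \<Longrightarrow> n \<ge> M1 \<Longrightarrow> dist (\<alpha> m) (\<alpha> n) < e / 8"
  using metric_CauchyD[OF \<alpha>, of "e / 8"] e by auto
 obtain M2 where M2: "\<And>n. n \<ge> M2 \<Longrightarrow> dist (\<beta> n) 0 < e / 8"
  using metric_LIMSEQ_D[OF \<beta>, of "e / 8"] e by auto
 show "\<exists>M. \<forall>m\<ge>M. \<forall>n\<ge>M. dist (s m) (s n) < e"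
 proof (intro exI allI impI)
  fix m n assume "max k (max M1 M2) \<le> m" "max k (max M1 M2) \<le> n"
  then have mn: "m \<ge> k" "n \<ge> k" "m \<ge> M1" "n \<ge> M1" "m \<ge> M2" "n \<ge> M2" by auto
  have "\<beta> m < e / 8" "\<beta> n < e / 8" using M2[OF mn(5)] M2[OF mn(6)] by (auto simp: dist_real_def)
  then show "dist (s m) (s n) < e"
   using b[OF mn(1,2)] M1[OF mn(3,4)] e unfolding dist_norm by argo
 qed
qed

lemma sum_UNIV_option: "(\<Sum>j\<in>(UNIV :: 'm::finite option set). f j) = f None + (\<Sum>i\<in>UNIV. f (Some i))"
 unfolding UNIV_option_conv by (subst sum.insert) (auto simp: sum.reindex)

text \<open>\<open>\<Gamma>\<close> stands for the flow map at time \<open>h\<close>: combinations of its finite differences behave as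
 under a linear map, up to quadratic errors. Hence \<open>\<Gamma> \<circ> \<phi>\<close> is \<open>C\<^sup>1\<close> although \<open>\<Gamma>\<close> is only known on \<open>M\<close>.\<close>

locale near_identity =
 fixes M :: "'a::euclidean_space set" and \<Gamma> :: "'a \<Rightarrow> 'a" and V :: "'a \<Rightarrow> 'a" and V' and h C :: real
  and dummy :: "'m::finite itself"
 assumes lip: "\<And>x y. x \<in> M \<Longrightarrow> y \<in> M \<Longrightarrow> norm (\<Gamma> x - \<Gamma> y) \<le> 2 * norm (x - y)"
  and inv_lip: "\<And>x y. x \<in> M \<Longrightarrow> y \<in> M \<Longrightarrow> norm (x - y) \<le> 2 * norm (\<Gamma> x - \<Gamma> y)"
  and comb: "\<And>(c :: 'm option \<Rightarrow> real) x y z. (\<And>j. x j \<in> M) \<Longrightarrow> (\<And>j. y j \<in> M) \<Longrightarrow> z \<in> M \<Longrightarrow>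
   norm (\<Sum>j\<in>UNIV. c j *\<^sub>R (\<Gamma> (x j) - \<Gamma> (y j))) \<le> 2 * (norm (\<Sum>j\<in>UNIV. c j *\<^sub>R (x j - y j)) +
   2 * (\<Sum>j\<in>UNIV. \<bar>c j\<bar> * ((norm (x j - y j) + norm (y j - z)) * norm (x j - y j))))"
  and first_order: "\<And>x y. x \<in> M \<Longrightarrow> y \<in> M \<Longrightarrow>
   norm ((\<Gamma> x - \<Gamma> y) - (x - y) - h *\<^sub>R (V x - V y)) \<le> C * norm (x - y)"
  and derV: "\<And>x. x \<in> M \<Longrightarrow> (V has_derivative V' x) (at x)"
begin

text \<open>The type \<open>'m option\<close> provides m + 1 terms: one increment and m coordinate
  directions. Here only two of them get nonzero coefficients, \<open>None\<close> and an arbitrary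
  index \<open>i0\<close>.\<close>

lemma comb2:
 assumes "x \<in> M" "y \<in> M" "x' \<in> M" "y' \<in> M"
 shows "norm (c *\<^sub>R (\<Gamma> x' - \<Gamma> y') - d *\<^sub>R (\<Gamma> x - \<Gamma> y)) \<le> 2 * (norm (c *\<^sub>R (x' - y') - d *\<^sub>R (x - y)) +
  2 * (\<bar>c\<bar> * ((norm (x' - y') + norm (y' - y)) * norm (x' - y')) + \<bar>d\<bar> * (norm (x - y) * norm (x - y))))"
proof -
 define i0 where "i0 = (undefined :: 'm)"
 define cc where "cc j = (case j of None \<Rightarrow> c | Some i \<Rightarrow> if i = i0 then - d else 0)" for j
 define xx where "xx j = (case j of None \<Rightarrow> x' | Some (i :: 'm) \<Rightarrow> x)" for j
 define yy where "yy j = (case j of None \<Rightarrow> y' | Some (i :: 'm) \<Rightarrow> y)" for j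
 have s: "(\<Sum>j\<in>UNIV. cc j *\<^sub>R (f (xx j) - f (yy j))) = c *\<^sub>R (f x' - f y') - d *\<^sub>R (f x - f y)" for f :: "'a \<Rightarrow> 'a"
  by (simp add: sum_UNIV_option cc_def xx_def yy_def if_distrib[of "\<lambda>t. t *\<^sub>R _"] cong: if_cong)
 have s2: "(\<Sum>j\<in>UNIV. \<bar>cc j\<bar> * ((norm (xx j - yy j) + norm (yy j - y)) * norm (xx j - yy j))) =
   \<bar>c\<bar> * ((norm (x' - y') + norm (y' - y)) * norm (x' - y')) + \<bar>d\<bar> * (norm (x - y) * norm (x - y))"
  by (simp add: sum_UNIV_option cc_def xx_def yy_def if_distrib[of abs] if_distrib[of "\<lambda>t. t * _"] cong: if_cong)
 show ?thesis
  using comb[of xx yy y cc] assms s[of \<Gamma>] s[of "\<lambda>x. x"] s2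
  by (auto simp: xx_def yy_def split: option.splits)
qed

context
 fixes W :: "(real^'m) set" and \<phi> :: "real^'m \<Rightarrow> 'a"
 assumes W: "open W" and \<phi>M: "\<phi> ` W \<subseteq> M" and C1: "Ck_on 1 \<phi> W"
begin

private abbreviation "A \<equiv> \<lambda>u. FD \<phi> u"

private lemma inM: "u \<in> W \<Longrightarrow> \<phi> u \<in> M" using \<phi>M by auto

private lemma derA: "u \<in> W \<Longrightarrow> (\<phi> has_derivative A u) (at u)"
 using C1 by (simp flip: frechet_derivative_works)

private definition S0 where "S0 u v n = real (Suc n) *\<^sub>R (\<phi> (u + (1 / real (Suc n)) *\<^sub>R v) - \<phi> u)"
private definition S1 where "S1 u v n = real (Suc n) *\<^sub>R (\<Gamma> (\<phi> (u + (1 / real (Suc n)) *\<^sub>R v)) - \<Gamma> (\<phi> u))"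
private definition N0 where "N0 u v n = norm (\<phi> (u + (1 / real (Suc n)) *\<^sub>R v) - \<phi> u)"

private lemma S0_lim: "u \<in> W \<Longrightarrow> S0 u v \<longlonglongrightarrow> A u v"
 unfolding S0_def by (rule has_derivative_sequence[OF derA])

private lemma step_lim: "(\<lambda>n. (u :: real^'m) + (1 / real (Suc n)) *\<^sub>R v) \<longlonglongrightarrow> u"
proof -
 have "(\<lambda>n. u + inverse (real (Suc n)) *\<^sub>R v) \<longlonglongrightarrow> u + 0 *\<^sub>R v"
  by (intro tendsto_add tendsto_scaleR tendsto_const LIMSEQ_inverse_real_of_nat)
 then show ?thesis by (simp add: divide_inverse)
qed

private lemma step_in: "u \<in> W \<Longrightarrow> \<forall>\<^sub>F n in sequentially. u + (1 / real (Suc n)) *\<^sub>R v \<in> W"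
 using topological_tendstoD[OF step_lim W] by blast

private lemma N0_lim: "u \<in> W \<Longrightarrow> N0 u v \<longlonglongrightarrow> 0"
proof -
 assume u: "u \<in> W"
 have "isCont \<phi> u" using derA[OF u] by (rule has_derivative_continuous)
 then have "(\<lambda>n. \<phi> (u + (1 / real (Suc n)) *\<^sub>R v) - \<phi> u) \<longlonglongrightarrow> \<phi> u - \<phi> u"
  by (intro tendsto_diff tendsto_const isCont_tendsto_compose[OF _ step_lim])
 then show ?thesis unfolding N0_def by (simp add: tendsto_norm_zero)
qed

private lemma error_lim:
 assumes u: "u \<in> W"
 shows "(\<lambda>n. real (Suc n) * ((N0 u v n + d) * N0 u v n)) \<longlonglongrightarrow> d * norm (A u v)"
proof -
 have "(\<lambda>n. (N0 u v n + d) * norm (S0 u v n)) \<longlonglongrightarrow> (0 + d) * norm (A u v)"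
  by (intro tendsto_intros N0_lim[OF u] S0_lim[OF u])
 moreover have "(N0 u v n + d) * norm (S0 u v n) = real (Suc n) * ((N0 u v n + d) * N0 u v n)" for n
  by (simp add: S0_def N0_def mult_ac del: of_nat_Suc)
 ultimately show ?thesis by simp
qed

text \<open>By \<open>comb2\<close> the difference of two quotients of the moved chart is bounded by
  that of the original chart plus errors that vanish with the steps. The limit is thus found as a
  Cauchy limit before any derivative is known.\<close>

private lemma S1_convergent: "u \<in> W \<Longrightarrow> convergent (S1 u v)"
proof -
 assume u: "u \<in> W"
 obtain k where k: "\<And>n. n \<ge> k \<Longrightarrow> u + (1 / real (Suc n)) *\<^sub>R v \<in> W"
  using step_in[OF u, of v] unfolding eventually_sequentially by blast
 have "Cauchy (S1 u v)"
 proof (rule Cauchy_dominated[where \<alpha> = "S0 u v" and \<beta> = "\<lambda>n. 2 * (real (Suc n) * ((N0 u v n + 0) * N0 u v n))" and k = k])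
  show "Cauchy (S0 u v)" using S0_lim[OF u] by (intro convergent_Cauchy) (auto simp: convergent_def)
  show "(\<lambda>n. 2 * (real (Suc n) * ((N0 u v n + 0) * N0 u v n))) \<longlonglongrightarrow> 0"
   using tendsto_mult_left[OF error_lim[OF u, of v 0], of 2] by simp
  fix m n assume mn: "m \<ge> k" "n \<ge> k"
  show "norm (S1 u v m - S1 u v n) \<le> 2 * (norm (S0 u v m - S0 u v n) +
    (2 * (real (Suc m) * ((N0 u v m + 0) * N0 u v m)) + 2 * (real (Suc n) * ((N0 u v n + 0) * N0 u v n))))"
   using comb2[OF inM[OF k[OF mn(2)]] inM[OF u] inM[OF k[OF mn(1)]] inM[OF u], of "real (Suc m)" "real (Suc n)"]
   unfolding S1_def S0_def N0_def abs_of_nat by (simp add: algebra_simps del: of_nat_Suc)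
 qed
 then show ?thesis by (rule Cauchy_convergent)
qed

text \<open>Built from the limits along the coordinate axes so that linearity is automatic; that it
  gives the limits in all directions is \<open>S1_lim\<close>, after differentiability has been
  shown.\<close>

private definition B where "B u v = (\<Sum>i\<in>UNIV. v $ i *\<^sub>R lim (S1 u (axis i 1)))"

private lemma linear_B: "linear (B u)"
 by (rule linearI) (simp_all add: B_def scaleR_add_left sum.distrib scaleR_sum_right)

text \<open>The combination of one increment with the coordinate quotients is estimated by
  \<open>comb\<close>, and the steps of the quotients are sent to 0. Their quadratic errors
  disappear and only the square of the increment itself stays.\<close>

private lemma B_bound:
 assumes u: "u \<in> W" and k: "u + k \<in> W"
 shows "norm (\<Gamma> (\<phi> (u + k)) - \<Gamma> (\<phi> u) - B u k) \<le>
  2 * (norm (\<phi> (u + k) - \<phi> u - A u k) + 2 * (norm (\<phi> (u + k) - \<phi> u))\<^sup>2)"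
proof -
 define T where "T n = \<Gamma> (\<phi> (u + k)) - \<Gamma> (\<phi> u) - (\<Sum>i\<in>UNIV. k $ i *\<^sub>R S1 u (axis i 1) n)" for n
 define T0 where "T0 n = \<phi> (u + k) - \<phi> u - (\<Sum>i\<in>UNIV. k $ i *\<^sub>R S0 u (axis i 1) n)" for n
 define e where "e n = (\<Sum>i\<in>UNIV. \<bar>k $ i\<bar> * (real (Suc n) * ((N0 u (axis i 1) n + 0) * N0 u (axis i 1) n)))" for n
 have "T \<longlonglongrightarrow> \<Gamma> (\<phi> (u + k)) - \<Gamma> (\<phi> u) - B u k"
  unfolding T_def B_def using S1_convergent[OF u] by (intro tendsto_intros) (simp add: convergent_LIMSEQ_iff)
 then have T: "(\<lambda>n. norm (T n)) \<longlonglongrightarrow> norm (\<Gamma> (\<phi> (u + k)) - \<Gamma> (\<phi> u) - B u k)" by (rule tendsto_norm)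
 have Ak: "A u k = (\<Sum>i\<in>UNIV. k $ i *\<^sub>R A u (axis i 1))"
 proof -
  have lin: "linear (A u)" using derA[OF u] by (rule has_derivative_linear)
  have "A u k = A u (\<Sum>i\<in>UNIV. k $ i *\<^sub>R axis i 1)"
   by (simp add: basis_expansion flip: scalar_mult_eq_scaleR)
  then show ?thesis by (simp add: linear_sum[OF lin] linear_cmul[OF lin])
 qed
 have "T0 \<longlonglongrightarrow> \<phi> (u + k) - \<phi> u - A u k"
  unfolding T0_def Ak by (intro tendsto_intros S0_lim[OF u])
 moreover have "e \<longlonglongrightarrow> (\<Sum>i\<in>UNIV. \<bar>k $ i\<bar> * (0 * norm (A u (axis i 1))))"
  unfolding e_def by (intro tendsto_sum tendsto_mult_left error_lim[OF u])
 ultimately have R: "(\<lambda>n. 2 * (norm (T0 n) + 2 * ((norm (\<phi> (u + k) - \<phi> u))\<^sup>2 + e n))) \<longlonglongrightarrow>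
   2 * (norm (\<phi> (u + k) - \<phi> u - A u k) + 2 * ((norm (\<phi> (u + k) - \<phi> u))\<^sup>2 + 0))"
  by (intro tendsto_intros) auto
 have "\<forall>\<^sub>F n in sequentially. \<forall>i. u + (1 / real (Suc n)) *\<^sub>R axis i 1 \<in> W"
  using step_in[OF u] by (intro eventually_all_finite)
 then have "\<forall>\<^sub>F n in sequentially. norm (T n) \<le> 2 * (norm (T0 n) + 2 * ((norm (\<phi> (u + k) - \<phi> u))\<^sup>2 + e n))"
 proof eventually_elim
  case (elim n)
  \<comment> \<open>\<open>None\<close> carries the increment, \<open>Some i\<close> the i-th
    quotient with the weight that turns the combination into the remainder
    \<open>T n\<close>.\<close>
  define c where "c j = (case j of None \<Rightarrow> 1 | Some i \<Rightarrow> - (k $ i * real (Suc n)))" for j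
  define x where "x j = (case j of None \<Rightarrow> \<phi> (u + k) | Some i \<Rightarrow> \<phi> (u + (1 / real (Suc n)) *\<^sub>R axis i 1))" for j
  have "x j \<in> M" for j unfolding x_def using elim inM[OF k] inM by (cases j) auto
  note * = comb[of x "\<lambda>_. \<phi> u" "\<phi> u" c, OF this inM[OF u] inM[OF u]]
  have "(\<Sum>j\<in>UNIV. c j *\<^sub>R (\<Gamma> (x j) - \<Gamma> (\<phi> u))) = T n"
   by (simp add: sum_UNIV_option c_def x_def T_def S1_def sum_negf del: of_nat_Suc)
  moreover have "(\<Sum>j\<in>UNIV. c j *\<^sub>R (x j - \<phi> u)) = T0 n"
   by (simp add: sum_UNIV_option c_def x_def T0_def S0_def sum_negf del: of_nat_Suc)
  moreover have "(\<Sum>j\<in>UNIV. \<bar>c j\<bar> * ((norm (x j - \<phi> u) + norm (\<phi> u - \<phi> u)) * norm (x j - \<phi> u))) =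
    (norm (\<phi> (u + k) - \<phi> u))\<^sup>2 + e n"
   by (simp add: sum_UNIV_option c_def x_def e_def N0_def power2_eq_square abs_mult mult_ac del: of_nat_Suc)
  ultimately show ?case using * by simp
 qed
 then have "norm (\<Gamma> (\<phi> (u + k)) - \<Gamma> (\<phi> u) - B u k) \<le>
   2 * (norm (\<phi> (u + k) - \<phi> u - A u k) + 2 * ((norm (\<phi> (u + k) - \<phi> u))\<^sup>2 + 0))"
  by (intro tendsto_le[OF _ R T]) auto
 then show ?thesis by simp
qed

text \<open>The remainder of the moved chart is bounded by that of the chart and the square of its
  increment; both are of smaller order than \<open>norm k\<close>.\<close>

private lemma has_derivative_B: "u \<in> W \<Longrightarrow> ((\<lambda>u. \<Gamma> (\<phi> u)) has_derivative B u) (at u)"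
proof -
 assume u: "u \<in> W"
 define q where "q k = norm (\<phi> (u + k) - \<phi> u - A u k) / norm k" for k
 have q: "(q \<longlongrightarrow> 0) (at 0)" using derA[OF u] unfolding has_derivative_at q_def by simp
 have bl: "bounded_linear (A u)" using derA[OF u] by (rule has_derivative_bounded_linear)
 obtain K where K: "\<And>k. norm (A u k) \<le> norm k * K" using bounded_linear.bounded[OF bl] by blast
 have "isCont \<phi> u" using derA[OF u] by (rule has_derivative_continuous)
 then have n0: "((\<lambda>k. norm (\<phi> (u + k) - \<phi> u)) \<longlongrightarrow> 0) (at 0)"
  unfolding isCont_iff by (rule tendsto_norm_zero[OF LIM_zero])
 have lim: "((\<lambda>k. 2 * (q k + 2 * ((q k + K) * norm (\<phi> (u + k) - \<phi> u)))) \<longlongrightarrow> 2 * (0 + 2 * ((0 + K) * 0))) (at 0)"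
  by (intro tendsto_intros q n0)
 have Win: "\<forall>\<^sub>F k in at 0. u + k \<in> W"
 proof -
  have "((\<lambda>k. u + k) \<longlongrightarrow> u + 0) (at 0)" by (intro tendsto_intros)
  from topological_tendstoD[OF this W] show ?thesis using u by simp
 qed
 have "((\<lambda>k. norm (\<Gamma> (\<phi> (u + k)) - \<Gamma> (\<phi> u) - B u k) / norm k) \<longlongrightarrow> 0) (at 0)"
 proof (rule Lim_null_comparison)
  show "\<forall>\<^sub>F k in at 0. norm (norm (\<Gamma> (\<phi> (u + k)) - \<Gamma> (\<phi> u) - B u k) / norm k) \<le>
    2 * (q k + 2 * ((q k + K) * norm (\<phi> (u + k) - \<phi> u)))"
   using Win eventually_neq_at_within[of 0]
  proof eventually_elim
   case (elim k)
   then have k: "0 < norm k" by simp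
   have qk: "norm (\<phi> (u + k) - \<phi> u - A u k) = q k * norm k" using k by (simp add: q_def)
   have "norm (\<phi> (u + k) - \<phi> u) \<le> norm (\<phi> (u + k) - \<phi> u - A u k) + norm (A u k)"
    by (metis diff_add_cancel norm_triangle_ineq)
   then have "norm (\<phi> (u + k) - \<phi> u) \<le> (q k + K) * norm k"
    using K[of k] qk by (simp add: algebra_simps)
   then have "(norm (\<phi> (u + k) - \<phi> u))\<^sup>2 \<le> ((q k + K) * norm k) * norm (\<phi> (u + k) - \<phi> u)"
    unfolding power2_eq_square by (intro mult_right_mono) auto
   then have "norm (\<Gamma> (\<phi> (u + k)) - \<Gamma> (\<phi> u) - B u k) \<le>
     2 * (q k * norm k + 2 * (((q k + K) * norm k) * norm (\<phi> (u + k) - \<phi> u)))"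
    using B_bound[OF u elim(1)] unfolding qk by argo
   also have "\<dots> = 2 * (q k + 2 * ((q k + K) * norm (\<phi> (u + k) - \<phi> u))) * norm k"
    by (simp add: algebra_simps)
   finally show ?case using k by (simp add: pos_divide_le_eq)
  qed
 qed (use lim in simp)
 then show ?thesis
  unfolding has_derivative_at using linear_B[of u] by (simp add: linear_conv_bounded_linear)
qed

private lemma frechet_B: "u \<in> W \<Longrightarrow> FD (\<lambda>u. \<Gamma> (\<phi> u)) u = B u"
 using has_derivative_B by (rule frechet_derivative_at[symmetric])

private lemma S1_lim: "u \<in> W \<Longrightarrow> S1 u v \<longlonglongrightarrow> B u v"
 unfolding S1_def by (rule has_derivative_sequence[OF has_derivative_B])

text \<open>The assumption \<open>first_order\<close>, applied to difference quotients and passed to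
  the limit.\<close>

lemma near_identity_derivative_bound:
 assumes u: "u \<in> W"
 shows "norm (FD (\<lambda>u. \<Gamma> (\<phi> u)) u v - A u v - h *\<^sub>R V' (\<phi> u) (A u v)) \<le> C * norm (A u v)"
proof -
 define SV where "SV n = real (Suc n) *\<^sub>R (V (\<phi> (u + (1 / real (Suc n)) *\<^sub>R v)) - V (\<phi> u))" for n
 have "((\<lambda>u. V (\<phi> u)) has_derivative (\<lambda>v. V' (\<phi> u) (A u v))) (at u)"
  using diff_chain_at[OF derA[OF u] derV[OF inM[OF u]]] by (simp add: comp_def)
 from has_derivative_sequence[OF this, of v] have SV: "SV \<longlonglongrightarrow> V' (\<phi> u) (A u v)" unfolding SV_def .
 have l: "(\<lambda>n. norm (S1 u v n - S0 u v n - h *\<^sub>R SV n)) \<longlonglongrightarrow> norm (B u v - A u v - h *\<^sub>R V' (\<phi> u) (A u v))"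
  by (intro tendsto_intros S1_lim[OF u] S0_lim[OF u] SV)
 have r: "(\<lambda>n. C * norm (S0 u v n)) \<longlonglongrightarrow> C * norm (A u v)"
  by (intro tendsto_intros S0_lim[OF u])
 have "\<forall>\<^sub>F n in sequentially. norm (S1 u v n - S0 u v n - h *\<^sub>R SV n) \<le> C * norm (S0 u v n)"
  using step_in[OF u, of v]
 proof eventually_elim
  case (elim n)
  let ?x = "\<phi> (u + (1 / real (Suc n)) *\<^sub>R v)" and ?y = "\<phi> u" and ?N = "real (Suc n)"
  have "S1 u v n - S0 u v n - h *\<^sub>R SV n = ?N *\<^sub>R ((\<Gamma> ?x - \<Gamma> ?y) - (?x - ?y) - h *\<^sub>R (V ?x - V ?y))"
   unfolding S1_def S0_def SV_def by (simp only: scaleR_diff_right scaleR_left_commute)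
  then have "norm (S1 u v n - S0 u v n - h *\<^sub>R SV n) = ?N * norm ((\<Gamma> ?x - \<Gamma> ?y) - (?x - ?y) - h *\<^sub>R (V ?x - V ?y))"
   by (simp only: norm_scaleR abs_of_nat)
  also have "\<dots> \<le> ?N * (C * norm (?x - ?y))"
   by (intro mult_left_mono first_order inM elim u) auto
  also have "\<dots> = C * norm (S0 u v n)" by (simp add: S0_def mult_ac del: of_nat_Suc)
  finally show ?case .
 qed
 then show ?thesis unfolding frechet_B[OF u] by (intro tendsto_le[OF _ r l]) auto
qed

text \<open>The lower Lipschitz bound of \<open>\<Gamma>\<close> in the limit; it transfers
  injectivity from the derivative of the chart.\<close>

private lemma B_lower: "u \<in> W \<Longrightarrow> norm (A u v) \<le> 2 * norm (B u v)"
proof -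
 assume u: "u \<in> W"
 have l: "(\<lambda>n. norm (S0 u v n)) \<longlonglongrightarrow> norm (A u v)" by (intro tendsto_intros S0_lim[OF u])
 have r: "(\<lambda>n. 2 * norm (S1 u v n)) \<longlonglongrightarrow> 2 * norm (B u v)" by (intro tendsto_intros S1_lim[OF u])
 have "\<forall>\<^sub>F n in sequentially. norm (S0 u v n) \<le> 2 * norm (S1 u v n)"
  using step_in[OF u, of v]
 proof eventually_elim
  case (elim n)
  show ?case using mult_left_mono[OF inv_lip[OF inM[OF elim] inM[OF u]], of "real (Suc n)"]
   unfolding S0_def S1_def by (simp add: mult_ac del: of_nat_Suc)
 qed
 then show ?thesis by (intro tendsto_le[OF _ r l]) auto
qed

text \<open>Quotients at two base points are compared by \<open>comb2\<close>. The distance of the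
  base points enters the error linearly, which gives continuity of the derivative.\<close>

private lemma B_continuity:
 assumes u: "u \<in> W" and u': "u' \<in> W"
 shows "norm (B u' v - B u v) \<le> 2 * (norm (A u' v - A u v) + 2 * (norm (\<phi> u' - \<phi> u) * norm (A u' v)))"
proof -
 let ?d = "norm (\<phi> u' - \<phi> u)"
 define e where "e n = real (Suc n) * ((N0 u' v n + ?d) * N0 u' v n) + real (Suc n) * ((N0 u v n + 0) * N0 u v n)" for n
 have e: "e \<longlonglongrightarrow> ?d * norm (A u' v) + 0 * norm (A u v)"
  unfolding e_def by (intro tendsto_add error_lim u u')
 have l: "(\<lambda>n. norm (S1 u' v n - S1 u v n)) \<longlonglongrightarrow> norm (B u' v - B u v)"
  by (intro tendsto_intros S1_lim u u')
 have r: "(\<lambda>n. 2 * (norm (S0 u' v n - S0 u v n) + 2 * e n)) \<longlonglongrightarrow>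
   2 * (norm (A u' v - A u v) + 2 * (?d * norm (A u' v) + 0 * norm (A u v)))"
  by (intro tendsto_intros S0_lim u u' e)
 have "\<forall>\<^sub>F n in sequentially. norm (S1 u' v n - S1 u v n) \<le> 2 * (norm (S0 u' v n - S0 u v n) + 2 * e n)"
  using step_in[OF u, of v] step_in[OF u', of v]
 proof eventually_elim
  case (elim n)
  show ?case
   using comb2[OF inM[OF elim(1)] inM[OF u] inM[OF elim(2)] inM[OF u'], of "real (Suc n)" "real (Suc n)"]
   unfolding S0_def S1_def e_def N0_def by (simp del: of_nat_Suc)
 qed
 then have "norm (B u' v - B u v) \<le> 2 * (norm (A u' v - A u v) + 2 * (?d * norm (A u' v) + 0 * norm (A u v)))"
  by (intro tendsto_le[OF _ r l]) auto
 then show ?thesis by simp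
qed

lemma near_identity_C1: "Ck_on 1 (\<lambda>u. \<Gamma> (\<phi> u)) W"
proof -
 have "Ck_on (Suc 0) (\<lambda>u. \<Gamma> (\<phi> u)) W"
 proof (rule Ck_on_SucI[OF W has_derivative_B])
  fix v
  have cA: "continuous_on W (\<lambda>u. A u v)" using C1 by simp
  have c\<phi>: "continuous_on W \<phi>" using C1 by (rule Ck_on_continuous_on)
  have "continuous_on W (\<lambda>u. B u v)"
   unfolding continuous_on_def
  proof
   fix u assume u: "u \<in> W"
   have A: "((\<lambda>u'. A u' v) \<longlongrightarrow> A u v) (at u within W)" using cA u unfolding continuous_on_def by blast
   have P: "(\<phi> \<longlongrightarrow> \<phi> u) (at u within W)" using c\<phi> u unfolding continuous_on_def by blast
   have lim: "((\<lambda>u'. 2 * (norm (A u' v - A u v) + 2 * (norm (\<phi> u' - \<phi> u) * norm (A u' v)))) \<longlongrightarrow>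
     2 * (norm (A u v - A u v) + 2 * (norm (\<phi> u - \<phi> u) * norm (A u v)))) (at u within W)"
    by (intro tendsto_intros A P)
   have "((\<lambda>u'. B u' v - B u v) \<longlongrightarrow> 0) (at u within W)"
   proof (rule Lim_null_comparison)
    show "\<forall>\<^sub>F u' in at u within W. norm (B u' v - B u v) \<le>
      2 * (norm (A u' v - A u v) + 2 * (norm (\<phi> u' - \<phi> u) * norm (A u' v)))"
     unfolding eventually_at_filter using B_continuity[OF u] by (intro always_eventually) blast
   qed (use lim in simp)
   then show "((\<lambda>u'. B u' v) \<longlongrightarrow> B u v) (at u within W)" by (rule LIM_zero_cancel)
  qed
  then show "Ck_on 0 (\<lambda>u. B u v) W" by simp
 qed
 then show ?thesis by (simp only: One_nat_def)
qed

lemma near_identity_derivative_inj: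
 assumes u: "u \<in> W" and inj: "inj (A u)"
 shows "inj (FD (\<lambda>u. \<Gamma> (\<phi> u)) u)"
 unfolding frechet_B[OF u]
proof (rule linear_injective_0[OF linear_B, THEN iffD2], intro allI impI)
 fix v assume "B u v = 0"
 then have "A u v = 0" using B_lower[OF u, of v] by simp
 moreover have "linear (A u)" using derA[OF u] by (rule has_derivative_linear)
 ultimately show "v = 0" using inj linear_injective_0 by blast
qed

end

lemma near_identity_inj: "inj_on \<Gamma> M"
proof (rule inj_onI)
 fix x y assume "x \<in> M" "y \<in> M" "\<Gamma> x = \<Gamma> y"
 then show "x = y" using inv_lip[of x y] by simp
qed

lemma continuous_inverse: "continuous_on (\<Gamma> ` M) (inv_into M \<Gamma>)"
proof -
 have "2-lipschitz_on (\<Gamma> ` M) (inv_into M \<Gamma>)"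
 proof (rule lipschitz_onI)
  fix a b assume "a \<in> \<Gamma> ` M" "b \<in> \<Gamma> ` M"
  then obtain x y where xy: "x \<in> M" "y \<in> M" "a = \<Gamma> x" "b = \<Gamma> y" by blast
  show "dist (inv_into M \<Gamma> a) (inv_into M \<Gamma> b) \<le> 2 * dist a b"
   using inv_lip[OF xy(1,2)] xy near_identity_inj by (simp add: dist_norm)
 qed simp
 then show ?thesis by (rule lipschitz_on_continuous_on)
qed

end

text \<open>The inverse of \<open>\<Gamma>\<close> on the moved set is Lipschitz, so homeomorphisms
  and relatively open sets are carried over; regularity and injectivity of the derivative come from
  the preceding estimates.\<close>

lemma near_identity_local_parametrization:
 fixes M :: "'n::finite point set" and \<phi> :: "real^'m::finite \<Rightarrow> 'n point"
 assumes ni: "near_identity TYPE('m) M \<Gamma> V V' h C" and \<phi>: "local_parametrization M W \<phi>"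
 shows "local_parametrization (\<Gamma> ` M) W (\<lambda>u. \<Gamma> (\<phi> u))"
proof -
 interpret near_identity M \<Gamma> V V' h C "TYPE('m)" by (rule ni)
 have sub: "\<phi> ` W \<subseteq> M" by (rule local_parametrization_subset[OF \<phi>])
 have W: "open W" and C1: "Ck_on 1 \<phi> W" using local_parametrization_Ck[OF \<phi>] by auto
 obtain g where g: "homeomorphism W (\<phi> ` W) \<phi> g" using \<phi> unfolding local_parametrization_def by blast
 have "openin (top_of_set M) (\<phi> ` W)" using \<phi> by (simp add: local_parametrization_def)
 then obtain S where S: "open S" "\<phi> ` W = M \<inter> S" unfolding openin_open by blast
 note inv = inv_into_f_f[OF near_identity_inj]
 have c\<Gamma>: "continuous_on M \<Gamma>"
 proof -
  have "2-lipschitz_on M \<Gamma>" by (rule lipschitz_onI) (auto simp: dist_norm lip)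
  then show ?thesis by (rule lipschitz_on_continuous_on)
 qed
 have im: "(\<lambda>u. \<Gamma> (\<phi> u)) ` W = \<Gamma> ` \<phi> ` W" by (simp add: image_image)
 show ?thesis unfolding local_parametrization_def
 proof (intro conjI ballI exI)
  show "open W" by (rule W)
  show "Ck_on 1 (\<lambda>u. \<Gamma> (\<phi> u)) W" by (rule near_identity_C1[OF W sub C1])
  show "inj (FD (\<lambda>u. \<Gamma> (\<phi> u)) u)" if u: "u \<in> W" for u
  proof (rule near_identity_derivative_inj[OF W sub C1 u])
   show "inj (FD \<phi> u)" using \<phi> u by (simp add: local_parametrization_def)
  qed
  show "homeomorphism W ((\<lambda>u. \<Gamma> (\<phi> u)) ` W) (\<lambda>u. \<Gamma> (\<phi> u)) (\<lambda>y. g (inv_into M \<Gamma> y))"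
   unfolding im
  proof (rule homeomorphismI)
   show "continuous_on W (\<lambda>u. \<Gamma> (\<phi> u))"
    using Ck_on_continuous_on[OF near_identity_C1[OF W sub C1]] .
   have "inv_into M \<Gamma> ` \<Gamma> ` \<phi> ` W \<subseteq> \<phi> ` W"
    using inv sub by (auto simp: image_subset_iff)
   moreover have "continuous_on (\<Gamma> ` \<phi> ` W) (inv_into M \<Gamma>)"
    using sub by (intro continuous_on_subset[OF continuous_inverse]) auto
   moreover have "continuous_on (\<phi> ` W) g" using g by (simp add: homeomorphism_def)
   ultimately show "continuous_on (\<Gamma> ` \<phi> ` W) (\<lambda>y. g (inv_into M \<Gamma> y))"
    using continuous_on_compose2 by metis
   have gi: "g (inv_into M \<Gamma> (\<Gamma> (\<phi> u))) = u" if "u \<in> W" for u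
   proof -
    have "inv_into M \<Gamma> (\<Gamma> (\<phi> u)) = \<phi> u" using sub that by (intro inv) auto
    then show ?thesis using g that by (simp add: homeomorphism_def)
   qed
   then show "g (inv_into M \<Gamma> (\<Gamma> (\<phi> x))) = x" if "x \<in> W" for x using that by blast
   show "\<Gamma> (\<phi> (g (inv_into M \<Gamma> y))) = y" if "y \<in> \<Gamma> ` \<phi> ` W" for y
    using that gi by auto
   show "(\<lambda>y. g (inv_into M \<Gamma> y)) ` \<Gamma> ` \<phi> ` W \<subseteq> W" using gi by (auto simp: image_subset_iff)
  qed auto
  have "openin (top_of_set (\<Gamma> ` M)) (\<Gamma> ` M \<inter> inv_into M \<Gamma> -` S)"
   by (rule continuous_openin_preimage_gen[OF continuous_inverse S(1)])
  moreover have "\<Gamma> ` M \<inter> inv_into M \<Gamma> -` S = \<Gamma> ` (M \<inter> S)" using inv by auto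
  ultimately show "openin (top_of_set (\<Gamma> ` M)) ((\<lambda>u. \<Gamma> (\<phi> u)) ` W)"
   by (simp add: im S(2))
 qed
qed

section \<open>Derivatives of Gram determinants and of integrals over a fixed set\<close>

lemma has_real_derivative_prod:
 fixes f :: "'i \<Rightarrow> real \<Rightarrow> real"
 assumes "finite I" "\<And>i. i \<in> I \<Longrightarrow> (f i has_real_derivative f' i) (at x within S)"
 shows "((\<lambda>x. \<Prod>i\<in>I. f i x) has_real_derivative (\<Sum>i\<in>I. f' i * (\<Prod>j\<in>I - {i}. f j x))) (at x within S)"
proof -
 have "((\<lambda>x. \<Prod>i\<in>I. f i x) has_derivative (\<lambda>y. \<Sum>i\<in>I. (f' i * y) * (\<Prod>j\<in>I - {i}. f j x))) (at x within S)"
  using assms(2) by (intro has_derivative_prod) (simp add: has_field_derivative_def)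
 moreover have "(\<lambda>y. \<Sum>i\<in>I. (f' i * y) * (\<Prod>j\<in>I - {i}. f j x)) = (*) (\<Sum>i\<in>I. f' i * (\<Prod>j\<in>I - {i}. f j x))"
  by (simp add: fun_eq_iff sum_distrib_left mult_ac)
 ultimately show ?thesis by (simp add: has_field_derivative_def)
qed

text \<open>A permutation other than the identity moves at least two indices, so after one factor is
  differentiated an off-diagonal entry of the identity remains.\<close>

lemma has_real_derivative_det_at_identity:
 fixes F :: "real \<Rightarrow> real^'m^'m::finite"
 assumes F: "\<And>i j. ((\<lambda>h. F h $ i $ j) has_real_derivative F' $ i $ j) (at 0 within J)" and F0: "F 0 = mat 1"
 shows "((\<lambda>h. det (F h)) has_real_derivative trace F') (at 0 within J)"
proof -
 let ?P = "{p. p permutes (UNIV :: 'm set)}"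
 let ?t = "\<lambda>p. of_int (sign p) * (\<Sum>i\<in>UNIV. F' $ i $ p i * (\<Prod>j\<in>UNIV - {i}. F 0 $ j $ p j))"
 have "((\<lambda>h. det (F h)) has_real_derivative (\<Sum>p\<in>?P. ?t p)) (at 0 within J)"
  unfolding det_def by (intro DERIV_sum DERIV_cmult has_real_derivative_prod F) auto
 moreover have "(\<Sum>p\<in>?P. ?t p) = (\<Sum>p\<in>?P. if p = id then trace F' else 0)"
 proof (rule sum.cong[OF refl])
  fix p assume "p \<in> ?P"
  then have p: "p permutes UNIV" by simp
  show "?t p = (if p = id then trace F' else 0)"
  proof (cases "p = id")
   case True
   then show ?thesis by (simp add: F0 mat_def trace_def)
  next
   case False
   have "(\<Prod>j\<in>UNIV - {i}. F 0 $ j $ p j) = 0" for i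
   proof -
    obtain j where j: "p j \<noteq> j" using False by (auto simp: fun_eq_iff)
    then have "p (p j) \<noteq> p j" using permutes_inj[OF p] by (simp add: inj_eq)
    then obtain k where "k \<noteq> i" "p k \<noteq> k" using j by metis
    then show ?thesis by (auto simp: prod_zero_iff F0 mat_def intro!: bexI[of _ k])
   qed
   then have "?t p = of_int (sign p) * (\<Sum>i\<in>UNIV. F' $ i $ p i * 0)" by (simp only:)
   then show ?thesis using False by simp
  qed
 qed
 moreover have "\<dots> = trace F'"
  by (simp add: sum.delta permutes_id)
 ultimately show ?thesis by simp
qed

text \<open>Multiplication by the constant inverse \<open>B\<close> moves the base point to the
  identity matrix.\<close>

lemma has_real_derivative_det:
 fixes G :: "real \<Rightarrow> real^'m^'m::finite"
 assumes G: "\<And>i j. ((\<lambda>h. G h $ i $ j) has_real_derivative G' $ i $ j) (at 0 within J)" and B: "B ** G 0 = mat 1"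
 shows "((\<lambda>h. det (G h)) has_real_derivative det (G 0) * trace (B ** G')) (at 0 within J)"
proof -
 have "((\<lambda>h. det (B ** G h)) has_real_derivative trace (B ** G')) (at 0 within J)"
 proof (rule has_real_derivative_det_at_identity[where F="\<lambda>h. B ** G h"])
  show "((\<lambda>h. (B ** G h) $ i $ j) has_real_derivative (B ** G') $ i $ j) (at 0 within J)" for i j
   unfolding matrix_matrix_mult_def vec_lambda_beta by (intro DERIV_sum DERIV_cmult G)
 qed (rule B)
 then have "((\<lambda>h. det (G 0) * det (B ** G h)) has_real_derivative det (G 0) * trace (B ** G')) (at 0 within J)"
  by (rule DERIV_cmult)
 moreover have "det (G 0) * det (B ** G h) = det (G h)" for h
 proof -
  have "det B * det (G 0) = 1" using B by (simp add: det_mul[symmetric] det_I)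
  then show ?thesis by (simp add: det_mul mult_ac)
 qed
 ultimately show ?thesis by simp
qed

text \<open>Summing the columns of the inverse Gram matrix against the frame gives its dual frame,
  so the logarithmic derivative of the volume is a trace in dual frames. The square root halves the
  two equal contributions of the product rule.\<close>

lemma has_real_derivative_sqrt_gram:
 fixes b :: "real \<Rightarrow> 'm::finite \<Rightarrow> 'a::real_inner"
 assumes b: "\<And>i. ((\<lambda>h. b h i) has_vector_derivative b' i) (at 0 within J)"
  and B: "B ** (\<chi> i j. b 0 i \<bullet> b 0 j) = mat 1" and sym: "\<And>i j. B $ i $ j = B $ j $ i"
  and pos: "0 < det (\<chi> i j. b 0 i \<bullet> b 0 j)"
 shows "((\<lambda>h. sqrt (det (\<chi> i j. b h i \<bullet> b h j))) has_real_derivative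
  sqrt (det (\<chi> i j. b 0 i \<bullet> b 0 j)) * (\<Sum>j\<in>UNIV. b' j \<bullet> (\<Sum>i\<in>UNIV. B $ i $ j *\<^sub>R b 0 i))) (at 0 within J)"
proof -
 define G where "G h = (\<chi> i j. b h i \<bullet> b h j)" for h
 define G' where "G' = (\<chi> i j. b 0 i \<bullet> b' j + b' i \<bullet> b 0 j)"
 define s where "s = (\<Sum>j\<in>UNIV. b' j \<bullet> (\<Sum>i\<in>UNIV. B $ i $ j *\<^sub>R b 0 i))"
 have "((\<lambda>h. G h $ i $ j) has_real_derivative G' $ i $ j) (at 0 within J)" for i j
 proof -
  have "((\<lambda>h. b h i \<bullet> b h j) has_derivative (\<lambda>s. b 0 i \<bullet> (s *\<^sub>R b' j) + (s *\<^sub>R b' i) \<bullet> b 0 j)) (at 0 within J)"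
   by (intro has_derivative_inner b[unfolded has_vector_derivative_def])
  moreover have "(\<lambda>s. b 0 i \<bullet> (s *\<^sub>R b' j) + (s *\<^sub>R b' i) \<bullet> b 0 j) = (*) (G' $ i $ j)"
   by (simp add: G'_def fun_eq_iff algebra_simps)
  ultimately show ?thesis by (simp add: has_field_derivative_def G_def)
 qed
 from has_real_derivative_det[OF this, of B] B
 have d: "((\<lambda>h. det (G h)) has_real_derivative det (G 0) * trace (B ** G')) (at 0 within J)"
  by (simp add: G_def)
 have "trace (B ** G') = (\<Sum>i\<in>UNIV. \<Sum>j\<in>UNIV. B $ i $ j * (b 0 j \<bullet> b' i)) + (\<Sum>i\<in>UNIV. \<Sum>j\<in>UNIV. B $ i $ j * (b' j \<bullet> b 0 i))"
  by (simp add: trace_def matrix_matrix_mult_def G'_def distrib_left sum.distrib)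
 also have "(\<Sum>i\<in>UNIV. \<Sum>j\<in>UNIV. B $ i $ j * (b 0 j \<bullet> b' i)) = (\<Sum>i\<in>UNIV. b' i \<bullet> (\<Sum>j\<in>UNIV. B $ j $ i *\<^sub>R b 0 j))"
  by (simp add: inner_sum_right inner_commute sym)
 also have "(\<Sum>i\<in>UNIV. \<Sum>j\<in>UNIV. B $ i $ j * (b' j \<bullet> b 0 i)) = (\<Sum>j\<in>UNIV. b' j \<bullet> (\<Sum>i\<in>UNIV. B $ i $ j *\<^sub>R b 0 i))"
  by (subst sum.swap) (simp add: inner_sum_right)
 finally have tr: "trace (B ** G') = 2 * s" by (simp add: s_def)
 have p: "0 < det (G 0)" using pos by (simp add: G_def)
 have "((\<lambda>h. sqrt (det (G h))) has_real_derivative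
   (inverse (sqrt (det (G 0))) / 2) * (det (G 0) * trace (B ** G'))) (at 0 within J)"
  using DERIV_chain2[OF DERIV_real_sqrt d] p by (simp add: mult.commute)
 moreover have "(inverse (sqrt (det (G 0))) / 2) * (det (G 0) * trace (B ** G')) = sqrt (det (G 0)) * s"
 proof -
  have "inverse (sqrt (det (G 0))) * det (G 0) = sqrt (det (G 0))"
   using p by (simp add: inverse_eq_divide real_div_sqrt)
  then have "(inverse (sqrt (det (G 0))) / 2) * (det (G 0) * (2 * s)) = sqrt (det (G 0)) * s" by simp
  then show ?thesis using tr by simp
 qed
 ultimately show ?thesis by (simp add: G_def s_def)
qed

lemma norm_matrix_le:
 fixes A :: "real^'m::finite^'m"
 assumes "\<And>i j. \<bar>A $ i $ j\<bar> \<le> a"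
 shows "norm A \<le> (real CARD('m))\<^sup>2 * a"
proof -
 have "norm A \<le> (\<Sum>i\<in>UNIV. norm (A $ i))"
  unfolding norm_vec_def[of A] by (rule L2_set_le_sum) simp
 also have "\<dots> \<le> (\<Sum>i\<in>(UNIV :: 'm set). real CARD('m) * a)"
 proof (rule sum_mono)
  fix i
  have "norm (A $ i) \<le> (\<Sum>j\<in>UNIV. \<bar>A $ i $ j\<bar>)" by (rule norm_le_l1_cart)
  also have "\<dots> \<le> (\<Sum>j\<in>(UNIV :: 'm set). a)" by (intro sum_mono assms)
  finally show "norm (A $ i) \<le> real CARD('m) * a" by simp
 qed
 finally show ?thesis by (simp add: power2_eq_square mult_ac)
qed

lemma sqrt_diff_le:
 assumes "0 \<le> a" "0 < d" "d \<le> sqrt b"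
 shows "\<bar>sqrt a - sqrt b\<bar> \<le> \<bar>a - b\<bar> / d"
proof -
 have b: "0 < b" using assms by (meson less_le_trans real_sqrt_gt_0_iff)
 have "d * \<bar>sqrt a - sqrt b\<bar> \<le> (sqrt a + sqrt b) * \<bar>sqrt a - sqrt b\<bar>"
  using assms by (intro mult_right_mono) (auto intro: add_increasing)
 also have "\<dots> = \<bar>(sqrt a + sqrt b) * (sqrt a - sqrt b)\<bar>"
  using assms b by (simp add: abs_mult)
 also have "(sqrt a + sqrt b) * (sqrt a - sqrt b) = a - b"
  using assms(1) b by (simp add: algebra_simps)
 finally show ?thesis using assms(2) by (simp add: field_simps)
qed

text \<open>Here \<open>C\<close> is fixed before the frames and \<open>h\<close>, so it is uniform
  over a compact parameter set. The bound \<open>d\<close> keeps the root away from 0, where it is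
  not Lipschitz.\<close>

lemma sqrt_gram_lipschitz:
 fixes T E d :: real
 assumes "0 \<le> T" "0 \<le> E" "0 < d"
 obtains C where "0 \<le> C" "\<And>(b :: 'm::finite \<Rightarrow> 'a::real_inner) b0 h. (\<And>i. norm (b0 i) \<le> T) \<Longrightarrow>
  (\<And>i. norm (b i - b0 i) \<le> \<bar>h\<bar> * E) \<Longrightarrow> \<bar>h\<bar> \<le> 1 \<Longrightarrow> 0 \<le> det (\<chi> i j. b i \<bullet> b j) \<Longrightarrow> d \<le> sqrt (det (\<chi> i j. b0 i \<bullet> b0 j)) \<Longrightarrow>
  \<bar>sqrt (det (\<chi> i j. b i \<bullet> b j)) - sqrt (det (\<chi> i j. b0 i \<bullet> b0 j))\<bar> \<le> C * \<bar>h\<bar>"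
proof -
 define R where "R = (real CARD('m))\<^sup>2 * ((T + E) * (T + E))"
 have "Ck_on 1 (\<lambda>A :: real^'m^'m. det A) UNIV"
 proof (rule Ck_on_det[OF open_UNIV])
  fix i j
  have "linear (\<lambda>A :: real^'m^'m. A $ i $ j)" by (rule linearI) simp_all
  then show "Ck_on 1 (\<lambda>A :: real^'m^'m. A $ i $ j) UNIV" by (intro Ck_on_linear) (auto simp: linear_conv_bounded_linear)
 qed
 from C1_bounds[OF this, of R] obtain L where L: "0 \<le> L"
  "\<And>A B :: real^'m^'m. A \<in> cball 0 R \<Longrightarrow> B \<in> cball 0 R \<Longrightarrow> norm (det A - det B) \<le> L * norm (A - B)" by metis
 define C where "C = L * ((real CARD('m))\<^sup>2 * (E * (2 * T + E))) / d"
 show thesis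
 proof
  show "0 \<le> C" using assms L by (simp add: C_def)
  fix b b0 :: "'m \<Rightarrow> 'a" and h
  assume b0: "\<And>i. norm (b0 i) \<le> T" and b: "\<And>i. norm (b i - b0 i) \<le> \<bar>h\<bar> * E" and h: "\<bar>h\<bar> \<le> 1"
   and pos: "0 \<le> det (\<chi> i j. b i \<bullet> b j)" "d \<le> sqrt (det (\<chi> i j. b0 i \<bullet> b0 j))"
  define G where "G = (\<chi> i j. b i \<bullet> b j)"
  define G0 where "G0 = (\<chi> i j. b0 i \<bullet> b0 j)"
  have hE: "\<bar>h\<bar> * E \<le> E" using h assms(2) by (simp add: mult_left_le_one_le)
  have nb: "norm (b i) \<le> T + E" for i
   using norm_triangle_ineq[of "b0 i" "b i - b0 i"] b0[of i] b[of i] hE by simp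
  have in1: "\<bar>b i \<bullet> b j\<bar> \<le> (T + E) * (T + E)" for i j
   using Cauchy_Schwarz_ineq2[of "b i" "b j"] mult_mono[OF nb[of i] nb[of j]] assms by simp
  have in0: "\<bar>b0 i \<bullet> b0 j\<bar> \<le> (T + E) * (T + E)" for i j
  proof -
   have "norm (b0 i) \<le> T + E" for i using b0[of i] assms by simp
   then have "norm (b0 i) * norm (b0 j) \<le> (T + E) * (T + E)" using assms by (intro mult_mono) auto
   then show ?thesis using Cauchy_Schwarz_ineq2[of "b0 i" "b0 j"] by simp
  qed
  have "norm (G - G0) \<le> (real CARD('m))\<^sup>2 * (\<bar>h\<bar> * (E * (2 * T + E)))"
  proof (rule norm_matrix_le)
   fix i j
   have "b i \<bullet> b j - b0 i \<bullet> b0 j = (b i - b0 i) \<bullet> b j + b0 i \<bullet> (b j - b0 j)"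
    by (simp add: algebra_simps)
   moreover have "\<bar>(b i - b0 i) \<bullet> b j\<bar> \<le> (\<bar>h\<bar> * E) * (T + E)"
    using Cauchy_Schwarz_ineq2[of "b i - b0 i" "b j"] mult_mono[OF b[of i] nb[of j]] assms by simp
   moreover have "\<bar>b0 i \<bullet> (b j - b0 j)\<bar> \<le> T * (\<bar>h\<bar> * E)"
    using Cauchy_Schwarz_ineq2[of "b0 i" "b j - b0 j"] mult_mono[OF b0[of i] b[of j]] assms by simp
   moreover have "(\<bar>h\<bar> * E) * (T + E) + T * (\<bar>h\<bar> * E) = \<bar>h\<bar> * (E * (2 * T + E))"
    by (simp add: algebra_simps)
   ultimately show "\<bar>(G - G0) $ i $ j\<bar> \<le> \<bar>h\<bar> * (E * (2 * T + E))"
    by (simp add: G_def G0_def)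
  qed
  then have "L * norm (G - G0) \<le> L * ((real CARD('m))\<^sup>2 * (\<bar>h\<bar> * (E * (2 * T + E))))"
   using L(1) by (rule mult_left_mono)
  moreover have "norm G \<le> R" "norm G0 \<le> R"
   unfolding R_def by (rule norm_matrix_le, simp add: G_def G0_def in1 in0)+
  ultimately have "\<bar>det G - det G0\<bar> \<le> L * ((real CARD('m))\<^sup>2 * (\<bar>h\<bar> * (E * (2 * T + E))))"
   using L(2)[of G G0] by simp
  then have "\<bar>det G - det G0\<bar> / d \<le> C * \<bar>h\<bar>"
   using assms(3) by (simp add: C_def field_simps)
  moreover have "\<bar>sqrt (det G) - sqrt (det G0)\<bar> \<le> \<bar>det G - det G0\<bar> / d"
   using pos assms(3) by (intro sqrt_diff_le) (auto simp: G_def G0_def)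
  ultimately show "\<bar>sqrt (det (\<chi> i j. b i \<bullet> b j)) - sqrt (det (\<chi> i j. b0 i \<bullet> b0 j))\<bar> \<le> C * \<bar>h\<bar>"
   by (simp add: G_def G0_def)
 qed
qed

text \<open>Dominated convergence along sequences in \<open>J\<close>; the Lipschitz bound at 0,
  uniform in \<open>u\<close>, supplies the majorant. Only the derivative at time 0 is used, and
  \<open>J\<close> may be one-sided.\<close>

lemma has_real_derivative_set_integral:
 fixes f :: "real \<Rightarrow> 'a \<Rightarrow> real"
 assumes A: "A \<in> sets \<mu>" "emeasure \<mu> A < \<infinity>" and J: "0 \<in> J"
  and int: "\<And>h. h \<in> J \<Longrightarrow> set_integrable \<mu> A (f h)"
  and der: "\<And>u. u \<in> A \<Longrightarrow> ((\<lambda>h. f h u) has_real_derivative g u) (at 0 within J)"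
  and lip: "\<And>h u. h \<in> J \<Longrightarrow> u \<in> A \<Longrightarrow> \<bar>f h u - f 0 u\<bar> \<le> C * \<bar>h\<bar>"
 shows "((\<lambda>h. LINT u:A|\<mu>. f h u) has_real_derivative (LINT u:A|\<mu>. g u)) (at 0 within J)"
 unfolding has_field_derivative_iff tendsto_at_iff_sequentially
proof (intro allI impI)
 fix X :: "nat \<Rightarrow> real"
 assume X: "\<forall>i. X i \<in> J - {0}" and lim: "X \<longlonglongrightarrow> 0"
 define q where "q n u = (f (X n) u - f 0 u) / (X n - 0)" for n u
 have XJ: "X n \<in> J" "X n \<noteq> 0" for n using X by auto
 have intq: "set_integrable \<mu> A (q n)" for n
  unfolding q_def by (intro set_integrable_divide set_integral_diff(1) int XJ J)
 have q: "(\<lambda>n. q n u) \<longlonglongrightarrow> g u" if u: "u \<in> A" for u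
  using der[OF u] X lim unfolding has_field_derivative_iff tendsto_at_iff_sequentially q_def comp_def by blast
 have "(\<lambda>n. LINT u:A|\<mu>. q n u) \<longlonglongrightarrow> (LINT u:A|\<mu>. g u)"
  unfolding set_lebesgue_integral_def
 proof (rule integral_dominated_convergence[where w="\<lambda>u. C * indicator A u"])
  have m: "(\<lambda>u. indicator A u *\<^sub>R q n u) \<in> borel_measurable \<mu>" for n
   using intq[of n] by (auto simp: set_integrable_def dest: borel_measurable_integrable)
  then show "(\<lambda>u. indicator A u *\<^sub>R q n u) \<in> borel_measurable \<mu>" for n .
  have l: "(\<lambda>n. indicator A u *\<^sub>R q n u) \<longlonglongrightarrow> indicator A u *\<^sub>R g u" for u
  proof (cases "u \<in> A")
   case True then show ?thesis using q[of u] by simp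
  qed simp
  show "(\<lambda>u. indicator A u *\<^sub>R g u) \<in> borel_measurable \<mu>"
   by (rule borel_measurable_LIMSEQ_real[OF l m])
  show "integrable \<mu> (\<lambda>u. C * indicator A u)"
   using A by (intro integrable_mult_right integrable_real_indicator) auto
  show "AE u in \<mu>. (\<lambda>n. indicator A u *\<^sub>R q n u) \<longlonglongrightarrow> indicator A u *\<^sub>R g u"
   using l by simp
  show "AE u in \<mu>. norm (indicator A u *\<^sub>R q n u) \<le> C * indicator A u" for n
  proof (rule AE_I2)
   fix u
   show "norm (indicator A u *\<^sub>R q n u) \<le> C * indicator A u"
   proof (cases "u \<in> A")
    case True
    have "0 < \<bar>X n\<bar>" using XJ[of n] by simp
    then show ?thesis using lip[OF XJ(1)[of n] True] True by (simp add: q_def divide_le_eq)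
   qed simp
  qed
 qed
 moreover have "(LINT u:A|\<mu>. q n u) = ((LINT u:A|\<mu>. f (X n) u) - (LINT u:A|\<mu>. f 0 u)) / (X n - 0)" for n
  unfolding q_def by (simp add: set_integral_divide_zero set_integral_diff int XJ J)
 ultimately show "((\<lambda>y. ((LINT u:A|\<mu>. f y u) - (LINT u:A|\<mu>. f 0 u)) / (y - 0)) \<circ> X) \<longlonglongrightarrow> (LINT u:A|\<mu>. g u)"
  by (simp add: comp_def)
qed

lemma has_vector_derivative_quadratic:
 fixes f :: "real \<Rightarrow> 'a::real_normed_vector"
 assumes "\<And>h. h \<in> J \<Longrightarrow> norm (f h - f 0 - h *\<^sub>R d) \<le> c * h\<^sup>2"
 shows "(f has_vector_derivative d) (at 0 within J)"
 unfolding has_vector_derivative_def has_derivative_within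
proof
 show "bounded_linear (\<lambda>h. h *\<^sub>R d)" by (rule bounded_linear_scaleR_left)
 show "((\<lambda>y. (1 / norm (y - 0)) *\<^sub>R (f y - (f 0 + (y - 0) *\<^sub>R d))) \<longlongrightarrow> 0) (at 0 within J)"
 proof (rule Lim_null_comparison)
  show "\<forall>\<^sub>F y in at 0 within J. norm ((1 / norm (y - 0)) *\<^sub>R (f y - (f 0 + (y - 0) *\<^sub>R d))) \<le> c * \<bar>y\<bar>"
   unfolding eventually_at_filter
  proof (intro always_eventually allI impI)
   fix y :: real assume y: "y \<noteq> 0" "y \<in> J"
   have "norm (f y - (f 0 + y *\<^sub>R d)) \<le> c * \<bar>y\<bar> * \<bar>y\<bar>"
    using assms[OF y(2)] by (simp add: power2_eq_square algebra_simps abs_mult_self_eq)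
   then show "norm ((1 / norm (y - 0)) *\<^sub>R (f y - (f 0 + (y - 0) *\<^sub>R d))) \<le> c * \<bar>y\<bar>"
    using y(1) by (simp add: divide_le_eq mult.assoc)
  qed
  have "((\<lambda>y. c * \<bar>y\<bar>) \<longlongrightarrow> c * \<bar>0\<bar>) (at 0 within J)" by (intro tendsto_intros)
  then show "((\<lambda>y. c * \<bar>y\<bar>) \<longlongrightarrow> 0) (at 0 within J)" by simp
 qed
qed

section \<open>Moving charts: variation of the area density\<close>

text \<open>\<open>\<Gamma> h\<close> moves points of \<open>M\<close> by the flow for a further
  time h. The first order error \<open>E * h\<^sup>2\<close> is what makes tangent vectors of the
  moved charts differentiable in h at 0.\<close>

locale near_identity_family =
 fixes M :: "'n::finite point set" and \<Gamma> :: "real \<Rightarrow> 'n point \<Rightarrow> 'n point" and V :: "'n point \<Rightarrow> 'n point"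
  and V' and J :: "real set" and E :: real and dummy :: "'m::finite itself"
 assumes zero_in: "0 \<in> J" and small: "\<And>h. h \<in> J \<Longrightarrow> \<bar>h\<bar> \<le> 1" and E0: "0 \<le> E"
  and near: "\<And>h. h \<in> J \<Longrightarrow> near_identity TYPE('m) M (\<Gamma> h) V V' h (E * h\<^sup>2)"
  and \<Gamma>0: "\<And>y. y \<in> M \<Longrightarrow> \<Gamma> 0 y = y"
  and move: "\<And>h y. h \<in> J \<Longrightarrow> y \<in> M \<Longrightarrow> norm (\<Gamma> h y - y) \<le> E * \<bar>h\<bar>"
  and flow: "\<And>y. y \<in> M \<Longrightarrow> ((\<lambda>h. \<Gamma> h y) has_vector_derivative V y) (at 0 within J)"
  and bound: "\<And>y v. y \<in> M \<Longrightarrow> norm (V' y v) \<le> E * norm v"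

locale near_identity_chart = near_identity_family M \<Gamma> V V' J E "TYPE('m)" +
 adapted_chart M p U \<rho> e Va W \<phi>
 for M :: "'n::{finite,linorder} point set" and \<Gamma> V V' J E p U \<rho> and e :: "'m::finite \<Rightarrow> 'n point" and Va W \<phi>
begin

definition b :: "real^'m \<Rightarrow> real \<Rightarrow> 'm \<Rightarrow> 'n point" where
 "b u h i = FD (\<lambda>u. \<Gamma> h (\<phi> u)) u (axis i 1)"

lemma \<phi>_sub: "\<phi> ` W \<subseteq> M" and C1': "Ck_on 1 \<phi> W"
 using \<phi>_in C1 by (auto simp only: One_nat_def)

lemma b_bound:
 assumes "h \<in> J" "u \<in> W"
 shows "norm (b u h i - \<tau> i u - h *\<^sub>R V' (\<phi> u) (\<tau> i u)) \<le> E * h\<^sup>2 * norm (\<tau> i u)"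
 unfolding b_def \<tau>_def
 using near_identity.near_identity_derivative_bound[OF near[OF assms(1)] openW \<phi>_sub C1' assms(2)] .

lemma b_0: "u \<in> W \<Longrightarrow> b u 0 i = \<tau> i u"
 using b_bound[OF zero_in, of u i] by simp

lemma area_density_b: "area_density (\<lambda>u. \<Gamma> h (\<phi> u)) u = sqrt (det (\<chi> i j. b u h i \<bullet> b u h j))"
 by (simp add: area_density_def b_def)

lemma area_density_0: "u \<in> W \<Longrightarrow> area_density (\<lambda>u. \<Gamma> 0 (\<phi> u)) u = area_density \<phi> u"
 by (simp add: area_density_b b_0 area_density_eq gram_\<tau>_def)

text \<open>By \<open>b_bound\<close> the moved coordinate vectors have the derivative
  \<open>V'\<close> applied to \<open>\<tau>\<close>, and the dual frame of \<open>\<tau>\<close>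
  consists of the \<open>w\<close>; the result is the trace of \<open>V'\<close> over the tangent
  space.\<close>

lemma area_density_derivative:
 assumes u: "u \<in> W"
 shows "((\<lambda>h. area_density (\<lambda>u. \<Gamma> h (\<phi> u)) u) has_real_derivative
  area_density \<phi> u * tan_trace (N (\<phi> u)) (V' (\<phi> u))) (at 0 within J)"
proof -
 have lin: "linear (V' (\<phi> u))"
  using near_identity.derV[OF near[OF zero_in] \<phi>_in(1)[OF u]] by (rule has_derivative_linear)
 have der: "((\<lambda>h. b u h i) has_vector_derivative V' (\<phi> u) (\<tau> i u)) (at 0 within J)" for i
 proof (rule has_vector_derivative_quadratic)
  fix h assume "h \<in> J"
  then show "norm (b u h i - b u 0 i - h *\<^sub>R V' (\<phi> u) (\<tau> i u)) \<le> (E * norm (\<tau> i u)) * h\<^sup>2"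
   using b_bound[of h u i] u by (simp add: b_0 mult_ac)
 qed
 have G: "(\<chi> i j. b u 0 i \<bullet> b u 0 j) = gram_\<tau> u" by (simp add: b_0 u gram_\<tau>_def)
 have "((\<lambda>h. sqrt (det (\<chi> i j. b u h i \<bullet> b u h j))) has_real_derivative
  sqrt (det (\<chi> i j. b u 0 i \<bullet> b u 0 j)) *
   (\<Sum>j\<in>UNIV. V' (\<phi> u) (\<tau> j u) \<bullet> (\<Sum>i\<in>UNIV. gram_w (\<phi> u) $ i $ j *\<^sub>R b u 0 i))) (at 0 within J)"
 proof (rule has_real_derivative_sqrt_gram[OF der])
  show "gram_w (\<phi> u) ** (\<chi> i j. b u 0 i \<bullet> b u 0 j) = mat 1" unfolding G by (rule gram_inverse[OF u])
  show "gram_w (\<phi> u) $ i $ j = gram_w (\<phi> u) $ j $ i" for i j by (simp add: gram_w_def inner_commute)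
  show "0 < det (\<chi> i j. b u 0 i \<bullet> b u 0 j)" unfolding G by (rule det_gram_pos(2)[OF u])
 qed
 moreover have "(\<Sum>i\<in>UNIV. gram_w (\<phi> u) $ i $ j *\<^sub>R b u 0 i) = w j (\<phi> u)" for j
  using sum_gram_\<tau>[OF u, of j] by (simp add: gram_w_def b_0 u)
 ultimately show ?thesis
  unfolding area_density_b G by (simp add: area_density_eq tan_trace_eq(2)[OF u lin])
qed

text \<open>On a compact parameter set the coordinate vectors are bounded and the initial density is
  bounded below, which are the constants required by \<open>sqrt_gram_lipschitz\<close>.\<close>

lemma area_density_lipschitz:
 assumes K: "compact K" "K \<subseteq> W"
 obtains C where "0 \<le> C" "\<And>h u. h \<in> J \<Longrightarrow> u \<in> K \<Longrightarrow>
  \<bar>area_density (\<lambda>u. \<Gamma> h (\<phi> u)) u - area_density \<phi> u\<bar> \<le> C * \<bar>h\<bar>"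
proof (cases "K = {}")
 case True
 then show thesis using that[of 0] by simp
next
 case False
 have "continuous_on W (\<lambda>u. \<tau> i u)" for i using C1 by (simp add: \<tau>_def[abs_def])
 then have "continuous_on K (\<lambda>u. \<Sum>i\<in>UNIV. norm (\<tau> i u))"
  using K(2) by (intro continuous_intros) (auto intro: continuous_on_subset)
 from continuous_attains_sup[OF K(1) False this] obtain u0 where u0:
  "\<And>u. u \<in> K \<Longrightarrow> (\<Sum>i\<in>UNIV. norm (\<tau> i u)) \<le> (\<Sum>i\<in>UNIV. norm (\<tau> i u0))" by blast
 define T where "T = (\<Sum>i\<in>UNIV. norm (\<tau> i u0))"
 have T0: "0 \<le> T" by (simp add: T_def sum_nonneg)
 have T: "norm (\<tau> i u) \<le> T" if "u \<in> K" for i u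
  using member_le_sum[of i UNIV "\<lambda>i. norm (\<tau> i u)"] u0[OF that] by (simp add: T_def)
 have "continuous_on K (area_density \<phi>)"
  using continuous_on_area_density[OF C1'] K(2) by (rule continuous_on_subset)
 from continuous_attains_inf[OF K(1) False this] obtain u1 where u1: "u1 \<in> K"
  "\<And>u. u \<in> K \<Longrightarrow> area_density \<phi> u1 \<le> area_density \<phi> u" by blast
 have d0: "0 < area_density \<phi> u1" using area_density_pos u1(1) K(2) by blast
 obtain C where C: "0 \<le> C" "\<And>(b :: 'm \<Rightarrow> 'n point) b0 h. (\<And>i. norm (b0 i) \<le> T) \<Longrightarrow>
  (\<And>i. norm (b i - b0 i) \<le> \<bar>h\<bar> * (2 * E * T)) \<Longrightarrow> \<bar>h\<bar> \<le> 1 \<Longrightarrow> 0 \<le> det (\<chi> i j. b i \<bullet> b j) \<Longrightarrow>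
  area_density \<phi> u1 \<le> sqrt (det (\<chi> i j. b0 i \<bullet> b0 j)) \<Longrightarrow>
  \<bar>sqrt (det (\<chi> i j. b i \<bullet> b j)) - sqrt (det (\<chi> i j. b0 i \<bullet> b0 j))\<bar> \<le> C * \<bar>h\<bar>"
  using sqrt_gram_lipschitz[of T "2 * E * T" "area_density \<phi> u1"] T0 E0 d0 by (metis mult_nonneg_nonneg zero_le_numeral)
 show thesis
 proof (rule that[OF C(1)])
  fix h u assume h: "h \<in> J" and u: "u \<in> K"
  have uW: "u \<in> W" using u K(2) by blast
  have b: "norm (b u h i - b u 0 i) \<le> \<bar>h\<bar> * (2 * E * T)" for i
  proof -
   have "b u h i - b u 0 i = (b u h i - \<tau> i u - h *\<^sub>R V' (\<phi> u) (\<tau> i u)) + h *\<^sub>R V' (\<phi> u) (\<tau> i u)"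
    by (simp add: b_0[OF uW])
   then have "norm (b u h i - b u 0 i) \<le> E * h\<^sup>2 * norm (\<tau> i u) + \<bar>h\<bar> * norm (V' (\<phi> u) (\<tau> i u))"
    using norm_triangle_ineq[of "b u h i - \<tau> i u - h *\<^sub>R V' (\<phi> u) (\<tau> i u)" "h *\<^sub>R V' (\<phi> u) (\<tau> i u)"]
     b_bound[OF h uW, of i] by simp
   also have "\<dots> \<le> E * \<bar>h\<bar> * T + \<bar>h\<bar> * (E * T)"
   proof (intro add_mono mult_mono mult_left_mono)
    have "\<bar>h\<bar> * \<bar>h\<bar> \<le> \<bar>h\<bar> * 1" by (intro mult_left_mono small h) simp
    then show "h\<^sup>2 \<le> \<bar>h\<bar>" by (simp add: power2_eq_square)
    show "norm (V' (\<phi> u) (\<tau> i u)) \<le> E * T"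
     using bound[OF \<phi>_in(1)[OF uW], of "\<tau> i u"] mult_left_mono[OF T[OF u, of i] E0] by linarith
   qed (use E0 T0 T[OF u] in auto)
   finally show ?thesis by (simp add: algebra_simps)
  qed
  have g0: "sqrt (det (\<chi> i j. b u 0 i \<bullet> b u 0 j)) = area_density \<phi> u"
   using area_density_b[of 0 u] area_density_0[OF uW] by simp
  have "\<bar>sqrt (det (\<chi> i j. b u h i \<bullet> b u h j)) - sqrt (det (\<chi> i j. b u 0 i \<bullet> b u 0 j))\<bar> \<le> C * \<bar>h\<bar>"
  proof (rule C(2)[OF _ b small[OF h]])
   show "norm (b u 0 i) \<le> T" for i using T[OF u] by (simp add: b_0[OF uW])
   show "0 \<le> det (\<chi> i j. b u h i \<bullet> b u h j)" by (rule det_gram_nonneg)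
   show "area_density \<phi> u1 \<le> sqrt (det (\<chi> i j. b u 0 i \<bullet> b u 0 j))"
    unfolding g0 by (rule u1(2)[OF u])
  qed
  then show "\<bar>area_density (\<lambda>u. \<Gamma> h (\<phi> u)) u - area_density \<phi> u\<bar> \<le> C * \<bar>h\<bar>"
   unfolding area_density_b g0 .
 qed
qed

lemma chart_integral_derivative:
 assumes K: "compact K" "K \<subseteq> W" and A: "A \<subseteq> K" "A \<in> sets borel"
  and M: "bounded M" and f: "Ck_on 1 f UNIV"
  and int: "\<And>h. h \<in> J \<Longrightarrow> set_integrable lborel A (\<lambda>u. area_density (\<lambda>u. \<Gamma> h (\<phi> u)) u * f (\<Gamma> h (\<phi> u)))"
 shows "((\<lambda>h. LINT u:A|lborel. area_density (\<lambda>u. \<Gamma> h (\<phi> u)) u * f (\<Gamma> h (\<phi> u))) has_real_derivative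
  (LINT u:A|lborel. area_density \<phi> u * (tan_trace (N (\<phi> u)) (V' (\<phi> u)) * f (\<phi> u) + grad f (\<phi> u) \<bullet> V (\<phi> u))))
  (at 0 within J)"
proof -
 obtain R where R: "\<And>y. y \<in> M \<Longrightarrow> norm y \<le> R" using M unfolding bounded_iff by blast
 have inball: "\<Gamma> h y \<in> cball 0 (R + E)" if "h \<in> J" "y \<in> M" for h y
 proof -
  have "E * \<bar>h\<bar> \<le> E * 1" using small[OF that(1)] E0 by (rule mult_left_mono)
  then show ?thesis
   using norm_triangle_ineq[of y "\<Gamma> h y - y"] R[OF that(2)] move[OF that] by simp
 qed
 have cont: "continuous_on (cball 0 (R + E)) f"
  using Ck_on_continuous_on[OF f] by (rule continuous_on_subset) simp
 from compact_imp_bounded[OF compact_continuous_image[OF cont compact_cball]]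
 obtain B where B: "\<And>y. y \<in> cball 0 (R + E) \<Longrightarrow> norm (f y) \<le> B" unfolding bounded_iff by blast
 obtain Lf where Lf: "0 \<le> Lf" "\<And>x y. x \<in> cball 0 (R + E) \<Longrightarrow> y \<in> cball 0 (R + E) \<Longrightarrow> norm (f x - f y) \<le> Lf * norm (x - y)"
  using C1_bounds[OF f, of "R + E"] by metis
 obtain C where C: "0 \<le> C" "\<And>h u. h \<in> J \<Longrightarrow> u \<in> K \<Longrightarrow>
  \<bar>area_density (\<lambda>u. \<Gamma> h (\<phi> u)) u - area_density \<phi> u\<bar> \<le> C * \<bar>h\<bar>"
  using area_density_lipschitz[OF K] by metis
 have "continuous_on K (area_density \<phi>)"
  using continuous_on_area_density[OF C1'] K(2) by (rule continuous_on_subset)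
 from compact_imp_bounded[OF compact_continuous_image[OF this K(1)]]
 obtain D where D: "\<And>u. u \<in> K \<Longrightarrow> norm (area_density \<phi> u) \<le> D" unfolding bounded_iff by blast
 show ?thesis
 proof (rule has_real_derivative_set_integral[where C = "C * B + D * (Lf * E)", OF _ _ zero_in int])
  show "A \<in> sets lborel" using A by simp
  have "emeasure lborel A \<le> emeasure lborel K"
   using A(1) K(1) by (intro emeasure_mono) (auto simp: borel_compact)
  also have "\<dots> < \<infinity>" using emeasure_compact_finite[OF K(1)] by simp
  finally show "emeasure lborel A < \<infinity>" .
  fix u assume u: "u \<in> A"
  then have uK: "u \<in> K" and uW: "u \<in> W" using A(1) K(2) by auto
  have y: "\<phi> u \<in> M" by (rule \<phi>_in(1)[OF uW])
  have fd: "(f has_derivative (\<lambda>v. grad f (\<phi> u) \<bullet> v)) (at (\<phi> u))"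
   using f by (intro has_derivative_grad) simp
  have "((\<lambda>h. \<Gamma> h (\<phi> u)) has_derivative (\<lambda>s. s *\<^sub>R V (\<phi> u))) (at 0 within J)"
   using flow[OF y] by (simp add: has_vector_derivative_def)
  from has_derivative_compose[OF this, of f "\<lambda>v. grad f (\<phi> u) \<bullet> v"] fd
  have "((\<lambda>h. f (\<Gamma> h (\<phi> u))) has_derivative (\<lambda>s. grad f (\<phi> u) \<bullet> (s *\<^sub>R V (\<phi> u)))) (at 0 within J)"
   by (simp add: \<Gamma>0[OF y])
  then have fder: "((\<lambda>h. f (\<Gamma> h (\<phi> u))) has_real_derivative grad f (\<phi> u) \<bullet> V (\<phi> u)) (at 0 within J)"
   by (simp add: has_field_derivative_def mult_commute_abs)
  show "((\<lambda>h. area_density (\<lambda>u. \<Gamma> h (\<phi> u)) u * f (\<Gamma> h (\<phi> u))) has_real_derivative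
    area_density \<phi> u * (tan_trace (N (\<phi> u)) (V' (\<phi> u)) * f (\<phi> u) + grad f (\<phi> u) \<bullet> V (\<phi> u))) (at 0 within J)"
   using DERIV_mult[OF area_density_derivative[OF uW] fder]
   by (simp add: area_density_0[OF uW] \<Gamma>0[OF y] algebra_simps)
  fix h assume h: "h \<in> J"
  let ?d = "area_density (\<lambda>u. \<Gamma> h (\<phi> u)) u" and ?e = "area_density \<phi> u"
  let ?f = "f (\<Gamma> h (\<phi> u))" and ?g = "f (\<phi> u)"
  have in0: "\<phi> u \<in> cball 0 (R + E)" using R[OF y] E0 by simp
  have "norm (?f - ?g) \<le> Lf * (E * \<bar>h\<bar>)"
   using Lf(2)[OF inball[OF h y] in0] mult_left_mono[OF move[OF h y] Lf(1)] by linarith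
  then have 2: "\<bar>?e * (?f - ?g)\<bar> \<le> D * (Lf * (E * \<bar>h\<bar>))"
   using D[OF uK] unfolding abs_mult by (intro mult_mono) auto
  have 1: "\<bar>(?d - ?e) * ?f\<bar> \<le> C * \<bar>h\<bar> * B"
   using C(2)[OF h uK] B[OF inball[OF h y]] C(1) unfolding abs_mult by (intro mult_mono) auto
  have "?d * ?f - ?e * ?g = (?d - ?e) * ?f + ?e * (?f - ?g)" by (simp add: algebra_simps)
  then have "\<bar>?d * ?f - ?e * ?g\<bar> \<le> C * \<bar>h\<bar> * B + D * (Lf * (E * \<bar>h\<bar>))"
   using 1 2 by linarith
  then show "\<bar>?d * ?f - area_density (\<lambda>u. \<Gamma> 0 (\<phi> u)) u * f (\<Gamma> 0 (\<phi> u))\<bar> \<le> (C * B + D * (Lf * E)) * \<bar>h\<bar>"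
   by (simp add: area_density_0[OF uW] \<Gamma>0[OF y] algebra_simps)
 qed
qed

end

text \<open>The pieces of the initial atlas parametrize disjoint pieces of every moved manifold, so
  the integral is a sum over parameter sets that do not depend on h. The function
  \<open>\<theta>\<close> is assumed to be independent of the chart so that the derivatives add up
  to one surface integral.\<close>

lemma (in surface_atlas) surface_integral_derivative:
 assumes fam: "near_identity_family TYPE('m) M \<Gamma> X X' J E"
  and f: "Ck_on 1 f UNIV"
  and \<mu>: "\<And>h. h \<in> J \<Longrightarrow> is_surface_measure TYPE('m) (\<Gamma> h ` M) (\<mu> h)"
   "\<And>h. h \<in> J \<Longrightarrow> compact (\<Gamma> h ` M)"
  and \<theta>: "\<And>i y. i < L \<Longrightarrow> y \<in> M \<Longrightarrow> y \<in> V i \<Longrightarrow>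
   tan_trace (set (normals p (\<rho> i) y)) (X' y) * f y + grad f y \<bullet> X y = \<theta> y"
  and cont: "continuous_on M \<theta>"
 shows "((\<lambda>h. LINT y:\<Gamma> h ` M|\<mu> h. f y) has_real_derivative (LINT y:M|\<mu> 0. \<theta> y)) (at 0 within J)"
proof -
 interpret near_identity_family M \<Gamma> X X' J E "TYPE('m)" by (rule fam)
 have \<Gamma>0M: "\<Gamma> 0 ` M = M" using \<Gamma>0 by (simp add: image_def)
 have lp: "local_parametrization M (W i) (\<phi> i)" if "i < L" for i
  using adapted_chart.local_parametrization[OF adapted[OF that]] .
 have lpG: "local_parametrization (\<Gamma> h ` M) (W i) (\<lambda>u. \<Gamma> h (\<phi> i u))" if "h \<in> J" "i < L" for h i
  using near_identity_local_parametrization[OF near[OF that(1)] lp[OF that(2)]] .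
 have K: "A i \<subseteq> cball (c i) (r i)" "cball (c i) (r i) \<subseteq> W i" "compact (cball (c i) (r i))" "A i \<in> sets borel"
  if "i < L" for i
  using A_cball[OF that] ball[OF that] A_borel[OF that] by auto
 have pieces: "(LINT y:\<Gamma> h ` M|\<mu> h. f y) =
   (\<Sum>i<L. LINT u:A i|lborel. area_density (\<lambda>u. \<Gamma> h (\<phi> i u)) u * f (\<Gamma> h (\<phi> i u)))"
  and int: "\<And>i. i < L \<Longrightarrow> set_integrable lborel (A i) (\<lambda>u. area_density (\<lambda>u. \<Gamma> h (\<phi> i u)) u * f (\<Gamma> h (\<phi> i u)))"
  if h: "h \<in> J" for h
 proof -
  have im: "(\<lambda>u. \<Gamma> h (\<phi> i u)) ` A i = \<Gamma> h ` \<phi> i ` A i" for i by (simp add: image_image)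
  have sub: "\<phi> i ` A i \<subseteq> M" if "i < L" for i using image_A[OF that] by simp
  have disj: "(\<lambda>u. \<Gamma> h (\<phi> i u)) ` A i \<inter> (\<lambda>u. \<Gamma> h (\<phi> j u)) ` A j = {}" if "i < L" "j < L" "i \<noteq> j" for i j
   unfolding im
   using inj_on_image_Int[OF near_identity.near_identity_inj[OF near[OF h]] sub[OF that(1)] sub[OF that(2)]]
    image_A_disjoint[OF that] by simp
  have cover: "(\<Union>i<L. (\<lambda>u. \<Gamma> h (\<phi> i u)) ` A i) = \<Gamma> h ` M"
   unfolding im using union_image_A by (metis image_UN)
  have cf: "continuous_on (\<Gamma> h ` M) f" using Ck_on_continuous_on[OF f] by (rule continuous_on_subset) simp
  note pc = surface_integral_pieces[OF \<mu>[OF h] lpG[OF h] K disj cover cf]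
  show "(LINT y:\<Gamma> h ` M|\<mu> h. f y) =
   (\<Sum>i<L. LINT u:A i|lborel. area_density (\<lambda>u. \<Gamma> h (\<phi> i u)) u * f (\<Gamma> h (\<phi> i u)))"
   by (rule pc(1))
  show "\<And>i. i < L \<Longrightarrow> set_integrable lborel (A i) (\<lambda>u. area_density (\<lambda>u. \<Gamma> h (\<phi> i u)) u * f (\<Gamma> h (\<phi> i u)))"
   by (rule pc(3))
 qed
 have \<mu>0: "is_surface_measure TYPE('m) M (\<mu> 0)" using \<mu>(1)[OF zero_in] by (simp add: \<Gamma>0M)
 have \<theta>int: "(LINT y:M|\<mu> 0. \<theta> y) = (\<Sum>i<L. LINT u:A i|lborel. area_density (\<phi> i) u * \<theta> (\<phi> i u))"
  by (rule surface_integral_pieces(1)[OF \<mu>0 compactM lp K image_A_disjoint union_image_A cont])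
 have "((\<lambda>h. \<Sum>i<L. LINT u:A i|lborel. area_density (\<lambda>u. \<Gamma> h (\<phi> i u)) u * f (\<Gamma> h (\<phi> i u)))
   has_real_derivative (\<Sum>i<L. LINT u:A i|lborel. area_density (\<phi> i) u * \<theta> (\<phi> i u))) (at 0 within J)"
 proof (rule DERIV_sum)
  fix i assume "i \<in> {..<L}"
  then have i: "i < L" by simp
  interpret ch: adapted_chart M p "U i" "\<rho> i" "e i" "V i" "W i" "\<phi> i" by (rule adapted[OF i])
  interpret nc: near_identity_chart M \<Gamma> X X' J E p "U i" "\<rho> i" "e i" "V i" "W i" "\<phi> i" by unfold_locales
  have "((\<lambda>h. LINT u:A i|lborel. area_density (\<lambda>u. \<Gamma> h (\<phi> i u)) u * f (\<Gamma> h (\<phi> i u))) has_real_derivative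
   (LINT u:A i|lborel. area_density (\<phi> i) u *
    (tan_trace (ch.N (\<phi> i u)) (X' (\<phi> i u)) * f (\<phi> i u) + grad f (\<phi> i u) \<bullet> X (\<phi> i u)))) (at 0 within J)"
   by (rule nc.chart_integral_derivative[OF K(3)[OF i] K(2)[OF i] K(1)[OF i] K(4)[OF i] compact_imp_bounded[OF compactM] f int[OF _ i]])
  also have "(LINT u:A i|lborel. area_density (\<phi> i) u *
    (tan_trace (ch.N (\<phi> i u)) (X' (\<phi> i u)) * f (\<phi> i u) + grad f (\<phi> i u) \<bullet> X (\<phi> i u))) =
    (LINT u:A i|lborel. area_density (\<phi> i) u * \<theta> (\<phi> i u))"
  proof (rule set_lebesgue_integral_cong)
   show "A i \<in> sets lborel" using A_borel[OF i] by simp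
   have "tan_trace (ch.N (\<phi> i u)) (X' (\<phi> i u)) * f (\<phi> i u) + grad f (\<phi> i u) \<bullet> X (\<phi> i u) = \<theta> (\<phi> i u)"
    if "u \<in> A i" for u
   proof -
    have "u \<in> W i" using A_W that by blast
    then show ?thesis unfolding ch.N_def by (intro \<theta>[OF i] ch.\<phi>_in)
   qed
   then show "\<forall>u. u \<in> A i \<longrightarrow> area_density (\<phi> i) u *
    (tan_trace (ch.N (\<phi> i u)) (X' (\<phi> i u)) * f (\<phi> i u) + grad f (\<phi> i u) \<bullet> X (\<phi> i u)) =
    area_density (\<phi> i) u * \<theta> (\<phi> i u)" by simp
  qed
  finally show "((\<lambda>h. LINT u:A i|lborel. area_density (\<lambda>u. \<Gamma> h (\<phi> i u)) u * f (\<Gamma> h (\<phi> i u))) has_real_derivative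
   (LINT u:A i|lborel. area_density (\<phi> i) u * \<theta> (\<phi> i u))) (at 0 within J)" .
 qed
 then show ?thesis unfolding \<theta>int
  by (rule has_field_derivative_transform_within[OF _ zero_less_one zero_in]) (simp add: pieces)
qed

section \<open>The mean curvature vector\<close>

lemma adapted_chart_exists:
 fixes M :: "'n::{finite,linorder} point set"
 assumes sys: "orthonormal_system M p U \<rho>" and y: "y \<in> M" "y \<in> U" and dim: "p + CARD('m) = CARD('n)"
 obtains e :: "'m::finite \<Rightarrow> 'n point" and V W \<phi> where "adapted_chart M p U \<rho> e V W \<phi>" "y \<in> V"
proof -
 obtain e :: "'m \<Rightarrow> 'n point" and V W \<phi> where
  ch: "graph_chart M e V W \<phi>" "y \<in> V" "V \<subseteq> U"
  "\<And>u v. u \<in> W \<Longrightarrow> (\<forall>j<p. v \<bullet> grad (\<rho> j) (\<phi> u) = 0) \<Longrightarrow>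
    FD \<phi> u (coords e v) = v"
  using graph_chart_exists[OF sys y dim] by blast
 have "adapted_chart M p U \<rho> e V W \<phi>"
  by (rule adapted_chart.intro) (use sys ch in auto)
 then show thesis using that ch(2) by blast
qed

text \<open>A vector orthogonal to one set of normals is a derivative of the chart, and the other
  defining functions vanish along the chart.\<close>

lemma orthonormal_system_tangent:
 fixes M :: "'n::{finite,linorder} point set"
 assumes s1: "orthonormal_system M p U \<rho>" and s2: "orthonormal_system M p U' \<rho>'"
  and y: "y \<in> M" "y \<in> U" "y \<in> U'" and dim: "p + CARD('m::finite) = CARD('n)"
  and v: "\<forall>j<p. v \<bullet> grad (\<rho> j) y = 0" and j: "j < p"
 shows "v \<bullet> grad (\<rho>' j) y = 0"
proof -
 obtain e :: "'m \<Rightarrow> 'n point" and V W \<phi> where ad: "adapted_chart M p U \<rho> e V W \<phi>" and yV: "y \<in> V"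
  using adapted_chart_exists[OF s1 y(1,2) dim] by blast
 interpret adapted_chart M p U \<rho> e V W \<phi> by (rule ad)
 define u where "u = coords e y"
 have u: "u \<in> W" "\<phi> u = y" using coords_in[OF y(1) yV] by (auto simp: u_def)
 have op: "open U'" and sm: "smooth_on (\<rho>' j) U'" and z: "M \<inter> U' = {x\<in>U'. \<forall>j<p. \<rho>' j x = 0}"
  using s2 j by (auto simp: orthonormal_system_def)
 have "(\<rho>' j has_derivative (\<lambda>v. grad (\<rho>' j) (\<phi> u) \<bullet> v)) (at (\<phi> u))"
  using smooth_on_differentiable[OF sm y(3)] u by (intro has_derivative_grad) simp
 then have "grad (\<rho>' j) (\<phi> u) \<bullet> FD \<phi> u (coords e v) = 0"
  by (rule derivative_along_D\<phi>[OF u(1) _ op]) (use u y z j in auto)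
 moreover have "FD \<phi> u (coords e v) = v"
  using tangent[OF u(1)] v u(2) by simp
 ultimately show ?thesis by (simp add: u(2) inner_commute)
qed

lemma orthonormal_system_orth_rest:
 assumes s: "orthonormal_system M p U \<rho>" and y: "y \<in> M" "y \<in> U"
 shows "orth_rest (set (normals p \<rho> y)) v = v - (\<Sum>j<p. (v \<bullet> grad (\<rho> j) y) *\<^sub>R grad (\<rho> j) y)"
  and "j < p \<Longrightarrow> orth_rest (set (normals p \<rho> y)) v \<bullet> grad (\<rho> j) y = 0"
proof -
 show "orth_rest (set (normals p \<rho> y)) v = v - (\<Sum>j<p. (v \<bullet> grad (\<rho> j) y) *\<^sub>R grad (\<rho> j) y)"
  using orthonormal_system_inj[OF s y] by (simp add: orth_rest_def set_normals sum.reindex)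
 show "j < p \<Longrightarrow> orth_rest (set (normals p \<rho> y)) v \<bullet> grad (\<rho> j) y = 0"
  using orthonormal_system_normals[OF s y]
  by (intro orth_rest_inner) (auto simp: orthonormal_list_def set_normals)
qed

text \<open>Both projections \<open>a\<close> and \<open>b\<close> of \<open>v\<close> are tangent
  with respect to either system, while \<open>v - a\<close> and \<open>v - b\<close> are normal;
  hence \<open>a - b\<close> is orthogonal to itself.\<close>

lemma orth_rest_independent:
 fixes M :: "'n::{finite,linorder} point set"
 assumes s1: "orthonormal_system M p U \<rho>" and s2: "orthonormal_system M p U' \<rho>'"
  and y: "y \<in> M" "y \<in> U" "y \<in> U'" and dim: "p + CARD('m::finite) = CARD('n)"
 shows "orth_rest (set (normals p \<rho> y)) = orth_rest (set (normals p \<rho>' y))"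
proof
 fix v
 define a where "a = orth_rest (set (normals p \<rho> y)) v"
 define b where "b = orth_rest (set (normals p \<rho>' y)) v"
 note r1 = orthonormal_system_orth_rest[OF s1 y(1,2)] and r2 = orthonormal_system_orth_rest[OF s2 y(1,3)]
 have a1: "\<forall>j<p. a \<bullet> grad (\<rho> j) y = 0" and b2: "\<forall>j<p. b \<bullet> grad (\<rho>' j) y = 0"
  using r1(2) r2(2) by (auto simp: a_def b_def)
 have a2: "a \<bullet> grad (\<rho>' j) y = 0" and b1: "b \<bullet> grad (\<rho> j) y = 0" if "j < p" for j
  using orthonormal_system_tangent[OF s1 s2 y dim a1 that]
   orthonormal_system_tangent[OF s2 s1 y(1,3,2) dim b2 that] by auto
 have "v - a = (\<Sum>j<p. (v \<bullet> grad (\<rho> j) y) *\<^sub>R grad (\<rho> j) y)" by (simp add: a_def r1(1))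
 then have "(a - b) \<bullet> (v - a) = 0"
  using a1 b1 by (simp only: inner_sum_right inner_diff_left inner_scaleR_right) simp
 moreover have "v - b = (\<Sum>j<p. (v \<bullet> grad (\<rho>' j) y) *\<^sub>R grad (\<rho>' j) y)" by (simp add: b_def r2(1))
 then have "(a - b) \<bullet> (v - b) = 0"
  using a2 b2 by (simp only: inner_sum_right inner_diff_left inner_scaleR_right) simp
 ultimately have "(a - b) \<bullet> (a - b) = 0" by (simp add: inner_diff_right)
 then show "orth_rest (set (normals p \<rho> y)) v = orth_rest (set (normals p \<rho>' y)) v"
  by (simp add: a_def b_def)
qed

lemma tan_trace_cong: "orth_rest N = orth_rest N' \<Longrightarrow> tan_trace N L = tan_trace N' L"
 by (simp add: tan_trace_def)

text \<open>The coefficient matrix of d applied to J of the j-th normal form is the Hessian of the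
  j-th defining function, so each component of the mean curvature is a tangential trace of a
  Hessian.\<close>

lemma mean_curvature_normal_system:
 fixes M :: "'n::{finite,linorder} point set" and m :: nat and y :: "'n point"
 defines "\<nu> \<equiv> normal_system m M y"
 assumes M: "submanifold m M" and y: "y \<in> M"
 shows "mean_curvature m M y = (\<Sum>j<CARD('n) - m.
  tan_trace (set (normals (CARD('n) - m) \<nu> y)) (hess (\<nu> j) y) *\<^sub>R grad (\<nu> j) y)"
proof -
 let ?p = "CARD('n) - m"
 obtain U where U: "y \<in> U" "orthonormal_system M ?p U \<nu>"
  using normal_system_orthonormal[OF M y] unfolding \<nu>_def by blast
 then have op: "open U" and sm: "\<And>j. j < ?p \<Longrightarrow> smooth_on (\<nu> j) U" by (auto simp: orthonormal_system_def)
 have nf: "normal_form m M y j z = dx_of (grad (\<nu> j) z)" if "j < ?p" "z \<in> U" for j z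
  unfolding normal_form_def using smooth_on_differentiable[OF sm[OF that(1)] that(2)]
  by (simp add: sd_fun_form \<nu>_def)
 have T: "tangent_space m M y = {v. \<forall>u\<in>set (normals ?p \<nu> y). v \<bullet> u = 0}"
  using nf[OF _ U(1)] by (auto simp: tangent_space_def set_normals)
 have dh: "(grad (\<nu> j) has_derivative hess (\<nu> j) y) (at y)" if "j < ?p" for j
  using sm[OF that] op U(1) by (intro has_derivative_hess) (auto simp: smooth_on_def)
 have bil: "bilinear_of_form (sd (\<lambda>z. Jop (normal_form m M y j z)) y) = (\<lambda>v w. hess (\<nu> j) y v \<bullet> w)"
  if j: "j < ?p" for j
 proof -
  have lin: "linear (hess (\<nu> j) y)" using dh[OF j] by (rule has_derivative_linear)
  have "((\<lambda>z. dxi_of (grad (\<nu> j) z)) has_derivative (\<lambda>v. dxi_of (hess (\<nu> j) y v))) (at y)"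
   using bounded_linear.has_derivative[OF _ dh[OF j], of dxi_of] linear_dxi_of
   by (simp add: linear_conv_bounded_linear)
  then have "((\<lambda>z. Jop (normal_form m M y j z)) has_derivative (\<lambda>v. dxi_of (hess (\<nu> j) y v))) (at y)"
   by (rule has_derivative_transform_within_open[OF _ op U(1)]) (simp add: nf[OF j])
  then have pd: "partial_deriv k (\<lambda>z. Jop (normal_form m M y j z)) y = dxi_of (hess (\<nu> j) y (axis k 1))" for k
   unfolding partial_deriv_def by (simp flip: frechet_derivative_at)
  have dc: "dxi_of w $ ({}, {l}) = w $ l" for w :: "'n point" and l
   by (simp add: dxi_of_def dxi_component if_distrib cong: if_cong)
  have comp: "(dx k \<and>\<^sub>s dxi_of w) $ ({i}, {l}) = (if k = i then w $ l else 0)" for k i l and w :: "'n point"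
  proof (cases "k = i")
   case True
   then show ?thesis by (simp add: dx_wedge dc cong: conj_cong)
  qed (simp add: dx_wedge)
  have c: "sd (\<lambda>z. Jop (normal_form m M y j z)) y $ ({i}, {l}) = hess (\<nu> j) y (axis i 1) $ l" for i l
   by (simp add: sd_def pd comp)
  show ?thesis
  proof (intro ext)
   fix v w
   have "bilinear_of_form (sd (\<lambda>z. Jop (normal_form m M y j z)) y) v w =
     (\<Sum>k\<in>UNIV. (v \<bullet> axis k 1) * (hess (\<nu> j) y (axis k 1) \<bullet> w))"
    by (simp add: bilinear_of_form_def c inner_axis inner_vec_def[of _ w] sum_distrib_left mult_ac)
   also have "\<dots> = hess (\<nu> j) y v \<bullet> w" by (rule sum_axis_inner[OF lin])
   finally show "bilinear_of_form (sd (\<lambda>z. Jop (normal_form m M y j z)) y) v w = hess (\<nu> j) y v \<bullet> w" .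
  qed
 qed
 have "trace_on (tangent_space m M y) (\<lambda>v w. hess (\<nu> j) y v \<bullet> w) =
   tan_trace (set (normals ?p \<nu> y)) (hess (\<nu> j) y)" if "j < ?p" for j
  unfolding T using orthonormal_system_normals[OF U(2) y U(1)] has_derivative_linear[OF dh[OF that]]
  by (intro trace_on_eq_tan_trace) (auto simp: orthonormal_list_def)
 then show ?thesis
  unfolding mean_curvature_def using U(1) by (intro sum.cong refl) (simp add: bil nf)
qed

text \<open>On tangent vectors the derivative of a field which is normal along \<open>M\<close> differs from
 \<open>\<Sum>\<^sub>j (Z \<bullet> grad \<rho>\<^sub>j) hess \<rho>\<^sub>j\<close> by a normal vector.\<close>

lemma (in adapted_chart) tan_trace_normal_field:
 assumes y: "y \<in> M" "y \<in> V" and Z: "(Z has_derivative Z') (at y)"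
  and S: "open S" "y \<in> S" "\<And>z. z \<in> M \<Longrightarrow> z \<in> S \<Longrightarrow> Z z = (\<Sum>j<p. (Z z \<bullet> grad (\<rho> j) z) *\<^sub>R grad (\<rho> j) z)"
 shows "tan_trace (set (normals p \<rho> y)) Z' =
  (\<Sum>j<p. (Z y \<bullet> grad (\<rho> j) y) * tan_trace (set (normals p \<rho> y)) (hess (\<rho> j) y))"
proof -
 define u where "u = coords e y"
 have u: "u \<in> W" "\<phi> u = y" using coords_in[OF y] by (auto simp: u_def)
 have yU: "y \<in> U" using \<phi>_in(3)[OF u(1)] u(2) by simp
 have dh: "(grad (\<rho> j) has_derivative hess (\<rho> j) y) (at y)" if "j < p" for j
  using smooth[OF that] openU yU by (intro has_derivative_hess) (auto simp: smooth_on_def)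
 define R where "R z = Z z - (\<Sum>j<p. (Z z \<bullet> grad (\<rho> j) z) *\<^sub>R grad (\<rho> j) z)" for z
 define R' where "R' v = Z' v - (\<Sum>j<p. (Z y \<bullet> grad (\<rho> j) y) *\<^sub>R hess (\<rho> j) y v +
  (Z y \<bullet> hess (\<rho> j) y v + Z' v \<bullet> grad (\<rho> j) y) *\<^sub>R grad (\<rho> j) y)" for v
 have "(R has_derivative R') (at y)"
  unfolding R_def[abs_def] R'_def[abs_def]
  by (intro has_derivative_diff has_derivative_sum has_derivative_scaleR has_derivative_inner Z dh) auto
 then have "(R has_derivative R') (at (\<phi> u))" by (simp add: u)
 from derivative_along_D\<phi>[OF u(1) this S(1)] have "R' (FD \<phi> u c) = 0" for c
  using S u(2) by (simp add: R_def)
 then have R0: "R' (\<tau> i u) = 0" for i by (simp add: \<tau>_def)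
 have lin: "linear Z'" using Z by (rule has_derivative_linear)
 have linh: "linear (hess (\<rho> j) y)" if "j < p" for j using dh[OF that] by (rule has_derivative_linear)
 have "Z' (\<tau> i u) \<bullet> w i y = (\<Sum>j<p. (Z y \<bullet> grad (\<rho> j) y) * (hess (\<rho> j) y (\<tau> i u) \<bullet> w i y))" for i
 proof -
  have "grad (\<rho> j) y \<bullet> w i y = 0" if "j < p" for j
   using w_tangent[OF y(1) yU that, of i] by (simp add: inner_commute)
  then have "R' (\<tau> i u) \<bullet> w i y =
    Z' (\<tau> i u) \<bullet> w i y - (\<Sum>j<p. (Z y \<bullet> grad (\<rho> j) y) * (hess (\<rho> j) y (\<tau> i u) \<bullet> w i y))"
   by (simp add: R'_def inner_diff_left inner_sum_left inner_add_left)
  then show ?thesis by (simp add: R0)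
 qed
 then have "(\<Sum>i\<in>UNIV. Z' (\<tau> i u) \<bullet> w i (\<phi> u)) =
   (\<Sum>j<p. (Z y \<bullet> grad (\<rho> j) y) * (\<Sum>i\<in>UNIV. hess (\<rho> j) y (\<tau> i u) \<bullet> w i (\<phi> u)))"
  unfolding u(2) by (subst sum_distrib_left, subst sum.swap) simp
 then show ?thesis
  using tan_trace_eq(2)[OF u(1) lin] tan_trace_eq(2)[OF u(1) linh] by (simp add: N_def u(2))
qed

context
 fixes M :: "'n::{finite,linorder} point set" and T :: "'m::finite itself" and p :: nat
 assumes M: "submanifold CARD('m) M" and dim: "p + CARD('m) = CARD('n)"
begin

lemma codim: "CARD('n) - CARD('m) = p" using dim by simp

text \<open>Being normal and the tangential trace depend only on the projections, so the computation
  can be moved to the normal system chosen at \<open>y\<close>, in which the mean curvature is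
  written.\<close>

lemma tan_trace_normal_field_mean_curvature:
 fixes Z :: "'n point \<Rightarrow> 'n point"
 assumes sys: "orthonormal_system M p U \<rho>" and y: "y \<in> M" "y \<in> U" and Z: "(Z has_derivative Z') (at y)"
  and S: "open S" "y \<in> S" "\<And>z. z \<in> M \<Longrightarrow> z \<in> S \<Longrightarrow> orth_rest (set (normals p \<rho> z)) (Z z) = 0"
 shows "tan_trace (set (normals p \<rho> y)) Z' = Z y \<bullet> mean_curvature CARD('m) M y"
proof -
 define \<nu> where "\<nu> = normal_system CARD('m) M y"
 obtain U' where U': "y \<in> U'" "orthonormal_system M p U' \<nu>"
  using normal_system_orthonormal[OF M y(1)] unfolding \<nu>_def codim by blast
 have op: "open U" "open U'" using sys U' by (auto simp: orthonormal_system_def)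
 obtain e :: "'m \<Rightarrow> 'n point" and V W \<phi> where ad: "adapted_chart M p U' \<nu> e V W \<phi>" and yV: "y \<in> V"
  using adapted_chart_exists[OF U'(2) y(1) U'(1) dim] by blast
 interpret ch: adapted_chart M p U' \<nu> e V W \<phi> by (rule ad)
 have eq: "orth_rest (set (normals p \<rho> z)) = orth_rest (set (normals p \<nu> z))" if "z \<in> M" "z \<in> U" "z \<in> U'" for z
  by (rule orth_rest_independent[OF sys U'(2) that dim])
 have "tan_trace (set (normals p \<nu> y)) Z' =
  (\<Sum>j<p. (Z y \<bullet> grad (\<nu> j) y) * tan_trace (set (normals p \<nu> y)) (hess (\<nu> j) y))"
 proof (rule ch.tan_trace_normal_field[OF y(1) yV Z])
  show "open (S \<inter> U \<inter> U')" using S op by auto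
  show "y \<in> S \<inter> U \<inter> U'" using S y U' by auto
  fix z assume z: "z \<in> M" "z \<in> S \<inter> U \<inter> U'"
  then have "orth_rest (set (normals p \<nu> z)) (Z z) = 0" using S(3)[of z] eq[of z] by simp
  then show "Z z = (\<Sum>j<p. (Z z \<bullet> grad (\<nu> j) z) *\<^sub>R grad (\<nu> j) z)"
   using orthonormal_system_orth_rest(1)[OF U'(2), of z "Z z"] z by simp
 qed
 also have "\<dots> = Z y \<bullet> mean_curvature CARD('m) M y"
  unfolding mean_curvature_normal_system[OF M y(1)] \<nu>_def[symmetric] codim by (simp add: inner_sum_right mult_ac)
 finally show ?thesis using tan_trace_cong[OF eq[OF y U'(1)]] by simp
qed

lemma mean_curvature_normal:
 assumes sys: "orthonormal_system M p U \<rho>" and y: "y \<in> M" "y \<in> U"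
 shows "orth_rest (set (normals p \<rho> y)) (mean_curvature CARD('m) M y) = 0"
proof -
 define \<nu> where "\<nu> = normal_system CARD('m) M y"
 obtain U' where U': "y \<in> U'" "orthonormal_system M p U' \<nu>"
  using normal_system_orthonormal[OF M y(1)] unfolding \<nu>_def codim by blast
 define H where "H = mean_curvature CARD('m) M y"
 define r where "r = orth_rest (set (normals p \<nu> y)) H"
 note o = orthonormal_system_orth_rest[OF U'(2) y(1) U'(1)]
 have "r \<bullet> grad (\<nu> j) y = 0" if "j < p" for j using o(2)[OF that] by (simp add: r_def)
 then have "r \<bullet> (H - (\<Sum>j<p. (H \<bullet> grad (\<nu> j) y) *\<^sub>R grad (\<nu> j) y)) = 0"
  unfolding H_def mean_curvature_normal_system[OF M y(1)] \<nu>_def[symmetric] codim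
  by (simp add: inner_diff_right inner_sum_right)
 then have "r \<bullet> r = 0" using o(1)[of H] by (simp add: r_def)
 then have "orth_rest (set (normals p \<nu> y)) H = 0" by (simp add: r_def)
 then show ?thesis
  using orth_rest_independent[OF sys U'(2) y U'(1) dim] by (simp add: H_def)
qed

text \<open>A unit normal of an arbitrary system is itself a normal field along \<open>M\<close>, so
  the preceding result applies to it; this frees the mean curvature from the pointwise choice of
  normals.\<close>

lemma mean_curvature_inner_grad:
 assumes sys: "orthonormal_system M p U \<rho>" and y: "y \<in> M" "y \<in> U" and j: "j < p"
 shows "tan_trace (set (normals p \<rho> y)) (hess (\<rho> j) y) = grad (\<rho> j) y \<bullet> mean_curvature CARD('m) M y"
proof (rule tan_trace_normal_field_mean_curvature[OF sys y])
 have op: "open U" and sm: "smooth_on (\<rho> j) U" using sys j by (auto simp: orthonormal_system_def)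
 then show "(grad (\<rho> j) has_derivative hess (\<rho> j) y) (at y)"
  using y(2) by (intro has_derivative_hess[of _ U]) (auto simp: smooth_on_def)
 show "open U" "y \<in> U" by (fact op y)+
 fix z assume z: "z \<in> M" "z \<in> U"
 have "(\<Sum>i<p. (grad (\<rho> j) z \<bullet> grad (\<rho> i) z) *\<^sub>R grad (\<rho> i) z) = (\<Sum>i<p. if i = j then grad (\<rho> j) z else 0)"
  using sys z j by (intro sum.cong refl) (auto simp: orthonormal_system_def)
 then show "orth_rest (set (normals p \<rho> z)) (grad (\<rho> j) z) = 0"
  using j by (simp add: orthonormal_system_orth_rest(1)[OF sys z])
qed

end

section \<open>The divergence theorem on a compact submanifold\<close>

lemma continuous_on_frechet_derivative_apply:
 fixes f :: "real^'n::finite \<Rightarrow> 'b::real_normed_vector"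
 assumes f: "Ck_on 1 f S" and \<phi>: "continuous_on W \<phi>" "\<phi> ` W \<subseteq> S" and t: "continuous_on W t"
 shows "continuous_on W (\<lambda>u. FD f (\<phi> u) (t u))"
proof -
 have eq: "FD f (\<phi> u) (t u) = (\<Sum>k\<in>UNIV. t u $ k *\<^sub>R FD f (\<phi> u) (axis k 1))"
  if "u \<in> W" for u
 proof -
  have "f differentiable (at (\<phi> u))" using f \<phi>(2) that by auto
  then have lin: "linear (FD f (\<phi> u))" by (rule linear_frechet_derivative)
  have "t u = (\<Sum>k\<in>UNIV. t u $ k *\<^sub>R axis k 1)" by (simp add: basis_expansion flip: scalar_mult_eq_scaleR)
  then have "FD f (\<phi> u) (t u) =
    FD f (\<phi> u) (\<Sum>k\<in>UNIV. t u $ k *\<^sub>R axis k 1)" by simp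
  then show ?thesis by (simp only: linear_sum[OF lin] linear_cmul[OF lin])
 qed
 have "continuous_on W (\<lambda>u. \<Sum>k\<in>UNIV. t u $ k *\<^sub>R FD f (\<phi> u) (axis k 1))"
 proof (intro continuous_on_sum continuous_on_scaleR)
  show "continuous_on W (\<lambda>u. t u $ k)" for k
   using continuous_on_compose2[OF linear_continuous_on[OF bounded_linear_vec_nth] t] by blast
  show "continuous_on W (\<lambda>u. FD f (\<phi> u) (axis k 1))" for k
  proof -
   have "continuous_on S (\<lambda>y. FD f y (axis k 1))" using f by simp
   then show ?thesis using \<phi> by (rule continuous_on_compose2)
  qed
 qed
 then show ?thesis using eq by (simp cong: continuous_on_cong)
qed

text \<open>By translation invariance the integral of the shifted function does not depend on the
  shift; differentiating it under the integral sign gives the integral of the directional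
  derivative.\<close>

lemma integral_directional_derivative_eq_0:
 fixes f :: "'a::euclidean_space \<Rightarrow> real"
 assumes cont: "continuous_on UNIV f" and K: "compact K" "\<And>u. u \<notin> K \<Longrightarrow> f u = 0" "\<And>u. u \<notin> K \<Longrightarrow> g u = 0"
  and der: "\<And>u. ((\<lambda>h. f (u + h *\<^sub>R b)) has_real_derivative g u) (at 0)"
  and B: "\<And>u. \<bar>g u\<bar> \<le> B"
 shows "(LINT u:K|lborel. g u) = 0"
proof -
 obtain R where R: "\<And>u. u \<in> K \<Longrightarrow> norm u \<le> R" using compact_imp_bounded[OF K(1)] unfolding bounded_iff by blast
 \<comment> \<open>Enlarged by \<open>norm b\<close> so that the ball contains the support of every
   shift with |h| \<le> 1.\<close>
 define A where "A = cball (0::'a) (R + norm b)"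
 define J where "J = {-1..1::real}"
 have cA: "compact A" by (simp add: A_def)
 have KA: "K \<subseteq> A"
 proof
  fix x assume "x \<in> K"
  then show "x \<in> A" using R[of x] norm_ge_zero[of b] unfolding A_def mem_cball_0 by linarith
 qed
 have comp: "continuous_on UNIV (\<lambda>u. f (u + h *\<^sub>R b))" for h
  by (rule continuous_on_compose2[OF cont]) (auto intro!: continuous_intros)
 have int: "set_integrable lborel A (\<lambda>u. f (u + h *\<^sub>R b))" for h
  unfolding set_integrable_def using cA
  by (intro borel_integrable_compact) (auto intro: continuous_on_subset[OF comp])
 have zero: "f (u + h *\<^sub>R b) = 0" if "h \<in> J" "u \<notin> A" for h u
 proof (rule K(2))
  have "\<bar>h\<bar> * norm b \<le> 1 * norm b" using that(1) by (intro mult_right_mono) (auto simp: J_def)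
  moreover have "norm u \<le> norm (u + h *\<^sub>R b) + norm (h *\<^sub>R b)" using norm_triangle_ineq4[of "u + h *\<^sub>R b" "h *\<^sub>R b"] by simp
  ultimately show "u + h *\<^sub>R b \<notin> K" using R[of "u + h *\<^sub>R b"] that(2) by (force simp: A_def)
 qed
 have const: "(LINT u:A|lborel. f (u + h *\<^sub>R b)) = (\<integral>u. f u \<partial>lborel)" if "h \<in> J" for h
 proof -
  have "(LINT u:A|lborel. f (u + h *\<^sub>R b)) = (\<integral>u. f (h *\<^sub>R b + u) \<partial>lborel)"
   unfolding set_lebesgue_integral_def using zero[OF that]
   by (intro Bochner_Integration.integral_cong refl) (auto split: split_indicator simp: add.commute)
  also have "\<dots> = (\<integral>u. f u \<partial>distr lborel borel ((+) (h *\<^sub>R b)))"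
   using cont by (intro integral_distr[symmetric]) (auto intro: borel_measurable_continuous_onI)
  finally show ?thesis by (simp add: lborel_distr_plus)
 qed
 have lip: "\<bar>f (u + h *\<^sub>R b) - f (u + 0 *\<^sub>R b)\<bar> \<le> B * \<bar>h\<bar>" for u h
 proof -
  have d: "((\<lambda>s. f (u + s *\<^sub>R b)) has_real_derivative g (u + s *\<^sub>R b)) (at s)" for s
   using der[of "u + s *\<^sub>R b"] DERIV_shift[of "\<lambda>s. f (u + s *\<^sub>R b)" "g (u + s *\<^sub>R b)" 0 s]
   by (simp add: scaleR_add_left add_ac)
  have "norm (f (u + h *\<^sub>R b) - f (u + 0 *\<^sub>R b)) \<le> B * norm (h - 0)"
   by (rule field_differentiable_bound[where S=UNIV and f'="\<lambda>s. g (u + s *\<^sub>R b)"]) (use d B in auto)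
  then show ?thesis by simp
 qed
 have "((\<lambda>h. LINT u:A|lborel. f (u + h *\<^sub>R b)) has_real_derivative (LINT u:A|lborel. g u)) (at 0 within J)"
 proof (rule has_real_derivative_set_integral[where C=B])
  show "A \<in> sets lborel" using cA by (simp add: borel_compact)
  show "emeasure lborel A < \<infinity>" using emeasure_compact_finite[OF cA] by simp
  show "((\<lambda>h. f (u + h *\<^sub>R b)) has_real_derivative g u) (at 0 within J)" for u
   using der[of u] by (rule has_field_derivative_at_within)
 qed (use int lip in \<open>auto simp: J_def\<close>)
 moreover have "((\<lambda>h. LINT u:A|lborel. f (u + h *\<^sub>R b)) has_real_derivative 0) (at 0 within J)"
  by (rule has_field_derivative_transform_within[OF DERIV_const zero_less_one]) (auto simp: const J_def)
 ultimately have "(LINT u:A|lborel. g u) = 0"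
  unfolding J_def using DERIV_unique by (simp add: at_within_Icc_at) blast
 moreover have "(LINT u:A|lborel. g u) = (LINT u:K|lborel. g u)"
  unfolding set_lebesgue_integral_def using KA K(3)
  by (intro Bochner_Integration.integral_cong refl) (auto split: split_indicator)
 ultimately show ?thesis by simp
qed

context adapted_chart
begin

abbreviation (input) "Dw j y \<equiv> FD (w j) y"

lemma has_derivative_w: "y \<in> U \<Longrightarrow> (w j has_derivative Dw j y) (at y)"
 using Ck_on_Suc_has_derivative[OF smooth_w] .

lemma has_derivative_grad_\<rho>: "j < p \<Longrightarrow> y \<in> U \<Longrightarrow> (grad (\<rho> j) has_derivative hess (\<rho> j) y) (at y)"
 using smooth[of j] openU by (intro has_derivative_hess[of _ U]) (auto simp: smooth_on_def)

text \<open>Of the product rule only the derivatives of the normals survive; the terms along the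
  normals themselves vanish against a tangent vector.\<close>

lemma Dw_\<tau>:
 assumes u: "u \<in> W"
 shows "Dw j (\<phi> u) v \<bullet> \<tau> k u = - (\<Sum>l<p. (e j \<bullet> grad (\<rho> l) (\<phi> u)) * (hess (\<rho> l) (\<phi> u) v \<bullet> \<tau> k u))"
proof -
 let ?y = "\<phi> u"
 have y: "?y \<in> U" by (rule \<phi>_in(3)[OF u])
 have d: "(w j has_derivative (\<lambda>v. 0 - (\<Sum>l<p. (e j \<bullet> grad (\<rho> l) ?y) *\<^sub>R hess (\<rho> l) ?y v +
   (e j \<bullet> hess (\<rho> l) ?y v + 0 \<bullet> grad (\<rho> l) ?y) *\<^sub>R grad (\<rho> l) ?y))) (at ?y)"
  unfolding w_def[abs_def]
  by (intro has_derivative_diff has_derivative_const has_derivative_sum has_derivative_scaleR has_derivative_inner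
    has_derivative_grad_\<rho> y) auto
 have "Dw j ?y v = 0 - (\<Sum>l<p. (e j \<bullet> grad (\<rho> l) ?y) *\<^sub>R hess (\<rho> l) ?y v +
   (e j \<bullet> hess (\<rho> l) ?y v + 0 \<bullet> grad (\<rho> l) ?y) *\<^sub>R grad (\<rho> l) ?y)"
  by (rule fun_cong[OF frechet_derivative_at[OF d, symmetric]])
 moreover have "grad (\<rho> l) ?y \<bullet> \<tau> k u = 0" if "l < p" for l
  using \<tau>_tangent[OF u that, of k] by (simp add: inner_commute)
 ultimately show ?thesis by (simp add: inner_sum_left inner_add_left)
qed

text \<open>The logarithmic derivative of the area density in the i-th coordinate direction. The
  minus sign appears because the density is the reciprocal root of the Gram determinant of the
  \<open>w j\<close>, whose dual frame is \<open>\<tau>\<close>.\<close>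

definition dens_der :: "'m \<Rightarrow> real^'m \<Rightarrow> real" where
 "dens_der i u = - (\<Sum>j\<in>UNIV. Dw j (\<phi> u) (\<tau> i u) \<bullet> \<tau> j u)"

lemma inverse_sqrt_gram_w: "u \<in> W \<Longrightarrow> inverse (sqrt (det (gram_w (\<phi> u)))) = area_density \<phi> u"
 using det_gram_pos(1)[of u] by (simp add: area_density_\<kappa> \<kappa>_def powr_minus powr_half_sqrt)

lemma \<phi>_direction: "u \<in> W \<Longrightarrow> ((\<lambda>h. \<phi> (u + h *\<^sub>R axis i 1)) has_vector_derivative \<tau> i u) (at 0)"
proof -
 assume u: "u \<in> W"
 have "((\<lambda>h. u + h *\<^sub>R axis i 1) has_derivative (\<lambda>h. h *\<^sub>R axis i 1)) (at 0)"
  by (auto intro!: derivative_eq_intros)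
 from diff_chain_at[OF this, of \<phi>] D\<phi>[OF u]
 have "((\<lambda>h. \<phi> (u + h *\<^sub>R axis i 1)) has_derivative (\<lambda>h. FD \<phi> u (h *\<^sub>R axis i 1))) (at 0)"
  by (simp add: comp_def)
 then show ?thesis
  by (simp add: has_vector_derivative_def \<tau>_def linear_cmul[OF linear_D\<phi>[OF u]])
qed

lemma vector_direction:
 assumes u: "u \<in> W" and f: "(f has_derivative f') (at (\<phi> u))"
 shows "((\<lambda>h. f (\<phi> (u + h *\<^sub>R axis i 1))) has_vector_derivative f' (\<tau> i u)) (at 0)"
proof -
 from diff_chain_at[OF \<phi>_direction[OF u, unfolded has_vector_derivative_def], of f f'] f
 have "((\<lambda>h. f (\<phi> (u + h *\<^sub>R axis i 1))) has_derivative (\<lambda>h. f' (h *\<^sub>R \<tau> i u))) (at 0)"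
  by (simp add: comp_def)
 then show ?thesis
  by (simp add: has_vector_derivative_def linear_cmul[OF has_derivative_linear[OF f]])
qed

lemma density_direction:
 assumes u: "u \<in> W"
 shows "((\<lambda>h. inverse (sqrt (det (gram_w (\<phi> (u + h *\<^sub>R axis i 1)))))) has_real_derivative
  area_density \<phi> u * dens_der i u) (at 0)"
proof -
 define b where "b h j = w j (\<phi> (u + h *\<^sub>R axis i 1))" for h j
 have G: "gram_w (\<phi> (u + h *\<^sub>R axis i 1)) = (\<chi> j k. b h j \<bullet> b h k)" for h by (simp add: gram_w_def b_def)
 have G0: "(\<chi> j k. b 0 j \<bullet> b 0 k) = gram_w (\<phi> u)" by (simp add: gram_w_def b_def)
 define s where "s h = sqrt (det (\<chi> j k. b h j \<bullet> b h k))" for h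
 have s0: "s 0 = sqrt (det (gram_w (\<phi> u)))" "0 < s 0" using det_gram_pos(1)[OF u] by (simp_all add: s_def G0)
 have "(s has_real_derivative s 0 * (\<Sum>j\<in>UNIV. Dw j (\<phi> u) (\<tau> i u) \<bullet> (\<Sum>a\<in>UNIV. gram_\<tau> u $ a $ j *\<^sub>R b 0 a))) (at 0 within UNIV)"
  unfolding s_def
 proof (rule has_real_derivative_sqrt_gram)
  show "((\<lambda>h. b h j) has_vector_derivative Dw j (\<phi> u) (\<tau> i u)) (at 0 within UNIV)" for j
   using vector_direction[OF u has_derivative_w[OF \<phi>_in(3)[OF u]], of j i] by (simp add: b_def)
  show "gram_\<tau> u ** (\<chi> j k. b 0 j \<bullet> b 0 k) = mat 1"
   unfolding G0 using gram_inverse[OF u] by (simp add: matrix_left_right_inverse)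
  show "gram_\<tau> u $ j $ k = gram_\<tau> u $ k $ j" for j k by (simp add: gram_\<tau>_def inner_commute)
  show "0 < det (\<chi> j k. b 0 j \<bullet> b 0 k)" unfolding G0 by (rule det_gram_pos(1)[OF u])
 qed
 moreover have "(\<Sum>a\<in>UNIV. gram_\<tau> u $ a $ j *\<^sub>R b 0 a) = \<tau> j u" for j
  using sum_gram_w[OF u, of j] by (simp add: gram_\<tau>_def b_def)
 ultimately have d: "(s has_real_derivative - (s 0 * dens_der i u)) (at 0)"
  by (simp add: dens_der_def)
 have "((\<lambda>h. inverse (s h)) has_real_derivative - (- (s 0 * dens_der i u) * inverse (s 0 ^ Suc (Suc 0)))) (at 0)"
  using DERIV_inverse_fun[OF d] s0(2) by simp
 moreover have "- (- (s 0 * dens_der i u) * inverse (s 0 ^ Suc (Suc 0))) = area_density \<phi> u * dens_der i u"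
  unfolding inverse_sqrt_gram_w[OF u, symmetric] s0(1)[symmetric] using s0(2) by (simp add: field_simps)
 ultimately have "((\<lambda>h. inverse (s h)) has_real_derivative area_density \<phi> u * dens_der i u) (at 0)"
  by (simp only:)
 then show ?thesis unfolding G s_def .
qed

text \<open>Up to the density factor, the coordinate divergence of density times dual frame is
  purely normal. Against a normal, differentiating the orthogonality of \<open>w i\<close> to it
  produces the mean curvature; against a tangent vector, symmetry of the Hessians cancels the two
  sums.\<close>

lemma sum_derivative_density_w:
 assumes u: "u \<in> W" and H: "orth_rest (N (\<phi> u)) H = 0"
  and Hj: "\<And>j. j < p \<Longrightarrow> tan_trace (N (\<phi> u)) (hess (\<rho> j) (\<phi> u)) = grad (\<rho> j) (\<phi> u) \<bullet> H"
 shows "(\<Sum>i\<in>UNIV. dens_der i u *\<^sub>R w i (\<phi> u) + Dw i (\<phi> u) (\<tau> i u)) = - H"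
proof -
 let ?y = "\<phi> u"
 have y: "?y \<in> M" "?y \<in> U" using \<phi>_in[OF u] by auto
 define x where "x = (\<Sum>i\<in>UNIV. dens_der i u *\<^sub>R w i ?y + Dw i ?y (\<tau> i u)) + H"
 have "x \<bullet> grad (\<rho> j) ?y = 0" if j: "j < p" for j
 proof -
  have "Dw i ?y (\<tau> i u) \<bullet> grad (\<rho> j) ?y = - (hess (\<rho> j) ?y (\<tau> i u) \<bullet> w i ?y)" for i
  proof -
   have "((\<lambda>z. w i z \<bullet> grad (\<rho> j) z) has_derivative
     (\<lambda>v. w i ?y \<bullet> hess (\<rho> j) ?y v + Dw i ?y v \<bullet> grad (\<rho> j) ?y)) (at ?y)"
    by (intro has_derivative_inner has_derivative_w has_derivative_grad_\<rho> j y)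
   from derivative_along_D\<phi>[OF u this openU y(2), of "axis i 1"] w_tangent j
   show ?thesis by (simp add: \<tau>_def inner_commute add_eq_0_iff)
  qed
  then have "x \<bullet> grad (\<rho> j) ?y = - (\<Sum>i\<in>UNIV. hess (\<rho> j) ?y (\<tau> i u) \<bullet> w i ?y) + H \<bullet> grad (\<rho> j) ?y"
   using w_tangent[OF y j] by (simp add: x_def inner_add_left inner_sum_left sum_negf)
  then show ?thesis
   using tan_trace_eq(2)[OF u has_derivative_linear[OF has_derivative_grad_\<rho>[OF j y(2)]]] Hj[OF j]
   by (simp add: inner_commute)
 qed
 then have o: "orth_rest (N ?y) x = x" by (simp add: orth_rest_N[OF y])
 have "\<tau> k u \<bullet> x = 0" for k
 proof -
  have H0: "H \<bullet> \<tau> k u = 0"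
  proof -
   have "H = (\<Sum>j<p. (H \<bullet> grad (\<rho> j) ?y) *\<^sub>R grad (\<rho> j) ?y)" using H by (simp add: orth_rest_N[OF y])
   then have "\<tau> k u \<bullet> H = (\<Sum>j<p. (H \<bullet> grad (\<rho> j) ?y) * (\<tau> k u \<bullet> grad (\<rho> j) ?y))"
    by (metis (no_types, lifting) inner_scaleR_right inner_sum_right sum.cong)
   then show ?thesis using \<tau>_tangent[OF u, of _ k] by (simp add: inner_commute)
  qed
  have 1: "(\<Sum>i\<in>UNIV. dens_der i u * (w i ?y \<bullet> \<tau> k u)) = dens_der k u"
   by (simp add: w_\<tau>[OF u] if_distrib cong: if_cong)
  \<comment> \<open>Exchanging \<open>i\<close> and \<open>k\<close> turns the tangential part of
    the second sum into minus the derivative of the density.\<close>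
  have sym: "hess (\<rho> l) ?y (\<tau> i u) \<bullet> \<tau> k u = hess (\<rho> l) ?y (\<tau> k u) \<bullet> \<tau> i u" if "l < p" for i l
   using smooth[OF that] openU y(2) by (intro hess_symmetric[of _ U]) (auto simp: smooth_on_def)
  have "(\<Sum>i\<in>UNIV. Dw i ?y (\<tau> i u) \<bullet> \<tau> k u) = - dens_der k u"
   by (simp add: dens_der_def Dw_\<tau>[OF u] sym)
  then show ?thesis using 1 H0
   by (simp add: x_def inner_add_right inner_sum_right sum.distrib inner_commute[of "\<tau> k u"])
 qed
 then have "orth_rest (N ?y) x = 0" by (simp add: orth_rest_eq_w[OF u])
 then show ?thesis using o by (simp add: x_def add_eq_0_iff)
qed

text \<open>For each i the i-th partial derivative of density times \<open>Z \<bullet> w i\<close>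
  integrates to zero. Adding these, the derivatives of \<open>Z\<close> form the tangential trace,
  and the remaining factor of \<open>Z\<close> is the vector found in
  \<open>sum_derivative_density_w\<close>. The field \<open>Z\<close> need not be tangent; its
  normal part is what meets the mean curvature.\<close>

lemma chart_divergence:
 assumes Q: "open Q" "M \<subseteq> Q" and Z: "Ck_on 1 Z Q" and M: "compact M"
  and K: "compact K" "K \<subseteq> V" "\<And>y. y \<notin> K \<Longrightarrow> Z y = 0"
  and H: "\<And>u. u \<in> W \<Longrightarrow> orth_rest (N (\<phi> u)) (H (\<phi> u)) = 0"
   "\<And>u j. u \<in> W \<Longrightarrow> j < p \<Longrightarrow> tan_trace (N (\<phi> u)) (hess (\<rho> j) (\<phi> u)) = grad (\<rho> j) (\<phi> u) \<bullet> H (\<phi> u)"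
 shows "(LINT u:W|lborel. area_density \<phi> u *
  (tan_trace (N (\<phi> u)) (FD Z (\<phi> u)) - H (\<phi> u) \<bullet> Z (\<phi> u))) = 0"
proof -
 \<comment> \<open>The support of \<open>Z\<close> in the parameter space, compact inside
   \<open>W\<close>; outside it the functions below can be continued by zero.\<close>
 define C where "C = coords e ` (M \<inter> K)"
 have cC: "compact C" unfolding C_def using M K(1)
  by (rule compact_continuous_image[OF linear_continuous_on[OF bounded_linear_coords] compact_Int])
 have CW: "C \<subseteq> W" using K(2) coords_in(1) by (auto simp: C_def)
 have out: "\<phi> u \<notin> K" if "u \<in> W" "u \<notin> C" for u
  using that \<phi>_in(1)[OF that(1)] coords_\<phi>[OF that(1)] unfolding C_def by (auto intro!: image_eqI[of u _ "\<phi> u"])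
 have inQ: "\<phi> u \<in> Q" if "u \<in> W" for u using Q(2) \<phi>_in(1)[OF that] by blast
 have DZ: "(Z has_derivative FD Z y) (at y)" if "y \<in> Q" for y
  using Ck_on_Suc_has_derivative[of 0 Z Q] Z that by simp
 have DZ0: "FD Z y v = 0" if "y \<notin> K" for y v
 proof -
  have "open (- K)" using K(1) by (simp add: compact_imp_closed open_Compl)
  then have "(Z has_derivative (\<lambda>v. 0)) (at y)"
   by (rule has_derivative_transform_within_open[OF has_derivative_const]) (use that K(3) in auto)
  from fun_cong[OF frechet_derivative_at[OF this]] show ?thesis by simp
 qed
 define f where "f i u = (if u \<in> W then inverse (sqrt (det (gram_w (\<phi> u)))) * (Z (\<phi> u) \<bullet> w i (\<phi> u)) else 0)" for i u
 define g0 where "g0 i u = area_density \<phi> u * (dens_der i u * (Z (\<phi> u) \<bullet> w i (\<phi> u)) +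
   (Z (\<phi> u) \<bullet> Dw i (\<phi> u) (\<tau> i u) + FD Z (\<phi> u) (\<tau> i u) \<bullet> w i (\<phi> u)))" for i u
 define g where "g i u = (if u \<in> W then g0 i u else 0)" for i u
 have f0: "f i u = 0" and g0: "g i u = 0" if "u \<notin> C" for i u
  using out[of u] that K(3) DZ0 by (auto simp: f_def g_def g0_def)
 have opC: "open (- C)" using cC by (simp add: compact_imp_closed open_Compl)
 have c\<tau>: "continuous_on W (\<lambda>u. \<tau> i u)" for i using C1 by (simp add: \<tau>_def[abs_def])
 have cont_in: "continuous_on W (\<lambda>u. F (\<phi> u))" if "continuous_on S F" "\<phi> ` W \<subseteq> S" for F :: "'n point \<Rightarrow> 'n point" and S
  using continuous_on_compose2[OF that(1) continuous_\<phi> that(2)] .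
 have cw: "continuous_on W (\<lambda>u. w i (\<phi> u))" for i
  by (rule cont_in[OF Ck_on_continuous_on[OF smooth_w]]) (use \<phi>_in in auto)
 have cZ: "continuous_on W (\<lambda>u. Z (\<phi> u))"
  by (rule cont_in[OF Ck_on_continuous_on[OF Z]]) (use inQ in auto)
 have cD: "continuous_on W (\<lambda>u. FD Z (\<phi> u) (\<tau> i u))" for i
  by (rule continuous_on_frechet_derivative_apply[OF Z continuous_\<phi> _ c\<tau>]) (use inQ in auto)
 have cDw: "continuous_on W (\<lambda>u. Dw j (\<phi> u) (\<tau> i u))" for i j
  by (rule continuous_on_frechet_derivative_apply[OF smooth_w continuous_\<phi> _ c\<tau>]) (use \<phi>_in in auto)
 have cd: "continuous_on W (area_density \<phi>)"
  using C1 by (intro continuous_on_area_density) (simp only: One_nat_def)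
 have cg0: "continuous_on W (g0 i)" for i
  unfolding g0_def dens_der_def by (intro continuous_intros cd cDw cD cZ cw c\<tau>)
 have cont: "continuous_on UNIV (f i)" for i
 proof -
  have "continuous_on W (\<lambda>u. area_density \<phi> u * (Z (\<phi> u) \<bullet> w i (\<phi> u)))"
   by (intro continuous_intros cd cZ cw)
  then have "continuous_on W (f i)"
   by (rule continuous_on_eq) (simp add: f_def inverse_sqrt_gram_w)
  moreover have "continuous_on (- C) (f i)"
   by (rule continuous_on_eq[OF continuous_on_const]) (simp add: f0)
  moreover have "W \<union> - C = UNIV" using CW by blast
  ultimately show ?thesis using continuous_on_open_Un[OF openW opC] by metis
 qed
 have der: "((\<lambda>h. f i (u + h *\<^sub>R axis i 1)) has_real_derivative g i u) (at 0)" for i u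
 proof -
  have line: "open {h. u + h *\<^sub>R axis i 1 \<in> S}" if "open S" for S
  proof -
   have "continuous_on UNIV (\<lambda>h. u + h *\<^sub>R axis i 1)" by (intro continuous_intros)
   from open_vimage[OF that this] show ?thesis by (simp add: vimage_def)
  qed
  show ?thesis
  proof (cases "u \<in> W")
   case True
   have "((\<lambda>h. Z (\<phi> (u + h *\<^sub>R axis i 1)) \<bullet> w i (\<phi> (u + h *\<^sub>R axis i 1))) has_derivative
     (\<lambda>h. Z (\<phi> (u + 0 *\<^sub>R axis i 1)) \<bullet> (h *\<^sub>R Dw i (\<phi> u) (\<tau> i u)) +
      (h *\<^sub>R FD Z (\<phi> u) (\<tau> i u)) \<bullet> w i (\<phi> (u + 0 *\<^sub>R axis i 1)))) (at 0)"
    by (intro has_derivative_inner vector_direction[OF True DZ[OF inQ[OF True]], unfolded has_vector_derivative_def]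
      vector_direction[OF True has_derivative_w[OF \<phi>_in(3)[OF True]], unfolded has_vector_derivative_def])
   then have "((\<lambda>h. Z (\<phi> (u + h *\<^sub>R axis i 1)) \<bullet> w i (\<phi> (u + h *\<^sub>R axis i 1))) has_real_derivative
     Z (\<phi> u) \<bullet> Dw i (\<phi> u) (\<tau> i u) + FD Z (\<phi> u) (\<tau> i u) \<bullet> w i (\<phi> u)) (at 0)"
    by (rule has_derivative_imp_has_field_derivative) (simp add: algebra_simps)
   from DERIV_mult[OF density_direction[OF True] this]
   have "((\<lambda>h. inverse (sqrt (det (gram_w (\<phi> (u + h *\<^sub>R axis i 1))))) *
     (Z (\<phi> (u + h *\<^sub>R axis i 1)) \<bullet> w i (\<phi> (u + h *\<^sub>R axis i 1)))) has_real_derivative g i u) (at 0)"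
    by (rule back_subst[where P="\<lambda>d. (_ has_real_derivative d) (at 0)"])
     (simp add: g_def g0_def True inverse_sqrt_gram_w[OF True] algebra_simps)
   then show ?thesis
    by (rule has_field_derivative_transform_within_open[OF _ line[OF openW]]) (use True in \<open>auto simp: f_def\<close>)
  next
   case False
   then have "u \<notin> C" using CW by blast
   then show ?thesis unfolding g_def using False
    by (simp, intro has_field_derivative_transform_within_open[OF DERIV_const[of 0] line[OF opC]]) (auto simp: f0)
  qed
 qed
 have zero: "(LINT u:C|lborel. g i u) = 0" for i
 proof -
  have "continuous_on C (g0 i)" using cg0 CW by (rule continuous_on_subset)
  from compact_imp_bounded[OF compact_continuous_image[OF this cC]]
  obtain B where B: "\<And>u. u \<in> C \<Longrightarrow> norm (g0 i u) \<le> B" unfolding bounded_iff by blast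
  have "\<bar>g i u\<bar> \<le> \<bar>B\<bar>" for u
  proof (cases "u \<in> C")
   case True
   then show ?thesis using B[OF True] CW by (auto simp: g_def)
  qed (simp add: g0)
  then show ?thesis by (intro integral_directional_derivative_eq_0[OF cont cC f0 g0 der])
 qed
 have int: "set_integrable lborel C (g i)" for i
 proof -
  have "set_integrable lborel C (g0 i)"
   unfolding set_integrable_def using cC CW cg0 by (intro borel_integrable_compact) (auto intro: continuous_on_subset)
  moreover have "(\<lambda>u. indicator C u *\<^sub>R g0 i u) = (\<lambda>u. indicator C u *\<^sub>R g i u)"
   using CW by (auto simp: g_def fun_eq_iff split: split_indicator)
  ultimately show ?thesis unfolding set_integrable_def by (simp only:)
 qed
 have sum: "(\<Sum>i\<in>UNIV. g0 i u) = area_density \<phi> u *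
   (tan_trace (N (\<phi> u)) (FD Z (\<phi> u)) - H (\<phi> u) \<bullet> Z (\<phi> u))" if u: "u \<in> W" for u
 proof -
  let ?y = "\<phi> u"
  have "(\<Sum>i\<in>UNIV. dens_der i u * (Z ?y \<bullet> w i ?y) + Z ?y \<bullet> Dw i ?y (\<tau> i u)) =
    Z ?y \<bullet> (\<Sum>i\<in>UNIV. dens_der i u *\<^sub>R w i ?y + Dw i ?y (\<tau> i u))"
   by (simp add: inner_sum_right inner_add_right)
  also have "\<dots> = - (H ?y \<bullet> Z ?y)" by (simp add: sum_derivative_density_w[OF u H(1)[OF u] H(2)[OF u]] inner_commute)
  finally have 1: "(\<Sum>i\<in>UNIV. dens_der i u * (Z ?y \<bullet> w i ?y) + Z ?y \<bullet> Dw i ?y (\<tau> i u)) = - (H ?y \<bullet> Z ?y)" .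
  have 2: "(\<Sum>i\<in>UNIV. FD Z ?y (\<tau> i u) \<bullet> w i ?y) =
    tan_trace (N ?y) (FD Z ?y)"
   using tan_trace_eq(2)[OF u has_derivative_linear[OF DZ[OF inQ[OF u]]]] by simp
  have "(\<Sum>i\<in>UNIV. g0 i u) = area_density \<phi> u * ((\<Sum>i\<in>UNIV. dens_der i u * (Z ?y \<bullet> w i ?y) + Z ?y \<bullet> Dw i ?y (\<tau> i u))
    + (\<Sum>i\<in>UNIV. FD Z ?y (\<tau> i u) \<bullet> w i ?y))"
   unfolding g0_def by (simp add: sum_distrib_left sum.distrib[symmetric] add.assoc)
  then show ?thesis unfolding 1 2 by simp
 qed
 have "(LINT u:W|lborel. area_density \<phi> u *
   (tan_trace (N (\<phi> u)) (FD Z (\<phi> u)) - H (\<phi> u) \<bullet> Z (\<phi> u))) = (LINT u:C|lborel. \<Sum>i\<in>UNIV. g i u)"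
  unfolding set_lebesgue_integral_def
 proof (intro Bochner_Integration.integral_cong refl)
  fix u
  have "(\<Sum>i\<in>UNIV. g i u) = 0" if "u \<notin> C" by (simp add: g0[OF that])
  moreover have "(\<Sum>i\<in>UNIV. g i u) = area_density \<phi> u *
    (tan_trace (N (\<phi> u)) (FD Z (\<phi> u)) - H (\<phi> u) \<bullet> Z (\<phi> u))" if "u \<in> W"
   using sum[OF that] that by (simp add: g_def)
  ultimately show "indicator W u *\<^sub>R (area_density \<phi> u *
    (tan_trace (N (\<phi> u)) (FD Z (\<phi> u)) - H (\<phi> u) \<bullet> Z (\<phi> u))) = indicator C u *\<^sub>R (\<Sum>i\<in>UNIV. g i u)"
   using CW by (cases "u \<in> C"; cases "u \<in> W") auto
 qed
 also have "\<dots> = (\<Sum>i\<in>UNIV. LINT u:C|lborel. g i u)"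
  unfolding set_lebesgue_integral_def scaleR_sum_right
  using int by (intro Bochner_Integration.integral_sum) (simp add: set_integrable_def)
 also have "\<dots> = 0" by (simp add: zero)
 finally show ?thesis .
qed

end

text \<open>The trace over the tangent space in terms of the normals chosen at \<open>y\<close>;
  \<open>tangent_trace_eq\<close> replaces these by any local system.\<close>

definition tangent_trace ::
  "nat \<Rightarrow> 'n::{finite,linorder} point set \<Rightarrow> 'n point \<Rightarrow> ('n point \<Rightarrow> 'n point) \<Rightarrow> real" where
 "tangent_trace m M y L = tan_trace (set (normals (CARD('n) - m) (normal_system m M y) y)) L"

lemma surface_set_integrable:
 fixes M :: "'n::{finite,linorder} point set"
 assumes M: "submanifold CARD('m::finite) M" "compact M" and \<mu>: "is_surface_measure TYPE('m) M \<mu>"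
  and f: "continuous_on M f"
 shows "set_integrable \<mu> M (f :: _ \<Rightarrow> real)"
proof -
 obtain L U \<rho> and e :: "nat \<Rightarrow> 'm \<Rightarrow> 'n point" and V W \<phi> c r where
  "surface_atlas M L (CARD('n) - CARD('m)) U \<rho> e V W \<phi> c r"
  using surface_atlas_exists[OF M] by blast
 then interpret surface_atlas M L "CARD('n) - CARD('m)" U \<rho> e V W \<phi> c r .
 show ?thesis
  by (rule surface_integral_pieces(2)[where \<psi>=\<phi> and A=A and X=W and L=L and K="\<lambda>i. cball (c i) (r i)",
    OF \<mu> M(2) adapted_chart.local_parametrization[OF adapted] A_cball ball _ A_borel image_A_disjoint union_image_A f])
   simp_all
qed

lemma continuous_on_local:
 fixes f :: "'a::t2_space \<Rightarrow> 'b::topological_space"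
 assumes "\<And>y. y \<in> M \<Longrightarrow> \<exists>U. open U \<and> y \<in> U \<and> continuous_on (M \<inter> U) f"
 shows "continuous_on M f"
proof (rule continuous_on_eq_continuous_within[THEN iffD2], rule ballI)
 fix y assume y: "y \<in> M"
 then obtain U where U: "open U" "y \<in> U" "continuous_on (M \<inter> U) f" using assms by blast
 then have "continuous (at y within M \<inter> U) f" using y by (simp add: continuous_on_eq_continuous_within)
 then show "continuous (at y within M) f"
  using at_within_nhd[OF U(2,1), of "M \<inter> U" M] by auto
qed

context
 fixes M :: "'n::{finite,linorder} point set" and T :: "'m::finite itself" and p :: nat
 assumes M: "submanifold CARD('m) M" and dim: "p + CARD('m) = CARD('n)" and cM: "compact M"
begin

lemma tangent_trace_eq:
 assumes sys: "orthonormal_system M p U \<rho>" and y: "y \<in> M" "y \<in> U"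
 shows "tangent_trace CARD('m) M y L = tan_trace (set (normals p \<rho> y)) L"
proof -
 obtain U' where U': "y \<in> U'" "orthonormal_system M p U' (normal_system CARD('m) M y)"
  using normal_system_orthonormal[OF M y(1)] unfolding codim[OF M dim] by blast
 show ?thesis unfolding tangent_trace_def codim[OF M dim]
  by (rule tan_trace_cong[OF orth_rest_independent[OF U'(2) sys y(1) U'(1) y(2) dim]])
qed

text \<open>The normals are chosen anew at each point, but near a given point the system chosen
  there computes the trace at all neighbours, and its gradients are continuous.\<close>

lemma continuous_on_tangent_trace:
 assumes D: "\<And>v. continuous_on M (\<lambda>y. D y v)"
 shows "continuous_on M (\<lambda>y. tangent_trace CARD('m) M y (D y))"
proof (rule continuous_on_local)
 fix y assume y: "y \<in> M"
 define \<nu> where "\<nu> = normal_system CARD('m) M y"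
 obtain U where U: "y \<in> U" "orthonormal_system M p U \<nu>"
  using normal_system_orthonormal[OF M y] unfolding codim[OF M dim] \<nu>_def by blast
 have op: "open U" using U by (simp add: orthonormal_system_def)
 have cg: "continuous_on (M \<inter> U) (grad (\<nu> j))" if "j < p" for j
 proof -
  have "smooth_on (\<nu> j) U" using U(2) that by (simp add: orthonormal_system_def)
  then have "Ck_on (Suc 0) (\<nu> j) U" by (simp only: smooth_on_def)
  then have "continuous_on U (grad (\<nu> j))" using Ck_on_grad[OF op] by fastforce
  then show ?thesis by (rule continuous_on_subset) simp
 qed
 have c: "continuous_on (M \<inter> U) (\<lambda>z. \<Sum>k\<in>UNIV. D z (axis k 1) \<bullet>
   (axis k 1 - (\<Sum>j<p. (axis k 1 \<bullet> grad (\<nu> j) z) *\<^sub>R grad (\<nu> j) z)))"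
  by (intro continuous_on_sum continuous_on_inner continuous_on_diff continuous_on_scaleR continuous_on_const
    continuous_on_subset[OF D]) (auto intro: cg)
 have t: "tangent_trace CARD('m) M z (D z) = (\<Sum>k\<in>UNIV. D z (axis k 1) \<bullet>
   (axis k 1 - (\<Sum>j<p. (axis k 1 \<bullet> grad (\<nu> j) z) *\<^sub>R grad (\<nu> j) z)))" if z: "z \<in> M \<inter> U" for z
  using tangent_trace_eq[OF U(2), of z "D z"] z
  by (simp add: tan_trace_def orthonormal_system_orth_rest(1)[OF U(2)])
 have "continuous_on (M \<inter> U) (\<lambda>z. tangent_trace CARD('m) M z (D z))"
  by (rule continuous_on_eq[OF c t[symmetric]])
 then show "\<exists>U. open U \<and> y \<in> U \<and> continuous_on (M \<inter> U) (\<lambda>z. tangent_trace CARD('m) M z (D z))"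
  using op U(1) by blast
qed

lemma tangent_trace_sum:
 "finite I \<Longrightarrow> tangent_trace k M y (\<lambda>v. \<Sum>i\<in>I. L i v) = (\<Sum>i\<in>I. tangent_trace k M y (L i))"
 unfolding tangent_trace_def tan_trace_def inner_sum_left by (rule sum.swap)

text \<open>A partition of unity splits the field into fields supported in single charts, to which
  \<open>chart_divergence\<close> applies; continuity of the mean curvature makes the split
  integrals finite.\<close>

lemma divergence_theorem:
 assumes \<mu>: "is_surface_measure TYPE('m) M \<mu>" and cH: "continuous_on M (mean_curvature CARD('m) M)"
  and Y: "Ck_on 1 Y UNIV"
 shows "(LINT y:M|\<mu>. tangent_trace CARD('m) M y (FD Y y)) =
  (LINT y:M|\<mu>. mean_curvature CARD('m) M y \<bullet> Y y)"
proof -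
 define H where "H = mean_curvature CARD('m) M"
 define \<Theta> where "\<Theta> Z y = tangent_trace CARD('m) M y (FD Z y) - H y \<bullet> Z y" for Z y
 have s: "sets \<mu> = sets borel" and Mb: "M \<in> sets borel" "closed M"
  using \<mu> compact_imp_closed[OF cM] by (auto simp: is_surface_measure_def)
 have ex: "\<exists>a b U \<rho> (e :: 'm \<Rightarrow> 'n point) V W \<phi>. x \<in> box a b \<and> cbox a b \<subseteq> V \<and> adapted_chart M p U \<rho> e V W \<phi>" if x: "x \<in> M" for x
 proof -
  obtain U where U: "x \<in> U" "orthonormal_system M p U (normal_system CARD('m) M x)"
   using normal_system_orthonormal[OF M x] unfolding codim[OF M dim] by blast
  obtain e :: "'m \<Rightarrow> 'n point" and V W \<phi> where ad: "adapted_chart M p U (normal_system CARD('m) M x) e V W \<phi>" and xV: "x \<in> V"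
   using adapted_chart_exists[OF U(2) x U(1) dim] by blast
  obtain a b where "cbox a b \<subseteq> V" "x \<in> box a b"
   by (rule open_contains_cbox[OF adapted_chart.openV[OF ad] xV], rule that; assumption)
  then have "x \<in> box a b \<and> cbox a b \<subseteq> V \<and> adapted_chart M p U (normal_system CARD('m) M x) e V W \<phi>"
   using ad by simp
  then show ?thesis by (intro exI)
 qed
 then obtain a b U \<rho> V W \<phi> and e :: "'n point \<Rightarrow> 'm \<Rightarrow> 'n point" where
  box: "\<And>x. x \<in> M \<Longrightarrow> x \<in> box (a x) (b x)" "\<And>x. x \<in> M \<Longrightarrow> cbox (a x) (b x) \<subseteq> V x"
  and ad: "\<And>x. x \<in> M \<Longrightarrow> adapted_chart M p (U x) (\<rho> x) (e x) (V x) (W x) (\<phi> x)"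
  by metis
 obtain F where F: "F \<subseteq> M" "finite F" "M \<subseteq> (\<Union>x\<in>F. box (a x) (b x))"
  by (rule compactE_image[OF cM, of M "\<lambda>x. box (a x) (b x)"]) (use box(1) in auto)
 define g where "g x = box_bump 1 (a x) (b x)" for x
 define G where "G y = (\<Sum>x\<in>F. g x y)" for y
 \<comment> \<open>An open neighbourhood of \<open>M\<close> on which the sum of the bumps is
   positive, so that it may be divided by. The quotients are smooth only there, which is why
   \<open>chart_divergence\<close> asks for regularity merely near \<open>M\<close>.\<close>
 define Q where "Q = {y. 0 < G y}"
 have smg: "Ck_on k (g x) S" for k x S
  using smooth_box_bump Ck_on_subset[of k "g x" UNIV S] by (auto simp: g_def smooth_on_def)
 have smG: "Ck_on k G S" if "open S" for k S unfolding G_def by (intro Ck_on_sum smg that)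
 have oQ: "open Q"
  unfolding Q_def using Ck_on_continuous_on[OF smG[OF open_UNIV]] by (intro open_Collect_less) auto
 have MQ: "M \<subseteq> Q"
 proof
  fix y assume "y \<in> M"
  then obtain x where x: "x \<in> F" "y \<in> box (a x) (b x)" using F(3) by blast
  have "0 < g x y" using x(2) by (simp add: g_def box_bump_pos)
  also have "g x y \<le> G y" unfolding G_def using F(2) x(1) by (intro member_le_sum) (auto simp: g_def box_bump_nonneg)
  finally show "y \<in> Q" by (simp add: Q_def)
 qed
 define Z where "Z x y = (g x y * G y powr (- 1)) *\<^sub>R Y y" for x y
 have CZ: "Ck_on 1 (Z x) Q" for x
  unfolding Z_def using Ck_on_subset[OF Y, of Q] oQ
  by (intro Ck_on_scaleR Ck_on_mult Ck_on_powr smg smG) (auto simp: Q_def)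
 have sumZ: "(\<Sum>x\<in>F. Z x y) = Y y" if "y \<in> Q" for y
 proof -
  have "(\<Sum>x\<in>F. Z x y) = ((\<Sum>x\<in>F. g x y) * G y powr (- 1)) *\<^sub>R Y y"
   unfolding Z_def by (simp only: sum_distrib_right scaleR_sum_left)
  then show ?thesis using that by (simp add: G_def[symmetric] Q_def powr_minus)
 qed
 have dZ: "(Z x has_derivative FD (Z x) y) (at y)" if "y \<in> Q" for x y
  using Ck_on_Suc_has_derivative[of 0 "Z x" Q] CZ that by simp
 have c\<Theta>: "continuous_on M (\<Theta> (Z x))" for x
  unfolding \<Theta>_def H_def
 proof (intro continuous_on_diff continuous_on_inner cH continuous_on_tangent_trace)
  show "continuous_on M (Z x)" using Ck_on_continuous_on[OF CZ] MQ by (rule continuous_on_subset)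
  have "continuous_on Q (\<lambda>y. FD (Z x) y v)" for v using CZ[of x] by simp
  then show "continuous_on M (\<lambda>y. FD (Z x) y v)" for v using MQ by (rule continuous_on_subset)
 qed
 have zero: "(LINT y:M|\<mu>. \<Theta> (Z x) y) = 0" and int: "set_integrable \<mu> M (\<Theta> (Z x))" if x: "x \<in> F" for x
 proof -
  have xM: "x \<in> M" using x F(1) by blast
  interpret ch: adapted_chart M p "U x" "\<rho> x" "e x" "V x" "W x" "\<phi> x" by (rule ad[OF xM])
  have loc: "\<Theta> (Z x) y = tan_trace (ch.N y) (FD (Z x) y) - H y \<bullet> Z x y" if "y \<in> M" "y \<in> V x" for y
   unfolding \<Theta>_def ch.N_def using ch.VU that by (subst tangent_trace_eq[OF ch.sys]) auto
  have "(LINT u:W x|lborel. area_density (\<phi> x) u *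
   (tan_trace (ch.N (\<phi> x u)) (FD (Z x) (\<phi> x u)) - H (\<phi> x u) \<bullet> Z x (\<phi> x u))) = 0"
  proof (rule ch.chart_divergence[OF oQ MQ CZ cM compact_cbox box(2)[OF xM]])
   fix y assume "y \<notin> cbox (a x) (b x)"
   then have "y \<notin> box (a x) (b x)" using box_subset_cbox by blast
   then show "Z x y = 0" by (simp add: Z_def g_def box_bump_eq_0)
  next
   fix u assume u: "u \<in> W x"
   show "orth_rest (ch.N (\<phi> x u)) (H (\<phi> x u)) = 0"
    unfolding ch.N_def H_def by (rule mean_curvature_normal[OF M dim ch.sys ch.\<phi>_in(1)[OF u] ch.\<phi>_in(3)[OF u]])
   fix j assume j: "j < p"
   show "tan_trace (ch.N (\<phi> x u)) (hess (\<rho> x j) (\<phi> x u)) = grad (\<rho> x j) (\<phi> x u) \<bullet> H (\<phi> x u)"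
    unfolding ch.N_def H_def by (rule mean_curvature_inner_grad[OF M dim ch.sys ch.\<phi>_in(1)[OF u] ch.\<phi>_in(3)[OF u] j])
  qed
  then have 0: "(LINT u:W x|lborel. area_density (\<phi> x) u * \<Theta> (Z x) (\<phi> x u)) = 0"
   using ch.\<phi>_in loc by (subst set_lebesgue_integral_cong[where g="\<lambda>u. area_density (\<phi> x) u *
   (tan_trace (ch.N (\<phi> x u)) (FD (Z x) (\<phi> x u)) - H (\<phi> x u) \<bullet> Z x (\<phi> x u))"])
    (auto simp: ch.openW)
  define f0 where "f0 y = indicator M y *\<^sub>R \<Theta> (Z x) y" for y
  have f0: "f0 \<in> borel_measurable borel"
   unfolding f0_def[abs_def] using Mb(1) c\<Theta> by (intro borel_measurable_continuous_on_indicator)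
  have "(LINT y:\<phi> x ` W x|\<mu>. f0 y) = (LINT u:W x|lborel. area_density (\<phi> x) u * f0 (\<phi> x u))"
   using ch.openW by (intro surface_measure_integral_image(2)[OF \<mu> Mb(2) ch.local_parametrization _ _ f0]) auto
  also have "\<dots> = 0"
   unfolding 0[symmetric] using ch.\<phi>_in(1) ch.openW
   by (intro set_lebesgue_integral_cong) (auto simp: f0_def)
  also have "(LINT y:\<phi> x ` W x|\<mu>. f0 y) = (LINT y:M|\<mu>. \<Theta> (Z x) y)"
   unfolding set_lebesgue_integral_def
  proof (intro Bochner_Integration.integral_cong refl)
   fix y
   have "\<Theta> (Z x) y = 0" if "y \<in> M" "y \<notin> \<phi> x ` W x"
   proof -
    have "y \<notin> V x" using that ch.image by blast
    then have "y \<in> - cbox (a x) (b x)" using box(2)[OF xM] by blast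
    moreover have "open (- cbox (a x) (b x))" by (simp add: closed_cbox open_Compl)
    moreover have Z0: "Z x z = 0" if "z \<in> - cbox (a x) (b x)" for z
    proof -
     have "z \<notin> box (a x) (b x)" using that box_subset_cbox by blast
     then show ?thesis by (simp add: Z_def g_def box_bump_eq_0)
    qed
    ultimately have "(Z x has_derivative (\<lambda>v. 0)) (at y)"
     by (intro has_derivative_transform_within_open[OF has_derivative_const]) auto
    then have "FD (Z x) y = (\<lambda>v. 0)" by (rule frechet_derivative_at[symmetric])
    then show ?thesis using Z0[OF \<open>y \<in> - cbox (a x) (b x)\<close>] by (simp add: \<Theta>_def tangent_trace_def tan_trace_def)
   qed
   then show "indicator (\<phi> x ` W x) y *\<^sub>R f0 y = indicator M y *\<^sub>R \<Theta> (Z x) y"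
    using ch.image by (auto simp: f0_def split: split_indicator)
  qed
  finally show "(LINT y:M|\<mu>. \<Theta> (Z x) y) = 0" .
 qed (rule surface_set_integrable[OF M cM \<mu> c\<Theta>])
 have dY: "(Y has_derivative FD Y y) (at y)" for y
  using Ck_on_Suc_has_derivative[of 0 Y UNIV] Y by simp
 have split: "\<Theta> Y y = (\<Sum>x\<in>F. \<Theta> (Z x) y)" if y: "y \<in> M" for y
 proof -
  have yQ: "y \<in> Q" using MQ y by blast
  have "(Y has_derivative (\<lambda>v. \<Sum>x\<in>F. FD (Z x) y v)) (at y)"
   by (rule has_derivative_transform_within_open[OF has_derivative_sum[OF dZ[OF yQ]] oQ yQ]) (rule sumZ)
  then have "FD Y y = (\<lambda>v. \<Sum>x\<in>F. FD (Z x) y v)"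
   by (rule frechet_derivative_at[symmetric])
  then show ?thesis
   unfolding \<Theta>_def sumZ[OF yQ, symmetric] inner_sum_right
   by (simp add: tangent_trace_sum[OF F(2)] sum_subtractf)
 qed
 have "(LINT y:M|\<mu>. \<Theta> Y y) = (LINT y:M|\<mu>. \<Sum>x\<in>F. \<Theta> (Z x) y)"
  using Mb s split by (intro set_lebesgue_integral_cong) auto
 also have "\<dots> = (\<Sum>x\<in>F. LINT y:M|\<mu>. \<Theta> (Z x) y)"
  unfolding set_lebesgue_integral_def scaleR_sum_right
  using int by (intro Bochner_Integration.integral_sum) (simp add: set_integrable_def)
 also have "\<dots> = 0" by (simp add: zero)
 finally have "(LINT y:M|\<mu>. \<Theta> Y y) = 0" .
 moreover have "set_integrable \<mu> M (\<lambda>y. tangent_trace CARD('m) M y (FD Y y))"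
 proof (intro surface_set_integrable[OF M cM \<mu>] continuous_on_tangent_trace)
  have "continuous_on UNIV (\<lambda>y. FD Y y v)" for v using Y by simp
  then show "continuous_on M (\<lambda>y. FD Y y v)" for v by (rule continuous_on_subset) simp
 qed
 moreover have "set_integrable \<mu> M (\<lambda>y. H y \<bullet> Y y)"
  using cH continuous_on_subset[OF Ck_on_continuous_on[OF Y] subset_UNIV]
  unfolding H_def by (intro surface_set_integrable[OF M cM \<mu>] continuous_on_inner)
 ultimately show ?thesis
  unfolding \<Theta>_def by (simp add: set_integral_diff(2) H_def)
qed

end

section \<open>The currents attached to a submanifold\<close>

lemma integral_box_bump_tendsto:
 fixes M :: "(real^'n::finite) measure"
 assumes M: "sets M = sets borel" "\<And>K. compact K \<Longrightarrow> emeasure M K < \<infinity>"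
 shows "(\<lambda>k. \<integral>x. box_bump (real (Suc k)) a b x \<partial>M) \<longlonglongrightarrow> (\<integral>x. indicator (box a b) x \<partial>M)"
  and "emeasure M (box a b) < \<infinity>"
proof -
 have "emeasure M (box a b) \<le> emeasure M (cbox a b)"
  by (intro emeasure_mono box_subset_cbox) (simp add: M(1))
 also have "\<dots> < \<infinity>" by (rule M(2)[OF compact_cbox])
 finally show f: "emeasure M (box a b) < \<infinity>" .
 show "(\<lambda>k. \<integral>x. box_bump (real (Suc k)) a b x \<partial>M) \<longlonglongrightarrow> (\<integral>x. indicator (box a b) x \<partial>M)"
 proof (rule integral_dominated_convergence[where w="indicator (box a b)"])
  have "continuous_on UNIV (box_bump c a b)" for c
   using smooth_box_bump[of c a b] Ck_on_continuous_on unfolding smooth_on_def by blast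
  then show "box_bump (real (Suc k)) a b \<in> borel_measurable M" for k
   unfolding measurable_cong_sets[OF M(1) refl] by (rule borel_measurable_continuous_onI)
  show "integrable M (indicat_real (box a b))" "indicat_real (box a b) \<in> borel_measurable M"
   using f by (auto simp: M(1) intro!: integrable_real_indicator borel_measurable_indicator)
  show "AE x in M. (\<lambda>k. box_bump (real (Suc k)) a b x) \<longlonglongrightarrow> indicator (box a b) x"
  proof (rule AE_I2)
   fix x show "(\<lambda>k. box_bump (real (Suc k)) a b x) \<longlonglongrightarrow> indicator (box a b) x"
    by (cases "x \<in> box a b") (simp_all add: box_bump_tendsto box_bump_eq_0 del: of_nat_Suc)
  qed
  show "AE x in M. norm (box_bump (real (Suc k)) a b x) \<le> indicator (box a b) x" for k
  proof (rule AE_I2)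
   fix x show "norm (box_bump (real (Suc k)) a b x) \<le> indicator (box a b) x"
    by (cases "x \<in> box a b") (simp_all add: box_bump_nonneg box_bump_le_1 box_bump_eq_0 del: of_nat_Suc)
  qed
 qed
qed

text \<open>The bumps converge to indicators of open boxes, so both measures agree on boxes, which
  form an intersection stable generator with finite values.\<close>

lemma test_functions_determine_measure:
 fixes \<mu> \<nu> :: "(real^'n::finite) measure"
 assumes s: "sets \<mu> = sets borel" "sets \<nu> = sets borel"
  and fin: "\<And>K. compact K \<Longrightarrow> emeasure \<mu> K < \<infinity>" "\<And>K. compact K \<Longrightarrow> emeasure \<nu> K < \<infinity>"
  and eq: "\<And>\<eta>. test_function \<eta> \<Longrightarrow> (\<integral>x. \<eta> x \<partial>\<mu>) = (\<integral>x. \<eta> x \<partial>\<nu>)"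
 shows "\<mu> = \<nu>"
proof -
 note lim = integral_box_bump_tendsto(1) and int = integral_box_bump_tendsto(2)
 have box: "emeasure \<mu> (box a b) = emeasure \<nu> (box a b)" for a b
 proof -
  have "(\<integral>x. box_bump (real (Suc k)) a b x \<partial>\<mu>) = (\<integral>x. box_bump (real (Suc k)) a b x \<partial>\<nu>)" for k
   by (intro eq test_function_box_bump) simp
  then have "(\<integral>x. indicator (box a b) x \<partial>\<mu>) = (\<integral>x. indicator (box a b) x \<partial>\<nu> :: real)"
   using lim[OF s(1) fin(1), of a b] lim[OF s(2) fin(2), of a b] LIMSEQ_unique by simp
  then have "measure \<mu> (box a b) = measure \<nu> (box a b)"
   using s sets_eq_imp_space_eq[OF s(1)] sets_eq_imp_space_eq[OF s(2)] by simp
  then show ?thesis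
   using int[OF s(1) fin(1), of a b] int[OF s(2) fin(2), of a b]
   by (simp add: emeasure_eq_ennreal_measure less_top[symmetric])
 qed
 show ?thesis
 proof (rule measure_eqI_generator_eq)
  let ?E = "range (\<lambda>(a, b). box a b :: (real^'n) set)"
  let ?A = "\<lambda>n::nat. box (- (real n *\<^sub>R One)) (real n *\<^sub>R One) :: (real^'n) set"
  show "Int_stable ?E" by (auto simp: Int_stable_def box_Int_box)
  show "?E \<subseteq> Pow UNIV" "sets \<mu> = sigma_sets UNIV ?E" "sets \<nu> = sigma_sets UNIV ?E"
   by (simp_all add: borel_eq_box s)
  show "range ?A \<subseteq> ?E" "(\<Union>i. ?A i) = UNIV" unfolding UN_box_eq_UNIV by auto
  show "emeasure \<mu> (?A i) \<noteq> \<infinity>" for i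
   using int[OF s(1) fin(1), of "- (real i *\<^sub>R One)" "real i *\<^sub>R One"] by simp
  show "emeasure \<mu> X = emeasure \<nu> X" if "X \<in> ?E" for X using that box by auto
 qed
qed

lemma current_measureI:
 assumes "sets \<mu> = sets borel" "\<And>K. compact K \<Longrightarrow> emeasure \<mu> K < \<infinity>"
  and "\<And>\<eta>. test_function \<eta> \<Longrightarrow> T (fun_form \<eta>) = (\<integral>x. \<eta> x \<partial>\<mu>)"
 shows "current_measure T = \<mu>"
 unfolding current_measure_def using assms
 by (intro the_equality) (auto intro!: test_functions_determine_measure)

lemma sd_sd_sharp_fun_form:
 fixes f :: "'n::{finite,linorder} point \<Rightarrow> real"
 assumes f: "Ck_on 2 f UNIV"
 shows "sd (sd_sharp (fun_form f)) y = (\<Sum>k\<in>UNIV. \<Sum>l\<in>UNIV. hess f y (axis k 1) $ l *\<^sub>R (dx k \<and>\<^sub>s d\<xi> l))"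
proof -
 have "f differentiable (at x)" for x using f by (simp add: numeral_2_eq_2)
 then have "sd_sharp (fun_form f) = (\<lambda>x. dxi_of (grad f x))"
  unfolding fun_form_def by (simp add: fun_eq_iff sd_sharp_scaleR)
 moreover have "partial_deriv k (\<lambda>x. dxi_of (grad f x)) y = dxi_of (hess f y (axis k 1))" for k
 proof -
  have "((\<lambda>x. dxi_of (grad f x)) has_derivative (\<lambda>v. dxi_of (hess f y v))) (at y)"
   using bounded_linear.has_derivative[OF _ has_derivative_hess[OF f open_UNIV UNIV_I], of dxi_of] linear_dxi_of
   by (simp add: linear_conv_bounded_linear)
  then show ?thesis unfolding partial_deriv_def by (simp flip: frechet_derivative_at)
 qed
 ultimately show ?thesis
  by (simp add: sd_def dxi_of_def wedge.sum_right wedge.scaleR_right)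
qed

context
 fixes M :: "'n::{finite,linorder} point set" and T :: "'m::finite itself" and \<mu> and p :: nat
 assumes M: "submanifold CARD('m) M" and cM: "compact M"
  and \<mu>: "\<mu> = surface_measure TYPE('m) M" and p: "p = CARD('n) - CARD('m)"
begin

private lemma surf: "is_surface_measure TYPE('m) M \<mu>"
 unfolding \<mu> by (rule surface_measure_is_surface_measure[OF M cM])

private lemma sets_\<mu>: "sets \<mu> = sets borel" and null: "emeasure \<mu> (- M) = 0"
 using surf by (auto simp: is_surface_measure_def)

text \<open>The constant c_p cancels the sign of \<open>wedge_list_normal_square\<close>, and the
  square of the normal form becomes the frame product of the unit normals.\<close>

lemma normal_square_eq:
 assumes y: "y \<in> M"
 obtains vs where "orthonormal_list vs" "length vs = p"
  "(- 1) ^ (p * (p - 1) div 2) *\<^sub>R normal_square CARD('m) M y = dx_dxi_list vs"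
  "\<And>L. tangent_trace CARD('m) M y L = tan_trace (set vs) L"
proof -
 define \<nu> where "\<nu> = normal_system CARD('m) M y"
 obtain U where U: "y \<in> U" "orthonormal_system M p U \<nu>"
  using normal_system_orthonormal[OF M y] unfolding \<nu>_def p by blast
 have "normal_form CARD('m) M y j y = dx_of (grad (\<nu> j) y)" if "j < p" for j
 proof -
  have "smooth_on (\<nu> j) U" using U(2) that by (simp add: orthonormal_system_def)
  then show ?thesis
   unfolding normal_form_def \<nu>_def[symmetric] by (rule sd_fun_form[OF smooth_on_differentiable[OF _ U(1)]])
 qed
 then have "map (\<lambda>j. normal_form CARD('m) M y j y) [0..<p] = map dx_of (normals p \<nu> y)"
  by (simp add: normals_def)
 then have "normal_square CARD('m) M y = (- 1) ^ (p * (p - 1) div 2) *\<^sub>R dx_dxi_list (normals p \<nu> y)"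
  using wedge_list_normal_square[of "normals p \<nu> y"] unfolding normal_square_def Let_def p by simp
 then have "(- 1) ^ (p * (p - 1) div 2) *\<^sub>R normal_square CARD('m) M y = dx_dxi_list (normals p \<nu> y)"
  by (simp add: power_add[symmetric] mult_2[symmetric] power_mult)
 then show thesis
  using orthonormal_system_normals[OF U(2) y U(1)]
  by (intro that[of "normals p \<nu> y"]) (simp_all add: tangent_trace_def \<nu>_def p)
qed

lemma emeasure_surface_measure_finite: "emeasure \<mu> B < \<infinity>"
proof (cases "B \<in> sets borel")
 case True
 have Mb: "M \<in> sets borel" using compact_imp_closed[OF cM] by auto
 have "set_integrable \<mu> M (\<lambda>x. 1 :: real)"
  by (rule surface_set_integrable[OF M cM surf continuous_on_const])
 then have "integrable \<mu> (indicat_real M)" by (simp add: set_integrable_def)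
 then have fM: "emeasure \<mu> M < \<infinity>" using Mb sets_\<mu> sets_eq_imp_space_eq[OF sets_\<mu>] by (simp add: integrable_indicator_iff)
 have "emeasure \<mu> B \<le> emeasure \<mu> (M \<union> - M)"
  using True Mb sets_\<mu> by (intro emeasure_mono) auto
 also have "\<dots> \<le> emeasure \<mu> M + emeasure \<mu> (- M)"
  using Mb sets_\<mu> by (intro emeasure_subadditive) (auto simp: sets.compl_sets)
 finally show ?thesis using fM null by (simp add: order.strict_trans1)
qed (simp add: emeasure_notin_sets sets_\<mu>)

lemma integral_surface_measure:
 assumes "continuous_on UNIV f"
 shows "(\<integral>x. f x \<partial>\<mu>) = (LINT x:M|\<mu>. f x :: real)"
 unfolding set_lebesgue_integral_def
proof (rule integral_cong_AE)
 have Mb: "M \<in> sets borel" using compact_imp_closed[OF cM] by auto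
 show "f \<in> borel_measurable \<mu>"
  unfolding measurable_cong_sets[OF sets_\<mu> refl] using assms by (rule borel_measurable_continuous_onI)
 then show "(\<lambda>x. indicator M x *\<^sub>R f x) \<in> borel_measurable \<mu>" using Mb sets_\<mu> by simp
 have "- M \<in> null_sets \<mu>" using null Mb sets_\<mu> by (auto simp: null_sets_def)
 from AE_not_in[OF this] show "AE x in \<mu>. f x = indicator M x *\<^sub>R f x" by (auto elim!: eventually_mono)
qed

lemma volume_form_eq: "volume_form TYPE('m) M = \<mu>"
 unfolding volume_form_def
proof (rule current_measureI[OF sets_\<mu> emeasure_surface_measure_finite])
 fix \<eta> :: "'n point \<Rightarrow> real" assume \<eta>: "test_function \<eta>"
 have "top_coeff ((- 1) ^ (p * (p - 1) div 2) *\<^sub>R normal_square CARD('m) M y \<and>\<^sub>s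
   ((1 / fact CARD('m)) *\<^sub>R wedge_power \<beta> CARD('m)) \<and>\<^sub>s fun_form \<eta> y) = \<eta> y" if y: "y \<in> M" for y
 proof -
  obtain vs where vs: "orthonormal_list vs" "length vs = p"
   "(- 1) ^ (p * (p - 1) div 2) *\<^sub>R normal_square CARD('m) M y = dx_dxi_list vs"
   using normal_square_eq[OF y] by metis
  have "length vs + CARD('m) = CARD('n)" using vs(2) M by (simp add: submanifold_def p)
  from top_coeff_dx_dxi_list_beta[OF vs(1) this] show ?thesis
   unfolding vs(3) by (simp add: fun_form_def wedge.scaleR_right wedge.scaleR_left linear_cmul[OF linear_top_coeff])
 qed
 moreover have "M \<in> sets \<mu>" using compact_imp_closed[OF cM] sets_\<mu> by auto
 ultimately have "(LINT y:M|\<mu>. top_coeff ((- 1) ^ (p * (p - 1) div 2) *\<^sub>R normal_square CARD('m) M y \<and>\<^sub>s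
   ((1 / fact CARD('m)) *\<^sub>R wedge_power \<beta> CARD('m)) \<and>\<^sub>s fun_form \<eta> y)) = (LINT y:M|\<mu>. \<eta> y)"
  by (intro set_lebesgue_integral_cong) auto
 moreover have c: "continuous_on UNIV \<eta>"
  using \<eta> Ck_on_continuous_on unfolding test_function_def smooth_on_def by blast
 ultimately show "current_wedge (submanifold_current TYPE('m) M)
   (\<lambda>x. (1 / fact CARD('m)) *\<^sub>R wedge_power \<beta> CARD('m)) (fun_form \<eta>) = (\<integral>x. \<eta> x \<partial>\<mu>)"
  by (simp only: current_wedge_def submanifold_current_def Let_def measure_current_def integral_surface_measure[OF c]
    \<mu>[symmetric] p[symmetric])
qed

lemma current_integral_sd_sd_sharp:
 assumes f: "Ck_on 2 f UNIV"
 shows "current_integral (current_wedge (current_wedge (submanifold_current TYPE('m) M)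
   (\<lambda>x. (1 / fact (CARD('m) - 1)) *\<^sub>R wedge_power \<beta> (CARD('m) - 1))) (sd (sd_sharp (fun_form f)))) =
  (LINT y:M|\<mu>. tangent_trace CARD('m) M y (hess f y))"
proof -
 have "top_coeff ((- 1) ^ (p * (p - 1) div 2) *\<^sub>R normal_square CARD('m) M y \<and>\<^sub>s
   ((1 / fact (CARD('m) - 1)) *\<^sub>R wedge_power \<beta> (CARD('m) - 1)) \<and>\<^sub>s sd (sd_sharp (fun_form f)) y) =
  tangent_trace CARD('m) M y (hess f y)" if y: "y \<in> M" for y
 proof -
  obtain vs where vs: "orthonormal_list vs" "length vs = p"
   "(- 1) ^ (p * (p - 1) div 2) *\<^sub>R normal_square CARD('m) M y = dx_dxi_list vs"
   and tt: "\<And>L. tangent_trace CARD('m) M y L = tan_trace (set vs) L"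
   using normal_square_eq[OF y] by metis
  \<comment> \<open>The dimension is positive, so the truncated difference
    \<open>CARD('m) - 1\<close> is its true predecessor.\<close>
  have "CARD('m) \<noteq> 0" by simp
  then have l: "length vs + Suc (CARD('m) - 1) = CARD('n)" using vs(2) M by (simp add: submanifold_def p)
  have "hess f y (axis k 1) $ l = hess f y (axis l 1) $ k" for k l
   using hess_symmetric[OF f open_UNIV UNIV_I, of y "axis k 1" "axis l 1"] by (simp add: inner_axis)
  from top_coeff_dx_dxi_list_beta_symmetric[OF vs(1) l this] show ?thesis
   unfolding vs(3) tt sd_sd_sharp_fun_form[OF f]
   by (simp add: tan_trace_def inner_vec_def wedge.scaleR_right wedge.scaleR_left linear_cmul[OF linear_top_coeff])
 qed
 moreover have "M \<in> sets \<mu>" using compact_imp_closed[OF cM] sets_\<mu> by auto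
 ultimately have "(LINT y:M|\<mu>. top_coeff ((- 1) ^ (p * (p - 1) div 2) *\<^sub>R normal_square CARD('m) M y \<and>\<^sub>s
   ((1 / fact (CARD('m) - 1)) *\<^sub>R wedge_power \<beta> (CARD('m) - 1)) \<and>\<^sub>s sd (sd_sharp (fun_form f)) y)) =
  (LINT y:M|\<mu>. tangent_trace CARD('m) M y (hess f y))"
  by (intro set_lebesgue_integral_cong) auto
 moreover have one: "fun_form (\<lambda>x. 1) y = sone" for y :: "'n point" by (simp add: fun_form_def)
 ultimately show ?thesis
  by (simp only: current_integral_def current_wedge_def submanifold_current_def Let_def measure_current_def
    one wedge_sone \<mu>[symmetric] p[symmetric])
qed

end

section \<open>Convex and $m$-subharmonic functions\<close>

text \<open>On a line through \<open>x\<close> the graph lies above its tangents. Tangents at two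
  points, compared with each other, show that the derivative is increasing, and the second
  derivative is a limit of nonnegative quotients.\<close>

lemma convex_hess_nonneg:
 fixes f :: "real^'n::finite \<Rightarrow> real"
 assumes c: "convex_on UNIV f" and f: "Ck_on 2 f UNIV"
 shows "0 \<le> hess f x v \<bullet> v"
proof -
 define g where "g s = f (x + s *\<^sub>R v)" for s
 define g' where "g' s = grad f (x + s *\<^sub>R v) \<bullet> v" for s
 have line: "((\<lambda>s. x + s *\<^sub>R v) has_derivative (\<lambda>h. h *\<^sub>R v)) (at s)" for s
  by (auto intro!: derivative_eq_intros)
 have "f differentiable (at y)" for y using f by (simp add: numeral_2_eq_2)
 from diff_chain_at[OF line has_derivative_grad[OF this]]
 have der: "(g has_real_derivative g' s) (at s)" for s
  by (simp add: g_def[abs_def] g'_def has_field_derivative_def comp_def mult_commute_abs)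
 have cg: "convex_on UNIV g"
 proof (rule convex_onI)
  fix t a b :: real assume t: "0 < t" "t < 1"
  have "x + ((1 - t) *\<^sub>R a + t *\<^sub>R b) *\<^sub>R v = (1 - t) *\<^sub>R (x + a *\<^sub>R v) + t *\<^sub>R (x + b *\<^sub>R v)"
   by (simp add: algebra_simps)
  then show "g ((1 - t) *\<^sub>R a + t *\<^sub>R b) \<le> (1 - t) * g a + t * g b"
   unfolding g_def using convex_onD[OF c, of t "x + a *\<^sub>R v" "x + b *\<^sub>R v"] t by simp
 qed simp
 have tangent: "g t - g s \<ge> g' s * (t - s)" for s t
  by (rule convex_on_imp_above_tangent[OF cg connected_UNIV]) (use der in auto)
 have mono: "0 \<le> (g' s - g' 0) / s" for s
 proof -
  have "0 \<le> (g' s - g' 0) * s" using tangent[of 0 s] tangent[of s 0] by (simp add: algebra_simps)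
  then show ?thesis by (simp add: zero_le_divide_iff zero_le_mult_iff)
 qed
 from diff_chain_at[OF line[of 0], of "grad f" "hess f x"] has_derivative_hess[OF f open_UNIV UNIV_I, of x]
 have "((\<lambda>s. grad f (x + s *\<^sub>R v)) has_derivative (\<lambda>h. hess f x (h *\<^sub>R v))) (at 0)"
  by (simp add: comp_def)
 from has_derivative_inner_left[OF this, of v]
 have "(g' has_derivative (\<lambda>h. h * (hess f x v \<bullet> v))) (at 0)"
  using linear_cmul[OF has_derivative_linear[OF has_derivative_hess[OF f open_UNIV UNIV_I]], of x _ v]
  by (simp add: g'_def[abs_def])
 then have "(g' has_real_derivative hess f x v \<bullet> v) (at 0)"
  by (simp add: has_field_derivative_def mult_commute_abs)
 then have "((\<lambda>s. (g' s - g' 0) / (s - 0)) \<longlongrightarrow> hess f x v \<bullet> v) (at 0)"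
  by (simp add: has_field_derivative_iff)
 then show ?thesis using mono by (intro tendsto_lowerbound[where F="at 0"]) auto
qed

text \<open>The operators reach the test form in the order d# d; exchanging d\<xi> and dx produces
  the minus sign, and the constant even form commutes with the rest.\<close>

lemma top_coeff_sd_sharp_sd:
 fixes vs :: "'n::{finite,linorder} point list"
 assumes vs: "orthonormal_list vs" "length vs + Suc m = CARD('n)" and \<eta>: "Ck_on 2 \<eta> UNIV"
 shows "top_coeff (sd_sharp (sd (\<lambda>x. \<eta> x *\<^sub>R (wedge_power \<beta> m \<and>\<^sub>s dx_dxi_list vs))) x) =
  - fact m * tan_trace (set vs) (hess \<eta> x)"
proof -
 let ?A = "dx_dxi_list vs" and ?B = "wedge_power \<beta> m \<and>\<^sub>s dx_dxi_list vs"
 define h where "h k l = hess \<eta> x (axis k 1) $ l" for k l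
 have hsym: "h k l = h l k" for k l
  using hess_symmetric[OF \<eta> open_UNIV UNIV_I, of x "axis k 1" "axis l 1"] by (simp add: h_def inner_axis)
 have "\<eta> differentiable (at x)" for x using \<eta> by (simp add: numeral_2_eq_2)
 then have sd: "sd (\<lambda>x. \<eta> x *\<^sub>R ?B) = (\<lambda>x. dx_of (grad \<eta> x) \<and>\<^sub>s ?B)" by (simp add: fun_eq_iff sd_scaleR)
 have bl: "bounded_linear (\<lambda>v. dx_of v \<and>\<^sub>s ?B)"
  using bounded_linear_compose[OF wedge.bounded_linear_left[of ?B], of dx_of] linear_dx_of
  by (simp add: linear_conv_bounded_linear)
 have "((\<lambda>x. dx_of (grad \<eta> x) \<and>\<^sub>s ?B) has_derivative (\<lambda>v. dx_of (hess \<eta> x v) \<and>\<^sub>s ?B)) (at x)"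
  by (rule bounded_linear.has_derivative[OF bl has_derivative_hess[OF \<eta> open_UNIV UNIV_I]])
 then have pd: "partial_deriv l (\<lambda>x. dx_of (grad \<eta> x) \<and>\<^sub>s ?B) x = dx_of (hess \<eta> x (axis l 1)) \<and>\<^sub>s ?B" for l
  unfolding partial_deriv_def by (simp flip: frechet_derivative_at)
 have swap: "d\<xi> l \<and>\<^sub>s dx k \<and>\<^sub>s ?B = - (?A \<and>\<^sub>s wedge_power \<beta> m \<and>\<^sub>s dx k \<and>\<^sub>s d\<xi> l)" for k l
 proof -
  have "dx k \<and>\<^sub>s d\<xi> l \<and>\<^sub>s ?B = (dx k \<and>\<^sub>s d\<xi> l) \<and>\<^sub>s ?B" by (simp only: wedge_assoc)
  also have "\<dots> = ?B \<and>\<^sub>s dx k \<and>\<^sub>s d\<xi> l"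
   using dx_of_dxi_of_central[of "axis k 1" "axis l 1" ?B] by simp
  also have "\<dots> = ?A \<and>\<^sub>s wedge_power \<beta> m \<and>\<^sub>s dx k \<and>\<^sub>s d\<xi> l"
   by (simp only: beta_power_central[of m ?A] wedge_assoc)
  finally show ?thesis by (simp only: dxi_dx_anticommute)
 qed
 have "sd_sharp (sd (\<lambda>x. \<eta> x *\<^sub>R ?B)) x = (\<Sum>l\<in>UNIV. \<Sum>k\<in>UNIV. h l k *\<^sub>R (d\<xi> l \<and>\<^sub>s dx k \<and>\<^sub>s ?B))"
  unfolding sd sd_sharp_def pd
  by (simp add: dx_of_def h_def wedge.sum_left wedge.sum_right wedge.scaleR_left wedge.scaleR_right)
 also have "\<dots> = - (\<Sum>k\<in>UNIV. \<Sum>l\<in>UNIV. h k l *\<^sub>R (?A \<and>\<^sub>s wedge_power \<beta> m \<and>\<^sub>s dx k \<and>\<^sub>s d\<xi> l))"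
  unfolding swap by (subst sum.swap) (simp add: sum_negf hsym)
 also have "\<dots> = - (?A \<and>\<^sub>s wedge_power \<beta> m \<and>\<^sub>s (\<Sum>k\<in>UNIV. \<Sum>l\<in>UNIV. h k l *\<^sub>R (dx k \<and>\<^sub>s d\<xi> l)))"
  by (simp add: wedge.sum_right wedge.scaleR_right)
 finally show ?thesis
  using top_coeff_dx_dxi_list_beta_symmetric[OF vs hsym]
  by (simp add: linear_neg[OF linear_top_coeff] tan_trace_def inner_vec_def h_def)
qed

lemma derivative_outside:
 assumes K: "closed K" "\<And>x. x \<notin> K \<Longrightarrow> f x = 0" and x: "x \<notin> K"
 shows "FD f x = (\<lambda>v. 0)"
proof -
 have "(f has_derivative (\<lambda>v. 0)) (at x)"
  by (rule has_derivative_transform_within_open[OF has_derivative_const, of "- K"]) (use K x in auto)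
 then show ?thesis by (rule frechet_derivative_at[symmetric])
qed

text \<open>Two integrations by parts meet at the integral of the product of first derivatives;
  compact support of \<open>\<eta>\<close> alone removes the boundary terms in both. Symmetry of the
  Hessian restores the order of the two directions.\<close>

lemma integral_hess_symmetric:
 fixes f \<eta> :: "real^'n::finite \<Rightarrow> real"
 assumes f: "Ck_on 2 f UNIV" and \<eta>: "Ck_on 2 \<eta> UNIV" and K: "compact K" "\<And>x. x \<notin> K \<Longrightarrow> \<eta> x = 0"
 shows "(LINT x:K|lborel. f x * (hess \<eta> x a \<bullet> b)) = (LINT x:K|lborel. \<eta> x * (hess f x a \<bullet> b))"
proof -
 have cK: "closed K" using K(1) by (rule compact_imp_closed)
 have g0: "grad \<eta> x = 0" if "x \<notin> K" for x
  using derivative_outside[OF cK K(2) that] by (simp add: grad_def vec_eq_iff)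
 have h0: "hess \<eta> x v = 0" if "x \<notin> K" for x v
  using derivative_outside[OF cK g0 that] by (simp add: hess_def)
 have c: "continuous_on UNIV u" "continuous_on UNIV (\<lambda>x. grad u x \<bullet> v)" "continuous_on UNIV (\<lambda>x. hess u x v \<bullet> w)"
  if u: "Ck_on 2 u UNIV" for u :: "real^'n \<Rightarrow> real" and v w
 proof -
  show "continuous_on UNIV u" using u by (rule Ck_on_continuous_on)
  have 1: "Ck_on (Suc 0) (grad u) UNIV" using u by (intro Ck_on_grad) (auto simp only: numeral_2_eq_2 open_UNIV)
  then show "continuous_on UNIV (\<lambda>x. grad u x \<bullet> v)"
   by (intro continuous_on_inner continuous_on_const Ck_on_continuous_on)
  have "continuous_on UNIV (\<lambda>x. hess u x v)" using 1 by (simp add: hess_def)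
  then show "continuous_on UNIV (\<lambda>x. hess u x v \<bullet> w)" by (intro continuous_on_inner continuous_on_const)
 qed
 have dir: "((\<lambda>h. u (x + h *\<^sub>R v)) has_real_derivative grad u x \<bullet> v) (at 0)"
  "((\<lambda>h. grad u (x + h *\<^sub>R v) \<bullet> w) has_real_derivative hess u x v \<bullet> w) (at 0)"
  if u: "Ck_on 2 u UNIV" for u :: "real^'n \<Rightarrow> real" and x v w
 proof -
  have line: "((\<lambda>s. x + s *\<^sub>R v) has_derivative (\<lambda>h. h *\<^sub>R v)) (at 0)" by (auto intro!: derivative_eq_intros)
  have "u differentiable (at x)" using u by (simp add: numeral_2_eq_2)
  from diff_chain_at[OF line, of u "\<lambda>v. grad u x \<bullet> v"] has_derivative_grad[OF this]
  show "((\<lambda>h. u (x + h *\<^sub>R v)) has_real_derivative grad u x \<bullet> v) (at 0)"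
   by (simp add: has_field_derivative_def comp_def mult_commute_abs)
  note dh = has_derivative_hess[OF u open_UNIV UNIV_I, of x]
  from has_derivative_inner_left[OF diff_chain_at[OF line, of "grad u" "hess u x"], of w] dh
  show "((\<lambda>h. grad u (x + h *\<^sub>R v) \<bullet> w) has_real_derivative hess u x v \<bullet> w) (at 0)"
   by (simp add: has_field_derivative_def comp_def mult_commute_abs linear_cmul[OF has_derivative_linear[OF dh]])
 qed
 have parts: "(LINT x:K|lborel. (grad u x \<bullet> a) * (grad w x \<bullet> b) + u x * (hess w x a \<bullet> b)) = 0"
  if u: "Ck_on 2 u UNIV" "Ck_on 2 w UNIV"
   and 0: "\<And>x. x \<notin> K \<Longrightarrow> u x * (grad w x \<bullet> b) = 0" "\<And>x. x \<notin> K \<Longrightarrow> (grad u x \<bullet> a) * (grad w x \<bullet> b) + u x * (hess w x a \<bullet> b) = 0"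
  for u w :: "real^'n \<Rightarrow> real" and a b
 proof -
  define g where "g x = (grad u x \<bullet> a) * (grad w x \<bullet> b) + u x * (hess w x a \<bullet> b)" for x
  have "continuous_on UNIV g" unfolding g_def by (intro continuous_intros c u)
  then have "continuous_on K g" by (rule continuous_on_subset) simp
  from compact_imp_bounded[OF compact_continuous_image[OF this K(1)]]
  obtain B where B: "\<And>x. x \<in> K \<Longrightarrow> norm (g x) \<le> B" unfolding bounded_iff by blast
  have "(LINT x:K|lborel. g x) = 0"
  proof (rule integral_directional_derivative_eq_0[where B="\<bar>B\<bar>"])
   show "continuous_on UNIV (\<lambda>x. u x * (grad w x \<bullet> b))" by (intro continuous_intros c u)
   show "g x = 0" if "x \<notin> K" for x using 0(2)[OF that] by (simp add: g_def)
   then show "\<bar>g x\<bar> \<le> \<bar>B\<bar>" for x using B[of x] by (cases "x \<in> K") auto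
   show "((\<lambda>h. u (x + h *\<^sub>R a) * (grad w (x + h *\<^sub>R a) \<bullet> b)) has_real_derivative g x) (at 0)" for x
    using DERIV_mult[OF dir(1)[OF u(1), of x a] dir(2)[OF u(2), of x a b]] by (simp add: g_def algebra_simps)
  qed (use K(1) 0(1) in auto)
  then show ?thesis by (simp add: g_def)
 qed
 have int: "set_integrable lborel K u" if "continuous_on UNIV u" for u :: "real^'n \<Rightarrow> real"
  unfolding set_integrable_def using K(1) that by (intro borel_integrable_compact) (auto intro: continuous_on_subset)
 have i1: "set_integrable lborel K (\<lambda>x. (grad f x \<bullet> a) * (grad \<eta> x \<bullet> b))"
  and i2: "set_integrable lborel K (\<lambda>x. f x * (hess \<eta> x a \<bullet> b))"
  and i3: "set_integrable lborel K (\<lambda>x. \<eta> x * (hess f x a \<bullet> b))"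
  by (intro int continuous_on_mult c f \<eta>)+
 have "(LINT x:K|lborel. (grad f x \<bullet> a) * (grad \<eta> x \<bullet> b)) + (LINT x:K|lborel. f x * (hess \<eta> x a \<bullet> b)) = 0"
  using parts[OF f \<eta>, of b a] g0 h0 unfolding set_integral_add(2)[OF i1 i2] by simp
 moreover have "(LINT x:K|lborel. (grad f x \<bullet> a) * (grad \<eta> x \<bullet> b)) + (LINT x:K|lborel. \<eta> x * (hess f x a \<bullet> b)) = 0"
 proof -
  have "(LINT x:K|lborel. (grad \<eta> x \<bullet> b) * (grad f x \<bullet> a) + \<eta> x * (hess f x b \<bullet> a)) = 0"
   using parts[OF \<eta> f, of a b] g0 K(2) by auto
  then show ?thesis
   unfolding set_integral_add(2)[OF i1 i3, symmetric]
   by (simp add: mult.commute hess_symmetric[OF f open_UNIV UNIV_I, of _ b a])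
 qed
 ultimately show ?thesis by linarith
qed

text \<open>Near a point with a negative value, continuity gives a box on which \<open>g\<close> is
  below half of it; for large scale the bump of that box has positive integral, and the tested
  integral would be negative.\<close>

lemma nonneg_if_integral_test_nonneg:
 fixes g :: "real^'n::finite \<Rightarrow> real"
 assumes g: "continuous_on UNIV g"
  and pos: "\<And>a b c. 0 < c \<Longrightarrow> 0 \<le> (LINT x:cbox a b|lborel. box_bump c a b x * g x)"
 shows "0 \<le> g y"
proof (rule ccontr)
 assume "\<not> 0 \<le> g y"
 then have y: "y \<in> {x. g x < g y / 2}" "g y < 0" by auto
 have "open {x. g x < g y / 2}" using g by (intro open_Collect_less) auto
 then obtain a b where ab: "cbox a b \<subseteq> {x. g x < g y / 2}" "y \<in> box a b" "\<forall>i\<in>Basis. a \<bullet> i < b \<bullet> i"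
  using y(1) by (rule open_contains_cbox)
 have "0 < measure lborel (box a b)"
  using ab(3) by (subst measure_lborel_box) (auto intro!: prod_pos simp: inner_diff_left less_imp_le)
 moreover have "(\<lambda>k. \<integral>x. box_bump (real (Suc k)) a b x \<partial>lborel) \<longlonglongrightarrow> (\<integral>x. indicator (box a b) x \<partial>lborel)"
  by (rule integral_box_bump_tendsto(1)) (auto simp: emeasure_compact_finite simp flip: infinity_ennreal_def)
 ultimately have "\<forall>\<^sub>F k in sequentially. 0 < (\<integral>x. box_bump (real (Suc k)) a b x \<partial>lborel)"
  by (intro order_tendstoD(1)) auto
 then obtain k where k: "0 < (\<integral>x. box_bump (real (Suc k)) a b x \<partial>lborel)"
  using eventually_happens by fastforce
 let ?u = "box_bump (real (Suc k)) a b"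
 have cu: "continuous_on UNIV ?u"
  using smooth_box_bump Ck_on_continuous_on unfolding smooth_on_def by blast
 have int: "set_integrable lborel (cbox a b) v" if "continuous_on UNIV v" for v :: "real^'n \<Rightarrow> real"
  unfolding set_integrable_def using that by (intro borel_integrable_compact) (auto intro: continuous_on_subset)
 have "0 \<le> (LINT x:cbox a b|lborel. ?u x * g x)" by (intro pos) simp
 also have "\<dots> \<le> (LINT x:cbox a b|lborel. ?u x * (g y / 2))"
 proof (rule set_integral_mono)
  show "?u x * g x \<le> ?u x * (g y / 2)" if "x \<in> cbox a b" for x
   using ab(1) that by (intro mult_left_mono box_bump_nonneg) auto
 qed (intro int continuous_on_mult cu g continuous_on_const)+
 also have "\<dots> = (LINT x:cbox a b|lborel. ?u x) * (g y / 2)" by simp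
 also have "(LINT x:cbox a b|lborel. ?u x) = (\<integral>x. ?u x \<partial>lborel)"
  unfolding set_lebesgue_integral_def
 proof (intro Bochner_Integration.integral_cong refl)
  fix x
  have "?u x = 0" if "x \<notin> cbox a b" using that box_subset_cbox by (intro box_bump_eq_0) auto
  then show "indicator (cbox a b) x *\<^sub>R ?u x = ?u x" by (auto split: split_indicator)
 qed
 also have "\<dots> * (g y / 2) < 0" using k y(2) by (intro mult_pos_neg) auto
 finally show False by simp
qed

text \<open>Testing with bumps times a constant frame form gives a distributional inequality;
  integration by parts converts it into one for the continuous traced Hessian, which then holds at
  each point.\<close>

lemma m_subharmonic_tan_trace_nonneg:
 fixes vs :: "'n::{finite,linorder} point list"
 assumes msh: "m_subharmonic (Suc m) f" and f: "Ck_on 2 f UNIV"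
  and vs: "orthonormal_list vs" "length vs + Suc m = CARD('n)"
 shows "0 \<le> tan_trace (set vs) (hess f y)"
proof (rule nonneg_if_integral_test_nonneg)
 have 1: "Ck_on (Suc 0) (grad f) UNIV" using f by (intro Ck_on_grad) (auto simp only: numeral_2_eq_2 open_UNIV)
 then have "continuous_on UNIV (\<lambda>x. hess f x v)" for v by (simp add: hess_def)
 then show "continuous_on UNIV (\<lambda>x. tan_trace (set vs) (hess f x))"
  unfolding tan_trace_def by (intro continuous_intros)
 fix a b :: "'n point" and c :: real assume c: "0 < c"
 define \<eta> where "\<eta> = box_bump c a b"
 have t: "test_function \<eta>" "\<And>x. 0 \<le> \<eta> x" and \<eta>2: "Ck_on 2 \<eta> UNIV"
  using test_function_box_bump[OF c] box_bump_nonneg smooth_box_bump[of c a b] by (simp_all only: \<eta>_def smooth_on_def)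
 have out: "\<eta> x = 0" if "x \<notin> cbox a b" for x
  using that box_subset_cbox unfolding \<eta>_def by (intro box_bump_eq_0 c) auto
 have wp: "weakly_positive (Suc m) (dx_dxi_list vs)" by (rule weakly_positive_dx_dxi_list[OF vs])
 have sm: "smooth_on (\<lambda>x :: 'n point. dx_dxi_list vs) UNIV" by (simp add: smooth_on_def Ck_on_const)
 have "positive_top_current (current_wedge (current_wedge (current_d 1 (current_d_sharp 0 (fun_current f)))
   (\<lambda>x. wedge_power \<beta> (Suc m - 1))) (\<lambda>x. dx_dxi_list vs))"
  using msh sm wp unfolding m_subharmonic_def by blast
 then have "0 \<le> current_wedge (current_wedge (current_d 1 (current_d_sharp 0 (fun_current f)))
   (\<lambda>x. wedge_power \<beta> (Suc m - 1))) (\<lambda>x. dx_dxi_list vs) (fun_form \<eta>)"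
  using t unfolding positive_top_current_def by blast
 \<comment> \<open>Moving d off a current of degree 1 costs no sign and moving d# off a function
   costs -1; this cancels the minus sign in \<open>top_coeff_sd_sharp_sd\<close>.\<close>
 also have "\<dots> = - (\<integral>x. top_coeff (f x *\<^sub>R sd_sharp (sd (\<lambda>x. \<eta> x *\<^sub>R (wedge_power \<beta> m \<and>\<^sub>s dx_dxi_list vs))) x) \<partial>lborel)"
  by (simp add: current_wedge_def current_d_def current_d_sharp_def fun_current_def superintegral_def fun_form_def
    wedge.scaleR_right)
 also have "\<dots> = fact m * (\<integral>x. f x * tan_trace (set vs) (hess \<eta> x) \<partial>lborel)"
  by (simp add: linear_cmul[OF linear_top_coeff] top_coeff_sd_sharp_sd[OF vs \<eta>2] mult_ac)
 finally have "0 \<le> (\<integral>x. f x * tan_trace (set vs) (hess \<eta> x) \<partial>lborel)" by (metis fact_gt_zero zero_le_mult_iff not_le)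
 also have "\<dots> = (LINT x:cbox a b|lborel. f x * tan_trace (set vs) (hess \<eta> x))"
  unfolding set_lebesgue_integral_def
 proof (intro Bochner_Integration.integral_cong refl)
  fix x
  have "grad \<eta> x = 0" if "x \<notin> cbox a b" for x
   using derivative_outside[OF closed_cbox out that] by (simp add: grad_def vec_eq_iff)
  from derivative_outside[OF closed_cbox this] have "hess \<eta> x = (\<lambda>v. 0)" if "x \<notin> cbox a b"
   using that by (simp add: hess_def)
  then show "f x * tan_trace (set vs) (hess \<eta> x) = indicator (cbox a b) x *\<^sub>R (f x * tan_trace (set vs) (hess \<eta> x))"
   by (auto simp: tan_trace_def split: split_indicator)
 qed
 also have "\<dots> = (LINT x:cbox a b|lborel. \<eta> x * tan_trace (set vs) (hess f x))"
 proof -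
  have ex: "(LINT x:cbox a b|lborel. u x * tan_trace (set vs) (hess w x)) =
    (\<Sum>k\<in>UNIV. LINT x:cbox a b|lborel. u x * (hess w x (axis k 1) \<bullet> orth_rest (set vs) (axis k 1)))"
   if u: "Ck_on 2 u UNIV" "Ck_on 2 w UNIV" for u w :: "'n point \<Rightarrow> real"
  proof -
   have "Ck_on (Suc 0) (grad w) UNIV" using u(2) by (intro Ck_on_grad) (auto simp only: numeral_2_eq_2 open_UNIV)
   then have "continuous_on UNIV (\<lambda>x. hess w x v)" for v by (simp add: hess_def)
   then have c: "continuous_on UNIV (\<lambda>x. u x * (hess w x v \<bullet> v'))" for v v'
    using Ck_on_continuous_on[OF u(1)] by (intro continuous_intros)
   show ?thesis
    unfolding tan_trace_def sum_distrib_left set_lebesgue_integral_def scaleR_sum_right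
    by (intro Bochner_Integration.integral_sum borel_integrable_compact) (auto intro: continuous_on_subset[OF c])
  qed
  show ?thesis unfolding ex[OF f \<eta>2] ex[OF \<eta>2 f]
   by (intro sum.cong refl integral_hess_symmetric f \<eta>2 compact_cbox out)
 qed
 finally show "0 \<le> (LINT x:cbox a b|lborel. box_bump c a b x * tan_trace (set vs) (hess f x))"
  by (simp add: \<eta>_def)
qed

lemma tangent_trace_hess_nonneg:
 fixes M :: "'n::{finite,linorder} point set"
 assumes M: "submanifold CARD('m::finite) M" "compact M" and y: "y \<in> M" and f: "Ck_on 2 f UNIV"
  and pos: "convex_on UNIV f \<or> m_subharmonic CARD('m) f"
 shows "0 \<le> tangent_trace CARD('m) M y (hess f y)"
proof -
 obtain vs where vs: "orthonormal_list vs" "length vs = CARD('n) - CARD('m)"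
  and tt: "tangent_trace CARD('m) M y (hess f y) = tan_trace (set vs) (hess f y)"
  using normal_square_eq[OF M refl refl y] by metis
 have l: "length vs + Suc (CARD('m) - 1) = CARD('n)" and m: "Suc (CARD('m) - 1) = CARD('m)"
  using vs(2) M(1) zero_less_card_finite[where 'a='m] by (auto simp: submanifold_def simp del: zero_less_card_finite)
 from pos show ?thesis unfolding tt
 proof
  assume "convex_on UNIV f"
  then show "0 \<le> tan_trace (set vs) (hess f y)"
   using vs(1) has_derivative_linear[OF has_derivative_hess[OF f open_UNIV UNIV_I]]
   by (intro tan_trace_nonneg convex_hess_nonneg f) (auto simp: orthonormal_list_def)
 next
  assume "m_subharmonic CARD('m) f"
  then show "0 \<le> tan_trace (set vs) (hess f y)"
   using m by (intro m_subharmonic_tan_trace_nonneg[OF _ f vs(1) l]) simp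
 qed
qed

section \<open>The first variation along the flow\<close>

lemma flow_near_identity_family:
 fixes F :: "real \<Rightarrow> 'n::finite point \<Rightarrow> 'n point"
 assumes I: "is_interval I" "t0 \<in> I" and V: "Ck_on 2 V UNIV" and F: "flow_on I A V F"
  and cM: "compact (F t0 ` A)"
 shows "\<exists>\<Gamma> E \<delta>. 0 < \<delta> \<and>
  near_identity_family TYPE('m::finite) (F t0 ` A) \<Gamma> V (\<lambda>x. FD V x) {h. t0 + h \<in> I \<and> \<bar>h\<bar> \<le> \<delta>} E \<and>
  (\<forall>h. t0 + h \<in> I \<and> \<bar>h\<bar> \<le> \<delta> \<longrightarrow> \<Gamma> h ` F t0 ` A = F (t0 + h) ` A)"
proof -
 obtain R0 where R0: "\<And>y. y \<in> F t0 ` A \<Longrightarrow> norm y \<le> R0"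
  using compact_imp_bounded[OF cM] unfolding bounded_iff by blast
 \<comment> \<open>The margin 1 in the radius leaves room for the trajectories to move, as required
   by \<open>trajectoryI\<close>.\<close>
 obtain L where "C2_field V (\<lambda>x. FD V x) (R0 + 1) L"
  using C2_field_exists[OF V] by blast
 then interpret C2_field V "\<lambda>x. FD V x" "R0 + 1" L .
 \<comment> \<open>This gives \<open>\<bar>h\<bar> * L \<le> 1 / 4\<close>: the Gronwall estimates
   need 1/2, while 1/4 makes the displacements of two points differ by at most half their distance,
   which yields the lower Lipschitz bound.\<close>
 define \<delta> where "\<delta> = 1 / (4 * (L + 1))"
 have \<delta>: "0 < \<delta>" "\<delta> \<le> 1" and \<delta>L: "\<delta> * L \<le> 1 / 4" using L0 by (auto simp: \<delta>_def field_simps)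
 define J where "J = {h. t0 + h \<in> I \<and> \<bar>h\<bar> \<le> \<delta>}"
 have hL4: "\<bar>h\<bar> * L \<le> 1 / 4" if "h \<in> J" for h
  using mult_right_mono[OF _ L0, of "\<bar>h\<bar>" \<delta>] that \<delta>L by (simp add: J_def)
 have hL: "\<bar>h\<bar> * L \<le> 1 / 2" if "h \<in> J" for h
  using hL4[OF that] by simp
 define E where "E = 4 * L\<^sup>2 + L"
 have flow: "((\<lambda>s. F s x) has_vector_derivative V (F t x)) (at t within I)" if "x \<in> A" "t \<in> I" for x t
  using F that by (simp add: flow_on_def)
 have traj: "trajectory h (\<lambda>s. F (t0 + s * h) x)" if h: "h \<in> J" and x: "x \<in> A" for h x
 proof (rule trajectoryI[OF _ _ hL[OF h]])
  fix s :: real assume s: "s \<in> {0..1}"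
  have "t0 + r * h \<in> I" if "r \<in> {0..1}" for r
  proof -
   have "min 0 h \<le> r * h" "r * h \<le> max 0 h"
    using that mult_left_le_one_le[of h r] mult_left_le_one_le[of "- h" r] by (auto simp: min_def max_def zero_le_mult_iff mult_le_0_iff)
   then show ?thesis
    using mem_is_interval_1_I[OF I(1), of "min t0 (t0 + h)" "max t0 (t0 + h)" "t0 + r * h"] I(2) h
    by (auto simp: J_def min_def max_def split: if_splits)
  qed
  then have sub: "(\<lambda>s. t0 + s * h) ` {0..1} \<subseteq> I" and sI: "t0 + s * h \<in> I" using s by auto
  have "((\<lambda>s. t0 + s * h) has_vector_derivative h) (at s within {0..1})"
   by (auto intro!: derivative_eq_intros simp: has_vector_derivative_def)
  from vector_diff_chain_within[OF this has_vector_derivative_within_subset[OF flow[OF x sI] sub]]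
  show "((\<lambda>s. F (t0 + s * h) x) has_vector_derivative h *\<^sub>R V (F (t0 + s * h) x)) (at s within {0..1})"
   by (simp add: comp_def)
 next
  show "norm (F (t0 + 0 * h) x) + 1 \<le> R0 + 1" using R0 x by simp
 qed
 \<comment> \<open>\<open>F t0\<close> has not been shown to be injective on \<open>A\<close>, so a
   starting point is chosen. Solutions that agree at time t0 agree nearby by
   \<open>trajectory_diff\<close>, so the moved set does not depend on the choice.\<close>
 define pick where "pick y = (SOME x. x \<in> A \<and> F t0 x = y)" for y
 have pick: "pick y \<in> A" "F t0 (pick y) = y" if "y \<in> F t0 ` A" for y
  using someI_ex[of "\<lambda>x. x \<in> A \<and> F t0 x = y"] that by (auto simp: pick_def)
 define \<Gamma> where "\<Gamma> h y = F (t0 + h) (pick y)" for h y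
 have T: "trajectory h (\<lambda>s. F (t0 + s * h) (pick y))" if "h \<in> J" "y \<in> F t0 ` A" for h y
  using traj[OF that(1) pick(1)[OF that(2)]] .
 have E: "L \<le> E" "4 * L\<^sup>2 \<le> E" "0 \<le> E" using L0 by (auto simp: E_def)
 have fam: "near_identity_family TYPE('m) (F t0 ` A) \<Gamma> V (\<lambda>x. FD V x) J E"
 proof (rule near_identity_family.intro)
  show "0 \<in> J" using I(2) \<delta> by (simp add: J_def)
  show "\<bar>h\<bar> \<le> 1" if "h \<in> J" for h using that \<delta> by (simp add: J_def)
  show "0 \<le> E" by (rule E(3))
  show "\<Gamma> 0 y = y" if "y \<in> F t0 ` A" for y using pick[OF that] by (simp add: \<Gamma>_def)
  show "norm (\<Gamma> h y - y) \<le> E * \<bar>h\<bar>" if h: "h \<in> J" and y: "y \<in> F t0 ` A" for h y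
  proof -
   have "norm (\<Gamma> h y - y) \<le> \<bar>h\<bar> * L" using trajectory_move[OF T[OF h y], of 1] pick[OF y] by (simp add: \<Gamma>_def)
   also have "\<dots> \<le> \<bar>h\<bar> * E" by (intro mult_left_mono E) simp
   finally show ?thesis by (simp add: mult.commute)
  qed
  show "((\<lambda>h. \<Gamma> h y) has_vector_derivative V y) (at 0 within J)" if y: "y \<in> F t0 ` A" for y
  proof -
   have "((\<lambda>h. t0 + h) has_vector_derivative 1) (at 0 within J)"
    by (auto intro!: derivative_eq_intros simp: has_vector_derivative_def)
   moreover have "((\<lambda>s. F s (pick y)) has_vector_derivative V y) (at (t0 + 0) within (\<lambda>h. t0 + h) ` J)"
    using has_vector_derivative_within_subset[OF flow[OF pick(1)[OF y] I(2)], of "(\<lambda>h. t0 + h) ` J"] pick(2)[OF y]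
    by (auto simp: J_def)
   ultimately show ?thesis using vector_diff_chain_within by (fastforce simp: \<Gamma>_def comp_def)
  qed
  show "norm (FD V y v) \<le> E * norm v" if y: "y \<in> F t0 ` A" for y v
   using V'bound[of y v] R0[OF y] mult_right_mono[OF E(1), of "norm v"] by simp
  fix h assume h: "h \<in> J"
  show "near_identity TYPE('m) (F t0 ` A) (\<Gamma> h) V (\<lambda>x. FD V x) h (E * h\<^sup>2)"
  proof
   fix x y assume x: "x \<in> F t0 ` A" and y: "y \<in> F t0 ` A"
   note Tx = T[OF h x] and Ty = T[OF h y]
   show "norm (\<Gamma> h x - \<Gamma> h y) \<le> 2 * norm (x - y)"
    using trajectory_diff[OF Tx Ty hL[OF h], of 1] pick[OF x] pick[OF y] by (simp add: \<Gamma>_def)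
   show "norm (x - y) \<le> 2 * norm (\<Gamma> h x - \<Gamma> h y)"
   proof -
    have "norm ((\<Gamma> h x - x) - (\<Gamma> h y - y)) \<le> 2 * (\<bar>h\<bar> * L) * norm (x - y)"
     using trajectory_diff_move[OF Tx Ty hL[OF h], of 1] pick[OF x] pick[OF y] by (simp add: \<Gamma>_def)
    also have "\<dots> \<le> norm (x - y) / 2" using mult_right_mono[OF hL4[OF h], of "norm (x - y)"] by simp
    finally have "norm ((\<Gamma> h x - \<Gamma> h y) - (x - y)) \<le> norm (x - y) / 2" by (simp add: algebra_simps)
    then show ?thesis
     using norm_triangle_ineq4[of "\<Gamma> h x - \<Gamma> h y" "(\<Gamma> h x - \<Gamma> h y) - (x - y)"] by simp
   qed
   show "norm ((\<Gamma> h x - \<Gamma> h y) - (x - y) - h *\<^sub>R (V x - V y)) \<le> E * h\<^sup>2 * norm (x - y)"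
   proof -
    have "norm ((\<Gamma> h x - \<Gamma> h y) - (x - y) - h *\<^sub>R (V x - V y)) \<le> 4 * L\<^sup>2 * h\<^sup>2 * norm (x - y)"
     using trajectory_diff_first_order[OF Tx Ty hL[OF h]] pick[OF x] pick[OF y] by (simp add: \<Gamma>_def)
    also have "\<dots> \<le> E * h\<^sup>2 * norm (x - y)" by (intro mult_right_mono E) auto
    finally show ?thesis .
   qed
  next
   fix c :: "'m option \<Rightarrow> real" and x y :: "'m option \<Rightarrow> 'n point" and z
   assume x: "\<And>j. x j \<in> F t0 ` A" and y: "\<And>j. y j \<in> F t0 ` A" and z: "z \<in> F t0 ` A"
   from trajectory_combination[OF T[OF h x] T[OF h y] T[OF h z] hL[OF h], of c]
   show "norm (\<Sum>j\<in>UNIV. c j *\<^sub>R (\<Gamma> h (x j) - \<Gamma> h (y j))) \<le> 2 * (norm (\<Sum>j\<in>UNIV. c j *\<^sub>R (x j - y j)) +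
    2 * (\<Sum>j\<in>UNIV. \<bar>c j\<bar> * ((norm (x j - y j) + norm (y j - z)) * norm (x j - y j))))"
    by (simp add: \<Gamma>_def pick(2)[OF x] pick(2)[OF y] pick(2)[OF z])
  qed (rule der)
 qed
 have "\<Gamma> h ` F t0 ` A = F (t0 + h) ` A" if h: "h \<in> J" for h
 proof -
  have "F (t0 + h) (pick (F t0 x)) = F (t0 + h) x" if x: "x \<in> A" for x
   using trajectory_diff[OF T[OF h imageI[OF x]] traj[OF h x] hL[OF h], of 1] pick[OF imageI[OF x]] by simp
  then show ?thesis by (auto simp: \<Gamma>_def image_image)
 qed
 then have "0 < \<delta> \<and> near_identity_family TYPE('m) (F t0 ` A) \<Gamma> V (\<lambda>x. FD V x) J E \<and>
   (\<forall>h. h \<in> J \<longrightarrow> \<Gamma> h ` F t0 ` A = F (t0 + h) ` A)" using \<delta>(1) fam by simp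
 then show ?thesis unfolding J_def mem_Collect_eq by (intro exI)
qed

lemma first_variation:
 fixes M :: "real \<Rightarrow> 'n::{finite,linorder} point set" and X :: "'n point \<Rightarrow> 'n point"
 assumes I: "is_interval I" "t0 \<in> I" and sub: "\<And>t. t \<in> I \<Longrightarrow> submanifold CARD('m::finite) (M t)"
  and cM: "\<And>t. t \<in> I \<Longrightarrow> compact (M t)" and X: "smooth_on X UNIV"
  and H: "\<And>x. x \<in> M t0 \<Longrightarrow> X x = mean_curvature CARD('m) (M t0) x"
  and F: "flow_on I A (\<lambda>x. - X x) F" "\<And>t. t \<in> I \<Longrightarrow> F t ` A = M t" and f: "Ck_on 2 f UNIV"
 defines "\<mu> \<equiv> \<lambda>t. surface_measure TYPE('m) (M t)"
 shows "((\<lambda>t. LINT y:M t|\<mu> t. f y) has_real_derivative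
  - (LINT y:M t0|\<mu> t0. f y * (norm (X y))\<^sup>2)
  - (LINT y:M t0|\<mu> t0. tangent_trace CARD('m) (M t0) y (hess f y))) (at t0 within I)"
proof -
 note sub0 = sub[OF I(2)] and cM0 = cM[OF I(2)]
 define V where "V x = - X x" for x
 define V' where "V' = (\<lambda>x. FD V x)"
 have V: "Ck_on k V UNIV" for k
  unfolding V_def using X by (intro Ck_on_bounded_linear[OF bounded_linear_minus[OF bounded_linear_ident]]) (auto simp: smooth_on_def)
 have dV: "(V has_derivative V' y) (at y)" for y
  using Ck_on_Suc_has_derivative[OF V[of "Suc 0"], of y] by (simp add: V'_def)
 have surf: "is_surface_measure TYPE('m) (M t) (\<mu> t)" if "t \<in> I" for t
  unfolding \<mu>_def by (rule surface_measure_is_surface_measure[OF sub[OF that] cM[OF that]])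
 have FM: "F t0 ` A = M t0" by (rule F(2)[OF I(2)])
 have FV: "flow_on I A V F" using F(1) by (simp add: V_def[abs_def])
 have cFM: "compact (F t0 ` A)" unfolding FM by (rule cM0)
 obtain \<Gamma> E \<delta> where "0 < \<delta> \<and> near_identity_family TYPE('m) (M t0) \<Gamma> V V' {h. t0 + h \<in> I \<and> \<bar>h\<bar> \<le> \<delta>} E \<and>
   (\<forall>h. t0 + h \<in> I \<and> \<bar>h\<bar> \<le> \<delta> \<longrightarrow> \<Gamma> h ` M t0 = F (t0 + h) ` A)"
  using flow_near_identity_family[where 'm='m, OF I V FV cFM, folded V'_def, unfolded FM] by (elim exE) (rule that)
 then have \<delta>: "0 < \<delta>" and fam: "near_identity_family TYPE('m) (M t0) \<Gamma> V V' {h. t0 + h \<in> I \<and> \<bar>h\<bar> \<le> \<delta>} E"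
  and \<Gamma>: "\<And>h. t0 + h \<in> I \<Longrightarrow> \<bar>h\<bar> \<le> \<delta> \<Longrightarrow> \<Gamma> h ` M t0 = F (t0 + h) ` A" by simp_all
 define J where "J = {h. t0 + h \<in> I \<and> \<bar>h\<bar> \<le> \<delta>}"
 have \<Gamma>M: "\<Gamma> h ` M t0 = M (t0 + h)" if "h \<in> J" for h using \<Gamma>[of h] F(2)[of "t0 + h"] that by (simp add: J_def)
 define \<theta> where "\<theta> y = - (f y * (norm (X y))\<^sup>2) - grad f y \<bullet> X y" for y
 have cX: "continuous_on S X" and cf: "continuous_on S f" for S
  using X f Ck_on_continuous_on[of 0 X UNIV] Ck_on_continuous_on[OF f] unfolding smooth_on_def
  by (auto intro: continuous_on_subset)
 have gf: "Ck_on (Suc 0) (grad f) UNIV" using f by (intro Ck_on_grad) (auto simp only: numeral_2_eq_2 open_UNIV)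
 have cg: "continuous_on S (grad f)" for S
  using Ck_on_continuous_on[OF gf] by (rule continuous_on_subset) simp
 obtain N U \<rho> and e :: "nat \<Rightarrow> 'm \<Rightarrow> 'n point" and Vc W \<phi> c r where
  "surface_atlas (M t0) N (CARD('n) - CARD('m)) U \<rho> e Vc W \<phi> c r"
  using surface_atlas_exists[OF sub0 cM0] by blast
 then interpret surface_atlas "M t0" N "CARD('n) - CARD('m)" U \<rho> e Vc W \<phi> c r .
 have dim: "CARD('n) - CARD('m) + CARD('m) = CARD('n)" using sub0 by (simp add: submanifold_def)
 have "((\<lambda>h. LINT y:\<Gamma> h ` M t0|\<mu> (t0 + h). f y) has_real_derivative (LINT y:M t0|\<mu> (t0 + 0). \<theta> y)) (at 0 within J)"
 proof (rule surface_integral_derivative[OF fam[folded J_def]])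
  show "Ck_on 1 f UNIV" by (rule Ck_on_le[OF f]) simp
  show "is_surface_measure TYPE('m) (\<Gamma> h ` M t0) (\<mu> (t0 + h))" "compact (\<Gamma> h ` M t0)" if "h \<in> J" for h
   unfolding \<Gamma>M[OF that] using that surf cM by (auto simp: J_def)
  show "continuous_on (M t0) \<theta>" unfolding \<theta>_def by (intro continuous_intros cX cf cg)
  fix i y assume i: "i < N" and y: "y \<in> M t0" "y \<in> Vc i"
  interpret ch: adapted_chart "M t0" "CARD('n) - CARD('m)" "U i" "\<rho> i" "e i" "Vc i" "W i" "\<phi> i" by (rule adapted[OF i])
  have yU: "y \<in> U i" using ch.VU y(2) by blast
  have "tan_trace (set (normals (CARD('n) - CARD('m)) (\<rho> i) y)) (V' y) = V y \<bullet> mean_curvature CARD('m) (M t0) y"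
  proof (rule tan_trace_normal_field_mean_curvature[OF sub0 dim ch.sys y(1) yU dV ch.openU yU])
   fix z assume z: "z \<in> M t0" "z \<in> U i"
   show "orth_rest (set (normals (CARD('n) - CARD('m)) (\<rho> i) z)) (V z) = 0"
    using mean_curvature_normal[OF sub0 dim ch.sys z] H[OF z(1)]
    by (simp add: V_def orth_rest_def sum_negf)
  qed
  also have "\<dots> = - (norm (X y))\<^sup>2" using H[OF y(1)] by (simp add: V_def dot_square_norm)
  finally show "tan_trace (set (normals (CARD('n) - CARD('m)) (\<rho> i) y)) (V' y) * f y + grad f y \<bullet> V y = \<theta> y"
   by (simp add: \<theta>_def V_def mult.commute)
 qed
 then have dG: "((\<lambda>h. LINT y:\<Gamma> h ` M t0|\<mu> (t0 + h). f y) has_real_derivative (LINT y:M t0|\<mu> t0. \<theta> y)) (at 0 within J)"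
  by (simp only: add_0_right)
 have "((\<lambda>h. LINT y:M (t0 + h)|\<mu> (t0 + h). f y) has_real_derivative (LINT y:M t0|\<mu> t0. \<theta> y)) (at 0 within J)"
 proof (rule has_field_derivative_transform_within[OF dG zero_less_one])
  show "0 \<in> J" using I(2) \<delta> by (simp add: J_def)
 qed (simp only: \<Gamma>M)
 \<comment> \<open>Restricting to |h| \<le> \<delta> does not change the filter, even at an end
   point of \<open>I\<close>.\<close>
 moreover have "at 0 within J = at 0 within {h. t0 + h \<in> I}"
 proof (rule at_within_nhd[of _ "ball 0 \<delta>"])
  have "J \<inter> ball 0 \<delta> = {h. t0 + h \<in> I} \<inter> ball 0 \<delta>" by (auto simp: J_def dist_real_def)
  then show "J \<inter> ball 0 \<delta> - {0} = {h. t0 + h \<in> I} \<inter> ball 0 \<delta> - {0}" by simp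
 qed (simp_all add: \<delta>)
 moreover have "(\<lambda>t. t - t0) ` I = {h. t0 + h \<in> I}"
 proof -
  have "h \<in> (\<lambda>t. t - t0) ` I" if "t0 + h \<in> I" for h using imageI[OF that, of "\<lambda>t. t - t0"] by simp
  then show ?thesis by auto
 qed
 ultimately have d0: "((\<lambda>h. LINT y:M (t0 + h)|\<mu> (t0 + h). f y) has_real_derivative (LINT y:M t0|\<mu> t0. \<theta> y)) (at (t0 - t0) within (\<lambda>t. t - t0) ` I)"
  by (simp only: diff_self)
 have "((\<lambda>t. t - t0) has_real_derivative 1) (at t0 within I)" by (auto intro!: derivative_eq_intros)
 from DERIV_image_chain[OF d0 this]
 have d: "((\<lambda>t. LINT y:M t|\<mu> t. f y) has_real_derivative (LINT y:M t0|\<mu> t0. \<theta> y)) (at t0 within I)"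
  by (simp add: comp_def)
 have i1: "set_integrable (\<mu> t0) (M t0) (\<lambda>y. - (f y * (norm (X y))\<^sup>2))" and i2: "set_integrable (\<mu> t0) (M t0) (\<lambda>y. grad f y \<bullet> X y)"
  by (intro surface_set_integrable[OF sub0 cM0 surf[OF I(2)]] continuous_intros cX cf cg)+
 have s: "M t0 \<in> sets (\<mu> t0)" using surf[OF I(2)] compact_imp_closed[OF cM0] by (auto simp: is_surface_measure_def)
 have "(LINT y:M t0|\<mu> t0. grad f y \<bullet> X y) = (LINT y:M t0|\<mu> t0. mean_curvature CARD('m) (M t0) y \<bullet> grad f y)"
  using s H by (intro set_lebesgue_integral_cong) (auto simp: inner_commute)
 also have "\<dots> = (LINT y:M t0|\<mu> t0. tangent_trace CARD('m) (M t0) y (hess f y))"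
 proof -
  \<comment> \<open>The mean curvature coincides on \<open>M t0\<close> with the smooth ambient
    field \<open>X\<close>.\<close>
  have "continuous_on (M t0) (mean_curvature CARD('m) (M t0))"
   by (rule continuous_on_eq[OF cX H])
  from divergence_theorem[OF sub0 dim cM0 surf[OF I(2)] this gf[folded One_nat_def]]
  show ?thesis by (simp add: hess_def)
 qed
 finally have "(LINT y:M t0|\<mu> t0. \<theta> y) = - (LINT y:M t0|\<mu> t0. f y * (norm (X y))\<^sup>2)
  - (LINT y:M t0|\<mu> t0. tangent_trace CARD('m) (M t0) y (hess f y))"
  unfolding \<theta>_def set_integral_diff(2)[OF i1 i2] by (simp add: set_lebesgue_integral_def)
 then show ?thesis using d by simp
qed

lemma nonpos_derivative_imp_antimono_on:
 fixes g :: "real \<Rightarrow> real"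
 assumes I: "is_interval I" and der: "\<And>t. t \<in> I \<Longrightarrow> (g has_real_derivative g' t) (at t within I)"
  and neg: "\<And>t. t \<in> I \<Longrightarrow> g' t \<le> 0"
 shows "antimono_on I g"
proof (rule monotone_onI)
 fix a b assume ab: "a \<in> I" "b \<in> I" "a \<le> b"
 have sub: "{a..b} \<subseteq> I" using mem_is_interval_1_I[OF I ab(1,2)] by auto
 show "g b \<le> g a"
 proof (cases "a = b")
  case False
  then have "a < b" using ab(3) by simp
  then have "\<exists>x\<in>{a<..<b}. g b - g a = g' x * (b - a)"
  proof (rule mvt_simple)
   fix x assume "a \<le> x" "x \<le> b"
   then have "(g has_real_derivative g' x) (at x within I)" using sub by (intro der) auto
   then show "(g has_derivative (*) (g' x)) (at x within {a..b})"
    using sub by (simp add: has_field_derivative_def has_derivative_subset)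
  qed
  then obtain x where x: "x \<in> {a<..<b}" "g b - g a = g' x * (b - a)" by blast
  have "x \<in> I" using x(1) sub by auto
  then have "g' x * (b - a) \<le> 0" using neg ab(3) by (intro mult_nonpos_nonneg) auto
  then show ?thesis using x(2) by simp
 qed simp
qed

theorem corollary8p3:
  fixes M :: "real \<Rightarrow> 'n::{finite,linorder} point set"
    and I :: "real set"
    and \<rho> :: "'n point \<Rightarrow> real"
    and \<sigma> :: "real \<Rightarrow> 'n point measure"
    and S :: "'n supercurrent"
    and H :: "'n point \<Rightarrow> 'n point"
  assumes "is_interval I" "0 \<in> I" "I \<noteq> {0}"
    and "\<forall>t\<in>I. compact (M t)"
    and "mean_curvature_flow CARD('m::finite) I M"
    and "\<And>t. \<sigma> t = volume_form TYPE('m) (M t)"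
    and "S = current_wedge (submanifold_current TYPE('m) (M 0))
               (\<lambda>x. (1 / fact (CARD('m) - 1)) *\<^sub>R wedge_power \<beta> (CARD('m) - 1))"
    and "H = mean_curvature CARD('m) (M 0)"
    and "Ck_on 2 \<rho> UNIV"
  shows "((\<lambda>t. \<integral>x. \<rho> x \<partial>\<sigma> t) has_real_derivative
            - (LINT x:M 0|\<sigma> 0. \<rho> x * (norm (H x))\<^sup>2)
            - current_integral (current_wedge S (sd (sd_sharp (fun_form \<rho>))))) (at 0 within I) \<and>
         ((convex_on UNIV \<rho> \<or> m_subharmonic CARD('m) \<rho>) \<and> (\<forall>t\<in>I. \<forall>x\<in>M t. 0 \<le> \<rho> x) \<longrightarrow>
            antimono_on I (\<lambda>t. \<integral>x. \<rho> x \<partial>\<sigma> t))"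
proof -
 note I = assms(1,2) and f = assms(9)
 have sub: "submanifold CARD('m) (M t)" if "t \<in> I" for t
  using assms(5) that unfolding mean_curvature_flow_def by (elim conjE) (rule bspec)
 have ex: "\<exists>X F. smooth_on X UNIV \<and> (\<forall>t\<in>I. \<forall>x\<in>M t. X x = mean_curvature CARD('m) (M t) x) \<and>
   flow_on I (M 0) (\<lambda>x. - X x) F \<and> (\<forall>t\<in>I. F t ` M 0 = M t)"
  using assms(5) unfolding mean_curvature_flow_def by (elim conjE)
 obtain X F where XF: "smooth_on X UNIV \<and> (\<forall>t\<in>I. \<forall>x\<in>M t. X x = mean_curvature CARD('m) (M t) x) \<and>
   flow_on I (M 0) (\<lambda>x. - X x) F \<and> (\<forall>t\<in>I. F t ` M 0 = M t)"
  using ex by (elim exE) (rule that)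
 then have X: "smooth_on X UNIV" and F: "flow_on I (M 0) (\<lambda>x. - X x) F" "\<And>t. t \<in> I \<Longrightarrow> F t ` M 0 = M t"
  and XH: "\<And>t x. t \<in> I \<Longrightarrow> x \<in> M t \<Longrightarrow> X x = mean_curvature CARD('m) (M t) x"
  by simp_all
 have cM: "compact (M t)" if "t \<in> I" for t using assms(4) that by blast
 define \<mu> where "\<mu> t = surface_measure TYPE('m) (M t)" for t
 have \<sigma>: "\<sigma> t = \<mu> t" if "t \<in> I" for t
  unfolding assms(6) \<mu>_def by (rule volume_form_eq[OF sub[OF that] cM[OF that] refl refl])
 have c\<rho>: "continuous_on UNIV \<rho>" using f by (rule Ck_on_continuous_on)
 have int: "(\<integral>x. \<rho> x \<partial>\<sigma> t) = (LINT x:M t|\<mu> t. \<rho> x)" if "t \<in> I" for t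
  unfolding \<sigma>[OF that] unfolding \<mu>_def
  by (rule integral_surface_measure[OF sub[OF that] cM[OF that] refl refl c\<rho>])
 define D where "D t = - (LINT y:M t|\<mu> t. \<rho> y * (norm (X y))\<^sup>2)
  - (LINT y:M t|\<mu> t. tangent_trace CARD('m) (M t) y (hess \<rho> y))" for t
 \<comment> \<open>The trajectories start on \<open>M 0\<close>, but \<open>first_variation\<close>
   lets the base time be any point of \<open>I\<close>, which is what monotonicity on all of
   \<open>I\<close> requires.\<close>
 have der: "((\<lambda>t. \<integral>x. \<rho> x \<partial>\<sigma> t) has_real_derivative D t) (at t within I)" if t: "t \<in> I" for t
 proof (rule has_field_derivative_transform_within[OF _ zero_less_one t])
  show "((\<lambda>t. LINT y:M t|\<mu> t. \<rho> y) has_real_derivative D t) (at t within I)"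
   unfolding D_def \<mu>_def
   by (rule first_variation[OF I(1) t sub cM X XH[OF t] F f])
 qed (simp only: int)
 have "D 0 = - (LINT x:M 0|\<sigma> 0. \<rho> x * (norm (H x))\<^sup>2) - current_integral (current_wedge S (sd (sd_sharp (fun_form \<rho>))))"
 proof -
  have s: "M 0 \<in> sets (\<mu> 0)"
   using surface_measure_is_surface_measure[OF sub[OF I(2)] cM[OF I(2)]] compact_imp_closed[OF cM[OF I(2)]]
   by (auto simp: \<mu>_def is_surface_measure_def)
  have "(LINT x:M 0|\<sigma> 0. \<rho> x * (norm (H x))\<^sup>2) = (LINT y:M 0|\<mu> 0. \<rho> y * (norm (X y))\<^sup>2)"
   unfolding \<sigma>[OF I(2)] assms(8) using s XH[OF I(2)] by (intro set_lebesgue_integral_cong) auto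
  moreover have "current_integral (current_wedge S (sd (sd_sharp (fun_form \<rho>)))) =
    (LINT y:M 0|\<mu> 0. tangent_trace CARD('m) (M 0) y (hess \<rho> y))"
   unfolding assms(7) \<mu>_def by (rule current_integral_sd_sd_sharp[OF sub[OF I(2)] cM[OF I(2)] refl refl f])
  ultimately show ?thesis by (simp only: D_def)
 qed
 moreover have "antimono_on I (\<lambda>t. \<integral>x. \<rho> x \<partial>\<sigma> t)"
  if pos: "convex_on UNIV \<rho> \<or> m_subharmonic CARD('m) \<rho>" and \<rho>0: "\<forall>t\<in>I. \<forall>x\<in>M t. 0 \<le> \<rho> x"
 proof (rule nonpos_derivative_imp_antimono_on[OF I(1) der])
  fix t assume t: "t \<in> I"
  \<comment> \<open>The one place where nonnegativity of \<rho> on \<open>M t\<close> is used: it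
    fixes the sign of the curvature term.\<close>
  have "0 \<le> (LINT y:M t|\<mu> t. \<rho> y * (norm (X y))\<^sup>2)"
   unfolding set_lebesgue_integral_def using \<rho>0 t
   by (intro Bochner_Integration.integral_nonneg) (auto split: split_indicator)
  moreover have "0 \<le> (LINT y:M t|\<mu> t. tangent_trace CARD('m) (M t) y (hess \<rho> y))"
   unfolding set_lebesgue_integral_def
   using tangent_trace_hess_nonneg[OF sub[OF t] cM[OF t] _ f pos]
   by (intro Bochner_Integration.integral_nonneg) (auto split: split_indicator)
  ultimately show "D t \<le> 0" by (simp add: D_def)
 qed
 ultimately show ?thesis using der[OF I(2)] by simp
qed

end
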